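(* The functor $T:N\mapsto K\otimes_{\mathbb C[z,z^{-1}]}N$ from the category of global difference modules admitting an ascending slope filtration to the category of difference modules over $K$ is an equivalence of Tannakian categories.
   Context: Fix $q\in\mathbb C$, $0<|q|<1$. $\mathbb D=\mathbb C[z,z^{-1}][\Phi,\Phi^{-1}]$ is the skew ring with $\Phi z=qz\Phi$; a global difference module is a left $\mathbb D$-module free and finitely generated over $\mathbb C[z,z^{-1}]$; morphisms are $\mathbb D$-linear maps. $K=\mathbb C(\{z\})$, $K'=\mathbb C(\{z^{-1}\})$, difference fields via $\phi(f)(z)=f(qz)$; a difference module over $K$ is a finite-dimensional $K$-space with additive bijection $\Phi$, $\Phi(fm)=\phi(f)\Phi(m)$. For $F\in\{K,K'\}$ and $M\cong F[\Phi,\Phi^{-1}]/F[\Phi,\Phi^{-1}]L$, $L=\sum_{i=0}^da_i\Phi^i$, $a_d=1$, $a_0\ne0$, the Newton polygon is the finite boundary of the convex hull of $\bigcup_i\{(i,-v(a_i)+y):y\le0\}$ with $v=\mathrm{ord}_z$ (resp. $\mathrm{ord}_{z^{-1}}$); $M$ is pure of slope $\lambda$ if it has the single slope $\lambda$. A global module $N$ is pure of slope $\lambda$ if $K\otimes N$ is pure of slope $\lambda$ and $K'\otimes N$ is pure of slope $-\lambda$. $N$ has an ascending slope filtration if there are global submodules $0=N_0\subset N_1\subset\cdots\subset N_r=N$ with each $N_i/N_{i-1}$ a pure global module of slope $\lambda_i$ and $\lambda_1<\cdots<\lambda_r$. *)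

theory Defs
  imports "HOL-Analysis.FPS_Convergence"
          "HOL-Computational_Algebra.Formal_Laurent_Series"
          "Jordan_Normal_Form.Matrix"
begin

text \<open>The Laurent series in the variable z (for K) resp. w = z^-1 (for K') are represented
  as elements of the type complex fls.  K = C({z}) is the subfield of convergent ones:
  the power series part has positive radius of convergence.  The ring R = C[z,z^-1] is the
  subring of Laurent series with finitely many nonzero coefficients.\<close>

definition conv_fls :: "complex fls \<Rightarrow> bool" where
  "conv_fls f \<longleftrightarrow> fps_conv_radius (fls_regpart f) > 0"

definition laurent_poly :: "complex fls \<Rightarrow> bool" where
  "laurent_poly f \<longleftrightarrow> finite {n. fls_nth f n \<noteq> 0}"

definition phiK :: "complex \<Rightarrow> complex fls \<Rightarrow> complex fls" where
  "phiK q f = Abs_fls (\<lambda>n. q powi n * fls_nth f n)"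

text \<open>On K' = C({z^-1}) written in the variable w = z^-1, phi(f)(z) = f(qz) becomes
  f(w) \<mapsto> f(w/q).\<close>
definition phiK' :: "complex \<Rightarrow> complex fls \<Rightarrow> complex fls" where
  "phiK' q f = Abs_fls (\<lambda>n. q powi (- n) * fls_nth f n)"

text \<open>Embedding of R = C[z,z^-1] into K' (as a series in w = z^-1): z^n \<mapsto> w^-n.\<close>
definition to_K' :: "complex fls \<Rightarrow> complex fls" where
  "to_K' f = Abs_fls (\<lambda>n. fls_nth f (- n))"

text \<open>A difference module of rank n over a difference ring (P, sigma) is given, after choice
  of a basis e_1..e_n, by its matrix A with Phi(e_j) = sum_i A_ij e_i; Phi is bijective iff A is
  invertible over P.  A morphism (n,A) \<rightarrow> (m,B) is an m\<times>n matrix F over P with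
  F A = B sigma(F).\<close>

definition entries_in :: "('a \<Rightarrow> bool) \<Rightarrow> 'a mat \<Rightarrow> bool" where
  "entries_in P A \<longleftrightarrow> (\<forall>i<dim_row A. \<forall>j<dim_col A. P (A $$ (i, j)))"

definition invertible_over :: "('a::semiring_1 \<Rightarrow> bool) \<Rightarrow> nat \<Rightarrow> 'a mat \<Rightarrow> bool" where
  "invertible_over P n A \<longleftrightarrow> A \<in> carrier_mat n n \<and> entries_in P A \<and>
     (\<exists>B. B \<in> carrier_mat n n \<and> entries_in P B \<and> A * B = 1\<^sub>m n \<and> B * A = 1\<^sub>m n)"

definition dmod :: "('a::semiring_1 \<Rightarrow> bool) \<Rightarrow> nat \<Rightarrow> 'a mat \<Rightarrow> bool" where
  "dmod P n A \<longleftrightarrow> invertible_over P n A"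

definition dhom :: "('a::semiring_1 \<Rightarrow> bool) \<Rightarrow> ('a \<Rightarrow> 'a) \<Rightarrow> nat \<Rightarrow> 'a mat \<Rightarrow> nat \<Rightarrow> 'a mat \<Rightarrow> 'a mat \<Rightarrow> bool" where
  "dhom P \<sigma> n A m B F \<longleftrightarrow> F \<in> carrier_mat m n \<and> entries_in P F \<and> F * A = B * map_mat \<sigma> F"

text \<open>Isomorphism of difference modules: an invertible morphism (its inverse is then
  automatically a morphism).\<close>
definition diso :: "('a::semiring_1 \<Rightarrow> bool) \<Rightarrow> ('a \<Rightarrow> 'a) \<Rightarrow> nat \<Rightarrow> 'a mat \<Rightarrow> nat \<Rightarrow> 'a mat \<Rightarrow> bool" where
  "diso P \<sigma> n A m B \<longleftrightarrow> (\<exists>G. dhom P \<sigma> n A m B G \<and> n = m \<and> invertible_over P n G)"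

text \<open>Companion matrix of L = sum_{i=0}^d a_i Phi^i with a_d = 1: the matrix of Phi on
  F[Phi,Phi^-1]/F[Phi,Phi^-1]L in the basis 1, Phi, ..., Phi^(d-1).\<close>
definition companion :: "nat \<Rightarrow> (nat \<Rightarrow> complex fls) \<Rightarrow> complex fls mat" where
  "companion d a = mat d d (\<lambda>(i, j).
      (if j = d - 1 then - a i else 0) + (if i = j + 1 then 1 else 0))"

text \<open>The Newton polygon of L (with valuation v) has the single slope lam:
  the finite boundary of the convex hull of the half-lines {(i, -v(a_i)+y) : y \<le> 0} is the
  single segment from (0, -v(a_0)) to (d, -v(a_d)) = (d, 0), of slope lam.
  (Equivalently: d \<ge> 1, lam is the slope of that segment, and every point (i, -v(a_i))
  lies on or below it.)\<close>
definition newton_single_slope :: "nat \<Rightarrow> (nat \<Rightarrow> complex fls) \<Rightarrow> real \<Rightarrow> bool" where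
  "newton_single_slope d a lam \<longleftrightarrow> d \<ge> 1 \<and>
     lam = real_of_int (fls_subdegree (a 0)) / real d \<and>
     (\<forall>i\<le>d. a i \<noteq> 0 \<longrightarrow>
        - real_of_int (fls_subdegree (a i)) \<le> - real_of_int (fls_subdegree (a 0)) + lam * real i)"

text \<open>A difference module (n,A) over F = K (resp. K') is pure of slope lam: it is isomorphic
  to F[Phi,Phi^-1]/F[Phi,Phi^-1]L for some L = sum a_i Phi^i, a_d = 1, a_0 \<noteq> 0, coefficients
  in F, whose Newton polygon has the single slope lam.\<close>
definition pure_over :: "(complex fls \<Rightarrow> complex fls) \<Rightarrow> nat \<Rightarrow> complex fls mat \<Rightarrow> real \<Rightarrow> bool" where
  "pure_over \<sigma> n A lam \<longleftrightarrow> (\<exists>d a. (\<forall>i\<le>d. conv_fls (a i)) \<and> a d = 1 \<and> a 0 \<noteq> 0 \<and>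
      diso conv_fls \<sigma> n A d (companion d a) \<and> newton_single_slope d a lam)"

definition global_mod :: "nat \<Rightarrow> complex fls mat \<Rightarrow> bool" where
  "global_mod n A \<longleftrightarrow> dmod laurent_poly n A"

text \<open>Pure global module of slope lam: K \<otimes> N pure of slope lam and K' \<otimes> N pure of
  slope -lam.\<close>
definition pure_global :: "complex \<Rightarrow> nat \<Rightarrow> complex fls mat \<Rightarrow> real \<Rightarrow> bool" where
  "pure_global q n A lam \<longleftrightarrow> global_mod n A \<and>
     pure_over (phiK q) n A lam \<and> pure_over (phiK' q) n (map_mat to_K' A) (- lam)"

definition blk_off :: "nat list \<Rightarrow> nat \<Rightarrow> nat" where
  "blk_off ks i = sum_list (take i ks)"

definition diag_block :: "nat list \<Rightarrow> nat \<Rightarrow> 'a mat \<Rightarrow> 'a mat" where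
  "diag_block ks i B = mat (ks ! i) (ks ! i)
      (\<lambda>(r, c). B $$ (blk_off ks i + r, blk_off ks i + c))"

text \<open>Global submodules N_i of N with global (i.e. free) quotients are successive direct
  summands over C[z,z^-1]; so N admits an ascending slope filtration iff in a suitable basis
  e_1..e_n over C[z,z^-1] with N_i spanned by the first k_1+...+k_i basis vectors, the matrix
  of Phi is block upper triangular and the diagonal blocks (the matrices of N_i/N_(i-1)) are
  pure global of strictly increasing slopes.\<close>
definition asc_slope_filtration :: "complex \<Rightarrow> nat \<Rightarrow> complex fls mat \<Rightarrow> bool" where
  "asc_slope_filtration q n A \<longleftrightarrow> global_mod n A \<and>
     (\<exists>B ks lams. diso laurent_poly (phiK q) n A n B \<and>
        (\<forall>k\<in>set ks. k > 0) \<and> sum_list ks = n \<and> length lams = length ks \<and>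
        sorted_wrt (<) lams \<and>
        (\<forall>i<length ks. \<forall>r c. blk_off ks i \<le> c \<and> c < blk_off ks (Suc i) \<and>
            blk_off ks (Suc i) \<le> r \<and> r < n \<longrightarrow> B $$ (r, c) = 0) \<and>
        (\<forall>i<length ks. pure_global q (ks ! i) (diag_block ks i B) (lams ! i)))"

definition kron :: "'a::times mat \<Rightarrow> 'a mat \<Rightarrow> 'a mat" where
  "kron A B = mat (dim_row A * dim_row B) (dim_col A * dim_col B)
     (\<lambda>(i, j). A $$ (i div dim_row B, j div dim_col B) * B $$ (i mod dim_row B, j mod dim_col B))"

definition dual_mat :: "('a::semiring_1 \<Rightarrow> bool) \<Rightarrow> nat \<Rightarrow> 'a mat \<Rightarrow> 'a mat" where
  "dual_mat P n A = transpose_mat (SOME B. B \<in> carrier_mat n n \<and> entries_in P B \<and>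
        A * B = 1\<^sub>m n \<and> B * A = 1\<^sub>m n)"

end

theory Submission
  imports Defs "HOL-Complex_Analysis.Laurent_Convergence" "Jordan_Normal_Form.Determinant"
    "Jordan_Normal_Form.Schur_Decomposition" "Jordan_Normal_Form.Spectral_Radius"
begin

text \<open>A module is pure of slope \<open>\<lambda>\<close> iff the entries of the matrix of \<open>\<Phi>\<^sup>k\<close> and of the inverse matrix have
  valuation at least \<open>k \<lambda> - O(1)\<close> and \<open>- k \<lambda> - O(1)\<close>. This growth criterion follows from a cyclic vector and
  a Gauss norm argument. For a global module it bounds the degrees of the iterates from both sides, and a basis adapted
  to the filtration is a block triangular matrix with such bounds on its diagonal blocks, a condition visibly stable under
  tensor products and duals.

  Fullness: morphisms are the convergent solutions of \<open>x = A \<phi>(x)\<close> for the internal Hom. Solving from the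
  highest slope downwards, positive slopes at \<open>0\<close> mean that iterating the equation kills \<open>x\<close>, and for slope at
  most \<open>0\<close> the coefficients of the iterates are bounded in degree, so that \<open>\<bar>q\<bar> < 1\<close> forces \<open>x\<close> to be a Laurent polynomial.

  Essential surjectivity: by Adams' lemma a module over \<open>K\<close> with least slope \<open>t / d\<close> (in lowest terms) contains a vector with
  \<open>\<Phi>\<^sup>d e = c z\<^sup>t e\<close>, which spans a submodule with an obvious global model. The quotient has a global model by induction,
  and the extension class becomes a Laurent polynomial because \<open>x - a \<phi>(x) = y\<close> is solvable modulo Laurent polynomials:
  \<open>\<phi>\<close> is a contraction on series of high order.\<close>

text \<open>Newton polygons belong to cyclic vectors, and these behave badly under tensor products,
  duals and subquotients, whereas growth of iterates does not depend on any such choice. Only lower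
  bounds on valuations are used, so a matrix is carried together with its contragredient: a lower
  bound for the inverse limits the slopes from the other side. The criterion needs only that q is
  nonzero and not a root of unity, hence it serves at infinity too, with q replaced by 1/q. Two
  obstacles shape the rest. For slope at most 0 the degrees of all iterates are bounded, but the
  matrix itself may still contain positive powers of z, so the contraction estimate does not apply
  to the given system; it applies after finitely many auxiliary combinations of the unknowns have
  been adjoined. And the quotient by a submodule of least slope may contain the same slope again, so
  essential surjectivity meets extensions within one slope, and the growth bounds have to survive
  these as well.\<close>

lemma fls_nth_phiK [simp]: "fls_nth (phiK q f) n = q powi n * fls_nth f n"
  unfolding phiK_def by (rule nth_Abs_fls_lower_bound[of "fls_subdegree f"]) auto

lemma fls_times_nth_bounds:
  fixes f g :: "'a::comm_ring_1 fls"
  assumes "\<And>i. i < a \<Longrightarrow> fls_nth f i = 0" "\<And>i. i < b \<Longrightarrow> fls_nth g i = 0"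
  shows "fls_nth (f * g) n = (\<Sum>i=a..n-b. fls_nth f i * fls_nth g (n - i))"
proof (cases "f = 0 \<or> g = 0")
  case True
  then show ?thesis by auto
next
  case False
  then have "a \<le> fls_subdegree f" "b \<le> fls_subdegree g"
    using assms nth_fls_subdegree_nonzero by (meson not_le)+
  have "fls_nth (f * g) n = (\<Sum>i=fls_subdegree f..n - fls_subdegree g. fls_nth f i * fls_nth g (n - i))"
    by (simp add: fls_times_nth(2))
  also have "\<dots> = (\<Sum>i=a..n-b. fls_nth f i * fls_nth g (n - i))"
    by (rule sum.mono_neutral_left) (use \<open>a \<le> _\<close> \<open>b \<le> _\<close> in auto)
  finally show ?thesis .
qed

lemma fls_nth_sum: "fls_nth (sum f A) n = (\<Sum>i\<in>A. fls_nth (f i) n)"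
  by (induction A rule: infinite_finite_induct) auto

lemma phiK_add: "phiK q (f + g) = phiK q f + phiK q g"
  by (rule fls_eqI) (simp add: algebra_simps)

lemma phiK_mult:
  assumes "q \<noteq> 0"
  shows "phiK q (f * g) = phiK q f * phiK q g"
proof (rule fls_eqI)
  fix n
  have "fls_nth (phiK q (f * g)) n = q powi n * (\<Sum>i=fls_subdegree f..n - fls_subdegree g. fls_nth f i * fls_nth g (n - i))"
    by (simp add: fls_times_nth_bounds[of "fls_subdegree f" f "fls_subdegree g" g])
  also have "\<dots> = (\<Sum>i=fls_subdegree f..n - fls_subdegree g. fls_nth (phiK q f) i * fls_nth (phiK q g) (n - i))"
    unfolding sum_distrib_left
  proof (rule sum.cong[OF refl])
    fix i
    have "q powi n = q powi i * q powi (n - i)"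
      using assms by (simp flip: power_int_add)
    then show "q powi n * (fls_nth f i * fls_nth g (n - i)) = fls_nth (phiK q f) i * fls_nth (phiK q g) (n - i)"
      by simp
  qed
  also have "\<dots> = fls_nth (phiK q f * phiK q g) n"
    by (rule fls_times_nth_bounds[symmetric]) auto
  finally show "fls_nth (phiK q (f * g)) n = fls_nth (phiK q f * phiK q g) n" .
qed

lemma phiK_0 [simp]: "phiK q 0 = 0" by (rule fls_eqI) simp
lemma phiK_1 [simp]: "phiK q 1 = 1" by (rule fls_eqI) simp

lemma phiK_comm_ring_hom: "q \<noteq> 0 \<Longrightarrow> comm_ring_hom (phiK q)"
  by unfold_locales (auto simp: phiK_add phiK_mult)

lemma phiK_sum: "phiK q (sum f A) = (\<Sum>i\<in>A. phiK q (f i))"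
  by (rule fls_eqI) (simp add: fls_nth_sum sum_distrib_left)

lemma phiK_phiK: "phiK p (phiK q f) = phiK (p * q) f"
  by (rule fls_eqI) (simp add: power_int_mult_distrib algebra_simps)

lemma phiK_one_left [simp]: "phiK 1 f = f"
  by (rule fls_eqI) simp

lemma phiK_const [simp]: "phiK q (fls_const c) = fls_const c"
  by (rule fls_eqI) simp

lemma phiK_eq_0_iff [simp]: "q \<noteq> 0 \<Longrightarrow> phiK q f = 0 \<longleftrightarrow> f = 0"
  by (auto simp: fls_eq_iff)

lemma phiK_uminus [simp]: "phiK q (- f) = - phiK q f" by (rule fls_eqI) simp
text \<open>Over \<open>K'\<close> everything is obtained from the results for \<open>phiK\<close>
  by replacing q with its inverse. Results to be used at infinity therefore assume only that q is
  nonzero or not a root of unity.\<close>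

lemma phiK'_eq: "phiK' q = phiK (inverse q)"
  by (auto simp: fun_eq_iff phiK'_def phiK_def power_int_minus power_int_inverse)

section \<open>Convergent series and Laurent polynomials\<close>

lemma conv_fls_iff_conv_radius: "conv_fls f \<longleftrightarrow> fls_conv_radius f > 0"
  by (simp add: conv_fls_def fps_conv_radius_fls_regpart)

lemma conv_fls_0 [simp]: "conv_fls 0" by (simp add: conv_fls_iff_conv_radius)
lemma conv_fls_1 [simp]: "conv_fls 1"
  by (simp add: conv_fls_iff_conv_radius flip: fps_one_to_fls)

lemma conv_fls_add [simp]: "conv_fls f \<Longrightarrow> conv_fls g \<Longrightarrow> conv_fls (f + g)"
  unfolding conv_fls_iff_conv_radius using fls_conv_radius_add[of f g] by (meson less_le_trans min_less_iff_conj)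
lemma conv_fls_uminus [simp]: "conv_fls f \<Longrightarrow> conv_fls (- f)"
  unfolding conv_fls_iff_conv_radius by simp
lemma conv_fls_diff [simp]: "conv_fls f \<Longrightarrow> conv_fls g \<Longrightarrow> conv_fls (f - g)"
  unfolding conv_fls_iff_conv_radius using fls_conv_radius_diff[of f g] by (meson less_le_trans min_less_iff_conj)
lemma conv_fls_mult [simp]: "conv_fls f \<Longrightarrow> conv_fls g \<Longrightarrow> conv_fls (f * g)"
  unfolding conv_fls_iff_conv_radius using fls_conv_radius_mult[of f g] by (meson less_le_trans min_less_iff_conj)

lemma fls_eq_shift_base: "f = fls_shift (- fls_subdegree f) (fps_to_fls (fls_base_factor_to_fps f))"
  by (rule fls_eqI) auto

lemma conv_fls_inverse [simp]:
  assumes "conv_fls f"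
  shows "conv_fls (inverse f)"
proof (cases "f = 0")
  case False
  define F where "F = fls_base_factor_to_fps f"
  have F: "f = fls_shift (- fls_subdegree f) (fps_to_fls F)"
    unfolding F_def by (rule fls_eq_shift_base)
  have 0: "fps_nth F 0 \<noteq> 0" using False by (simp add: F_def)
  have r: "fps_conv_radius F > 0"
    using assms F unfolding conv_fls_iff_conv_radius by (metis fls_conv_radius_fps_to_fls fls_conv_radius_shift)
  have "inverse f = fls_shift (fls_subdegree f) (fps_to_fls (inverse F))"
    by (simp add: F_def fls_inverse_def)
  then show ?thesis
    using fps_conv_radius_inverse_pos[OF 0 r] by (simp add: conv_fls_iff_conv_radius)
qed simp

text \<open>A formal Laurent series is bounded below by construction, so finiteness of the support
  amounts to boundedness above.\<close>

lemma laurent_poly_iff: "laurent_poly f \<longleftrightarrow> (\<exists>b. \<forall>n>b. fls_nth f n = 0)"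
proof
  assume "laurent_poly f"
  then have "finite {n. fls_nth f n \<noteq> 0}" by (simp add: laurent_poly_def)
  then obtain b where "\<forall>n\<in>{n. fls_nth f n \<noteq> 0}. n \<le> b"
    using bdd_above_finite[unfolded bdd_above_def] by blast
  then show "\<exists>b. \<forall>n>b. fls_nth f n = 0" by (intro exI[of _ b]) (auto simp flip: not_le)
next
  assume "\<exists>b. \<forall>n>b. fls_nth f n = 0"
  then obtain b where b: "\<forall>n>b. fls_nth f n = 0" by auto
  have "{n. fls_nth f n \<noteq> 0} \<subseteq> {fls_subdegree f..b}"
    using b by (auto simp: not_less[symmetric])
  then show "laurent_poly f" unfolding laurent_poly_def by (rule finite_subset) simp
qed

lemma laurent_poly_mult [simp]:
  assumes "laurent_poly f" "laurent_poly g"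
  shows "laurent_poly (f * g)"
proof -
  obtain b c where b: "\<And>n. n > b \<Longrightarrow> fls_nth f n = 0" and c: "\<And>n. n > c \<Longrightarrow> fls_nth g n = 0"
    using assms unfolding laurent_poly_iff by blast
  have "fls_nth (f * g) n = 0" if "n > b + c" for n
    unfolding fls_times_nth_bounds[of "fls_subdegree f" f "fls_subdegree g" g n, simplified]
  proof (rule sum.neutral, rule ballI)
    fix i
    have "i > b \<or> n - i > c" using that by linarith
    then show "fls_nth f i * fls_nth g (n - i) = 0" using b c by auto
  qed
  then show ?thesis unfolding laurent_poly_iff by blast
qed

lemma laurent_poly_0 [simp]: "laurent_poly 0" by (simp add: laurent_poly_def)
lemma laurent_poly_const [simp]: "laurent_poly (fls_const c)"
  unfolding laurent_poly_iff by (rule exI[of _ 0]) auto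
lemma laurent_poly_1 [simp]: "laurent_poly 1"
  using laurent_poly_const[of 1] by simp
lemma laurent_poly_X [simp]: "laurent_poly (fls_X_intpow k)"
  unfolding laurent_poly_iff by (rule exI[of _ k]) auto
lemma laurent_poly_add [simp]: "laurent_poly f \<Longrightarrow> laurent_poly g \<Longrightarrow> laurent_poly (f + g)"
proof -
  assume "laurent_poly f" "laurent_poly g"
  then obtain b c where "\<forall>n>b. fls_nth f n = 0" "\<forall>n>c. fls_nth g n = 0"
    unfolding laurent_poly_iff by blast
  then show ?thesis unfolding laurent_poly_iff by (intro exI[of _ "max b c"]) auto
qed
lemma laurent_poly_uminus [simp]: "laurent_poly f \<Longrightarrow> laurent_poly (- f)"
  unfolding laurent_poly_iff by auto
lemma laurent_poly_phiK [simp]: "laurent_poly f \<Longrightarrow> laurent_poly (phiK q f)"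
  unfolding laurent_poly_iff by auto

lemma conv_fls_iff_geometric_bound:
  "conv_fls f \<longleftrightarrow> (\<exists>C\<ge>0. \<exists>\<rho>>0. \<forall>n::nat. norm (fls_nth f (int n)) \<le> C * \<rho> ^ n)"
proof
  assume "conv_fls f"
  then have "fps_conv_radius (fls_regpart f) > 0" by (simp add: conv_fls_def)
  then obtain r where r: "r > 0" "ereal r < fps_conv_radius (fls_regpart f)"
    using ereal_dense2[of 0 "fps_conv_radius (fls_regpart f)"] by auto
  have "summable (\<lambda>n. fps_nth (fls_regpart f) n * of_real r ^ n)"
    using r by (intro summable_fps) auto
  then have "Bseq (\<lambda>n. fps_nth (fls_regpart f) n * of_real r ^ n)"
    by (simp add: summable_imp_Bseq)
  then obtain C where C: "C > 0" "\<And>n. norm (fps_nth (fls_regpart f) n * of_real r ^ n) \<le> C"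
    unfolding Bseq_def by blast
  have "norm (fls_nth f (int n)) \<le> C * (1/r) ^ n" for n
    using C(2)[of n] r by (simp add: norm_mult norm_power field_simps)
  then show "\<exists>C\<ge>0. \<exists>\<rho>>0. \<forall>n::nat. norm (fls_nth f (int n)) \<le> C * \<rho> ^ n"
    using C(1) r by (intro exI[of _ C] conjI exI[of _ "1/r"]) auto
next
  assume "\<exists>C\<ge>0. \<exists>\<rho>>0. \<forall>n::nat. norm (fls_nth f (int n)) \<le> C * \<rho> ^ n"
  then obtain C \<rho> where C: "C \<ge> 0" "\<rho> > 0" "\<And>n. norm (fls_nth f (int n)) \<le> C * \<rho> ^ n" by blast
  have "summable (\<lambda>n. fps_nth (fls_regpart f) n * of_real (1 / (2*\<rho>)) ^ n)"
  proof (rule summable_comparison_test)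
    have "norm (fps_nth (fls_regpart f) n * complex_of_real (1 / (2 * \<rho>)) ^ n) \<le> C * (1/2)^n" for n
    proof -
      have "norm (fps_nth (fls_regpart f) n * complex_of_real (1 / (2 * \<rho>)) ^ n) = norm (fls_nth f n) * (1 / (2*\<rho>))^n"
        using C by (simp add: norm_mult norm_power norm_divide)
      also have "\<dots> \<le> C * \<rho>^n * (1 / (2*\<rho>))^n"
        using C by (intro mult_right_mono) auto
      also have "\<dots> = C * (1/2)^n" using C by (simp add: power_mult_distrib power_divide)
      finally show ?thesis .
    qed
    then show "\<exists>N. \<forall>n\<ge>N. norm (fps_nth (fls_regpart f) n * complex_of_real (1 / (2 * \<rho>)) ^ n) \<le> C * (1/2)^n"
      by blast
    show "summable (\<lambda>n. C * (1/2::real)^n)" by (intro summable_mult summable_geometric) auto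
  qed
  then have "fps_conv_radius (fls_regpart f) \<ge> norm (complex_of_real (1 / (2*\<rho>)))"
    unfolding fps_conv_radius_def by (rule conv_radius_geI)
  moreover have "norm (complex_of_real (1 / (2*\<rho>))) > 0" using C by simp
  ultimately show "conv_fls f" unfolding conv_fls_def
    by (metis ereal_less(2) less_le_trans)
qed

text \<open>The bound is stated for every large ratio r and for all integer exponents, so that
  finitely many series can share one r and r can be enlarged at will in later estimates; the
  finitely many negative exponents only affect the constant.\<close>

lemma conv_bound:
  assumes "conv_fls f"
  shows "\<exists>r0\<ge>1. \<forall>r\<ge>r0. \<exists>C\<ge>0. \<forall>n. norm (fls_nth f n) \<le> C * r powi n"
proof -
  obtain C \<rho> where C: "C \<ge> 0" "\<rho> > 0" "\<And>n. norm (fls_nth f (int n)) \<le> C * \<rho> ^ n"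
    using assms unfolding conv_fls_iff_geometric_bound by blast
  have "\<exists>C\<ge>0. \<forall>n. norm (fls_nth f n) \<le> C * r powi n" if r: "r \<ge> max 1 \<rho>" for r
  proof -
    define N where "N = fls_subdegree f"
    define C' where "C' = C + (\<Sum>n\<in>{N..<0}. norm (fls_nth f n) * r powi (-n))"
    have r0: "r > 0" using r C by auto
    have "C' \<ge> C" unfolding C'_def using r0 by (simp add: sum_nonneg)
    have "norm (fls_nth f n) \<le> C' * r powi n" for n
    proof (cases "n \<ge> 0")
      case True
      then obtain m where m: "n = int m" using nonneg_int_cases by blast
      have "norm (fls_nth f n) \<le> C * \<rho> ^ m" using C m by auto
      also have "\<dots> \<le> C' * r ^ m" using r C \<open>C' \<ge> C\<close> by (intro mult_mono power_mono) auto
      finally show ?thesis by (simp add: m)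
    next
      case False
      show ?thesis
      proof (cases "n < N")
        case True
        then show ?thesis using N_def \<open>C' \<ge> C\<close> C r0 by simp
      next
        case F2: False
        have "norm (fls_nth f n) * r powi (-n) \<le> (\<Sum>n\<in>{N..<0}. norm (fls_nth f n) * r powi (-n))"
          by (rule member_le_sum) (use False F2 r0 in auto)
        then have "norm (fls_nth f n) * r powi (-n) \<le> C'" using C C'_def by simp
        then have "norm (fls_nth f n) * r powi (-n) * r powi n \<le> C' * r powi n"
          using r0 by (intro mult_right_mono) auto
        moreover have "r powi (-n) * r powi n = 1" using r0 by (simp flip: power_int_add)
        ultimately show ?thesis by (simp add: mult.assoc)
      qed
    qed
    then show ?thesis using \<open>C' \<ge> C\<close> C by (intro exI[of _ C']) auto
  qed
  then show ?thesis by (intro exI[of _ "max 1 \<rho>"]) auto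
qed

lemma conv_boundI:
  assumes "r > 0" "C \<ge> 0" "\<And>n. norm (fls_nth f n) \<le> C * r powi n"
  shows "conv_fls f"
  unfolding conv_fls_iff_geometric_bound using assms(3)[of "int _"] assms(1,2) by (intro exI[of _ C] conjI exI[of _ r]) (auto)

lemma conv_bound_finite:
  assumes "finite I" "\<And>i. i \<in> I \<Longrightarrow> conv_fls (f i)"
  shows "\<exists>r0\<ge>1. \<forall>r\<ge>r0. \<exists>C\<ge>0. \<forall>i\<in>I. \<forall>n. norm (fls_nth (f i) n) \<le> C * r powi n"
  using assms
proof (induction I rule: finite_induct)
  case empty
  then show ?case by (intro exI[of _ 1]) auto
next
  case (insert x F)
  obtain r1 where r1: "r1 \<ge> 1" "\<forall>r\<ge>r1. \<exists>C\<ge>0. \<forall>i\<in>F. \<forall>n. norm (fls_nth (f i) n) \<le> C * r powi n"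
    using insert by auto
  obtain r2 where r2: "r2 \<ge> 1" "\<forall>r\<ge>r2. \<exists>C\<ge>0. \<forall>n. norm (fls_nth (f x) n) \<le> C * r powi n"
    using conv_bound[of "f x"] insert by auto
  have "\<exists>C\<ge>0. \<forall>i\<in>insert x F. \<forall>n. norm (fls_nth (f i) n) \<le> C * r powi n" if r: "r \<ge> max r1 r2" for r
  proof -
    obtain C1 C2 where C: "C1 \<ge> 0" "C2 \<ge> 0" "\<forall>i\<in>F. \<forall>n. norm (fls_nth (f i) n) \<le> C1 * r powi n"
      "\<forall>n. norm (fls_nth (f x) n) \<le> C2 * r powi n"
      using r1 r2 r by (meson max.bounded_iff)
    have "r > 0" using r r1 by auto
    then have "C1 * r powi n \<le> (C1 + C2) * r powi n" "C2 * r powi n \<le> (C1 + C2) * r powi n" for n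
      using C by (auto intro!: mult_right_mono)
    then show ?thesis using C by (intro exI[of _ "C1 + C2"]) (use order_trans in \<open>auto, blast+\<close>)
  qed
  then show ?case using r1 by (intro exI[of _ "max r1 r2"]) auto
qed

lemma conv_fls_laurent: "laurent_poly f \<Longrightarrow> conv_fls f"
proof -
  assume "laurent_poly f"
  then obtain b where b: "\<And>n. n > b \<Longrightarrow> fls_nth f n = 0" unfolding laurent_poly_iff by blast
  define C where "C = (\<Sum>n\<in>{0..b}. norm (fls_nth f n))"
  have "norm (fls_nth f (int n)) \<le> C" for n
  proof (cases "int n \<le> b")
    case True
    then show ?thesis unfolding C_def by (intro member_le_sum) auto
  next
    case False
    then show ?thesis using b by (auto simp: C_def intro!: sum_nonneg)
  qed
  moreover have "C \<ge> 0" unfolding C_def by (simp add: sum_nonneg)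
  ultimately show ?thesis unfolding conv_fls_iff_geometric_bound
    by (intro exI[of _ C] conjI exI[of _ 1]) auto
qed

lemma conv_fls_const [simp]: "conv_fls (fls_const c)" by (rule conv_fls_laurent) simp
lemma conv_fls_X [simp]: "conv_fls (fls_X_intpow k)" by (rule conv_fls_laurent) simp

lemma conv_fls_phiK [simp]:
  assumes "conv_fls f" shows "conv_fls (phiK q f)"
proof -
  obtain C \<rho> where C: "C \<ge> 0" "\<rho> > 0" "\<And>n. norm (fls_nth f (int n)) \<le> C * \<rho> ^ n"
    using assms unfolding conv_fls_iff_geometric_bound by blast
  have "norm (fls_nth (phiK q f) (int n)) \<le> C * ((norm q + 1) * \<rho>) ^ n" for n
  proof -
    have "norm (fls_nth (phiK q f) (int n)) = norm q ^ n * norm (fls_nth f (int n))"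
      by (simp add: norm_mult norm_power)
    also have "\<dots> \<le> (norm q + 1) ^ n * (C * \<rho> ^ n)"
      using C by (intro mult_mono power_mono) auto
    finally show ?thesis by (simp only: power_mult_distrib ac_simps)
  qed
  moreover have "(norm q + 1) * \<rho> > 0" using C by (simp add: add_nonneg_pos)
  ultimately show ?thesis unfolding conv_fls_iff_geometric_bound using C(1) by blast
qed

text \<open>The valuation of f is at least x, where 0 has infinite valuation. The bound x is real
  because slopes are rational and polygons yield bounds such as x (n - i); in coefficientwise form
  it passes to sums without case distinctions at 0.\<close>

definition vge :: "complex fls \<Rightarrow> real \<Rightarrow> bool" where
  "vge f x \<longleftrightarrow> (\<forall>n. fls_nth f n \<noteq> 0 \<longrightarrow> x \<le> real_of_int n)"

lemma vge_0 [simp]: "vge 0 x" by (simp add: vge_def)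
lemma vge_add: "vge f x \<Longrightarrow> vge g x \<Longrightarrow> vge (f + g) x"
  unfolding vge_def by (metis add_0 fls_plus_nth)
lemma vge_sum: "(\<And>i. i \<in> I \<Longrightarrow> vge (f i) x) \<Longrightarrow> vge (sum f I) x"
  by (induction I rule: infinite_finite_induct) (auto intro: vge_add)
lemma vge_uminus [simp]: "vge (- f) x \<longleftrightarrow> vge f x" by (simp add: vge_def)
lemma vge_mono: "vge f x \<Longrightarrow> y \<le> x \<Longrightarrow> vge f y"
  unfolding vge_def by force
lemma vge_iff: "vge f x \<longleftrightarrow> f = 0 \<or> x \<le> real_of_int (fls_subdegree f)"
proof (cases "f = 0")
  case False
  have "x \<le> real_of_int (fls_subdegree f) \<Longrightarrow> fls_nth f n \<noteq> 0 \<Longrightarrow> x \<le> real_of_int n" for n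
    using fls_subdegree_leI[of f n] by linarith
  then show ?thesis unfolding vge_def using False nth_fls_subdegree_nonzero[of f] by blast
qed simp
lemma vge_mult:
  assumes "vge f x" "vge g y" shows "vge (f * g) (x + y)"
  using assms by (cases "f = 0 \<or> g = 0") (auto simp: vge_iff)
lemma vge_phiK [simp]: "q \<noteq> 0 \<Longrightarrow> vge (phiK q f) x \<longleftrightarrow> vge f x" by (simp add: vge_def)
lemma vge_1 [simp]: "vge 1 x \<longleftrightarrow> x \<le> 0" by (simp add: vge_iff)
lemma vge_prod: "finite I \<Longrightarrow> (\<And>i. i \<in> I \<Longrightarrow> vge (f i) (x i)) \<Longrightarrow> vge (prod f I) (sum x I)"
  by (induction I rule: finite_induct) (auto intro: vge_mult)
lemma vge_ex: "\<exists>x. vge f x" using vge_iff by blast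
lemma vge_ex_finite:
  assumes "finite I" shows "\<exists>x. \<forall>i\<in>I. vge (f i) x"
  using assms
proof (induction rule: finite_induct)
  case (insert i I)
  then obtain x where "\<forall>i\<in>I. vge (f i) x" by blast
  moreover obtain y where "vge (f i) y" using vge_ex by blast
  ultimately show ?case by (intro exI[of _ "min x y"]) (auto intro: vge_mono)
qed auto
lemma vge_unbounded: "(\<And>N::nat. \<exists>x\<ge>real N. vge f x) \<Longrightarrow> f = 0"
proof (rule ccontr)
  assume *: "\<And>N::nat. \<exists>x\<ge>real N. vge f x" and "f \<noteq> 0"
  obtain N :: nat where "real N > real_of_int (fls_subdegree f)" using reals_Archimedean2 by blast
  then show False using *[of N] \<open>f \<noteq> 0\<close> unfolding vge_iff by auto
qed
lemma vge_nth: "vge f x \<Longrightarrow> real_of_int n < x \<Longrightarrow> fls_nth f n = 0"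
  unfolding vge_def by force

section \<open>Expansion of Laurent polynomials at infinity\<close>

lemma fls_nth_to_K' [simp]:
  assumes "laurent_poly f" shows "fls_nth (to_K' f) n = fls_nth f (-n)"
proof -
  obtain b where "\<And>n. n > b \<Longrightarrow> fls_nth f n = 0" using assms unfolding laurent_poly_iff by blast
  then show ?thesis unfolding to_K'_def by (intro nth_Abs_fls_lower_bound[of "-b"]) auto
qed

lemma laurent_to_K' [simp]: "laurent_poly f \<Longrightarrow> laurent_poly (to_K' f)"
  unfolding laurent_poly_iff[of "to_K' f"]
  by (intro exI[of _ "- fls_subdegree f"]) auto

lemma to_K'_0 [simp]: "to_K' 0 = 0" by (rule fls_eqI) simp
lemma to_K'_1 [simp]: "to_K' 1 = 1" by (rule fls_eqI) auto
lemma to_K'_add: "laurent_poly f \<Longrightarrow> laurent_poly g \<Longrightarrow> to_K' (f + g) = to_K' f + to_K' g"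
  by (rule fls_eqI) simp
lemma laurent_sum: "(\<And>i. i \<in> I \<Longrightarrow> laurent_poly (f i)) \<Longrightarrow> laurent_poly (sum f I)"
  by (induction I rule: infinite_finite_induct) auto
lemma to_K'_sum: "(\<And>i. i \<in> I \<Longrightarrow> laurent_poly (f i)) \<Longrightarrow> to_K' (sum f I) = (\<Sum>i\<in>I. to_K' (f i))"
  by (rule fls_eqI) (simp add: fls_nth_sum laurent_sum)

lemma to_K'_mult:
  assumes "laurent_poly f" "laurent_poly g"
  shows "to_K' (f * g) = to_K' f * to_K' g"
proof (rule fls_eqI)
  fix n
  obtain b c where b: "\<And>n. n > b \<Longrightarrow> fls_nth f n = 0" and c: "\<And>n. n > c \<Longrightarrow> fls_nth g n = 0"
    using assms unfolding laurent_poly_iff by blast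
  define a d where "a = fls_subdegree f" and "d = fls_subdegree g"
  have "fls_nth (to_K' (f * g)) n = (\<Sum>i=a..-n-d. fls_nth f i * fls_nth g (-n - i))"
    using assms by (simp add: fls_times_nth(2) a_def d_def)
  also have "\<dots> = (\<Sum>i=-n-c..b. fls_nth f i * fls_nth g (-n - i))"
    by (rule sum.mono_neutral_cong) (use b c in \<open>auto simp: a_def d_def not_le fls_eq0_below_subdegree\<close>)
  also have "\<dots> = (\<Sum>i=-b..n+c. fls_nth f (-i) * fls_nth g (-(n - i)))"
    by (rule sum.reindex_bij_witness[of _ uminus uminus]) auto
  also have "\<dots> = fls_nth (to_K' f * to_K' g) n"
    using b c assms by (subst fls_times_nth_bounds[of "-b" _ "-c"]) auto
  finally show "fls_nth (to_K' (f * g)) n = fls_nth (to_K' f * to_K' g) n" .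
qed

lemma to_K'_phiK: "laurent_poly f \<Longrightarrow> to_K' (phiK q f) = phiK (inverse q) (to_K' f)"
  by (rule fls_eqI) (simp add: power_int_minus power_int_inverse)
section \<open>Matrices of difference modules\<close>

text \<open>A subring of the Laurent series stable under all dilations. Both R and K qualify, so
  that gauge equivalence and tensor products are treated once for the two. Division is absent
  because R is not a field.\<close>

definition coef_ring :: "(complex fls \<Rightarrow> bool) \<Rightarrow> bool" where
  "coef_ring P \<longleftrightarrow> P 0 \<and> P 1 \<and> (\<forall>f g. P f \<longrightarrow> P g \<longrightarrow> P (f + g) \<and> P (f * g)) \<and> (\<forall>f q. P f \<longrightarrow> P (- f) \<and> P (phiK q f))"

lemma coef_ring_conv: "coef_ring conv_fls" by (simp add: coef_ring_def)
lemma coef_ring_laurent: "coef_ring laurent_poly" by (simp add: coef_ring_def)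

lemma coef_ringD:
  assumes "coef_ring P"
  shows "P 0" "P 1" "P f \<Longrightarrow> P g \<Longrightarrow> P (f + g)" "P f \<Longrightarrow> P g \<Longrightarrow> P (f * g)" "P f \<Longrightarrow> P (- f)" "P f \<Longrightarrow> P (phiK q f)"
  using assms by (auto simp: coef_ring_def)

lemma coef_ring_sum: "coef_ring P \<Longrightarrow> (\<And>i. i \<in> I \<Longrightarrow> P (f i)) \<Longrightarrow> P (sum f I)"
  by (induction I rule: infinite_finite_induct) (auto intro: coef_ringD)
lemma coef_ring_prod: "coef_ring P \<Longrightarrow> (\<And>i. i \<in> I \<Longrightarrow> P (f i)) \<Longrightarrow> P (prod f I)"
  by (induction I rule: infinite_finite_induct) (auto intro: coef_ringD)

lemma index_mult_sum:
  assumes "A \<in> carrier_mat n m" "B \<in> carrier_mat m p" "i < n" "j < p"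
  shows "(A * B) $$ (i, j) = (\<Sum>k<m. A $$ (i, k) * B $$ (k, j))"
  using assms by (auto simp: scalar_prod_def intro!: sum.cong simp: atLeast0LessThan)

abbreviation mphi :: "complex \<Rightarrow> complex fls mat \<Rightarrow> complex fls mat" where
  "mphi q \<equiv> map_mat (phiK q)"

lemma mphi_mult:
  assumes "q \<noteq> 0" "A \<in> carrier_mat n m" "B \<in> carrier_mat m p"
  shows "mphi q (A * B) = mphi q A * mphi q B"
proof -
  interpret comm_ring_hom "phiK q" using assms(1) by (rule phiK_comm_ring_hom)
  show ?thesis by (rule mat_hom_mult[OF assms(2,3)])
qed

lemma mphi_1 [simp]: "mphi q (1\<^sub>m n) = 1\<^sub>m n"
  by (rule eq_matI) auto

lemma mphi_mphi: "mphi p (mphi q A) = mphi (p * q) A"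
  by (rule eq_matI) (auto simp: phiK_phiK)

lemma map_mat_ident [simp]: "map_mat (\<lambda>a. a) A = A"
  by (rule eq_matI) auto

lemma entries_inD: "entries_in P A \<Longrightarrow> A \<in> carrier_mat n m \<Longrightarrow> i < n \<Longrightarrow> j < m \<Longrightarrow> P (A $$ (i, j))"
  by (auto simp: entries_in_def)
lemma entries_inI: "A \<in> carrier_mat n m \<Longrightarrow> (\<And>i j. i < n \<Longrightarrow> j < m \<Longrightarrow> P (A $$ (i, j))) \<Longrightarrow> entries_in P A"
  by (auto simp: entries_in_def)

lemma entries_in_mult:
  assumes "coef_ring P" "A \<in> carrier_mat n m" "B \<in> carrier_mat m p" "entries_in P A" "entries_in P B"
  shows "entries_in P (A * B)"
proof (rule entries_inI)
  show "A * B \<in> carrier_mat n p" using assms by auto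
  fix i j assume ij: "i < n" "j < p"
  show "P ((A * B) $$ (i, j))"
    unfolding index_mult_sum[OF assms(2,3) ij]
    by (rule coef_ring_sum[OF assms(1)]) (use ij assms in \<open>auto intro!: coef_ringD[OF assms(1)] intro: entries_inD\<close>)
qed

lemma entries_in_mphi: "coef_ring P \<Longrightarrow> entries_in P A \<Longrightarrow> entries_in P (mphi q A)"
  by (auto simp: entries_in_def coef_ringD)
lemma entries_in_one: "coef_ring P \<Longrightarrow> entries_in P (1\<^sub>m n)"
  by (auto simp: entries_in_def coef_ringD)
lemma entries_in_transpose: "entries_in P A \<Longrightarrow> entries_in P (transpose_mat A)"
  by (auto simp: entries_in_def)
lemma entries_in_laurent_conv: "entries_in laurent_poly A \<Longrightarrow> entries_in conv_fls A"
  by (auto simp: entries_in_def conv_fls_laurent)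

lemma coef_ring_det:
  assumes "coef_ring P" "A \<in> carrier_mat n n" "entries_in P A"
  shows "P (det A)"
proof -
  have "P (signof p)" for p :: "nat \<Rightarrow> nat"
    using coef_ringD[OF assms(1)] by (auto simp: sign_def)
  then show ?thesis
    unfolding det_def'[OF assms(2)]
    by (intro coef_ring_sum[OF assms(1)] coef_ringD(4)[OF assms(1)] coef_ring_prod[OF assms(1)])
      (use assms in \<open>auto simp: permutes_def intro: entries_inD\<close>)
qed

text \<open>Cramer's rule stays inside K because K is a field. Over R a nonzero determinant is not
  enough, so there inverse matrices are carried along explicitly.\<close>

lemma conv_matrix_inverse:
  assumes A: "A \<in> carrier_mat n n" and "entries_in conv_fls A" "det A \<noteq> 0"
  shows "\<exists>B. B \<in> carrier_mat n n \<and> entries_in conv_fls B \<and> A * B = 1\<^sub>m n \<and> B * A = 1\<^sub>m n"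
proof -
  define B where "B = inverse (det A) \<cdot>\<^sub>m adj_mat A"
  have adj: "adj_mat A \<in> carrier_mat n n" "A * adj_mat A = det A \<cdot>\<^sub>m 1\<^sub>m n" "adj_mat A * A = det A \<cdot>\<^sub>m 1\<^sub>m n"
    using adj_mat[OF A] by auto
  have "entries_in conv_fls B"
  proof (rule entries_inI)
    show "B \<in> carrier_mat n n" using adj by (simp add: B_def)
    fix i j assume ij: "i < n" "j < n"
    have d: "mat_delete A j i \<in> carrier_mat (n - 1) (n - 1)" using A by (intro mat_delete_carrier)
    have "entries_in conv_fls (mat_delete A j i)"
    proof (rule entries_inI[OF d])
      fix k l assume "k < n - 1" "l < n - 1"
      then show "conv_fls (mat_delete A j i $$ (k, l))"
        using A assms(2) by (auto simp: mat_delete_def entries_in_def)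
    qed
    then have "conv_fls (det (mat_delete A j i))"
      using coef_ring_det[OF coef_ring_conv d] by blast
    moreover have "conv_fls ((- 1) ^ m)" for m by (induction m) auto
    moreover have "conv_fls (det A)" using assms coef_ring_det[OF coef_ring_conv A] by blast
    ultimately show "conv_fls (B $$ (i, j))"
      using ij A by (simp add: B_def adj_mat_def cofactor_def)
  qed
  moreover have "A * B = 1\<^sub>m n" "B * A = 1\<^sub>m n" "B \<in> carrier_mat n n"
    using A adj assms(3) unfolding B_def
    by (auto simp: mult_smult_distrib[of _ n n _ n] mult_smult_assoc_mat[of _ n n _ n] intro!: eq_matI)
  ultimately show ?thesis by blast
qed

text \<open>\<open>it q A k\<close> is the matrix of \<open>\<Phi>\<^sup>k\<close>.\<close>

primrec it :: "complex \<Rightarrow> complex fls mat \<Rightarrow> nat \<Rightarrow> complex fls mat" where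
  "it q A 0 = 1\<^sub>m (dim_row A)"
| "it q A (Suc k) = A * mphi q (it q A k)"

lemma it_carrier [simp]: "A \<in> carrier_mat n n \<Longrightarrow> it q A k \<in> carrier_mat n n"
  by (induction k) auto

lemma it_add:
  assumes "q \<noteq> 0" "A \<in> carrier_mat n n"
  shows "it q A (j + k) = it q A j * mphi (q ^ j) (it q A k)"
proof (induction j)
  case 0
  then show ?case using assms by (simp add: left_mult_one_mat[of _ n n])
next
  case (Suc j)
  have "it q A (Suc j + k) = A * mphi q (it q A j * mphi (q ^ j) (it q A k))"
    using Suc by simp
  also have "\<dots> = A * (mphi q (it q A j) * mphi (q ^ Suc j) (it q A k))"
    using assms by (subst mphi_mult[of _ _ n n _ n]) (auto simp: mphi_mphi)
  also have "\<dots> = it q A (Suc j) * mphi (q ^ Suc j) (it q A k)"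
    using assms by (simp add: assoc_mult_mat[of _ n n _ n _ n])
  finally show ?case .
qed

lemma it_Suc': "q \<noteq> 0 \<Longrightarrow> A \<in> carrier_mat n n \<Longrightarrow> it q A (Suc k) = it q A k * mphi (q ^ k) A"
  using it_add[of q A n k "Suc 0"] by simp

lemma it_gauge:
  assumes "q \<noteq> 0" "A \<in> carrier_mat n n" "B \<in> carrier_mat m m" "G \<in> carrier_mat m n" "G * A = B * mphi q G"
  shows "G * it q A k = it q B k * mphi (q ^ k) G"
proof (induction k)
  case 0
  then show ?case using assms by (simp add: left_mult_one_mat[of _ m n] right_mult_one_mat[of _ m n])
next
  case (Suc k)
  have "G * it q A (Suc k) = (G * A) * mphi q (it q A k)"
    using assms(2-4) by (simp add: assoc_mult_mat[of _ m n _ n _ n])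
  also have "\<dots> = B * (mphi q (G * it q A k))"
    unfolding assms(5) using assms(1-4) by (simp add: assoc_mult_mat[of _ m m _ n _ n] mphi_mult[of _ _ m n _ n])
  also have "\<dots> = B * (mphi q (it q B k) * mphi (q ^ Suc k) G)"
    using assms by (simp add: Suc mphi_mult[of _ _ m m _ n] mphi_mphi)
  also have "\<dots> = it q B (Suc k) * mphi (q ^ Suc k) G"
    using assms by (simp add: assoc_mult_mat[of _ m m _ m _ n])
  finally show ?case .
qed

lemma entries_in_it: "coef_ring P \<Longrightarrow> A \<in> carrier_mat n n \<Longrightarrow> entries_in P A \<Longrightarrow> entries_in P (it q A k)"
  by (induction k) (auto intro!: entries_in_mult[of _ _ n n _ n] entries_in_mphi entries_in_one)

text \<open>Passing from Phi to its power \<open>d\<close> gives a module for the dilation by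
  \<open>q ^ d\<close>, whose iterates form a subsequence of the original ones.\<close>

lemma it_pow:
  assumes "q \<noteq> 0" "A \<in> carrier_mat n n"
  shows "it (q ^ d) (it q A d) m = it q A (d * m)"
proof (induction m)
  case 0
  have "dim_row (it q A d) = n" using it_carrier[OF assms(2), of q d] by auto
  then show ?case using assms by simp
next
  case (Suc m)
  then show ?case using it_add[OF assms, of d "d * m"] by (simp add: add.commute)
qed

section \<open>Isomorphism of modules as gauge equivalence\<close>

lemma diso_iff:
  "diso P (phiK q) n A m B \<longleftrightarrow> n = m \<and> (\<exists>G H. G \<in> carrier_mat n n \<and> H \<in> carrier_mat n n \<and> entries_in P G \<and> entries_in P H
     \<and> G * H = 1\<^sub>m n \<and> H * G = 1\<^sub>m n \<and> G * A = B * mphi q G)"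
  by (auto simp: diso_def dhom_def invertible_over_def)

lemma diso_refl: "coef_ring P \<Longrightarrow> A \<in> carrier_mat n n \<Longrightarrow> diso P (phiK q) n A n A"
  unfolding diso_iff by (intro conjI refl exI[of _ "1\<^sub>m n"]) (auto simp: entries_in_one)

lemma hom_inverse:
  assumes "q \<noteq> 0" "A \<in> carrier_mat n n" "B \<in> carrier_mat n n" "G \<in> carrier_mat n n" "H \<in> carrier_mat n n"
    "G * H = 1\<^sub>m n" "H * G = 1\<^sub>m n" "G * A = B * mphi q G"
  shows "H * B = A * mphi q H"
proof -
  have GH: "mphi q G * mphi q H = 1\<^sub>m n"
    using assms by (metis mphi_1 mphi_mult)
  have "H * B = H * (B * (mphi q G * mphi q H))" using assms by (simp add: GH)
  also have "\<dots> = H * ((B * mphi q G) * mphi q H)" using assms by (simp add: assoc_mult_mat[of _ n n _ n _ n])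
  also have "\<dots> = (H * G) * (A * mphi q H)" unfolding assms(8)[symmetric] using assms(2-5) by (simp add: assoc_mult_mat[of _ n n _ n _ n])
  also have "\<dots> = A * mphi q H" using assms by (simp add: left_mult_one_mat[of _ n n])
  finally show ?thesis .
qed

lemma diso_sym:
  assumes "q \<noteq> 0" "A \<in> carrier_mat n n" "B \<in> carrier_mat m m" "diso P (phiK q) n A m B"
  shows "diso P (phiK q) m B n A"
proof -
  obtain G H where G: "n = m" "G \<in> carrier_mat n n" "H \<in> carrier_mat n n" "entries_in P G" "entries_in P H"
    "G * H = 1\<^sub>m n" "H * G = 1\<^sub>m n" "G * A = B * mphi q G" using assms(4) unfolding diso_iff by auto
  have "H * B = A * mphi q H"
    by (rule hom_inverse[of q A n B G H]) (use assms G in auto)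
  then show ?thesis unfolding diso_iff using G by (intro conjI exI[of _ H] exI[of _ G]) auto
qed

lemma hom_comp:
  assumes "q \<noteq> 0" "A \<in> carrier_mat n n" "B \<in> carrier_mat m m" "C \<in> carrier_mat p p" "G \<in> carrier_mat m n" "G' \<in> carrier_mat p m"
    "G * A = B * mphi q G" "G' * B = C * mphi q G'"
  shows "(G' * G) * A = C * mphi q (G' * G)"
proof -
  have "(G' * G) * A = G' * (B * mphi q G)" using assms by (simp add: assoc_mult_mat[of _ p m _ n _ n])
  also have "\<dots> = (G' * B) * mphi q G" using assms by (intro assoc_mult_mat[of _ p m _ m _ n, symmetric]) auto
  also have "\<dots> = C * (mphi q G' * mphi q G)" unfolding assms(8) using assms by (intro assoc_mult_mat[of _ p p _ m _ n]) auto
  also have "\<dots> = C * mphi q (G' * G)" using assms by (simp add: mphi_mult[of _ _ p m _ n])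
  finally show ?thesis .
qed

lemma inverse_mult_mat:
  fixes G :: "'a :: semiring_1 mat"
  assumes "G \<in> carrier_mat n n" "H \<in> carrier_mat n n" "G' \<in> carrier_mat n n" "H' \<in> carrier_mat n n"
    "G * H = 1\<^sub>m n" "G' * H' = 1\<^sub>m n"
  shows "(G' * G) * (H * H') = 1\<^sub>m n"
proof -
  have "(G' * G) * (H * H') = G' * (G * H * H')" using assms(1-4) by (simp add: assoc_mult_mat[of _ n n _ n _ n])
  then show ?thesis using assms by (simp add: left_mult_one_mat[of _ n n])
qed

lemma diso_trans:
  assumes P: "coef_ring P" and "q \<noteq> 0" "A \<in> carrier_mat n n" "B \<in> carrier_mat m m" "C \<in> carrier_mat p p" "diso P (phiK q) n A m B" "diso P (phiK q) m B p C"
  shows "diso P (phiK q) n A p C"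
proof -
  obtain G H where G: "n = m" "G \<in> carrier_mat n n" "H \<in> carrier_mat n n" "entries_in P G" "entries_in P H"
    "G * H = 1\<^sub>m n" "H * G = 1\<^sub>m n" "G * A = B * mphi q G" using assms(6) unfolding diso_iff by auto
  obtain G' H' where G': "n = p" "G' \<in> carrier_mat n n" "H' \<in> carrier_mat n n" "entries_in P G'" "entries_in P H'"
    "G' * H' = 1\<^sub>m n" "H' * G' = 1\<^sub>m n" "G' * B = C * mphi q G'" using assms(7) G(1) unfolding diso_iff by auto
  have "(G' * G) * A = C * mphi q (G' * G)"
    by (rule hom_comp[of _ _ n B n _ n]) (use assms G G' in auto)
  moreover have "(G' * G) * (H * H') = 1\<^sub>m n" "(H * H') * (G' * G) = 1\<^sub>m n"
    using G G' inverse_mult_mat by auto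
  ultimately show ?thesis unfolding diso_iff using G G' entries_in_mult[OF P, of _ n n _ n]
    by (intro conjI exI[of _ "G' * G"] exI[of _ "H * H'"]) auto
qed

section \<open>Cyclic vectors\<close>

text \<open>All power sums vanish, hence so do all sums weighted by the values of a polynomial; the
  polynomial vanishing at every node but \<open>x i\<close> isolates \<open>d i\<close>.\<close>

lemma vandermonde_zero:
  fixes d x :: "'i \<Rightarrow> 'a::field"
  assumes fin: "finite I" and inj: "inj_on x I" and z: "\<And>k. (\<Sum>i\<in>I. d i * x i ^ k) = 0" and i: "i \<in> I"
  shows "d i = 0"
proof -
  have *: "(\<Sum>i\<in>I. d i * poly p (x i)) = 0" for p
  proof -
    have "(\<Sum>i\<in>I. d i * poly p (x i)) = (\<Sum>k\<le>degree p. coeff p k * (\<Sum>i\<in>I. d i * x i ^ k))"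
      unfolding poly_altdef sum_distrib_left by (subst sum.swap) (simp add: algebra_simps)
    then show ?thesis using z by simp
  qed
  define p where "p = (\<Prod>j\<in>I - {i}. [:- x j, 1:])"
  have "0 = (\<Sum>j\<in>I. d j * poly p (x j))" using * by simp
  also have "\<dots> = d i * poly p (x i) + (\<Sum>j\<in>I-{i}. d j * poly p (x j))"
    using fin i by (simp add: sum.remove)
  also have "(\<Sum>j\<in>I-{i}. d j * poly p (x j)) = 0"
    by (rule sum.neutral) (use fin in \<open>auto simp: p_def poly_prod\<close>)
  finally have "d i * poly p (x i) = 0" by simp
  moreover have "poly p (x i) \<noteq> 0"
    using fin inj i by (auto simp: p_def poly_prod inj_on_def)
  ultimately show ?thesis by simp
qed

lemma coeff_1_prod_linear:
  fixes a b :: "'i \<Rightarrow> 'a::comm_ring_1"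
  assumes "finite I"
  shows "coeff (\<Prod>i\<in>I. [:a i, b i:]) 0 = (\<Prod>i\<in>I. a i)"
    "coeff (\<Prod>i\<in>I. [:a i, b i:]) (Suc 0) = (\<Sum>r\<in>I. b r * (\<Prod>i\<in>I-{r}. a i))"
proof -
  show *: "coeff (\<Prod>i\<in>I. [:a i, b i:]) 0 = (\<Prod>i\<in>I. a i)" for I
    by (induction I rule: infinite_finite_induct) auto
  show "coeff (\<Prod>i\<in>I. [:a i, b i:]) (Suc 0) = (\<Sum>r\<in>I. b r * (\<Prod>i\<in>I-{r}. a i))"
    using assms
  proof (induction I rule: finite_induct)
    case (insert j I)
    have "(\<Sum>r\<in>I. b r * (\<Prod>i\<in>insert j I - {r}. a i)) = a j * (\<Sum>r\<in>I. b r * (\<Prod>i\<in>I-{r}. a i))"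
      unfolding sum_distrib_left
    proof (rule sum.cong[OF refl])
      fix r assume r: "r \<in> I"
      then have "insert j I - {r} = insert j (I - {r})" using insert by auto
      then show "b r * (\<Prod>i\<in>insert j I - {r}. a i) = a j * (b r * (\<Prod>i\<in>I-{r}. a i))"
        using insert by (simp add: algebra_simps)
    qed
    moreover have "insert j I - {j} = I" using insert by auto
    ultimately show ?case using insert by (simp add: * algebra_simps)
  qed simp
qed

text \<open>The determinant of a + c b is a polynomial in c with infinitely many zeros, hence zero.
  The sum in the conclusion is its linear coefficient, the derivative of the determinant at a in the
  direction b.\<close>

lemma det_linear_coefficient:
  fixes a b :: "nat \<Rightarrow> nat \<Rightarrow> 'a::field_char_0"
  assumes z: "\<And>c::nat. det (mat n n (\<lambda>(i,l). a i l + of_nat c * b i l)) = 0"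
  shows "(\<Sum>r<n. det (mat n n (\<lambda>(i,l). if i = r then b i l else a i l))) = 0"
proof -
  let ?P = "{p. p permutes {0..<n}}"
  define p where "p = (\<Sum>\<pi>\<in>?P. Polynomial.smult (signof \<pi>) (\<Prod>i\<in>{0..<n}. [:a i (\<pi> i), b i (\<pi> i):]))"
  have lt: "\<pi> i < n" if "\<pi> permutes {0..<n}" "i < n" for \<pi> i
    using that by (meson atLeastLessThan_iff permutes_in_image zero_le)
  have "poly p (of_nat c) = 0" for c
  proof -
    have "poly p (of_nat c) = det (mat n n (\<lambda>(i,l). a i l + of_nat c * b i l))"
      by (subst det_def'[of _ n]) (auto simp: p_def poly_sum poly_prod lt intro!: sum.cong)
    then show ?thesis using z by simp
  qed
  then have "range of_nat \<subseteq> {x. poly p x = 0}" by auto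
  moreover have "infinite (range (of_nat :: nat \<Rightarrow> 'a))"
    by (simp add: finite_image_iff inj_on_def)
  ultimately have "p = 0" using poly_roots_finite finite_subset by blast
  then have "0 = coeff p (Suc 0)" by simp
  also have "\<dots> = (\<Sum>\<pi>\<in>?P. signof \<pi> * (\<Sum>r<n. b r (\<pi> r) * (\<Prod>i\<in>{0..<n}-{r}. a i (\<pi> i))))"
    unfolding p_def by (simp add: coeff_sum coeff_1_prod_linear atLeast0LessThan)
  also have "\<dots> = (\<Sum>r<n. \<Sum>\<pi>\<in>?P. signof \<pi> * (b r (\<pi> r) * (\<Prod>i\<in>{0..<n}-{r}. a i (\<pi> i))))"
    unfolding sum_distrib_left by (rule sum.swap)
  also have "\<dots> = (\<Sum>r<n. det (mat n n (\<lambda>(i,l). if i = r then b i l else a i l)))"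
  proof (rule sum.cong[OF refl])
    fix r assume r: "r \<in> {..<n}"
    have "(\<Prod>i\<in>{0..<n}. mat n n (\<lambda>(i,l). if i = r then b i l else a i l) $$ (i, \<pi> i)) = b r (\<pi> r) * (\<Prod>i\<in>{0..<n}-{r}. a i (\<pi> i))"
      if "\<pi> permutes {0..<n}" for \<pi>
    proof -
      have "(\<Prod>i\<in>{0..<n}. mat n n (\<lambda>(i,l). if i = r then b i l else a i l) $$ (i, \<pi> i)) =
        (\<Prod>i\<in>{0..<n}. if i = r then b i (\<pi> i) else a i (\<pi> i))"
        using that by (intro prod.cong) (auto simp: lt)
      also have "\<dots> = b r (\<pi> r) * (\<Prod>i\<in>{0..<n}-{r}. if i = r then b i (\<pi> i) else a i (\<pi> i))"
        using r by (subst prod.remove[of _ r]) auto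
      also have "(\<Prod>i\<in>{0..<n}-{r}. if i = r then b i (\<pi> i) else a i (\<pi> i)) = (\<Prod>i\<in>{0..<n}-{r}. a i (\<pi> i))"
        by (rule prod.cong) auto
      finally show ?thesis .
    qed
    then show "(\<Sum>\<pi>\<in>?P. signof \<pi> * (b r (\<pi> r) * (\<Prod>i\<in>{0..<n}-{r}. a i (\<pi> i)))) =
      det (mat n n (\<lambda>(i,l). if i = r then b i l else a i l))"
      by (subst det_def'[of _ n]) auto
  qed
  finally show ?thesis by simp
qed

text \<open>The coordinates of \<open>\<Phi>\<^sup>i e\<close>.\<close>

definition kry :: "complex \<Rightarrow> complex fls mat \<Rightarrow> (nat \<Rightarrow> complex fls) \<Rightarrow> nat \<Rightarrow> nat \<Rightarrow> complex fls" where
  "kry q A e i l = (\<Sum>m<dim_row A. it q A i $$ (l, m) * phiK (q ^ i) (e m))"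

text \<open>Laplace expansion along row r, whose cofactors do not involve that row.\<close>

lemma det_row_replace:
  fixes X :: "nat \<Rightarrow> nat \<Rightarrow> 'a::comm_ring_1"
  assumes "r < n"
  shows "\<exists>c. \<forall>v. det (mat n n (\<lambda>(i,l). if i = r then v l else X i l)) = (\<Sum>l<n. v l * c l)"
proof (intro exI allI)
  fix v
  let ?M = "\<lambda>v. mat n n (\<lambda>(i,l). if i = r then v l else X i l)"
  have "det (?M v) = (\<Sum>l<n. ?M v $$ (r, l) * cofactor (?M v) r l)"
    by (rule laplace_expansion_row) (use assms in auto)
  also have "\<dots> = (\<Sum>l<n. v l * cofactor (?M (\<lambda>_. 0)) r l)"
  proof (rule sum.cong[OF refl])
    fix l assume "l \<in> {..<n}"
    have "mat_delete (?M v) r l = mat_delete (?M (\<lambda>_. 0)) r l"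
      unfolding mat_delete_def by (rule eq_matI) auto
    then show "?M v $$ (r, l) * cofactor (?M v) r l = v l * cofactor (?M (\<lambda>_. 0)) r l"
      using \<open>l \<in> _\<close> assms by (simp add: cofactor_def)
  qed
  finally show "det (?M v) = (\<Sum>l<n. v l * cofactor (?M (\<lambda>_. 0)) r l)" .
qed

lemma det_mphi: "q \<noteq> 0 \<Longrightarrow> det (mphi q A) = phiK q (det A)"
proof -
  assume "q \<noteq> 0"
  interpret comm_ring_hom "phiK q" using \<open>q \<noteq> 0\<close> by (rule phiK_comm_ring_hom)
  show ?thesis by simp
qed

lemma det_it_Suc: "q \<noteq> 0 \<Longrightarrow> A \<in> carrier_mat n n \<Longrightarrow> det (it q A (Suc k)) = det A * phiK q (det (it q A k))"
  by (simp add: det_mult[of _ n] det_mphi)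

lemma det_it_nonzero: "q \<noteq> 0 \<Longrightarrow> A \<in> carrier_mat n n \<Longrightarrow> det A \<noteq> 0 \<Longrightarrow> det (it q A k) \<noteq> 0"
proof (induction k)
  case (Suc k)
  then show ?case by (simp only: det_it_Suc mult_eq_0_iff phiK_eq_0_iff simp_thms)
qed simp

lemma phiK_mono: "phiK p (fls_const c * fls_X_intpow k) = fls_const (c * p powi k) * fls_X_intpow k"
  by (rule fls_eqI) auto

text \<open>If no vector worked, perturbing \<open>e\<close> by t z^k f for a basis vector f would
  keep the determinant zero for all t. Its part linear in t is a combination of determinants, one
  for each row r, with weights (q^r)^k; as k varies, distinctness of the powers of q separates the
  rows. So row m may be replaced by any Phi^m f without making the determinant nonzero. Such vectors
  span the whole space, which contradicts the nonzero determinant with row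
  \<open>w m\<close>.\<close>

lemma cyclic_step:
  assumes q: "q \<noteq> 0" "\<And>i. i > 0 \<Longrightarrow> q ^ i \<noteq> 1" and A: "A \<in> carrier_mat n n" "det A \<noteq> 0" and m: "m < n"
    and e: "\<And>j. laurent_poly (e j)" and d: "det (mat n n (\<lambda>(i,l). if i < m then kry q A e i l else w i l)) \<noteq> 0"
  shows "\<exists>e'. (\<forall>j. laurent_poly (e' j)) \<and> det (mat n n (\<lambda>(i,l). if i < Suc m then kry q A e' i l else w i l)) \<noteq> 0"
proof (rule ccontr)
  assume "\<not> ?thesis"
  then have no: "det (mat n n (\<lambda>(i,l). if i < Suc m then kry q A e' i l else w i l)) = 0" if "\<And>j. laurent_poly (e' j)" for e'
    using that by blast
  define a where "a i l = (if i < Suc m then kry q A e i l else w i l)" for i l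
  obtain c where c: "\<And>v. det (mat n n (\<lambda>(i,l). if i = m then v l else a i l)) = (\<Sum>l<n. v l * c l)"
    using det_row_replace[OF m, of a] by blast
  have cz: "(\<Sum>l<n. it q A m $$ (l, j) * c l) = 0" if j: "j < n" for j
  proof -
    define f where "f = (\<lambda>i::nat. if i = j then 1 else (0 :: complex fls))"
    have kf: "kry q A f i l = it q A i $$ (l, j)" for i l
      using j A by (simp add: kry_def f_def if_distrib[of "phiK _"] if_distrib[of "\<lambda>x. _ * x"] cong: if_cong)
    define D where "D r = det (mat n n (\<lambda>(i,l). if i = r then kry q A f i l else a i l))" for r
    have D: "(\<Sum>r<Suc m. D r * fls_const (q ^ r) ^ k) = 0" for k :: nat
    proof -
      define b where "b i l = (if i < Suc m then fls_const (q ^ (i*k)) * fls_X_intpow (int k) * kry q A f i l else 0)" for i l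
      have "det (mat n n (\<lambda>(i,l). a i l + of_nat t * b i l)) = 0" for t
      proof -
        \<comment> \<open>Phi^i multiplies the added monomial z^k by q^(i k), and this factor is
          what tells the rows apart.\<close>
        define e' where "e' = (\<lambda>i. e i + fls_const (of_nat t) * fls_X_intpow (int k) * f i)"
        have ke: "kry q A e' i l = kry q A e i l + of_nat t * (fls_const (q ^ (i*k)) * fls_X_intpow (int k) * kry q A f i l)" for i l
        proof -
          have "phiK (q ^ i) (e' m) = phiK (q^i) (e m) + of_nat t * (fls_const (q ^ (i*k)) * fls_X_intpow (int k)) * phiK (q^i) (f m)" for m
            using q by (simp add: e'_def phiK_add phiK_mult phiK_mono power_mult fls_of_nat power_int_power
                del: fls_X_intpow_times_conv_shift)
          then show ?thesis by (simp add: kry_def sum.distrib sum_distrib_left algebra_simps)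
        qed
        have "mat n n (\<lambda>(i,l). a i l + of_nat t * b i l) = mat n n (\<lambda>(i,l). if i < Suc m then kry q A e' i l else w i l)"
          by (rule eq_matI) (auto simp: a_def b_def ke)
        moreover have "laurent_poly (e' j)" for j using e by (auto simp: e'_def f_def simp del: fls_X_intpow_times_conv_shift)
        ultimately show ?thesis using no by simp
      qed
      then have "(\<Sum>r<n. det (mat n n (\<lambda>(i,l). if i = r then b i l else a i l))) = 0"
        by (rule det_linear_coefficient)
      also have "(\<Sum>r<n. det (mat n n (\<lambda>(i,l). if i = r then b i l else a i l))) = 
         (\<Sum>r<n. if r < Suc m then fls_const (q ^ (r*k)) * fls_X_intpow (int k) * D r else 0)"
      proof (rule sum.cong[OF refl])
        fix r assume r: "r \<in> {..<n}"
        obtain c' where c': "\<And>v. det (mat n n (\<lambda>(i,l). if i = r then v l else a i l)) = (\<Sum>l<n. v l * c' l)"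
          using det_row_replace[of r n a] r by blast
        have "mat n n (\<lambda>(i,l). if i = r then b i l else a i l) = mat n n (\<lambda>(i,l). if i = r then b r l else a i l)"
          "mat n n (\<lambda>(i,l). if i = r then kry q A f i l else a i l) = mat n n (\<lambda>(i,l). if i = r then kry q A f r l else a i l)"
          by (rule eq_matI; auto)+
        then show "det (mat n n (\<lambda>(i,l). if i = r then b i l else a i l)) = 
          (if r < Suc m then fls_const (q ^ (r*k)) * fls_X_intpow (int k) * D r else 0)"
          unfolding D_def by (simp only: c') (simp add: b_def sum_distrib_left mult.assoc del: fls_X_intpow_times_conv_shift)
      qed
      also have "\<dots> = (\<Sum>r<Suc m. fls_const (q ^ (r*k)) * fls_X_intpow (int k) * D r)"
        using m by (intro sum.mono_neutral_cong_right) auto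
      also have "\<dots> = fls_X_intpow (int k) * (\<Sum>r<Suc m. D r * fls_const (q ^ r) ^ k)"
        by (simp add: sum_distrib_left power_mult fls_const_power algebra_simps del: sum.lessThan_Suc fls_X_intpow_times_conv_shift)
      finally have "fls_X_intpow (int k) = (0 :: complex fls) \<or> (\<Sum>r<Suc m. D r * fls_const (q ^ r) ^ k) = 0"
        by (simp only: mult_eq_0_iff)
      then show ?thesis by (simp del: sum.lessThan_Suc)
    qed
    have inj: "inj_on (\<lambda>r. fls_const (q ^ r)) {..<Suc m}"
    proof (rule inj_onI)
      fix r s assume "fls_const (q ^ r) = fls_const (q ^ s)"
      then have "q ^ r = q ^ s" by (metis fls_const_nth)
      then show "r = s"
      proof (induction r s rule: linorder_wlog)
        case (le r s)
        then have "q ^ (s - r) = 1" using q(1) by (simp add: power_diff)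
        then show ?case using q(2)[of "s - r"] le by (cases "s - r") auto
      qed simp
    qed
    have "D m = 0"
      by (rule vandermonde_zero[OF _ inj D]) auto
    moreover have "mat n n (\<lambda>(i,l). if i = m then kry q A f i l else a i l) = mat n n (\<lambda>(i,l). if i = m then kry q A f m l else a i l)"
      by (rule eq_matI) auto
    ultimately show ?thesis unfolding D_def by (simp add: c kf)
  qed
  have "vec n c = 0\<^sub>v n"
  proof (rule ccontr)
    assume nz: "vec n c \<noteq> 0\<^sub>v n"
    have M: "(it q A m)\<^sup>T \<in> carrier_mat n n" using A by simp
    have "(it q A m)\<^sup>T *\<^sub>v vec n c = 0\<^sub>v n"
    proof (rule eq_vecI)
      fix j assume j: "j < dim_vec (0\<^sub>v n)"
      have dm: "it q A m \<in> carrier_mat n n" using A by simp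
      then show "((it q A m)\<^sup>T *\<^sub>v vec n c) $ j = 0\<^sub>v n $ j"
        using j cz[of j] carrier_matD[OF dm] by (auto simp: scalar_prod_def atLeast0LessThan)
    qed (use M in auto)
    then have "det ((it q A m)\<^sup>T) = 0"
      using det_0_iff_vec_prod_zero[OF M] nz vec_carrier[of n c] by blast
    then show False using det_transpose[of "it q A m" n] det_it_nonzero[OF q(1) A] A by simp
  qed
  then have "c l = 0" if "l < n" for l using that by (metis index_vec index_zero_vec(1))
  then have "det (mat n n (\<lambda>(i,l). if i = m then w m l else a i l)) = 0" using c by simp
  moreover have "mat n n (\<lambda>(i,l). if i = m then w m l else a i l) = mat n n (\<lambda>(i,l). if i < m then kry q A e i l else w i l)"
    by (rule eq_matI) (auto simp: a_def)
  ultimately show False using d by simp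
qed

text \<open>Rows of the identity matrix are exchanged for Krylov vectors one at a time; the vector
  \<open>e\<close> itself may change at each exchange.\<close>

lemma cyclic_vector:
  assumes q: "q \<noteq> 0" "\<And>i. i > 0 \<Longrightarrow> q ^ i \<noteq> 1" and A: "A \<in> carrier_mat n n" "det A \<noteq> 0"
  shows "\<exists>e. (\<forall>j. laurent_poly (e j)) \<and> det (mat n n (\<lambda>(i,l). kry q A e i l)) \<noteq> 0"
proof -
  define w :: "nat \<Rightarrow> nat \<Rightarrow> complex fls" where "w = (\<lambda>i l. if i = l then 1 else (0::complex fls))"
  have "m \<le> n \<Longrightarrow> \<exists>e. (\<forall>j. laurent_poly (e j)) \<and> det (mat n n (\<lambda>(i,l). if i < m then kry q A e i l else w i l)) \<noteq> 0" for m
  proof (induction m)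
    case 0
    have "mat n n (\<lambda>(i,l). if i < 0 then kry q A (\<lambda>_. 0) i l else w i l) = 1\<^sub>m n"
      by (rule eq_matI) (auto simp: w_def)
    then show ?case by (intro exI[of _ "\<lambda>_. 0"]) auto
  next
    case (Suc m)
    then obtain e where "\<And>j. laurent_poly (e j)" "det (mat n n (\<lambda>(i,l). if i < m then kry q A e i l else w i l)) \<noteq> 0" by auto
    then show ?case using cyclic_step[OF q A, of m e w] Suc by auto
  qed
  then obtain e where e: "\<And>j. laurent_poly (e j)" "det (mat n n (\<lambda>(i,l). if i < n then kry q A e i l else w i l)) \<noteq> 0" by blast
  moreover have "mat n n (\<lambda>(i,l). if i < n then kry q A e i l else w i l) = mat n n (\<lambda>(i,l). kry q A e i l)"
    by (rule eq_matI) auto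
  ultimately show ?thesis by auto
qed

lemma kry_Suc:
  assumes "q \<noteq> 0" "A \<in> carrier_mat n n" "l < n"
  shows "kry q A e (Suc i) l = (\<Sum>k<n. A $$ (l, k) * phiK q (kry q A e i k))"
proof -
  have c: "it q A i \<in> carrier_mat n n" using assms by simp
  have "kry q A e (Suc i) l = (\<Sum>m<n. (\<Sum>k<n. A $$ (l, k) * phiK q (it q A i $$ (k, m))) * phiK (q ^ Suc i) (e m))"
    unfolding kry_def it.simps using assms carrier_matD[OF c]
    by (intro sum.cong) (auto simp: index_mult_sum[of _ n n _ n] simp del: index_mult_mat)
  also have "\<dots> = (\<Sum>k<n. \<Sum>m<n. A $$ (l, k) * phiK q (it q A i $$ (k, m)) * phiK (q ^ Suc i) (e m))"
    unfolding sum_distrib_right by (rule sum.swap)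
  also have "\<dots> = (\<Sum>k<n. A $$ (l, k) * phiK q (kry q A e i k))"
    using assms unfolding kry_def phiK_sum sum_distrib_left
    by (intro sum.cong refl) (auto simp: phiK_mult phiK_phiK algebra_simps)
  finally show ?thesis .
qed

lemma cyclic_companion:
  assumes q: "q \<noteq> 0" "\<And>i. i > 0 \<Longrightarrow> q ^ i \<noteq> 1" and A: "A \<in> carrier_mat n n" "entries_in conv_fls A" "det A \<noteq> 0" and n: "n \<ge> 1"
  shows "\<exists>a G H. (\<forall>i\<le>n. conv_fls (a i)) \<and> a n = 1 \<and> G \<in> carrier_mat n n \<and> H \<in> carrier_mat n n \<and> entries_in conv_fls G \<and>
    entries_in conv_fls H \<and> G * H = 1\<^sub>m n \<and> H * G = 1\<^sub>m n \<and> G * A = companion n a * mphi q G"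
proof -
  obtain e where e: "\<And>j. laurent_poly (e j)" "det (mat n n (\<lambda>(i,l). kry q A e i l)) \<noteq> 0"
    using cyclic_vector[OF q A(1,3)] by blast
  have ck: "conv_fls (kry q A e i l)" if "l < n" for i l
    unfolding kry_def using that A e entries_in_it[OF coef_ring_conv A(1,2)] 
    by (intro coef_ring_sum[OF coef_ring_conv] conv_fls_mult conv_fls_phiK) (auto intro!: conv_fls_laurent[of "e _"] intro: entries_inD[of _ _ n n])
  define X where "X = mat n n (\<lambda>(l,i). kry q A e i l)"
  have X: "X \<in> carrier_mat n n" "entries_in conv_fls X" by (auto simp: X_def entries_in_def ck)
  have "X = (mat n n (\<lambda>(i,l). kry q A e i l))\<^sup>T" unfolding X_def by (rule eq_matI) auto
  then have "det X \<noteq> 0" using e(2) by (simp add: det_transpose[of _ n])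
  then obtain G where G: "G \<in> carrier_mat n n" "entries_in conv_fls G" "X * G = 1\<^sub>m n" "G * X = 1\<^sub>m n"
    using conv_matrix_inverse[OF X] by blast
  \<comment> \<open>Coordinates of Phi^n e in the Krylov basis, with the sign that
    \<open>companion\<close> expects for the relation of order n satisfied by e.\<close>
  define a where "a i = (if i < n then - (\<Sum>l<n. G $$ (i, l) * kry q A e n l) else 1)" for i
  have a: "conv_fls (a i)" for i
    unfolding a_def using G ck by (auto intro!: conv_fls_uminus coef_ring_sum[OF coef_ring_conv] conv_fls_mult intro: entries_inD[of _ _ n n])
  have AX: "A * mphi q X = X * companion n a"
  proof (rule eq_matI)
    fix l i assume li: "l < dim_row (X * companion n a)" "i < dim_col (X * companion n a)"
    then have li: "l < n" "i < n" using X by (auto simp: companion_def)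
    have C: "companion n a \<in> carrier_mat n n" by (simp add: companion_def)
    have "(A * mphi q X) $$ (l, i) = kry q A e (Suc i) l"
      using li X A q by (subst index_mult_sum[of _ n n _ n]) (auto simp: kry_Suc X_def)
    also have "\<dots> = (X * companion n a) $$ (l, i)"
    proof (cases "i = n - 1")
      case False
      then have "(X * companion n a) $$ (l, i) = (\<Sum>k<n. X $$ (l, k) * (if k = Suc i then 1 else 0))"
        using li by (subst index_mult_sum[OF X(1) C li]) (intro sum.cong refl, auto simp: companion_def)
      also have "\<dots> = X $$ (l, Suc i)" using li False by (simp add: if_distrib[of "\<lambda>x. _ * x"] cong: if_cong)
      finally show ?thesis using li False by (simp add: X_def)
    next
      case True
      have "(X * companion n a) $$ (l, i) = (\<Sum>k<n. X $$ (l, k) * - a k)"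
        using li True by (subst index_mult_sum[OF X(1) C li]) (intro sum.cong refl, auto simp: companion_def)
      also have "\<dots> = (\<Sum>k<n. X $$ (l, k) * (\<Sum>m<n. G $$ (k, m) * kry q A e n m))"
        by (intro sum.cong) (auto simp: a_def)
      also have "\<dots> = (\<Sum>m<n. (\<Sum>k<n. X $$ (l, k) * G $$ (k, m)) * kry q A e n m)"
        unfolding sum_distrib_left sum_distrib_right by (subst sum.swap) (simp add: mult.assoc)
      also have "\<dots> = (\<Sum>m<n. (if l = m then 1 else 0) * kry q A e n m)"
        using li G(3) X G by (intro sum.cong refl) (auto simp: index_mult_sum[symmetric, of X n n G n])
      also have "\<dots> = kry q A e n l" using li by (simp add: if_distrib[of "\<lambda>x. x * _"] cong: if_cong)
      finally show ?thesis using True n by simp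
    qed
    finally show "(A * mphi q X) $$ (l, i) = (X * companion n a) $$ (l, i)" .
  qed (use X A in \<open>auto simp: companion_def\<close>)
  have "G * A = companion n a * mphi q G"
    by (rule hom_inverse[of q "companion n a" n A X G]) (use q A X G AX in \<open>auto simp: companion_def\<close>)
  then show ?thesis using a G X
    by (intro exI[of _ a] exI[of _ G] exI[of _ X]) (auto simp: a_def)
qed

section \<open>Newton polygons and growth of iterates\<close>

text \<open>Strictness beyond the chosen point is what makes the extremal term unique in the Gauss
  argument of \<open>gauss_newton\<close>.\<close>

lemma last_minimizer:
  fixes f :: "nat \<Rightarrow> real"
  assumes "finite S" "S \<noteq> {}"
  shows "\<exists>x\<in>S. \<forall>y\<in>S. f x \<le> f y \<and> (y > x \<longrightarrow> f x < f y)"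
proof -
  define m where "m = Min (f ` S)"
  define T where "T = {y\<in>S. f y = m}"
  have "m \<in> f ` S" unfolding m_def using assms by (intro Min_in) auto
  then have T: "finite T" "T \<noteq> {}" using assms by (auto simp: T_def)
  have le: "m \<le> f y" if "y \<in> S" for y unfolding m_def using assms that by auto
  have x: "Max T \<in> T" using T by (rule Max_in)
  have "m < f y" if "y \<in> S" "y > Max T" for y
  proof -
    have "y \<notin> T" using T that Max_ge[of T y] by auto
    then show ?thesis using that le[of y] by (auto simp: T_def)
  qed
  then show ?thesis using x le by (intro bexI[of _ "Max T"]) (auto simp: T_def)
qed

lemma companion_carrier [simp]: "companion n a \<in> carrier_mat n n" by (simp add: companion_def)

text \<open>Phi^k raises valuations by at least k x up to a constant independent of k, and a change
  of basis alters only that constant. This is the lower half of having slope x; the other half is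
  the same condition for the contragredient with - x.\<close>

definition grow :: "complex \<Rightarrow> nat \<Rightarrow> complex fls mat \<Rightarrow> real \<Rightarrow> bool" where
  "grow q n A x \<longleftrightarrow> (\<exists>K. \<forall>k. \<forall>i<n. \<forall>j<n. vge (it q A k $$ (i, j)) (real k * x - K))"

text \<open>The last coordinates \<open>G\<close> of the vectors Phi^k e_0 satisfy a linear
  recurrence with coefficients \<open>l\<close>. If some a_i lay on the wrong side of the line of
  slope x, take x' slightly smaller than x. Weighted by x', the coefficients have a negative
  minimum, and the sequence \<open>G\<close> also attains its minimum because it grows at the faster
  rate x. As in Gauss's lemma, the product of the last minimizers of both sequences has strictly
  smaller valuation than every other term in one instance of the recurrence, which therefore cannot
  sum to zero.\<close>

lemma gauss_newton:
  assumes q: "q \<noteq> 0" and n: "n \<ge> 1" and an: "a n = 1" and gr: "grow q n (companion n a) x" and i: "i < n"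
  shows "vge (a i) (x * (real n - real i))"
proof (rule ccontr)
  assume "\<not> ?thesis"
  then have ai: "a i \<noteq> 0" "real_of_int (fls_subdegree (a i)) < x * (real n - real i)" by (auto simp: vge_iff)
  obtain K where K: "\<And>k i j. i < n \<Longrightarrow> j < n \<Longrightarrow> vge (it q (companion n a) k $$ (i, j)) (real k * x - K)"
    using gr unfolding grow_def by blast
  define C where "C = companion n a"
  have C [simp]: "C \<in> carrier_mat n n" by (simp add: C_def)
  define r where "r k i = it q C k $$ (i, 0)" for k i
  define G where "G k = r k (n - 1)" for k
  have r0: "r 0 i = (if i = 0 then 1 else 0)" if "i < n" for i
    using that n by (simp add: r_def C_def companion_def)
  have rS: "r (Suc k) i = (if i = 0 then 0 else phiK q (r k (i - 1))) - a i * phiK q (G k)" if i: "i < n" for k i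
  proof -
    have c: "it q C k \<in> carrier_mat n n" by simp
    have "r (Suc k) i = (\<Sum>m<n. C $$ (i, m) * phiK q (it q C k $$ (m, 0)))"
      unfolding r_def it.simps using i n carrier_matD[OF c] by (subst index_mult_sum[of _ n n _ n]) auto
    also have "\<dots> = (\<Sum>m<n. (if m = n - 1 then - a i * phiK q (r k m) else 0) + (if i = Suc m then phiK q (r k m) else 0))"
      using i by (intro sum.cong refl) (auto simp: C_def companion_def r_def algebra_simps)
    also have "\<dots> = (\<Sum>m<n. (if m = n - 1 then - a i * phiK q (r k m) else 0)) + (\<Sum>m<n. (if i = Suc m then phiK q (r k m) else 0))"
      by (rule sum.distrib)
    also have "(\<Sum>m<n. (if m = n - 1 then - a i * phiK q (r k m) else 0)) = - a i * phiK q (G k)"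
      using n by (simp add: G_def)
    also have "(\<Sum>m<n. (if i = Suc m then phiK q (r k m) else 0)) = (if i = 0 then 0 else phiK q (r k (i - 1)))"
      using i by (cases i) auto
    finally show ?thesis by simp
  qed
  have rlow: "r k i = (if i = k then 1 else 0)" if "k < n" "i < n" for k i
    using that
  proof (induction k arbitrary: i)
    case 0
    then show ?case by (auto simp: r0)
  next
    case (Suc k)
    then have "G k = 0" by (simp add: G_def)
    then show ?case using Suc by (auto simp: rS)
  qed
  have Glow: "G k = 0" if "k < n - 1" for k using that by (simp add: G_def rlow)
  have G1: "G (n - 1) = 1" using n by (simp add: G_def rlow)
  have run: "r k i = - (\<Sum>s\<le>i. phiK (q ^ s) (a (i - s)) * phiK (q ^ Suc s) (G (k - Suc s)))" if "i < n" "i < k" for k i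
    using that
  proof (induction i arbitrary: k)
    case 0
    then obtain k' where "k = Suc k'" by (cases k) auto
    then show ?case using 0 by (simp add: rS)
  next
    case (Suc i)
    then obtain k' where k: "k = Suc k'" "i < k'" by (cases k) auto
    have "r k (Suc i) = phiK q (r k' i) - a (Suc i) * phiK q (G k')" using Suc k by (simp add: rS)
    also have "phiK q (r k' i) = - (\<Sum>s\<le>i. phiK (q ^ Suc s) (a (i - s)) * phiK (q ^ Suc (Suc s)) (G (k' - Suc s)))"
      using Suc k q by (simp add: phiK_sum phiK_mult phiK_phiK)
    finally show ?case using k by (subst sum.atMost_Suc_shift) simp
  qed
  \<comment> \<open>Coefficients of the recurrence for \<open>G\<close>; the twist by q^(s-1) arises
    from unrolling the coordinates from row n - 1 down to row 0.\<close>
  define l where "l s = (if s = 0 then 1 else phiK (q ^ (s - 1)) (a (n - s)))" for s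
  have rel: "(\<Sum>s\<le>n. l s * phiK (q ^ s) (G (k - s))) = 0" if "k \<ge> n" for k
  proof -
    have "G k = - (\<Sum>s\<le>n-1. phiK (q ^ s) (a (n - 1 - s)) * phiK (q ^ Suc s) (G (k - Suc s)))"
      unfolding G_def[of k] using n that by (intro run) auto
    moreover have "(\<Sum>s\<le>n. l s * phiK (q ^ s) (G (k - s))) = l 0 * G k + (\<Sum>s\<le>n-1. l (Suc s) * phiK (q ^ Suc s) (G (k - Suc s)))"
      using n sum.atMost_Suc_shift[of "\<lambda>s. l s * phiK (q ^ s) (G (k - s))" "n - 1"] by simp
    ultimately show ?thesis by (simp add: l_def)
  qed
  define s1 where "s1 = n - i"
  have s1: "1 \<le> s1" "s1 \<le> n" "real s1 = real n - real i" using i by (auto simp: s1_def)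
  have ls1: "l s1 \<noteq> 0" "real_of_int (fls_subdegree (l s1)) < x * real s1"
  proof -
    have *: "l s1 = phiK (q ^ (s1 - 1)) (a i)" using s1(1) i by (simp add: l_def s1_def)
    show nz: "l s1 \<noteq> 0" using * ai q by simp
    have "\<not> vge (a i) (x * real s1)" using ai s1 by (simp add: vge_iff)
    then have "\<not> vge (l s1) (x * real s1)" using * q by simp
    then show "real_of_int (fls_subdegree (l s1)) < x * real s1" by (auto simp: vge_iff)
  qed
  \<comment> \<open>Midpoint between the slope of the offending coefficient and x. The gap to x
    makes the values \<open>\<alpha>\<close> tend to infinity, the gap on the other side makes some
    \<open>\<beta>\<close> negative.\<close>
  define x' where "x' = (x + real_of_int (fls_subdegree (l s1)) / real s1) / 2"
  have x': "x' < x" "real_of_int (fls_subdegree (l s1)) < x' * real s1"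
    using ls1(2) s1(1) by (auto simp: x'_def field_simps)
  define \<beta> where "\<beta> s = real_of_int (fls_subdegree (l s)) - x' * real s" for s
  define \<alpha> where "\<alpha> j = real_of_int (fls_subdegree (G (n - 1 + j))) - x' * real j" for j
  define S where "S = {s. s \<le> n \<and> l s \<noteq> 0}"
  have S: "finite S" "s1 \<in> S" using ls1 s1 by (auto simp: S_def)
  obtain b where b: "b \<in> S" "\<And>s. s \<in> S \<Longrightarrow> \<beta> b \<le> \<beta> s" "\<And>s. s \<in> S \<Longrightarrow> s > b \<Longrightarrow> \<beta> b < \<beta> s"
    using last_minimizer[OF S(1), of \<beta>] S(2) by blast
  have "\<beta> b < 0" using b(2)[OF S(2)] x'(2) by (simp add: \<beta>_def)
  \<comment> \<open>The weight of \<open>l 0 = 1\<close> is 0, so the minimizer is not 0; hence the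
    index k chosen below is at least n, where the recurrence is valid.\<close>
  then have b1: "b \<ge> 1" by (cases b) (auto simp: \<beta>_def l_def)
  \<comment> \<open>Indices that can compete with j = 0, whose weight is 0 because G (n - 1) = 1.
    The minimum over the infinite sequence thus becomes a minimum over a finite set.\<close>
  define T where "T = {j. G (n - 1 + j) \<noteq> 0 \<and> \<alpha> j \<le> 0}"
  have T0: "0 \<in> T" using G1 by (simp add: T_def \<alpha>_def)
  have Tfin: "finite T"
  proof (rule finite_subset)
    define N where "N = n - 1"
    define B where "B = (K - real N * x) / (x - x')"
    have vG: "vge (G (N + j)) (real (N + j) * x - K)" for j
      unfolding G_def r_def C_def by (rule K) (use n in auto)
    have jB: "real j \<le> B" if "j \<in> T" for j
    proof -
      have g: "G (N + j) \<noteq> 0" "real_of_int (fls_subdegree (G (N + j))) \<le> x' * real j"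
        using that unfolding T_def \<alpha>_def N_def by auto
      then have "real (N + j) * x - K \<le> x' * real j" using vG[of j] unfolding vge_iff by linarith
      then have "real j * (x - x') \<le> K - real N * x" by (simp add: algebra_simps)
      then show ?thesis using x' by (simp add: B_def pos_le_divide_eq)
    qed
    show "T \<subseteq> {..nat \<lceil>B\<rceil>}"
    proof
      fix j assume "j \<in> T"
      then have "real j \<le> real (nat \<lceil>B\<rceil>)" using jB real_nat_ceiling_ge order_trans by blast
      then show "j \<in> {..nat \<lceil>B\<rceil>}" by simp
    qed
  qed simp
  obtain c where c: "c \<in> T" "\<And>j. j \<in> T \<Longrightarrow> \<alpha> c \<le> \<alpha> j" "\<And>j. j \<in> T \<Longrightarrow> j > c \<Longrightarrow> \<alpha> c < \<alpha> j"
    using last_minimizer[of T \<alpha>] Tfin T0 by blast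
  have c0: "\<alpha> c \<le> 0" using c(1) by (simp add: T_def)
  have c2: "\<alpha> c \<le> \<alpha> j" "j > c \<Longrightarrow> \<alpha> c < \<alpha> j" if "G (n - 1 + j) \<noteq> 0" for j
    using c that c0 by (cases "j \<in> T"; force simp: T_def)+
  define k where "k = n - 1 + c + b"
  define t where "t s = l s * phiK (q ^ s) (G (k - s))" for s
  have bn: "b \<le> n" "l b \<noteq> 0" using b(1) by (auto simp: S_def)
  have kb: "k - b = n - 1 + c" by (simp add: k_def)
  have Gc: "G (n - 1 + c) \<noteq> 0" using c(1) by (simp add: T_def)
  define v where "v = fls_subdegree (l b) + fls_subdegree (G (n - 1 + c))"
  have sd: "fls_subdegree (phiK p f) = fls_subdegree f" if "p \<noteq> 0" for p f
    using that by (cases "f = 0") (auto intro!: fls_subdegree_eqI)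
  have vv: "real_of_int v = \<beta> b + \<alpha> c + x' * real (b + c)" by (simp add: v_def \<beta>_def \<alpha>_def algebra_simps)
  have tb: "fls_nth (t b) v \<noteq> 0"
  proof -
    have "t b \<noteq> 0" "fls_subdegree (t b) = v" unfolding t_def kb v_def using bn Gc q by (auto simp: sd)
    then show ?thesis using nth_fls_subdegree_nonzero by blast
  qed
  have ts: "fls_nth (t s) v = 0" if s: "s \<le> n" "s \<noteq> b" for s
  proof (cases "t s = 0")
    case False
    then have ls: "l s \<noteq> 0" "G (k - s) \<noteq> 0" using q by (auto simp: t_def)
    then have "k - s \<ge> n - 1" using Glow not_less by blast
    define j where "j = c + b - s"
    have j: "k - s = n - 1 + j" "j + s = c + b" using \<open>k - s \<ge> n - 1\<close> s n b1 unfolding j_def k_def by (cases "n = 1"; auto)+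
    have sS: "s \<in> S" using ls s by (simp add: S_def)
    have "fls_subdegree (t s) = fls_subdegree (l s) + fls_subdegree (G (n - 1 + j))"
      unfolding t_def j(1) using ls j q by (simp add: sd)
    then have "real_of_int (fls_subdegree (t s)) = \<beta> s + \<alpha> j + x' * real (j + s)" by (simp add: \<beta>_def \<alpha>_def algebra_simps)
    also have "\<dots> > \<beta> b + \<alpha> c + x' * real (b + c)"
    proof (cases "s > b")
      case True
      then show ?thesis using b(3)[OF sS] c2(1)[of j] ls j by (simp add: add.commute)
    next
      case False
      then have "j > c" using j s by auto
      then show ?thesis using b(2)[OF sS] c2(2)[of j] ls j by (simp add: add.commute)
    qed
    finally have "v < fls_subdegree (t s)" using vv by linarith
    then show ?thesis by simp
  qed simp
  have "(\<Sum>s\<le>n. t s) = 0" unfolding t_def by (rule rel) (use b1 in \<open>simp add: k_def\<close>)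
  then have "(\<Sum>s\<le>n. fls_nth (t s) v) = 0" using fls_nth_sum[of t "{..n}" v] by simp
  moreover have "(\<Sum>s\<le>n. fls_nth (t s) v) = (\<Sum>s\<in>{b}. fls_nth (t s) v)"
    by (rule sum.mono_neutral_right) (use ts bn in auto)
  ultimately show False using tb by simp
qed

section \<open>Growth under determinants, weights and gauge transformations\<close>

lemma mult_square_carrier [simp]: "A \<in> carrier_mat n n \<Longrightarrow> B \<in> carrier_mat n n \<Longrightarrow> A * B \<in> carrier_mat n n"
  by (rule mult_carrier_mat)

lemma vge_det:
  assumes A: "A \<in> carrier_mat n n" and v: "\<And>i j. i < n \<Longrightarrow> j < n \<Longrightarrow> vge (A $$ (i, j)) x"
  shows "vge (det A) (real n * x)"
  unfolding det_def'[OF A]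
proof (rule vge_sum)
  fix p assume "p \<in> {p. p permutes {0..<n}}"
  then have p: "p i < n" if "i < n" for i
    using that by (metis atLeastLessThan_iff mem_Collect_eq permutes_in_image zero_le)
  have "vge (\<Prod>i\<in>{0..<n}. A $$ (i, p i)) (\<Sum>i\<in>{0..<n}. x)"
    by (rule vge_prod) (use p v in auto)
  then have "vge (\<Prod>i\<in>{0..<n}. A $$ (i, p i)) (real n * x)" by simp
  then show "vge (signof p * (\<Prod>i\<in>{0..<n}. A $$ (i, p i))) (real n * x)"
    by (cases "sign p = 1") (auto simp: sign_def)
qed

lemma fls_subdegree_phiK [simp]: "q \<noteq> 0 \<Longrightarrow> fls_subdegree (phiK q f) = fls_subdegree f"
  by (cases "f = 0") (auto intro!: fls_subdegree_eqI)

lemma subdegree_det_it: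
  assumes "q \<noteq> 0" "A \<in> carrier_mat n n" "det A \<noteq> 0"
  shows "fls_subdegree (det (it q A k)) = int k * fls_subdegree (det A)"
proof (induction k)
  case (Suc k)
  then show ?case using assms det_it_nonzero[OF assms, of k]
    by (simp only: det_it_Suc fls_subdegree_phiK fls_subdegree_mult phiK_eq_0_iff simp_thms) (simp add: algebra_simps)
qed simp

text \<open>The valuation of the determinant of Phi^k is exactly k times that of
  \<open>det A\<close>, so a growth rate x in all n directions is paid for by the determinant;
  letting k grow removes the constant.\<close>

lemma grow_det:
  assumes "q \<noteq> 0" "A \<in> carrier_mat n n" "det A \<noteq> 0" "grow q n A x"
  shows "real n * x \<le> real_of_int (fls_subdegree (det A))"
proof (rule ccontr)
  assume nle: "\<not> ?thesis"
  define e where "e = real n * x - real_of_int (fls_subdegree (det A))"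
  have e: "e > 0" using nle by (simp add: e_def)
  obtain K where K: "\<And>k i j. i < n \<Longrightarrow> j < n \<Longrightarrow> vge (it q A k $$ (i, j)) (real k * x - K)"
    using assms(4) unfolding grow_def by blast
  have le: "real k * e \<le> real n * K" for k
  proof -
    have "vge (det (it q A k)) (real n * (real k * x - K))"
      by (rule vge_det) (use assms K in auto)
    then have "real n * (real k * x - K) \<le> real_of_int (int k * fls_subdegree (det A))"
      using det_it_nonzero[OF assms(1-3)] by (simp add: vge_iff subdegree_det_it[OF assms(1-3)])
    then show ?thesis by (simp add: e_def algebra_simps)
  qed
  obtain k :: nat where "real n * K / e < real k" using reals_Archimedean2 by blast
  then show False using le[of k] e by (simp add: divide_less_eq)
qed

text \<open>The weights r act like exponents of a diagonal rescaling, but are real and so in general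
  not realizable by powers of z. The estimate telescopes along products because the weight of the
  intermediate index cancels.\<close>

lemma it_weights:
  assumes "q \<noteq> 0" "C \<in> carrier_mat n n" "\<And>i j. i < n \<Longrightarrow> j < n \<Longrightarrow> vge (C $$ (i, j)) (x + r j - r i)" "i < n" "j < n"
  shows "vge (it q C k $$ (i, j)) (real k * x + r j - r i)"
  using assms(4,5)
proof (induction k arbitrary: i j)
  case 0
  then show ?case using assms by auto
next
  case (Suc k)
  have c: "it q C k \<in> carrier_mat n n" using assms by simp
  have "vge (C $$ (i, m) * phiK q (it q C k $$ (m, j))) (real (Suc k) * x + r j - r i)" if "m < n" for m
  proof -
    have "vge (C $$ (i, m) * phiK q (it q C k $$ (m, j))) ((x + r m - r i) + (real k * x + r j - r m))"
      by (rule vge_mult) (use assms Suc that in auto)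
    then show ?thesis by (simp add: algebra_simps)
  qed
  then show ?case using Suc.prems assms carrier_matD[OF c] unfolding it.simps
    by (subst index_mult_sum[of _ n n _ n]) (auto intro!: vge_sum)
qed

lemma grow_weights:
  fixes r :: "nat \<Rightarrow> real"
  assumes "q \<noteq> 0" "C \<in> carrier_mat n n" "\<And>i j. i < n \<Longrightarrow> j < n \<Longrightarrow> vge (C $$ (i, j)) (x + r j - r i)"
  shows "grow q n C x"
proof -
  define K where "K = (\<Sum>i<n. \<bar>r i\<bar>)"
  have K: "\<bar>r i\<bar> \<le> K" if "i < n" for i
    unfolding K_def using that by (intro member_le_sum[of i _ "\<lambda>i. \<bar>r i\<bar>"]) auto
  have "vge (it q C k $$ (i, j)) (real k * x - 2 * K)" if "i < n" "j < n" for k i j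
    using it_weights[OF assms that, of k] K[of i] K[of j] that by (auto elim!: vge_mono)
  then show ?thesis unfolding grow_def by blast
qed

lemma vge_mat_ex:
  "\<exists>x. \<forall>i<n. \<forall>j<m. vge (A $$ (i, j)) x"
proof -
  obtain x where "\<forall>p\<in>{..<n}\<times>{..<m}. vge (A $$ p) x"
    using vge_ex_finite[of "{..<n}\<times>{..<m}" "\<lambda>p. A $$ p"] by blast
  then show ?thesis by auto
qed

lemma vge_mat_mult:
  assumes "A \<in> carrier_mat n m" "B \<in> carrier_mat m p" "\<And>i j. i < n \<Longrightarrow> j < m \<Longrightarrow> vge (A $$ (i, j)) x"
    "\<And>i j. i < m \<Longrightarrow> j < p \<Longrightarrow> vge (B $$ (i, j)) y" "i < n" "j < p"
  shows "vge ((A * B) $$ (i, j)) (x + y)"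
  unfolding index_mult_sum[OF assms(1,2,5,6)] by (rule vge_sum, rule vge_mult) (use assms in auto)

lemma it_gauge':
  assumes "q \<noteq> 0" "A \<in> carrier_mat n n" "B \<in> carrier_mat n n" "G \<in> carrier_mat n n" "H \<in> carrier_mat n n" "H * G = 1\<^sub>m n"
    "G * A = B * mphi q G"
  shows "it q A k = H * (it q B k * mphi (q ^ k) G)"
proof -
  have "it q A k = H * (G * it q A k)"
    using assms by (simp add: assoc_mult_mat[of _ n n _ n _ n, symmetric] left_mult_one_mat[of _ n n])
  then show ?thesis using it_gauge[OF assms(1-4,7)] by simp
qed

text \<open>Iterates of gauge equivalent matrices differ by the fixed factor \<open>H\<close> on the
  left and a dilated \<open>G\<close> on the right, and dilation does not change valuations.\<close>

lemma grow_gauge: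
  assumes "q \<noteq> 0" "A \<in> carrier_mat n n" "B \<in> carrier_mat n n" "G \<in> carrier_mat n n" "H \<in> carrier_mat n n" "H * G = 1\<^sub>m n"
    "G * A = B * mphi q G" "grow q n B x"
  shows "grow q n A x"
proof -
  obtain K where K: "\<And>k i j. i < n \<Longrightarrow> j < n \<Longrightarrow> vge (it q B k $$ (i, j)) (real k * x - K)"
    using assms(8) unfolding grow_def by blast
  obtain g where g: "\<And>i j. i < n \<Longrightarrow> j < n \<Longrightarrow> vge (G $$ (i, j)) g" using vge_mat_ex[of n n G] by blast
  obtain h where h: "\<And>i j. i < n \<Longrightarrow> j < n \<Longrightarrow> vge (H $$ (i, j)) h" using vge_mat_ex[of n n H] by blast
  have g': "vge (mphi (q ^ k) G $$ (i, j)) g" if "i < n" "j < n" for i j k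
    using g[OF that] that assms by simp
  have "vge (it q A k $$ (i, j)) (real k * x - (K - g - h))" if "i < n" "j < n" for k i j
  proof -
    have "vge ((H * (it q B k * mphi (q ^ k) G)) $$ (i, j)) (h + ((real k * x - K) + g))"
      by (intro vge_mat_mult[of _ n n _ n] h K g' that) (use assms in auto)
    then show ?thesis unfolding it_gauge'[OF assms(1-7)] by (simp add: algebra_simps)
  qed
  then show ?thesis unfolding grow_def by blast
qed

section \<open>Contragredients and the purity criterion\<close>

lemma dual_gauge:
  assumes "q \<noteq> 0" "A \<in> carrier_mat n n" "B \<in> carrier_mat n n" "Ai \<in> carrier_mat n n" "Bi \<in> carrier_mat n n"
    "H \<in> carrier_mat n n" "Ai * A = 1\<^sub>m n" "B * Bi = 1\<^sub>m n" "H * B = A * mphi q H"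
  shows "H\<^sup>T * Ai\<^sup>T = Bi\<^sup>T * mphi q (H\<^sup>T)"
proof -
  have "Ai * H = Ai * (H * (B * Bi))" using assms by simp
  also have "\<dots> = Ai * ((A * mphi q H) * Bi)" unfolding assms(9)[symmetric] using assms(2-6) by (simp add: assoc_mult_mat[of _ n n _ n _ n])
  also have "\<dots> = (Ai * A) * (mphi q H * Bi)" using assms(2-6) by (simp add: assoc_mult_mat[of _ n n _ n _ n])
  also have "\<dots> = mphi q H * Bi" using assms by (simp add: left_mult_one_mat[of _ n n])
  finally have "(Ai * H)\<^sup>T = (mphi q H * Bi)\<^sup>T" by simp
  then show ?thesis using assms(1-6) by (simp add: transpose_mult[of _ n n _ n] map_mat_transpose)
qed

text \<open>The inverse of the companion matrix: its first column comes from solving the relation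
  given by L for the term with a_0. The transpose is the matrix of the dual module.\<close>

definition companion_inv :: "nat \<Rightarrow> (nat \<Rightarrow> complex fls) \<Rightarrow> complex fls mat" where
  "companion_inv d a = mat d d (\<lambda>(i, j). if j = 0 then - a (Suc i) / a 0 else if Suc i = j then 1 else 0)"

lemma companion_inv_carrier [simp]: "companion_inv n a \<in> carrier_mat n n" by (simp add: companion_inv_def)

lemma companion_inverse:
  assumes "a 0 \<noteq> 0" "a d = 1" "d \<ge> 1"
  shows "companion d a * companion_inv d a = 1\<^sub>m d" "companion_inv d a * companion d a = 1\<^sub>m d"
proof -
  show *: "companion d a * companion_inv d a = 1\<^sub>m d"
  proof (rule eq_matI)
    fix i j assume "i < dim_row (1\<^sub>m d)" "j < dim_col (1\<^sub>m d)"
    then have ij: "i < d" "j < d" by auto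
    have "(companion d a * companion_inv d a) $$ (i, j) = (\<Sum>k<d. companion d a $$ (i, k) * companion_inv d a $$ (k, j))"
      by (rule index_mult_sum[OF _ _ ij]) auto
    also have "\<dots> = (\<Sum>k<d. (if k = d - 1 then - a i * companion_inv d a $$ (k, j) else 0) + (if i = Suc k then companion_inv d a $$ (k, j) else 0))"
      using ij by (intro sum.cong refl) (auto simp: companion_def algebra_simps)
    also have "\<dots> = - a i * companion_inv d a $$ (d - 1, j) + (if i = 0 then 0 else companion_inv d a $$ (i - 1, j))"
      using ij assms(3) by (cases i) (auto simp: sum.distrib)
    also have "\<dots> = 1\<^sub>m d $$ (i, j)"
      using ij assms by (cases i) (auto simp: companion_inv_def)
    finally show "(companion d a * companion_inv d a) $$ (i, j) = 1\<^sub>m d $$ (i, j)" .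
  qed (auto simp: companion_def companion_inv_def)
  show "companion_inv d a * companion d a = 1\<^sub>m d"
    by (rule mat_mult_left_right_inverse[OF _ _ *]) auto
qed

lemma det_companion:
  assumes "n \<ge> 1"
  shows "\<exists>u. (u = 1 \<or> u = -1) \<and> det (companion n a) = u * a 0"
proof -
  have "det (companion n a) = (\<Sum>j<n. companion n a $$ (0, j) * cofactor (companion n a) 0 j)"
    by (rule laplace_expansion_row) (use assms in auto)
  also have "\<dots> = (\<Sum>j\<in>{n-1}. companion n a $$ (0, j) * cofactor (companion n a) 0 j)"
    by (rule sum.mono_neutral_right) (use assms in \<open>auto simp: companion_def\<close>)
  also have "\<dots> = - a 0 * cofactor (companion n a) 0 (n - 1)" using assms by (simp add: companion_def)
  also have "mat_delete (companion n a) 0 (n - 1) = 1\<^sub>m (n - 1)"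
    by (rule eq_matI) (auto simp: mat_delete_def companion_def)
  then have "cofactor (companion n a) 0 (n - 1) = (-1) ^ (n - 1)" by (simp add: cofactor_def)
  finally have "det (companion n a) = (- ((-1) ^ (n - 1))) * a 0" by simp
  moreover have "- ((-1) ^ (n - 1)) = (1 :: complex fls) \<or> - ((-1) ^ (n - 1)) = (-1 :: complex fls)"
    by (cases "even (n - 1)") auto
  ultimately show ?thesis by blast
qed

text \<open>A polygon with the single slope x says that the companion matrix obeys the weight
  estimate with r_i = x i, which the subdiagonal ones meet with equality. The inverse transpose
  obeys it with - x i, and there v(a_0) = x d enters as an equality.\<close>

lemma pure_companion_grow:
  assumes q: "q \<noteq> 0" and a: "a d = 1" "a 0 \<noteq> 0" and s: "newton_single_slope d a x"
  shows "grow q d (companion d a) x" "grow q d ((companion_inv d a)\<^sup>T) (- x)"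
proof -
  have d: "d \<ge> 1" and x: "x * real d = real_of_int (fls_subdegree (a 0))" and
    le: "\<And>i. i \<le> d \<Longrightarrow> a i \<noteq> 0 \<Longrightarrow> - real_of_int (fls_subdegree (a i)) \<le> - real_of_int (fls_subdegree (a 0)) + x * real i"
    using s by (auto simp: newton_single_slope_def)
  have v: "vge (a i) (x * (real d - real i))" if "i \<le> d" for i
    using le[OF that] x by (auto simp: vge_iff algebra_simps)
  have C: "vge (companion d a $$ (i, j)) (x + x * real j - x * real i)" if "i < d" "j < d" for i j
  proof -
    have "vge (if j = d - 1 then - a i else 0) (x + x * real j - x * real i)"
      using v[of i] that by (auto simp: of_nat_diff algebra_simps)
    moreover have "vge (if i = j + 1 then 1 else 0) (x + x * real j - x * real i)"
      by (auto simp: algebra_simps)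
    ultimately show ?thesis using that by (auto simp: companion_def intro: vge_add)
  qed
  then show "grow q d (companion d a) x"
    by (intro grow_weights[OF q, where r = "\<lambda>i. x * real i"]) auto
  have "vge ((companion_inv d a)\<^sup>T $$ (i, j)) (- x + (- x * real j) - (- x * real i))" if "i < d" "j < d" for i j
  proof (cases "i = 0")
    case True
    have i0: "vge (inverse (a 0)) (- x * real d)" using a x by (simp add: vge_iff)
    have "vge (a (Suc j) * inverse (a 0)) (x * (real d - real (Suc j)) + - x * real d)"
      by (intro vge_mult v i0) (use that in auto)
    then show ?thesis using True that by (simp add: companion_inv_def algebra_simps divide_inverse)
  next
    case False
    then show ?thesis using that by (auto simp: companion_inv_def algebra_simps)
  qed
  then show "grow q d ((companion_inv d a)\<^sup>T) (- x)"
    by (intro grow_weights[OF q, where r = "\<lambda>i. - x * real i"]) auto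
qed

lemma pure_over_grow:
  assumes q: "q \<noteq> 0" and A: "A \<in> carrier_mat n n" "Ai \<in> carrier_mat n n" "Ai * A = 1\<^sub>m n"
    and p: "pure_over (phiK q) n A x"
  shows "n \<ge> 1" "grow q n A x" "grow q n (Ai\<^sup>T) (- x)"
proof -
  obtain d a where da: "a d = 1" "a 0 \<noteq> 0" "diso conv_fls (phiK q) n A d (companion d a)" "newton_single_slope d a x"
    using p unfolding pure_over_def by blast
  obtain G H where G: "n = d" "G \<in> carrier_mat n n" "H \<in> carrier_mat n n" "G * H = 1\<^sub>m n" "H * G = 1\<^sub>m n"
    "G * A = companion d a * mphi q G" using da(3) unfolding diso_iff by auto
  show n: "n \<ge> 1" using da(4) G(1) by (simp add: newton_single_slope_def)
  show "grow q n A x"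
    by (rule grow_gauge[of q A n "companion n a" G H]) (use q A G pure_companion_grow[OF q da(1,2,4)] in auto)
  have "H * companion n a = A * mphi q H"
    by (rule hom_inverse[of q A n "companion n a" G H]) (use q A G in auto)
  then have "H\<^sup>T * Ai\<^sup>T = (companion_inv n a)\<^sup>T * mphi q (H\<^sup>T)"
    by (intro dual_gauge[of q A n "companion n a"]) (use q A G n da companion_inverse[of a n] in auto)
  then show "grow q n (Ai\<^sup>T) (- x)"
    by (intro grow_gauge[of q "Ai\<^sup>T" n "(companion_inv n a)\<^sup>T" "H\<^sup>T" "G\<^sup>T"])
      (use q A G pure_companion_grow[OF q da(1,2,4)] in \<open>auto simp: transpose_mult[symmetric, of _ n n _ n]\<close>)
qed

text \<open>The two growth conditions bound v(det A) from both sides, so v(det A) = n x. For the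
  companion matrix of a cyclic vector the determinant is a_0 up to sign, which fixes the left end of
  the polygon, while the Gauss argument keeps the other points on or below the segment. Nothing is
  assumed about the size of q, so infinity is included.\<close>

lemma pure_over_criterion:
  assumes q: "q \<noteq> 0" "\<And>i. i > 0 \<Longrightarrow> q ^ i \<noteq> 1" and n: "n \<ge> 1"
    and A: "A \<in> carrier_mat n n" "Ai \<in> carrier_mat n n" "Ai * A = 1\<^sub>m n" "entries_in conv_fls A"
    and g: "grow q n A x" "grow q n (Ai\<^sup>T) (- x)"
  shows "pure_over (phiK q) n A x"
proof -
  have dd: "det (Ai\<^sup>T) * det A = 1"
    using A det_mult[of Ai n A] by (simp add: det_transpose[of _ n])
  then have d: "det A \<noteq> 0" "det (Ai\<^sup>T) \<noteq> 0" by auto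
  have "fls_subdegree (det (Ai\<^sup>T)) + fls_subdegree (det A) = 0"
    using arg_cong[OF dd, of fls_subdegree] d by simp
  moreover have "real n * x \<le> real_of_int (fls_subdegree (det A))" by (rule grow_det) (use q A d g in auto)
  moreover have "real n * - x \<le> real_of_int (fls_subdegree (det (Ai\<^sup>T)))" by (rule grow_det) (use q A d g in auto)
  ultimately have sd: "real_of_int (fls_subdegree (det A)) = real n * x" by linarith
  obtain a G H where a: "\<And>i. i \<le> n \<Longrightarrow> conv_fls (a i)" "a n = 1" and G: "G \<in> carrier_mat n n" "H \<in> carrier_mat n n" "entries_in conv_fls G"
    "entries_in conv_fls H" "G * H = 1\<^sub>m n" "H * G = 1\<^sub>m n" "G * A = companion n a * mphi q G"
    using cyclic_companion[OF q A(1,4) d(1) n] by blast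
  have iso: "diso conv_fls (phiK q) n A n (companion n a)" unfolding diso_iff using G by auto
  have "H * companion n a = A * mphi q H"
    by (rule hom_inverse[of q A n "companion n a" G H]) (use q A G in auto)
  then have gc: "grow q n (companion n a) x"
    by (intro grow_gauge[of q "companion n a" n A H G]) (use q A G g in auto)
  have va: "vge (a i) (x * (real n - real i))" if "i < n" for i
    by (rule gauss_newton[OF q(1) n a(2) gc that])
  have "det G * det A = det (companion n a) * phiK q (det G)"
    using arg_cong[OF G(7), of det] A(1) G(1) q(1) by (simp add: det_mult[of G n A] det_mult[of "companion n a" n "mphi q G"] det_mphi del: comm_ring_hom.hom_det)
  moreover have dG: "det G \<noteq> 0" using arg_cong[OF G(5), of det] det_mult[OF G(1,2)] by auto
  moreover obtain u where u: "u = 1 \<or> u = -1" "det (companion n a) = u * a 0" using det_companion[OF n] by blast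
  ultimately have e: "det G * det A = u * a 0 * phiK q (det G)" by simp
  then have a0: "a 0 \<noteq> 0" using dG d by auto
  have "fls_subdegree u = 0" "u \<noteq> 0" using u(1) by auto
  then have "fls_subdegree (a 0) = fls_subdegree (det A)"
    using arg_cong[OF e, of fls_subdegree] dG d a0 q by simp
  then have s0: "real_of_int (fls_subdegree (a 0)) = real n * x" using sd by simp
  have "newton_single_slope n a x"
    unfolding newton_single_slope_def
  proof (intro conjI allI impI n)
    show "x = real_of_int (fls_subdegree (a 0)) / real n" using s0 n by simp
    fix i assume i: "i \<le> n" "a i \<noteq> 0"
    show "- real_of_int (fls_subdegree (a i)) \<le> - real_of_int (fls_subdegree (a 0)) + x * real i"
    proof (cases "i = n")
      case True
      then show ?thesis using a s0 by (simp add: algebra_simps)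
    next
      case False
      then show ?thesis using va[of i] i s0 by (simp add: vge_iff algebra_simps)
    qed
  qed
  then show ?thesis unfolding pure_over_def using a a0 iso by blast
qed

section \<open>Slope data\<close>

text \<open>Slopes are attached to single basis vectors, and the vectors of slope at most a given
  value span a stable subspace. The basis need not be ordered by slope; this is why tensor products,
  whose slopes come interleaved, fit without rearrangement.\<close>

definition tri :: "nat \<Rightarrow> (nat \<Rightarrow> real) \<Rightarrow> complex fls mat \<Rightarrow> bool" where
  "tri n s A \<longleftrightarrow> (\<forall>i<n. \<forall>j<n. s j < s i \<longrightarrow> A $$ (i, j) = 0)"

text \<open>Growth is required only between indices of equal slope, that is, in the diagonal blocks;
  entries joining different slopes are left unconstrained.\<close>

definition gro :: "complex \<Rightarrow> nat \<Rightarrow> (nat \<Rightarrow> real) \<Rightarrow> complex fls mat \<Rightarrow> bool" where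
  "gro q n s A \<longleftrightarrow> (\<exists>K. \<forall>k. \<forall>i<n. \<forall>j<n. s i = s j \<longrightarrow> vge (it q A k $$ (i, j)) (real k * s i - K))"

abbreviation hat :: "complex fls mat \<Rightarrow> complex fls mat" where "hat \<equiv> map_mat to_K'"

text \<open>The bounds at 0 and at infinity together confine the exponents in the diagonal blocks of
  the k-th iterate to a bounded distance from k s.\<close>

definition half_data :: "complex \<Rightarrow> nat \<Rightarrow> (nat \<Rightarrow> real) \<Rightarrow> complex fls mat \<Rightarrow> bool" where
  "half_data q n s A \<longleftrightarrow> A \<in> carrier_mat n n \<and> entries_in laurent_poly A \<and> tri n s A \<and> gro q n s A \<and>
     gro (inverse q) n (\<lambda>i. - s i) (hat A)"

text \<open>Here \<open>D\<close> is the contragredient of \<open>A\<close>: lower valuation bounds for the iterates of both matrices,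
  at \<open>0\<close> and (through \<open>hat\<close>) at \<open>\<infinity>\<close>, pin down the slope of every diagonal block.\<close>

definition gdata :: "complex \<Rightarrow> nat \<Rightarrow> (nat \<Rightarrow> real) \<Rightarrow> complex fls mat \<Rightarrow> complex fls mat \<Rightarrow> bool" where
  "gdata q n s A D \<longleftrightarrow> half_data q n s A \<and> half_data q n (\<lambda>i. - s i) D \<and> A * D\<^sup>T = 1\<^sub>m n \<and> D\<^sup>T * A = 1\<^sub>m n"

lemma gdata_dual: "gdata q n s A D \<Longrightarrow> gdata q n (\<lambda>i. - s i) D A"
proof -
  assume g: "gdata q n s A D"
  then have c: "A \<in> carrier_mat n n" "D \<in> carrier_mat n n" "A * D\<^sup>T = 1\<^sub>m n" "D\<^sup>T * A = 1\<^sub>m n"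
    by (auto simp: gdata_def half_data_def)
  have "D * A\<^sup>T = (A * D\<^sup>T)\<^sup>T" "A\<^sup>T * D = (D\<^sup>T * A)\<^sup>T"
    using c(1,2) by (simp_all add: transpose_mult[of _ n n _ n])
  then show ?thesis using g c by (simp add: gdata_def)
qed

lemma tri_one: "tri n s (1\<^sub>m n)" by (auto simp: tri_def)
lemma tri_mphi: "A \<in> carrier_mat n n \<Longrightarrow> tri n s A \<Longrightarrow> tri n s (mphi q A)" by (auto simp: tri_def)
lemma tri_hat: "A \<in> carrier_mat n n \<Longrightarrow> tri n s A \<Longrightarrow> tri n s (hat A)" by (auto simp: tri_def)
lemma tri_mult:
  assumes "A \<in> carrier_mat n n" "B \<in> carrier_mat n n" "tri n s A" "tri n s B"
  shows "tri n s (A * B)"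
  unfolding tri_def
proof (intro allI impI)
  fix i j assume ij: "i < n" "j < n" "s j < s i"
  show "(A * B) $$ (i, j) = 0"
    unfolding index_mult_sum[OF assms(1,2) ij(1,2)]
  proof (rule sum.neutral, rule ballI)
    fix k assume "k \<in> {..<n}"
    then show "A $$ (i, k) * B $$ (k, j) = 0"
      using assms(3,4) ij unfolding tri_def by (cases "s k < s i") (auto simp: not_less)
  qed
qed
lemma tri_it: "A \<in> carrier_mat n n \<Longrightarrow> tri n s A \<Longrightarrow> tri n s (it q A k)"
  by (induction k) (auto intro!: tri_mult tri_mphi tri_one)

text \<open>\<open>to_K'\<close> reverses exponents and yields a meaningful series only on Laurent
  polynomials, whence the hypotheses on entries here and below.\<close>

lemma hat_mult:
  assumes "A \<in> carrier_mat n m" "B \<in> carrier_mat m p" "entries_in laurent_poly A" "entries_in laurent_poly B"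
  shows "hat (A * B) = hat A * hat B"
proof (rule eq_matI)
  fix i j assume "i < dim_row (hat A * hat B)" "j < dim_col (hat A * hat B)"
  then have ij: "i < n" "j < p" using assms by auto
  have "hat (A * B) $$ (i, j) = to_K' (\<Sum>k<m. A $$ (i, k) * B $$ (k, j))"
    using ij assms by (simp add: index_mult_sum[OF assms(1,2) ij, symmetric])
  also have "\<dots> = (\<Sum>k<m. to_K' (A $$ (i, k)) * to_K' (B $$ (k, j)))"
    using ij assms entries_inD[OF assms(3,1)] entries_inD[OF assms(4,2)] by (subst to_K'_sum) (auto simp: to_K'_mult intro!: sum.cong)
  also have "\<dots> = (hat A * hat B) $$ (i, j)"
    using ij assms by (subst index_mult_sum[of _ n m _ p]) auto
  finally show "hat (A * B) $$ (i, j) = (hat A * hat B) $$ (i, j)" .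
qed (use assms in auto)

lemma hat_one [simp]: "hat (1\<^sub>m n) = 1\<^sub>m n" by (rule eq_matI) auto

lemma hat_mphi:
  assumes "entries_in laurent_poly A"
  shows "hat (mphi q A) = mphi (inverse q) (hat A)"
  using assms by (intro eq_matI) (auto simp: to_K'_phiK entries_in_def)

lemma hat_laurent: "entries_in laurent_poly A \<Longrightarrow> entries_in laurent_poly (hat A)"
  by (auto simp: entries_in_def)

lemma hat_it:
  assumes "A \<in> carrier_mat n n" "entries_in laurent_poly A"
  shows "it (inverse q) (hat A) k = hat (it q A k)"
proof (induction k)
  case (Suc k)
  have "entries_in laurent_poly (it q A k)" by (rule entries_in_it[OF coef_ring_laurent assms])
  then show ?case using Suc assms
    by (simp add: hat_mult[of _ n n _ n] hat_mphi entries_in_mphi[OF coef_ring_laurent])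
qed (use assms in simp)

section \<open>Tensor products\<close>

lemma div_mod_sum:
  fixes f :: "nat \<Rightarrow> nat \<Rightarrow> 'a::comm_monoid_add"
  shows "(\<Sum>k<n*m. f (k div m) (k mod m)) = (\<Sum>a<n. \<Sum>b<m. f a b)"
proof -
  have lt: "a * m + b < n * m" if "a < n" "b < m" for a b
  proof -
    have "a * m + b < (a + 1) * m" using that by simp
    also have "\<dots> \<le> n * m" using that by (intro mult_le_mono1) simp
    finally show ?thesis .
  qed
  have "(\<Sum>k<n*m. f (k div m) (k mod m)) = (\<Sum>(a,b)\<in>{..<n}\<times>{..<m}. f a b)"
    by (rule sum.reindex_bij_witness[of _ "\<lambda>(a,b). a * m + b" "\<lambda>k. (k div m, k mod m)"])
       (use lt in \<open>auto simp: less_mult_imp_div_less intro!: mod_less_divisor gr0I\<close>)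
  then show ?thesis by (simp add: sum.cartesian_product)
qed

lemma kron_carrier [simp]: "A \<in> carrier_mat n m \<Longrightarrow> B \<in> carrier_mat n' m' \<Longrightarrow> kron A B \<in> carrier_mat (n * n') (m * m')"
  by (auto simp: kron_def)

lemma div_mod_bounds: "i < n * (m::nat) \<Longrightarrow> i div m < n \<and> i mod m < m"
  by (cases "m = 0") (auto simp: less_mult_imp_div_less)

lemma index_kron:
  assumes "A \<in> carrier_mat n m" "B \<in> carrier_mat n' m'" "i < n * n'" "j < m * m'"
  shows "kron A B $$ (i, j) = A $$ (i div n', j div m') * B $$ (i mod n', j mod m')"
  using assms by (auto simp: kron_def)

lemma kron_mult:
  fixes A B C D :: "'a::comm_ring_1 mat"
  assumes "A \<in> carrier_mat n m" "B \<in> carrier_mat n' m'" "C \<in> carrier_mat m p" "D \<in> carrier_mat m' p'"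
  shows "kron A B * kron C D = kron (A * C) (B * D)"
proof (rule eq_matI)
  fix i j assume "i < dim_row (kron (A * C) (B * D))" "j < dim_col (kron (A * C) (B * D))"
  then have ij: "i < n * n'" "j < p * p'" using assms by (auto simp: kron_def)
  note b = div_mod_bounds[OF ij(1)] div_mod_bounds[OF ij(2)]
  have m: "(X * Y) $$ (i, j) = (\<Sum>k<m. X $$ (i, k) * Y $$ (k, j))"
    if "X \<in> carrier_mat n m" "Y \<in> carrier_mat m p" "i < n" "j < p" for X Y :: "'a mat" and n m p i j
    using that by (auto simp: scalar_prod_def intro!: sum.cong simp: atLeast0LessThan)
  have "(kron A B * kron C D) $$ (i, j) = (\<Sum>k<m*m'. kron A B $$ (i, k) * kron C D $$ (k, j))"
    by (rule m[OF _ _ ij]) (use assms in auto)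
  also have "\<dots> = (\<Sum>k<m*m'. (A $$ (i div n', k div m') * B $$ (i mod n', k mod m')) * (C $$ (k div m', j div p') * D $$ (k mod m', j mod p')))"
    using ij by (intro sum.cong refl) (simp add: index_kron[OF assms(1,2)] index_kron[OF assms(3,4)])
  also have "\<dots> = (\<Sum>a<m. \<Sum>b<m'. (A $$ (i div n', a) * B $$ (i mod n', b)) * (C $$ (a, j div p') * D $$ (b, j mod p')))"
    by (rule div_mod_sum)
  also have "\<dots> = (\<Sum>a<m. A $$ (i div n', a) * C $$ (a, j div p')) * (\<Sum>b<m'. B $$ (i mod n', b) * D $$ (b, j mod p'))"
    by (simp add: sum_product algebra_simps)
  also have "\<dots> = (A * C) $$ (i div n', j div p') * (B * D) $$ (i mod n', j mod p')"
    using b by (simp only: m[OF assms(1,3)] m[OF assms(2,4)])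
  also have "\<dots> = kron (A * C) (B * D) $$ (i, j)"
    using index_kron[OF mult_carrier_mat[OF assms(1,3)] mult_carrier_mat[OF assms(2,4)] ij] by simp
  finally show "(kron A B * kron C D) $$ (i, j) = kron (A * C) (B * D) $$ (i, j)" .
qed (use assms in \<open>auto simp: kron_def\<close>)

lemma kron_one: "kron (1\<^sub>m n) (1\<^sub>m m) = (1\<^sub>m (n * m) :: 'a::comm_ring_1 mat)"
proof (rule eq_matI)
  fix i j assume "i < dim_row (1\<^sub>m (n * m) :: 'a mat)" "j < dim_col (1\<^sub>m (n * m) :: 'a mat)"
  then have ij: "i < n * m" "j < n * m" by auto
  note b = div_mod_bounds[OF ij(1)] div_mod_bounds[OF ij(2)]
  have "i = j" if "i div m = j div m" "i mod m = j mod m"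
  proof -
    have "i div m * m + i mod m = j div m * m + j mod m" using that by simp
    then show ?thesis by (simp only: div_mult_mod_eq)
  qed
  then have "i = j \<longleftrightarrow> i div m = j div m \<and> i mod m = j mod m" by blast
  then show "kron (1\<^sub>m n) (1\<^sub>m m) $$ (i, j) = (1\<^sub>m (n * m) :: 'a mat) $$ (i, j)"
    using ij b index_kron[of "1\<^sub>m n :: 'a mat" n n "1\<^sub>m m" m m i j] by auto
qed (auto simp: kron_def)

lemma kron_transpose: "(kron A B)\<^sup>T = kron (A\<^sup>T) (B\<^sup>T)"
proof (rule eq_matI)
  fix i j assume "i < dim_row (kron (A\<^sup>T) (B\<^sup>T))" "j < dim_col (kron (A\<^sup>T) (B\<^sup>T))"
  then have ij: "i < dim_col A * dim_col B" "j < dim_row A * dim_row B" by (auto simp: kron_def)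
  then show "(kron A B)\<^sup>T $$ (i, j) = kron (A\<^sup>T) (B\<^sup>T) $$ (i, j)"
    using div_mod_bounds[OF ij(1)] div_mod_bounds[OF ij(2)] by (simp add: kron_def)
qed (auto simp: kron_def)

lemma mphi_kron:
  assumes "q \<noteq> 0" "A \<in> carrier_mat n m" "B \<in> carrier_mat n' m'"
  shows "mphi q (kron A B) = kron (mphi q A) (mphi q B)"
proof (rule eq_matI)
  fix i j assume "i < dim_row (kron (mphi q A) (mphi q B))" "j < dim_col (kron (mphi q A) (mphi q B))"
  then have ij: "i < n * n'" "j < m * m'" using assms by (auto simp: kron_def)
  note b = div_mod_bounds[OF ij(1)] div_mod_bounds[OF ij(2)]
  show "mphi q (kron A B) $$ (i, j) = kron (mphi q A) (mphi q B) $$ (i, j)"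
    using ij b assms by (simp add: kron_def phiK_mult)
qed (use assms in \<open>auto simp: kron_def\<close>)

lemma kron_entries:
  assumes "coef_ring P" "A \<in> carrier_mat n m" "B \<in> carrier_mat n' m'" "entries_in P A" "entries_in P B"
  shows "entries_in P (kron A B)"
proof (rule entries_inI)
  show "kron A B \<in> carrier_mat (n * n') (m * m')" using assms by simp
  fix i j assume ij: "i < n * n'" "j < m * m'"
  then show "P (kron A B $$ (i, j))"
    using div_mod_bounds[OF ij(1)] div_mod_bounds[OF ij(2)] assms
    by (simp only: index_kron[OF assms(2,3)]) (auto intro!: coef_ringD[OF assms(1)] intro: entries_inD)
qed

lemma hat_kron:
  assumes "A \<in> carrier_mat n m" "B \<in> carrier_mat n' m'" "entries_in laurent_poly A" "entries_in laurent_poly B"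
  shows "hat (kron A B) = kron (hat A) (hat B)"
proof (rule eq_matI)
  fix i j assume "i < dim_row (kron (hat A) (hat B))" "j < dim_col (kron (hat A) (hat B))"
  then have ij: "i < n * n'" "j < m * m'" using assms by (auto simp: kron_def)
  note b = div_mod_bounds[OF ij(1)] div_mod_bounds[OF ij(2)]
  have "laurent_poly (A $$ (i div n', j div m'))" "laurent_poly (B $$ (i mod n', j mod m'))"
    using b assms by (auto intro: entries_inD)
  then show "hat (kron A B) $$ (i, j) = kron (hat A) (hat B) $$ (i, j)"
    using ij b assms by (simp add: kron_def to_K'_mult)
qed (use assms in \<open>auto simp: kron_def\<close>)

lemma it_kron:
  assumes "q \<noteq> 0" "A \<in> carrier_mat n n" "B \<in> carrier_mat m m"
  shows "it q (kron A B) k = kron (it q A k) (it q B k)"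
proof (induction k)
  case 0
  have "dim_row (kron A B) = n * m" "dim_row A = n" "dim_row B = m" using assms by (auto simp: kron_def)
  then show ?case by (simp add: kron_one)
next
  case (Suc k)
  then show ?case using assms
    by (simp add: mphi_kron[of _ _ n n _ m m] kron_mult[of A n n B m m _ n _ m])
qed

lemma tri_kron:
  assumes "A \<in> carrier_mat n n" "B \<in> carrier_mat m m" "tri n s A" "tri m t B"
  shows "tri (n * m) (\<lambda>i. s (i div m) + t (i mod m)) (kron A B)"
  unfolding tri_def
proof (intro allI impI)
  fix i j assume ij: "i < n * m" "j < n * m" "s (j div m) + t (j mod m) < s (i div m) + t (i mod m)"
  then have "s (j div m) < s (i div m) \<or> t (j mod m) < t (i mod m)" by linarith
  then show "kron A B $$ (i, j) = 0"
    unfolding index_kron[OF assms(1,2) ij(1,2)] 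
    using assms(3,4) div_mod_bounds[OF ij(1)] div_mod_bounds[OF ij(2)] by (auto simp: tri_def)
qed

text \<open>Two index pairs can have equal total slope without equal slopes in each factor; then one
  of the two factors vanishes by triangularity. The factor e lets one argument serve at 0 with e = 1
  and at infinity with e = - 1, where the growth rates change sign but the shape of the matrix does
  not.\<close>

lemma gro_kron:
  assumes q: "q \<noteq> 0" and e: "e \<noteq> 0" and c: "A \<in> carrier_mat n n" "B \<in> carrier_mat m m" and t: "tri n s A" "tri m t B"
    and g: "gro q n (\<lambda>i. e * s i) A" "gro q m (\<lambda>i. e * t i) B"
  shows "gro q (n * m) (\<lambda>i. e * (s (i div m) + t (i mod m))) (kron A B)"
proof -
  obtain K where K: "\<And>k i j. i < n \<Longrightarrow> j < n \<Longrightarrow> e * s i = e * s j \<Longrightarrow> vge (it q A k $$ (i, j)) (real k * (e * s i) - K)"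
    using g(1) unfolding gro_def by blast
  obtain L where L: "\<And>k i j. i < m \<Longrightarrow> j < m \<Longrightarrow> e * t i = e * t j \<Longrightarrow> vge (it q B k $$ (i, j)) (real k * (e * t i) - L)"
    using g(2) unfolding gro_def by blast
  have "vge (it q (kron A B) k $$ (i, j)) (real k * (e * (s (i div m) + t (i mod m))) - (K + L))"
    if ij: "i < n * m" "j < n * m" and e': "e * (s (i div m) + t (i mod m)) = e * (s (j div m) + t (j mod m))" for k i j
  proof -
    have e: "s (i div m) + t (i mod m) = s (j div m) + t (j mod m)" using e' e by simp
    note b = div_mod_bounds[OF ij(1)] div_mod_bounds[OF ij(2)]
    have ci: "it q A k \<in> carrier_mat n n" "it q B k \<in> carrier_mat m m" using c by auto
    have eq: "it q (kron A B) k $$ (i, j) = it q A k $$ (i div m, j div m) * it q B k $$ (i mod m, j mod m)"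
      unfolding it_kron[OF q c] by (rule index_kron[OF ci ij])
    show ?thesis
    proof (cases "s (i div m) = s (j div m)")
      case True
      then have "t (i mod m) = t (j mod m)" using e by simp
      then have "vge (it q (kron A B) k $$ (i, j)) ((real k * (e * s (i div m)) - K) + (real k * (e * t (i mod m)) - L))"
        unfolding eq using b True by (intro vge_mult K L) auto
      then show ?thesis by (simp add: algebra_simps)
    next
      case False
      then have "s (j div m) < s (i div m) \<or> t (j mod m) < t (i mod m)" using e by linarith
      then have "it q (kron A B) k $$ (i, j) = 0"
        unfolding eq using tri_it[OF c(1) t(1), of q k] tri_it[OF c(2) t(2), of q k] b by (auto simp: tri_def)
      then show ?thesis by simp
    qed
  qed
  then show ?thesis unfolding gro_def by blast
qed

lemma half_data_kron:
  assumes "q \<noteq> 0" "half_data q n s A" "half_data q m t B"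
  shows "half_data q (n * m) (\<lambda>i. s (i div m) + t (i mod m)) (kron A B)"
proof -
  have c: "A \<in> carrier_mat n n" "B \<in> carrier_mat m m" "entries_in laurent_poly A" "entries_in laurent_poly B"
    "tri n s A" "tri m t B" using assms by (auto simp: half_data_def)
  have "gro q (n * m) (\<lambda>i. 1 * (s (i div m) + t (i mod m))) (kron A B)"
    by (rule gro_kron) (use assms c in \<open>auto simp: half_data_def\<close>)
  moreover have "gro (inverse q) (n * m) (\<lambda>i. -1 * (s (i div m) + t (i mod m))) (kron (hat A) (hat B))"
    by (rule gro_kron) (use assms c in \<open>auto simp: half_data_def intro: tri_hat\<close>)
  ultimately show ?thesis unfolding half_data_def
    using c kron_entries[OF coef_ring_laurent c(1-4)] tri_kron[OF c(1,2,5,6)] by (simp add: hat_kron[OF c(1-4)])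
qed

lemma gdata_kron:
  assumes "q \<noteq> 0" "gdata q n s A D" "gdata q m t B E"
  shows "gdata q (n * m) (\<lambda>i. s (i div m) + t (i mod m)) (kron A B) (kron D E)"
proof -
  have c: "A \<in> carrier_mat n n" "B \<in> carrier_mat m m" "D \<in> carrier_mat n n" "E \<in> carrier_mat m m"
    "A * D\<^sup>T = 1\<^sub>m n" "D\<^sup>T * A = 1\<^sub>m n" "B * E\<^sup>T = 1\<^sub>m m" "E\<^sup>T * B = 1\<^sub>m m"
    using assms by (auto simp: gdata_def half_data_def)
  have "half_data q (n * m) (\<lambda>i. - s (i div m) + - t (i mod m)) (kron D E)"
    by (rule half_data_kron) (use assms in \<open>auto simp: gdata_def\<close>)
  then show ?thesis
    using assms c half_data_kron[OF assms(1), of n s A m t B]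
    by (simp add: gdata_def kron_transpose kron_mult[of _ n n _ m m _ n _ m] kron_one)
qed

section \<open>From filtrations to slope data and back\<close>

definition sub_block :: "nat \<Rightarrow> nat \<Rightarrow> 'a mat \<Rightarrow> 'a mat" where
  "sub_block a k X = mat k k (\<lambda>(r, c). X $$ (a + r, a + c))"

lemma sub_block_carrier [simp]: "sub_block a k X \<in> carrier_mat k k" by (simp add: sub_block_def)

text \<open>An intermediate index whose slope is not \<open>\<sigma>\<close> has a smaller or a
  larger one, and triangularity kills one of the two factors; so taking a diagonal block is
  multiplicative.\<close>

lemma sub_block_mult:
  assumes "X \<in> carrier_mat n n" "Y \<in> carrier_mat n n" "tri n s X" "tri n s Y" "{p. p < n \<and> s p = \<sigma>} = {a..<a+k}"
  shows "sub_block a k (X * Y) = sub_block a k X * sub_block a k Y"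
proof (rule eq_matI)
  fix i j assume "i < dim_row (sub_block a k X * sub_block a k Y)" "j < dim_col (sub_block a k X * sub_block a k Y)"
  then have ij: "i < k" "j < k" by (auto simp: sub_block_def)
  have mem: "p < n \<and> s p = \<sigma> \<longleftrightarrow> a \<le> p \<and> p < a + k" for p
    using assms(5) by (metis (mono_tags, lifting) atLeastLessThan_iff mem_Collect_eq)
  have in_block: "a + i < n \<and> s (a + i) = \<sigma>" if "i < k" for i
    using mem[of "a + i"] that by simp
  have "sub_block a k (X * Y) $$ (i, j) = (\<Sum>l<n. X $$ (a + i, l) * Y $$ (l, a + j))"
    using ij in_block[OF ij(1)] in_block[OF ij(2)] by (simp add: sub_block_def index_mult_sum[OF assms(1,2)] del: index_mult_mat)
  also have "\<dots> = (\<Sum>l\<in>{a..<a+k}. X $$ (a + i, l) * Y $$ (l, a + j))"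
  proof (rule sum.mono_neutral_right)
    show "{a..<a+k} \<subseteq> {..<n}" using mem by (meson atLeastLessThan_iff lessThan_iff subsetI)
    show "\<forall>l\<in>{..<n} - {a..<a+k}. X $$ (a + i, l) * Y $$ (l, a + j) = 0"
    proof
      fix l assume "l \<in> {..<n} - {a..<a+k}"
      then have "l < n" "s l \<noteq> \<sigma>" using mem[of l] by auto
      then have "s l < s (a + i) \<or> s (a + j) < s l" using in_block[OF ij(1)] in_block[OF ij(2)] by auto
      then show "X $$ (a + i, l) * Y $$ (l, a + j) = 0"
        using assms(3,4) in_block[OF ij(1)] in_block[OF ij(2)] \<open>l < n\<close> by (auto simp: tri_def)
    qed
  qed simp
  also have "\<dots> = (\<Sum>l<k. X $$ (a + i, a + l) * Y $$ (a + l, a + j))"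
    by (rule sum.reindex_bij_witness[of _ "\<lambda>l. a + l" "\<lambda>l. l - a"]) auto
  also have "\<dots> = (sub_block a k X * sub_block a k Y) $$ (i, j)"
    using ij by (subst index_mult_sum[of _ k k _ k]) (auto simp: sub_block_def)
  finally show "sub_block a k (X * Y) $$ (i, j) = (sub_block a k X * sub_block a k Y) $$ (i, j)" .
qed (auto simp: sub_block_def)

lemma sub_block_map:
  "a + k \<le> n \<Longrightarrow> X \<in> carrier_mat n n \<Longrightarrow> sub_block a k (map_mat f X) = map_mat f (sub_block a k X)"
  by (rule eq_matI) (auto simp: sub_block_def)
lemma sub_block_transpose:
  "a + k \<le> n \<Longrightarrow> X \<in> carrier_mat n n \<Longrightarrow> sub_block a k (X\<^sup>T) = (sub_block a k X)\<^sup>T"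
  by (rule eq_matI) (auto simp: sub_block_def)
lemma sub_block_one: "a + k \<le> n \<Longrightarrow> sub_block a k (1\<^sub>m n) = (1\<^sub>m k :: complex fls mat)"
  by (rule eq_matI) (auto simp: sub_block_def)

lemma block_le: "{p. p < n \<and> s p = \<sigma>} = {a..<a+k} \<Longrightarrow> k > 0 \<Longrightarrow> a + k \<le> (n::nat)"
proof -
  assume h: "{p. p < n \<and> s p = \<sigma>} = {a..<a+k}" "k > 0"
  then have "a + k - 1 \<in> {a..<a+k}" by auto
  then have "a + k - 1 < n" using h(1) by blast
  then show ?thesis using h(2) by linarith
qed

lemma sub_block_it:
  assumes "X \<in> carrier_mat n n" "tri n s X" "{p. p < n \<and> s p = \<sigma>} = {a..<a+k}" "k > 0"
  shows "it q (sub_block a k X) j = sub_block a k (it q X j)"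
proof (induction j)
  case 0
  then show ?case using assms block_le[OF assms(3,4)] by (simp add: sub_block_one) (simp add: sub_block_def)
next
  case (Suc j)
  have "sub_block a k (it q X (Suc j)) = sub_block a k X * sub_block a k (mphi q (it q X j))"
    unfolding it.simps
    by (rule sub_block_mult[OF _ _ _ _ assms(3)]) (use assms tri_it[OF assms(1,2)] in \<open>auto intro!: tri_mphi\<close>)
  then show ?case using Suc assms block_le[OF assms(3,4)] by (simp add: sub_block_map[of _ _ n])
qed

lemma diag_block_eq: "diag_block ks i B = sub_block (blk_off ks i) (ks ! i) B"
  by (simp add: diag_block_def sub_block_def)

lemma blk_off_Suc: "i < length ks \<Longrightarrow> blk_off ks (Suc i) = blk_off ks i + ks ! i"
  by (simp add: blk_off_def take_Suc_conv_app_nth)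

lemma blk_off_mono: "i \<le> j \<Longrightarrow> blk_off ks i \<le> blk_off ks j"
proof (induction j rule: dec_induct)
  case (step j)
  have "blk_off ks j \<le> blk_off ks (Suc j)"
    by (cases "j < length ks") (auto simp: blk_off_Suc, simp add: blk_off_def)
  then show ?case using step by simp
qed simp

lemma sub_block_grow:
  assumes X: "X \<in> carrier_mat n n" "tri n s X" and b: "{p. p < n \<and> s p = \<sigma>} = {a..<a+k}" "k > 0"
    and g: "gro q n t X" and t: "\<And>p. a \<le> p \<Longrightarrow> p < a + k \<Longrightarrow> t p = y"
  shows "grow q k (sub_block a k X) y"
proof -
  obtain K where K: "\<And>k i j. i < n \<Longrightarrow> j < n \<Longrightarrow> t i = t j \<Longrightarrow> vge (it q X k $$ (i, j)) (real k * t i - K)"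
    using g unfolding gro_def by blast
  have "vge (it q (sub_block a k X) l $$ (i, j)) (real l * y - K)" if "i < k" "j < k" for l i j
    using K[of "a + i" "a + j" l] t that block_le[OF b] unfolding sub_block_it[OF X b] by (simp add: sub_block_def)
  then show ?thesis unfolding grow_def by blast
qed

lemma gro_from_blocks:
  fixes \<sigma> :: "nat \<Rightarrow> real" and m :: nat
  assumes X: "X \<in> carrier_mat n n" "tri n s X" and b: "\<And>i. i < m \<Longrightarrow> {p. p < n \<and> s p = \<sigma> i} = {a i..<a i + k i}" "\<And>i. i < m \<Longrightarrow> k i > 0"
    and c: "\<And>p. p < n \<Longrightarrow> \<exists>i<m. s p = \<sigma> i"
    and g: "\<And>i. i < m \<Longrightarrow> grow q (k i) (sub_block (a i) (k i) X) (e * \<sigma> i)" and e: "e \<noteq> 0"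
  shows "gro q n (\<lambda>i. e * s i) X"
proof -
  have "\<forall>i. \<exists>K. i < m \<longrightarrow> (\<forall>l. \<forall>r<k i. \<forall>c<k i. vge (it q (sub_block (a i) (k i) X) l $$ (r, c)) (real l * (e * \<sigma> i) - K))"
    using g unfolding grow_def by blast
  then obtain K where K: "\<And>i l r c. i < m \<Longrightarrow> r < k i \<Longrightarrow> c < k i \<Longrightarrow> vge (it q (sub_block (a i) (k i) X) l $$ (r, c)) (real l * (e * \<sigma> i) - K i)"
    by metis
  define K' where "K' = (\<Sum>i<m. \<bar>K i\<bar>)"
  have K': "K i \<le> K'" if "i < m" for i
  proof -
    have "\<bar>K i\<bar> \<le> K'" unfolding K'_def using that by (intro member_le_sum) auto
    then show ?thesis by simp
  qed
  have "vge (it q X l $$ (r, c)) (real l * (e * s r) - K')" if rc: "r < n" "c < n" "e * s r = e * s c" for l r c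
  proof -
    obtain i where i: "i < m" "s r = \<sigma> i" using c[OF rc(1)] by blast
    have "r \<in> {a i..<a i + k i}" "c \<in> {a i..<a i + k i}"
      unfolding b(1)[OF i(1), symmetric] using rc i e by auto
    then have *: "r = a i + (r - a i)" "c = a i + (c - a i)" "r - a i < k i" "c - a i < k i" by auto
    have "vge (it q (sub_block (a i) (k i) X) l $$ (r - a i, c - a i)) (real l * (e * \<sigma> i) - K i)"
      by (rule K) (use i * in auto)
    then have "vge (it q X l $$ (r, c)) (real l * (e * \<sigma> i) - K i)"
      unfolding sub_block_it[OF X b(1)[OF i(1)] b(2)[OF i(1)]] using * by (simp add: sub_block_def)
    then show ?thesis using K'[OF i(1)] i(2) by (auto elim!: vge_mono)
  qed
  then show ?thesis unfolding gro_def by blast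
qed

text \<open>Induction over the blocks from the lowest slope. In V B = 1, read at a row of larger
  slope and the columns of block t, blocks of lower slope contribute nothing by induction and those
  of higher slope by triangularity of \<open>B\<close>. What remains is a row piece of
  \<open>V\<close> times the diagonal block, and the right inverse \<open>W t\<close> removes the
  latter.\<close>

lemma tri_inverse:
  fixes \<sigma> :: "nat \<Rightarrow> real"
  assumes B: "B \<in> carrier_mat n n" "tri n s B" and V: "V \<in> carrier_mat n n" "V * B = 1\<^sub>m n"
    and b: "\<And>i. i < m \<Longrightarrow> {p. p < n \<and> s p = \<sigma> i} = {a i..<a i + k i}" "\<And>i. i < m \<Longrightarrow> k i > 0"
    and c: "\<And>p. p < n \<Longrightarrow> \<exists>i<m. s p = \<sigma> i" and mono: "\<And>i j. i < j \<Longrightarrow> j < m \<Longrightarrow> \<sigma> i < \<sigma> j"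
    and W: "\<And>i. i < m \<Longrightarrow> W i \<in> carrier_mat (k i) (k i) \<and> sub_block (a i) (k i) B * W i = 1\<^sub>m (k i)"
  shows "tri n s V"
proof -
  have "V $$ (p, r) = 0" if "t < m" "p < n" "r < n" "s r = \<sigma> t" "\<sigma> t < s p" for t p r
    using that
  proof (induction t arbitrary: r rule: less_induct)
    case (less t)
    have bt: "x < n \<and> s x = \<sigma> t \<longleftrightarrow> a t \<le> x \<and> x < a t + k t" for x
      using b(1)[OF less.prems(1)] by (metis (mono_tags, lifting) atLeastLessThan_iff mem_Collect_eq)
    have le: "a t + k t \<le> n" by (rule block_le[OF b(1)[OF less.prems(1)] b(2)[OF less.prems(1)]])
    have z: "(\<Sum>l<k t. V $$ (p, a t + l) * sub_block (a t) (k t) B $$ (l, x)) = 0" if x: "x < k t" for x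
    proof -
      have sx: "a t + x < n" "s (a t + x) = \<sigma> t" using bt[of "a t + x"] x by auto
      have "0 = (V * B) $$ (p, a t + x)" using V less.prems sx by auto
      also have "\<dots> = (\<Sum>l<n. V $$ (p, l) * B $$ (l, a t + x))"
        by (rule index_mult_sum[OF V(1) B(1)]) (use less.prems sx in auto)
      also have "\<dots> = (\<Sum>l\<in>{a t..<a t + k t}. V $$ (p, l) * B $$ (l, a t + x))"
      proof (rule sum.mono_neutral_right)
        show "{a t..<a t + k t} \<subseteq> {..<n}" using le by auto
        show "\<forall>l\<in>{..<n} - {a t..<a t + k t}. V $$ (p, l) * B $$ (l, a t + x) = 0"
        proof
          fix l assume "l \<in> {..<n} - {a t..<a t + k t}"
          then have l: "l < n" "s l \<noteq> \<sigma> t" using bt[of l] by auto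
          show "V $$ (p, l) * B $$ (l, a t + x) = 0"
          proof (cases "s l < \<sigma> t")
            case True
            obtain t' where t': "t' < m" "s l = \<sigma> t'" using c[OF l(1)] by blast
            have "t' < t"
            proof (rule ccontr)
              assume "\<not> t' < t"
              then have "\<sigma> t \<le> \<sigma> t'" using mono[of t t'] t' by (cases "t = t'") auto
              then show False using True t' by simp
            qed
            then have "V $$ (p, l) = 0" using less.IH[of t' l] t' l less.prems True by auto
            then show ?thesis by simp
          next
            case False
            then have "s (a t + x) < s l" using sx l by auto
            then show ?thesis using B(2) l sx by (auto simp: tri_def)
          qed
        qed
      qed simp
      also have "\<dots> = (\<Sum>l<k t. V $$ (p, a t + l) * B $$ (a t + l, a t + x))"
        by (rule sum.reindex_bij_witness[of _ "\<lambda>l. a t + l" "\<lambda>l. l - a t"]) auto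
      finally show ?thesis using x by (simp add: sub_block_def)
    qed
    define y where "y = r - a t"
    have y: "r = a t + y" "y < k t" using bt[of r] less.prems by (auto simp: y_def)
    have Wt: "W t \<in> carrier_mat (k t) (k t)" "sub_block (a t) (k t) B * W t = 1\<^sub>m (k t)" using W[OF less.prems(1)] by auto
    have "V $$ (p, r) = (\<Sum>l<k t. V $$ (p, a t + l) * (if l = y then 1 else 0))"
      using y by (simp add: if_distrib[of "\<lambda>x. _ * x"] cong: if_cong)
    also have "\<dots> = (\<Sum>l<k t. V $$ (p, a t + l) * (\<Sum>x<k t. sub_block (a t) (k t) B $$ (l, x) * W t $$ (x, y)))"
      using y Wt by (intro sum.cong refl) (auto simp: index_mult_sum[symmetric, of _ "k t" "k t" "W t" "k t"])
    also have "\<dots> = (\<Sum>x<k t. (\<Sum>l<k t. V $$ (p, a t + l) * sub_block (a t) (k t) B $$ (l, x)) * W t $$ (x, y))"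
      unfolding sum_distrib_left sum_distrib_right by (subst sum.swap) (simp add: mult.assoc)
    also have "\<dots> = 0" using z by simp
    finally show ?case .
  qed
  then show ?thesis unfolding tri_def using c by metis
qed

lemma dmod_diso:
  assumes "coef_ring P" "q \<noteq> 0" "dmod P n A" "diso P (phiK q) n A n B" "B \<in> carrier_mat n n"
  shows "dmod P n B"
proof -
  obtain Ai where A: "A \<in> carrier_mat n n" "Ai \<in> carrier_mat n n" "entries_in P A" "entries_in P Ai" "A * Ai = 1\<^sub>m n" "Ai * A = 1\<^sub>m n"
    using assms(3) unfolding dmod_def invertible_over_def by blast
  obtain G H where G: "G \<in> carrier_mat n n" "H \<in> carrier_mat n n" "entries_in P G" "entries_in P H"
    "G * H = 1\<^sub>m n" "H * G = 1\<^sub>m n" "G * A = B * mphi q G" using assms(4) unfolding diso_iff by auto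
  have GH: "mphi q G * mphi q H = 1\<^sub>m n" "mphi q H * mphi q G = 1\<^sub>m n"
    using G assms(2) by (metis mphi_1 mphi_mult)+
  have B: "B = (G * A) * mphi q H"
    unfolding G(7) using G assms(5) GH by (simp add: assoc_mult_mat[of _ n n _ n _ n])
  define V where "V = mphi q G * (Ai * H)"
  have "(G * A) * (Ai * H) = 1\<^sub>m n" by (rule inverse_mult_mat) (use A G in auto)
  then have 1: "B * V = 1\<^sub>m n" unfolding B V_def
  proof -
    have "G * A * mphi q H * (mphi q G * (Ai * H)) = (G * A) * ((mphi q H * mphi q G) * (Ai * H))"
      using A(1,2) G(1,2) by (simp add: assoc_mult_mat[of _ n n _ n _ n])
    then show "G * A * mphi q H * (mphi q G * (Ai * H)) = 1\<^sub>m n" 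
      using A G \<open>(G * A) * (Ai * H) = 1\<^sub>m n\<close> by (simp add: GH left_mult_one_mat[of _ n n])
  qed
  have Vc: "V \<in> carrier_mat n n" using A G by (simp add: V_def)
  have "V * B = 1\<^sub>m n" by (rule mat_mult_left_right_inverse[OF assms(5) Vc 1])
  moreover have "entries_in P (G * A * mphi q H)" "entries_in P V" unfolding V_def
    using A G(1-4) by (auto intro!: entries_in_mult[OF assms(1), of _ n n _ n] entries_in_mphi[OF assms(1)])
  ultimately show ?thesis unfolding dmod_def invertible_over_def using 1 Vc assms(5) B by auto
qed

lemma nonroot_inverse: "(\<And>i. i > 0 \<Longrightarrow> q ^ i \<noteq> 1) \<Longrightarrow> i > 0 \<Longrightarrow> inverse q ^ i \<noteq> (1::complex)"
  by (simp add: power_inverse inverse_eq_1_iff)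

text \<open>Reading a list beyond its end gives a value that depends only on how far the index
  overshoots; rows of matrices and vectors therefore return the same junk at the same
  distance.\<close>

lemma mat_index_beyond:
  assumes "i < dim_row B" "dim_col B \<le> k"
  shows "B $$ (i, k) = undef_vec (k - dim_col B)"
proof -
  have nth_ge: "\<not> i < length xs \<Longrightarrow> xs ! i = [] ! (i - length xs)" for i and xs :: "'b list"
    by (metis append_Nil2 nth_append)
  show ?thesis using assms
    by transfer (auto simp: mk_mat_def undef_mat_def undef_vec_def nth_ge[of _ "map _ _"])
qed

lemma vec_index_beyond: "n \<le> k \<Longrightarrow> vec n f $ k = undef_vec (k - n)"
  by transfer (simp add: mk_vec_def)

text \<open>The definition of the filtration leaves the number of columns of the basis matrix open.
  Since row vectors and matrices agree on their junk values beyond the last column,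
  one may cut out the leading square block.\<close>

lemma mult_truncate_cols:
  assumes "dim_row B = n" "C \<in> carrier_mat n m"
  shows "B * C = mat n n (\<lambda>(i, j). B $$ (i, j)) * C"
proof (rule eq_matI)
  fix i j assume "i < dim_row (mat n n (\<lambda>(i, j). B $$ (i, j)) * C)" "j < dim_col (mat n n (\<lambda>(i, j). B $$ (i, j)) * C)"
  then have ij: "i < n" "j < m" using assms by auto
  have "row B i $ k = B $$ (i, k)" for k
    using ij assms by (cases "k < dim_col B") (auto simp: row_def vec_index_beyond mat_index_beyond)
  then show "(B * C) $$ (i, j) = (mat n n (\<lambda>(i, j). B $$ (i, j)) * C) $$ (i, j)"
    using ij assms by (auto simp: scalar_prod_def intro!: sum.cong)
qed (use assms in auto)

text \<open>The filtration becomes a slope function on the basis vectors, constant on each block.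
  Growth of the contragredient is checked blockwise as well, which presupposes that the inverse
  matrix has the same triangular shape; for this the diagonal blocks have to be invertible
  themselves.\<close>

lemma asc_imp_gdata:
  assumes q: "q \<noteq> 0" and asc: "asc_slope_filtration q n A"
  shows "\<exists>B D s. B \<in> carrier_mat n n \<and> diso laurent_poly (phiK q) n A n B \<and> gdata q n s B D"
proof -
  obtain B0 ks lams where A: "global_mod n A" and iso0: "diso laurent_poly (phiK q) n A n B0" and ks: "\<And>k. k \<in> set ks \<Longrightarrow> k > 0"
    and sum: "sum_list ks = n" and len: "length lams = length ks" and srt: "sorted_wrt (<) lams"
    and z0: "\<And>i r c. i < length ks \<Longrightarrow> blk_off ks i \<le> c \<Longrightarrow> c < blk_off ks (Suc i) \<Longrightarrow> blk_off ks (Suc i) \<le> r \<Longrightarrow> r < n \<Longrightarrow> B0 $$ (r, c) = 0"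
    and pure0: "\<And>i. i < length ks \<Longrightarrow> pure_global q (ks ! i) (diag_block ks i B0) (lams ! i)"
    using asc unfolding asc_slope_filtration_def by blast
  define B where "B = mat n n (\<lambda>(i, j). B0 $$ (i, j))"
  have Bc: "B \<in> carrier_mat n n" by (simp add: B_def)
  obtain G H where G: "G \<in> carrier_mat n n" "H \<in> carrier_mat n n" "entries_in laurent_poly G" "entries_in laurent_poly H" 
    "G * H = 1\<^sub>m n" "H * G = 1\<^sub>m n" "G * A = B0 * mphi q G"
    using iso0 unfolding diso_iff by auto
  have "dim_row (B0 * mphi q G) = n" unfolding G(7)[symmetric] using G(1) by simp
  then have "dim_row B0 = n" by simp
  then have "B0 * mphi q G = B * mphi q G" unfolding B_def using G(1) by (intro mult_truncate_cols[of _ _ _ n]) auto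
  then have "G * A = B * mphi q G" using G(7) by simp
  then have iso: "diso laurent_poly (phiK q) n A n B" unfolding diso_iff using G by blast
  have lt: "blk_off ks i + r < n" if "i < length ks" "r < ks ! i" for i r
  proof -
    have "blk_off ks (Suc i) \<le> blk_off ks (length ks)" using that by (intro blk_off_mono) simp
    then show ?thesis using that sum by (simp add: blk_off_Suc) (simp add: blk_off_def)
  qed
  have pure: "pure_global q (ks ! i) (diag_block ks i B) (lams ! i)" if "i < length ks" for i
  proof -
    have "diag_block ks i B = diag_block ks i B0" unfolding diag_block_def
      by (rule eq_matI) (use lt[OF that] in \<open>auto simp: B_def\<close>)
    then show ?thesis using pure0[OF that] by simp
  qed
  have z: "B $$ (r, c) = 0" if "i < length ks" "blk_off ks i \<le> c" "c < blk_off ks (Suc i)" "blk_off ks (Suc i) \<le> r" "r < n" for i r c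
    using that z0[OF that] by (simp add: B_def)
  define m where "m = length ks"
  define a where "a i = blk_off ks i" for i
  define k where "k i = ks ! i" for i
  define \<sigma> where "\<sigma> i = lams ! i" for i
  have mono: "\<sigma> i < \<sigma> j" if "i < j" "j < m" for i j
    using srt that len unfolding \<sigma>_def m_def by (auto simp: sorted_wrt_iff_nth_less)
  have kpos: "k i > 0" if "i < m" for i using ks that by (simp add: k_def m_def)
  have aS: "a (Suc i) = a i + k i" if "i < m" for i using that by (simp add: a_def k_def m_def blk_off_Suc)
  have amono: "i \<le> j \<Longrightarrow> a i \<le> a j" for i j unfolding a_def by (rule blk_off_mono)
  have am: "a m = n" "a 0 = 0" using sum by (simp_all add: a_def m_def blk_off_def)
  define bi where "bi p = (LEAST i. p < a (Suc i))" for p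
  have bi: "bi p < m" "a (bi p) \<le> p" "p < a (Suc (bi p))" if "p < n" for p
  proof -
    have "m \<noteq> 0" using am that by (cases m) auto
    then have "p < a (Suc (m - 1))" using am that by simp
    then show "p < a (Suc (bi p))" unfolding bi_def by (rule LeastI)
    have "bi p \<le> m - 1" unfolding bi_def by (rule Least_le) fact
    then show "bi p < m" using \<open>m \<noteq> 0\<close> by simp
    show "a (bi p) \<le> p"
    proof (cases "bi p")
      case (Suc i)
      then have "\<not> p < a (Suc i)" unfolding bi_def by (metis lessI not_less_Least)
      then show ?thesis using Suc by simp
    qed (simp add: am)
  qed
  have bi_eq: "bi p = i" if "i < m" "a i \<le> p" "p < a (Suc i)" for p i
  proof -
    have "p < n" using that amono[of "Suc i" m] am by auto
    have "\<not> bi p < i" using bi(3)[OF \<open>p < n\<close>] that amono[of "Suc (bi p)" i] by auto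
    moreover have "\<not> i < bi p" using bi(2)[OF \<open>p < n\<close>] that amono[of "Suc i" "bi p"] by auto
    ultimately show ?thesis by simp
  qed
  define s where "s p = \<sigma> (bi p)" for p
  have inj: "\<sigma> i = \<sigma> j \<Longrightarrow> i < m \<Longrightarrow> j < m \<Longrightarrow> i = j" for i j
    using mono[of i j] mono[of j i] by (cases i j rule: linorder_cases) auto
  have blocks: "{p. p < n \<and> s p = \<sigma> i} = {a i..<a i + k i}" if i: "i < m" for i
  proof (intro equalityI subsetI)
    fix p assume "p \<in> {p. p < n \<and> s p = \<sigma> i}"
    then have p: "p < n" "s p = \<sigma> i" by auto
    then have "bi p = i" using inj bi(1)[of p] i by (simp add: s_def)
    then show "p \<in> {a i..<a i + k i}" using bi[OF p(1)] aS[OF i] by auto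
  next
    fix p assume "p \<in> {a i..<a i + k i}"
    then have p: "a i \<le> p" "p < a (Suc i)" using aS[OF i] by auto
    then have "bi p = i" using bi_eq i by blast
    moreover have "p < n" using p amono[of "Suc i" m] i am by auto
    ultimately show "p \<in> {p. p < n \<and> s p = \<sigma> i}" by (simp add: s_def)
  qed
  have cover: "\<exists>i<m. s p = \<sigma> i" if "p < n" for p using bi(1)[OF that] by (auto simp: s_def)
  have triB: "tri n s B" unfolding tri_def
  proof (intro allI impI)
    fix i j assume ij: "i < n" "j < n" "s j < s i"
    have "bi j < bi i"
    proof (rule ccontr)
      assume "\<not> bi j < bi i"
      then have "\<sigma> (bi i) \<le> \<sigma> (bi j)" using mono[of "bi i" "bi j"] bi(1)[OF ij(2)] by (cases "bi i = bi j") auto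
      then show False using ij by (simp add: s_def)
    qed
    then have "a (Suc (bi j)) \<le> i" using amono[of "Suc (bi j)" "bi i"] bi(2)[OF ij(1)] by auto
    then show "B $$ (i, j) = 0" using z[of "bi j" j i] bi[OF ij(2)] ij by (simp add: a_def m_def)
  qed
  have "dmod laurent_poly n B"
    by (rule dmod_diso[OF coef_ring_laurent q _ iso Bc]) (use A in \<open>simp add: global_mod_def\<close>)
  then obtain V where V: "V \<in> carrier_mat n n" "entries_in laurent_poly V" "B * V = 1\<^sub>m n" "V * B = 1\<^sub>m n" and Be: "entries_in laurent_poly B"
    unfolding dmod_def invertible_over_def by blast
  have pb: "pure_global q (k i) (sub_block (a i) (k i) B) (\<sigma> i)" if "i < m" for i
    using pure that unfolding diag_block_eq k_def a_def \<sigma>_def m_def by auto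
  have "\<forall>i. \<exists>W. i < m \<longrightarrow> W \<in> carrier_mat (k i) (k i) \<and> sub_block (a i) (k i) B * W = 1\<^sub>m (k i)"
    using pb unfolding pure_global_def global_mod_def dmod_def invertible_over_def by blast
  then obtain W where W: "\<And>i. i < m \<Longrightarrow> W i \<in> carrier_mat (k i) (k i) \<and> sub_block (a i) (k i) B * W i = 1\<^sub>m (k i)" by metis
  have triV: "tri n s V"
    by (rule tri_inverse[OF Bc triB V(1,4) blocks kpos cover mono W])
  define D where "D = V\<^sup>T"
  have D: "D \<in> carrier_mat n n" "entries_in laurent_poly D" "D\<^sup>T = V" using V by (auto simp: D_def entries_in_transpose)
  have triD: "tri n (\<lambda>i. - s i) D" using triV V by (auto simp: tri_def D_def)
  have blocks': "{p. p < n \<and> - s p = - \<sigma> i} = {a i..<a i + k i}" if i: "i < m" for i using blocks[OF i] by simp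
  have cover': "\<exists>i<m. - s p = - \<sigma> i" if "p < n" for p using cover[OF that] by auto
  have sV: "sub_block (a i) (k i) V * sub_block (a i) (k i) B = 1\<^sub>m (k i)" if i: "i < m" for i
    using sub_block_mult[OF V(1) Bc triV triB blocks[OF i]] V(4) sub_block_one[OF block_le[OF blocks[OF i] kpos[OF i]]] by simp
  have le: "a i + k i \<le> n" if i: "i < m" for i using block_le[OF blocks[OF i] kpos[OF i]] .
  have Dsub: "sub_block (a i) (k i) D = (sub_block (a i) (k i) V)\<^sup>T" if i: "i < m" for i
    unfolding D_def by (rule sub_block_transpose[OF le[OF i] V(1)])
  have hatV: "hat V * hat B = 1\<^sub>m n" using hat_mult[OF V(1) Bc V(2) Be] V(4) by simp
  have sVh: "sub_block (a i) (k i) (hat V) * sub_block (a i) (k i) (hat B) = 1\<^sub>m (k i)" if i: "i < m" for i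
    using sub_block_mult[OF _ _ tri_hat[OF V(1) triV] tri_hat[OF Bc triB] blocks[OF i]] hatV V Bc sub_block_one[OF le[OF i]] by simp
  have pK: "pure_over (phiK q) (k i) (sub_block (a i) (k i) B) (\<sigma> i)" 
    "pure_over (phiK (inverse q)) (k i) (sub_block (a i) (k i) (hat B)) (- \<sigma> i)" if i: "i < m" for i
    using pb[OF i] unfolding pure_global_def phiK'_eq by (auto simp: sub_block_map[OF le[OF i] Bc])
  have g1: "gro q n (\<lambda>i. 1 * s i) B"
    by (rule gro_from_blocks[OF Bc triB blocks kpos cover]) (use pure_over_grow[OF q _ _ sV pK(1)] in auto)
  have g2: "gro q n (\<lambda>i. 1 * (- s i)) D"
    by (rule gro_from_blocks[OF D(1) triD blocks' kpos cover']) (use pure_over_grow[OF q _ _ sV pK(1)] in \<open>auto simp: Dsub\<close>)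
  have iq: "inverse q \<noteq> 0" using q by simp
  have g3: "gro (inverse q) n (\<lambda>i. -1 * s i) (hat B)"
    by (rule gro_from_blocks[OF _ tri_hat[OF Bc triB] blocks kpos cover]) (use Bc pure_over_grow[OF iq _ _ sVh pK(2)] in auto)
  have g4: "gro (inverse q) n (\<lambda>i. -1 * (- s i)) (hat D)"
  proof (rule gro_from_blocks[OF _ tri_hat[OF D(1) triD] blocks' kpos cover'])
    fix i assume i: "i < m"
    have "sub_block (a i) (k i) (hat D) = (sub_block (a i) (k i) (hat V))\<^sup>T"
      using V by (simp add: sub_block_map[OF le[OF i]] D(1) Dsub[OF i] map_mat_transpose)
    then show "grow (inverse q) (k i) (sub_block (a i) (k i) (hat D)) (-1 * (- \<sigma> i))"
      using pure_over_grow(3)[OF iq _ _ sVh[OF i] pK(2)[OF i]] by simp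
  qed (use D in auto)
  have "gdata q n s B D" unfolding gdata_def half_data_def
    using Bc Be D triB triD g1 g2 g3 g4 V by simp
  then show ?thesis using iso Bc by blast
qed

section \<open>Reordering a basis by slope\<close>

definition perm_mat :: "nat \<Rightarrow> (nat \<Rightarrow> nat) \<Rightarrow> 'a mat \<Rightarrow> 'a mat" where
  "perm_mat n \<pi> X = mat n n (\<lambda>(i, j). X $$ (\<pi> i, \<pi> j))"

lemma perm_mat_carrier [simp]: "perm_mat n \<pi> X \<in> carrier_mat n n" by (simp add: perm_mat_def)

lemma perm_mat_mult:
  fixes X Y :: "complex fls mat"
  assumes "bij_betw \<pi> {..<n} {..<n}" "X \<in> carrier_mat n n" "Y \<in> carrier_mat n n"
  shows "perm_mat n \<pi> (X * Y) = perm_mat n \<pi> X * perm_mat n \<pi> Y"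
proof (rule eq_matI)
  fix i j assume "i < dim_row (perm_mat n \<pi> X * perm_mat n \<pi> Y)" "j < dim_col (perm_mat n \<pi> X * perm_mat n \<pi> Y)"
  then have ij: "i < n" "j < n" by (auto simp: perm_mat_def)
  have lt: "\<pi> i < n" if "i < n" for i using assms(1) that by (auto simp: bij_betw_def)
  have "perm_mat n \<pi> (X * Y) $$ (i, j) = (\<Sum>k<n. X $$ (\<pi> i, k) * Y $$ (k, \<pi> j))"
    using ij lt by (simp add: perm_mat_def index_mult_sum[OF assms(2,3)] del: index_mult_mat)
  also have "\<dots> = (\<Sum>k<n. X $$ (\<pi> i, \<pi> k) * Y $$ (\<pi> k, \<pi> j))"
    by (rule sum.reindex_bij_betw[OF assms(1), symmetric])
  also have "\<dots> = (perm_mat n \<pi> X * perm_mat n \<pi> Y) $$ (i, j)"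
    using ij by (subst index_mult_sum[of _ n n _ n]) (auto simp: perm_mat_def)
  finally show "perm_mat n \<pi> (X * Y) $$ (i, j) = (perm_mat n \<pi> X * perm_mat n \<pi> Y) $$ (i, j)" .
qed (auto simp: perm_mat_def)

lemma bij_betw_lessThan: "bij_betw \<pi> {..<n} {..<n::nat} \<Longrightarrow> i < n \<Longrightarrow> \<pi> i < n"
  using bij_betwE by blast

lemma perm_mat_map:
  "bij_betw \<pi> {..<n} {..<n} \<Longrightarrow> X \<in> carrier_mat n n \<Longrightarrow> perm_mat n \<pi> (map_mat f X) = map_mat f (perm_mat n \<pi> X)"
  by (rule eq_matI) (auto simp: perm_mat_def bij_betw_lessThan)

lemma perm_mat_transpose:
  "bij_betw \<pi> {..<n} {..<n} \<Longrightarrow> X \<in> carrier_mat n n \<Longrightarrow> perm_mat n \<pi> (X\<^sup>T) = (perm_mat n \<pi> X)\<^sup>T"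
  by (rule eq_matI) (auto simp: perm_mat_def bij_betw_lessThan)

lemma perm_mat_one: "bij_betw \<pi> {..<n} {..<n} \<Longrightarrow> perm_mat n \<pi> (1\<^sub>m n) = 1\<^sub>m n"
  by (rule eq_matI) (auto simp: perm_mat_def bij_betw_lessThan dest!: bij_betw_imp_inj_on dest: inj_onD)

lemma perm_mat_it:
  assumes "bij_betw \<pi> {..<n} {..<n}" "X \<in> carrier_mat n n"
  shows "it q (perm_mat n \<pi> X) k = perm_mat n \<pi> (it q X k)"
proof (induction k)
  case 0
  have "dim_row (perm_mat n \<pi> X) = n" by (simp add: perm_mat_def)
  then show ?case using assms by (simp add: perm_mat_one)
next
  case (Suc k)
  then show ?case using assms by (simp add: perm_mat_mult perm_mat_map)
qed

lemma half_data_perm: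
  assumes p: "bij_betw \<pi> {..<n} {..<n}" and h: "half_data q n s X"
  shows "half_data q n (\<lambda>i. s (\<pi> i)) (perm_mat n \<pi> X)"
proof -
  have X: "X \<in> carrier_mat n n" "entries_in laurent_poly X" "tri n s X" using h by (auto simp: half_data_def)
  have lt: "\<pi> i < n" if "i < n" for i using p that by (auto simp: bij_betw_def)
  have "gro q n (\<lambda>i. s (\<pi> i)) (perm_mat n \<pi> X)"
  proof -
    obtain K where "\<And>k i j. i < n \<Longrightarrow> j < n \<Longrightarrow> s i = s j \<Longrightarrow> vge (it q X k $$ (i, j)) (real k * s i - K)"
      using h unfolding gro_def half_data_def by blast
    then show ?thesis unfolding gro_def perm_mat_it[OF p X(1)]
      by (intro exI[of _ K]) (auto simp: perm_mat_def lt)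
  qed
  moreover have "gro (inverse q) n (\<lambda>i. - s (\<pi> i)) (hat (perm_mat n \<pi> X))"
  proof -
    obtain K where K: "\<And>k i j. i < n \<Longrightarrow> j < n \<Longrightarrow> - s i = - s j \<Longrightarrow> vge (it (inverse q) (hat X) k $$ (i, j)) (real k * (- s i) - K)"
      using h unfolding gro_def half_data_def by blast
    have "it (inverse q) (hat (perm_mat n \<pi> X)) k = perm_mat n \<pi> (it (inverse q) (hat X) k)" for k
      using perm_mat_it[OF p, of "hat X"] X by (simp add: perm_mat_map[OF p X(1)])
    then show ?thesis unfolding gro_def using K
      by (intro exI[of _ K]) (auto simp: perm_mat_def lt)
  qed
  moreover have "entries_in laurent_poly (perm_mat n \<pi> X)"
    by (rule entries_inI[of _ n n]) (use X lt in \<open>auto simp: perm_mat_def intro: entries_inD\<close>)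
  moreover have "tri n (\<lambda>i. s (\<pi> i)) (perm_mat n \<pi> X)" using X lt by (auto simp: tri_def perm_mat_def)
  ultimately show ?thesis by (simp add: half_data_def)
qed

lemma gdata_perm:
  assumes p: "bij_betw \<pi> {..<n} {..<n}" and h: "gdata q n s B D"
  shows "gdata q n (\<lambda>i. s (\<pi> i)) (perm_mat n \<pi> B) (perm_mat n \<pi> D)"
proof -
  have c: "B \<in> carrier_mat n n" "D \<in> carrier_mat n n" using h by (auto simp: gdata_def half_data_def)
  show ?thesis
    using h half_data_perm[OF p, of q s B] half_data_perm[OF p, of q "\<lambda>i. - s i" D] c
    by (simp add: gdata_def perm_mat_mult[OF p, symmetric] perm_mat_transpose[OF p, symmetric] perm_mat_one[OF p])
qed

lemma diso_perm:
  fixes B :: "complex fls mat"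
  assumes p: "bij_betw \<pi> {..<n} {..<n}" and B: "B \<in> carrier_mat n n"
  shows "diso laurent_poly (phiK q) n B n (perm_mat n \<pi> B)"
proof -
  define P where "P = mat n n (\<lambda>(i, j). if j = \<pi> i then 1 else (0 :: complex fls))"
  have lt: "\<pi> i < n" if "i < n" for i using p that by (auto simp: bij_betw_def)
  have inj: "\<pi> i = \<pi> j \<longleftrightarrow> i = j" if "i < n" "j < n" for i j using p that by (auto simp: bij_betw_def inj_on_def)
  have P: "P \<in> carrier_mat n n" "entries_in laurent_poly P" by (auto simp: P_def entries_in_def)
  have PX: "(P * X) $$ (i, j) = X $$ (\<pi> i, j)" if "X \<in> carrier_mat n n" "i < n" "j < n" for X i j
  proof -
    have "(P * X) $$ (i, j) = (\<Sum>k<n. (if k = \<pi> i then X $$ (k, j) else 0))"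
      unfolding index_mult_sum[OF P(1) that] using that by (intro sum.cong) (auto simp: P_def)
    then show ?thesis using lt that by simp
  qed
  have "P * P\<^sup>T = 1\<^sub>m n"
  proof (rule eq_matI)
    fix i j assume "i < dim_row (1\<^sub>m n :: complex fls mat)" "j < dim_col (1\<^sub>m n :: complex fls mat)"
    then have ij: "i < n" "j < n" by auto
    then show "(P * P\<^sup>T) $$ (i, j) = 1\<^sub>m n $$ (i, j)"
      using PX[of "P\<^sup>T" i j] P lt inj[of i j] by (auto simp: P_def)
  qed (use P in auto)
  moreover from this have "P\<^sup>T * P = 1\<^sub>m n" using P by (intro mat_mult_left_right_inverse[of P n]) auto
  moreover have "P * B = perm_mat n \<pi> B * mphi q P"
  proof (rule eq_matI)
    fix i j assume "i < dim_row (perm_mat n \<pi> B * mphi q P)" "j < dim_col (perm_mat n \<pi> B * mphi q P)"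
    then have ij: "i < n" "j < n" using P by (auto simp: perm_mat_def)
    have "(perm_mat n \<pi> B * mphi q P) $$ (i, j) = (\<Sum>k<n. B $$ (\<pi> i, \<pi> k) * (if j = \<pi> k then 1 else 0))"
      using ij P by (subst index_mult_sum[of _ n n _ n]) (auto simp: perm_mat_def P_def intro!: sum.cong)
    also have "\<dots> = (\<Sum>k<n. B $$ (\<pi> i, k) * (if j = k then 1 else 0))"
      by (rule sum.reindex_bij_betw[OF p])
    also have "\<dots> = B $$ (\<pi> i, j)" using ij by (simp add: if_distrib[of "\<lambda>x. _ * x"] cong: if_cong)
    finally show "(P * B) $$ (i, j) = (perm_mat n \<pi> B * mphi q P) $$ (i, j)" using PX[OF B ij] by simp
  qed (use P B in \<open>auto simp: perm_mat_def\<close>)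
  ultimately show ?thesis unfolding diso_iff using P entries_in_transpose[OF P(2)]
    by (intro conjI refl exI[of _ P] exI[of _ "P\<^sup>T"]) auto
qed

lemma downward_closed_nat:
  assumes "finite S" "\<And>p p'. p \<in> S \<Longrightarrow> p' \<le> p \<Longrightarrow> p' \<in> S"
  shows "S = {..<card (S :: nat set)}"
proof (cases "S = {}")
  case False
  have "S = {..Max S}" using assms(2)[OF Max_in[OF assms(1) False]] Max_ge[OF assms(1)] by auto
  then have "card S = Suc (Max S)" by (metis card_atMost)
  then show ?thesis using \<open>S = {..Max S}\<close> by (simp add: lessThan_Suc_atMost)
qed simp

lemma card_level_sets:
  assumes "distinct xs"
  shows "card {p. p < (n::nat) \<and> s p \<in> set xs} = sum_list (map (\<lambda>l. card {p. p < n \<and> s p = l}) xs)"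
  using assms
proof (induction xs)
  case (Cons x xs)
  have "{p. p < n \<and> s p \<in> set (x # xs)} = {p. p < n \<and> s p = x} \<union> {p. p < n \<and> s p \<in> set xs}" by auto
  then show ?case using Cons by (simp, subst card_Un_disjoint) auto
qed simp

text \<open>With slopes weakly increasing along the basis, each slope occupies an interval and
  triangularity in \<open>s\<close> becomes block triangularity. Each diagonal block is pure by the
  growth criterion, applied at 0 with q and at infinity with its inverse.\<close>

lemma gdata_sorted_imp_asc:
  assumes q: "q \<noteq> 0" "\<And>i. i > 0 \<Longrightarrow> q ^ i \<noteq> 1" and A: "global_mod n A" "diso laurent_poly (phiK q) n A n B"
    and g: "gdata q n s B D" and srt: "\<And>i j. i \<le> j \<Longrightarrow> j < n \<Longrightarrow> s i \<le> s j"
  shows "asc_slope_filtration q n A"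
proof -
  define lams where "lams = sorted_list_of_set (s ` {..<n})"
  define ks where "ks = map (\<lambda>l. card {p. p < n \<and> s p = l}) lams"
  have lams: "sorted_wrt (<) lams" "set lams = s ` {..<n}" "distinct lams" by (auto simp: lams_def)
  have lenk: "length lams = length ks" by (simp add: ks_def)
  have nless: "lams ! i < lams ! j" if "i < j" "j < length lams" for i j using lams(1) that by (auto simp: sorted_wrt_iff_nth_less)
  \<comment> \<open>Positions carrying one of the i smallest slopes; monotonicity of
    \<open>s\<close> makes them an initial segment, whose length is the block offset.\<close>
  define T where "T i = {p. p < n \<and> s p \<in> set (take i lams)}" for i
  have Tcard: "card (T i) = blk_off ks i" for i
    unfolding T_def blk_off_def ks_def by (subst card_level_sets) (auto simp: lams take_map)
  have T: "T i = {..<blk_off ks i}" for i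
    unfolding Tcard[symmetric]
  proof (rule downward_closed_nat)
    fix p p' assume p: "p \<in> T i" "p' \<le> p"
    then obtain a where a: "a < i" "a < length lams" "s p = lams ! a" "p < n" by (auto simp: T_def in_set_conv_nth)
    have "s p' \<in> set lams" using p a by (auto simp: lams)
    then obtain b where b: "b < length lams" "s p' = lams ! b" by (auto simp: in_set_conv_nth)
    have "\<not> a < b" using srt[OF p(2) a(4)] nless[of a b] a b by auto
    then have "b < i" using a by simp
    then have "lams ! b \<in> set (take i lams)" using b by (metis in_set_conv_nth length_take min_less_iff_conj nth_take)
    then show "p' \<in> T i" using a b p by (simp add: T_def)
  qed (simp add: T_def)
  have block: "{p. p < n \<and> s p = lams ! i} = {blk_off ks i..<blk_off ks i + ks ! i}" if i: "i < length ks" for i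
  proof -
    have "set (take (Suc i) lams) = insert (lams ! i) (set (take i lams))" using i lenk by (simp add: take_Suc_conv_app_nth)
    moreover have "lams ! x \<noteq> lams ! i" if "x < i" for x using nless[of x i] that i lenk by simp
    then have "lams ! i \<notin> set (take i lams)" by (auto simp: in_set_conv_nth)
    ultimately have "{p. p < n \<and> s p = lams ! i} = T (Suc i) - T i" by (auto simp: T_def)
    then show ?thesis using i by (auto simp: T blk_off_Suc)
  qed
  have kpos: "ks ! i > 0" if "i < length ks" for i
  proof -
    have "lams ! i \<in> s ` {..<n}" using that lenk lams(2) nth_mem by metis
    then have "{p. p < n \<and> s p = lams ! i} \<noteq> {}" by auto
    then show ?thesis using block[OF that] by auto
  qed
  have off_end: "blk_off ks (length ks) = n"
  proof -
    have "T (length ks) = {..<n}" using lams(2) lenk by (auto simp: T_def)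
    then show ?thesis using Tcard[of "length ks"] by simp
  qed
  have B: "B \<in> carrier_mat n n" "D \<in> carrier_mat n n" "entries_in laurent_poly B" "entries_in laurent_poly D" "tri n s B" "tri n (\<lambda>i. - s i) D"
    "gro q n s B" "gro q n (\<lambda>i. - s i) D" "gro (inverse q) n (\<lambda>i. - s i) (hat B)" "gro (inverse q) n (\<lambda>i. - (- s i)) (hat D)"
    "B * D\<^sup>T = 1\<^sub>m n" "D\<^sup>T * B = 1\<^sub>m n" using g by (auto simp: gdata_def half_data_def)
  have triV: "tri n s (D\<^sup>T)" using B by (auto simp: tri_def)
  have "pure_global q (ks ! i) (diag_block ks i B) (lams ! i)" if i: "i < length ks" for i
  proof -
    define a k where "a = blk_off ks i" and "k = ks ! i"
    have bl: "{p. p < n \<and> s p = lams ! i} = {a..<a+k}" "k > 0" using block[OF i] kpos[OF i] by (auto simp: a_def k_def)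
    have bl': "{p. p < n \<and> - s p = - (lams ! i)} = {a..<a+k}" using bl(1) by simp
    have le: "a + k \<le> n" by (rule block_le[OF bl])
    have sp: "s p = lams ! i" if "a \<le> p" "p < a + k" for p
      using bl(1) that by (metis (mono_tags, lifting) atLeastLessThan_iff mem_Collect_eq)
    define X V where "X = sub_block a k B" and "V = sub_block a k (D\<^sup>T)"
    have XV: "X \<in> carrier_mat k k" "V \<in> carrier_mat k k" "X * V = 1\<^sub>m k" "V * X = 1\<^sub>m k"
      using sub_block_mult[OF B(1) _ B(5) triV bl(1)] sub_block_mult[OF _ B(1) triV B(5) bl(1)] B sub_block_one[OF le]
      by (auto simp: X_def V_def)
    have XVl: "entries_in laurent_poly X" "entries_in laurent_poly V"
      using B(1-4) le by (auto simp: X_def V_def sub_block_def entries_in_def)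
    have VT: "V\<^sup>T = sub_block a k D" using sub_block_transpose[OF le, of "D\<^sup>T"] B(2) by (simp add: V_def)
    have hX: "hat X = sub_block a k (hat B)" unfolding X_def by (rule sub_block_map[OF le B(1), symmetric])
    have hVT: "(hat V)\<^sup>T = sub_block a k (hat D)" using VT sub_block_map[OF le B(2), of to_K'] by (simp add: map_mat_transpose)
    have hVX: "hat V * hat X = 1\<^sub>m k" using hat_mult[OF XV(2,1) XVl(2,1)] XV(4) by simp
    have "global_mod k X" unfolding global_mod_def dmod_def invertible_over_def using XV XVl by blast
    moreover have "pure_over (phiK q) k X (lams ! i)"
    proof (rule pure_over_criterion[OF q _ XV(1,2,4)])
      show "grow q k X (lams ! i)" unfolding X_def by (rule sub_block_grow[OF B(1,5) bl B(7)]) (use sp in auto)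
      show "grow q k (V\<^sup>T) (- (lams ! i))" unfolding VT by (rule sub_block_grow[OF B(2,6) bl' bl(2) B(8)]) (use sp in auto)
    qed (use bl XVl entries_in_laurent_conv in auto)
    moreover have "pure_over (phiK (inverse q)) k (hat X) (- (lams ! i))"
    proof (rule pure_over_criterion[OF _ nonroot_inverse[OF q(2)] _ _ _ hVX])
      show "grow (inverse q) k (hat X) (- (lams ! i))" unfolding hX
        by (rule sub_block_grow[OF _ tri_hat[OF B(1,5)] bl B(9)]) (use sp B in auto)
      show "grow (inverse q) k ((hat V)\<^sup>T) (- (- (lams ! i)))" unfolding hVT
        by (rule sub_block_grow[OF _ tri_hat[OF B(2,6)] bl' bl(2) B(10)]) (use sp B in auto)
    qed (use q bl XV XVl entries_in_laurent_conv hat_laurent in auto)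
    ultimately show ?thesis unfolding pure_global_def phiK'_eq diag_block_eq by (simp add: X_def a_def k_def)
  qed
  moreover have "B $$ (r, c) = 0" if "i < length ks" "blk_off ks i \<le> c" "c < blk_off ks (Suc i)" "blk_off ks (Suc i) \<le> r" "r < n" for i r c
  proof -
    have c: "c < n" "s c = lams ! i" using that block[OF that(1)] blk_off_Suc[OF that(1)]
      by (metis (mono_tags, lifting) atLeastLessThan_iff mem_Collect_eq)+
    have "r \<notin> T (Suc i)" using that by (simp add: T)
    then have *: "s r \<notin> set (take (Suc i) lams)" using that by (simp add: T_def)
    have "s r \<in> set lams" using that by (auto simp: lams)
    then obtain b where b: "b < length lams" "s r = lams ! b" by (auto simp: in_set_conv_nth)
    then have "i < b" using * by (auto simp: in_set_conv_nth) (metis lessI min_less_iff_conj not_less_eq)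
    then have "s c < s r" using c b nless by auto
    then show ?thesis using B(5) c that by (auto simp: tri_def)
  qed
  moreover have "k > 0" if "k \<in> set ks" for k using that kpos by (auto simp: in_set_conv_nth)
  moreover have "sum_list ks = n" using off_end by (simp add: blk_off_def)
  ultimately show ?thesis unfolding asc_slope_filtration_def using A lams(1) lenk
    by (intro conjI exI[of _ B] exI[of _ ks] exI[of _ lams]) auto
qed

text \<open>Sorting the basis by slope is an isomorphism over R, since permutation matrices have
  constant entries.\<close>

lemma gdata_imp_asc:
  assumes q: "q \<noteq> 0" "\<And>i. i > 0 \<Longrightarrow> q ^ i \<noteq> 1" and A: "global_mod n A" "diso laurent_poly (phiK q) n A n B"
    and g: "gdata q n s B D"
  shows "asc_slope_filtration q n A"
proof -
  define L where "L = sort_key s [0..<n]"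
  define \<pi> where "\<pi> i = L ! i" for i
  have L: "length L = n" "set L = {..<n}" "distinct L" "sorted (map s L)" by (auto simp: L_def)
  have p: "bij_betw \<pi> {..<n} {..<n}"
    unfolding \<pi>_def by (rule bij_betw_nth) (use L in auto)
  have srt: "s (\<pi> i) \<le> s (\<pi> j)" if "i \<le> j" "j < n" for i j
    using sorted_nth_mono[OF L(4), of i j] that L(1) by (simp add: \<pi>_def)
  have B: "B \<in> carrier_mat n n" using g by (simp add: gdata_def half_data_def)
  have "A \<in> carrier_mat n n" using A(1) by (simp add: global_mod_def dmod_def invertible_over_def)
  then have "diso laurent_poly (phiK q) n A n (perm_mat n \<pi> B)"
    using diso_trans[OF coef_ring_laurent q(1) _ B _ A(2) diso_perm[OF p B]] by simp
  then have "diso laurent_poly (phiK q) n A n (perm_mat n \<pi> B)" .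
  note r = gdata_sorted_imp_asc[OF q A(1) this gdata_perm[OF p g]]
  show ?thesis by (rule r) (use srt in auto)
qed

section \<open>Convergent horizontal vectors\<close>

lemma fls_times_nth_window:
  fixes f g :: "complex fls"
  assumes "\<And>i. i < a \<Longrightarrow> fls_nth f i = 0" "\<And>i. i > b \<Longrightarrow> fls_nth f i = 0"
  shows "fls_nth (f * g) n = (\<Sum>i=a..b. fls_nth f i * fls_nth g (n - i))"
proof -
  have "fls_nth (f * g) n = (\<Sum>i=a..n - fls_subdegree g. fls_nth f i * fls_nth g (n - i))"
    by (rule fls_times_nth_bounds) (use assms in auto)
  also have "\<dots> = (\<Sum>i=a..b. fls_nth f i * fls_nth g (n - i))"
    by (rule sum.mono_neutral_cong) (use assms in auto)
  finally show ?thesis .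
qed

text \<open>Since a has no positive exponents, beyond the support of \<open>y\<close> the
  coefficient of x at m depends only on coefficients at m and later, each weighted by |q|^m or less.
  Far enough out, every use of the equation improves a geometric bound on the coefficients by the
  factor 1/2, so they vanish.\<close>

lemma laurent_fixed_contraction:
  fixes a :: "'i \<Rightarrow> 'i \<Rightarrow> complex fls"
  assumes q: "0 < norm q" "norm q < 1" and I: "finite I"
    and a: "\<And>p r n. p \<in> I \<Longrightarrow> r \<in> I \<Longrightarrow> n > 0 \<Longrightarrow> fls_nth (a p r) n = 0"
    and y: "\<And>p. p \<in> I \<Longrightarrow> laurent_poly (y p)" and x: "\<And>p. p \<in> I \<Longrightarrow> conv_fls (x p)"
    and eq: "\<And>p. p \<in> I \<Longrightarrow> x p = (\<Sum>r\<in>I. a p r * phiK q (x r)) + y p"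
    and p: "p \<in> I"
  shows "laurent_poly (x p)"
proof -
  obtain R C where R: "R \<ge> 1" "C \<ge> 0" "\<And>p n. p \<in> I \<Longrightarrow> norm (fls_nth (x p) n) \<le> C * R powi n"
    using conv_bound_finite[OF I, of x] x by blast
  obtain v where v: "\<forall>z\<in>I\<times>I. vge (case z of (p, r) \<Rightarrow> a p r) v"
    using vge_ex_finite[of "I\<times>I" "\<lambda>(p, r). a p r"] I by blast
  define N where "N = \<lfloor>v\<rfloor>"
  have aN: "fls_nth (a p r) n = 0" if "p \<in> I" "r \<in> I" "n < N" for p r n
  proof (rule vge_nth)
    show "vge (a p r) v" using v that by auto
    show "real_of_int n < v" using that by (simp add: N_def less_floor_iff)
  qed
  \<comment> \<open>Total weight of the equation relative to the bound C R^m: passing from m to m -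
    k costs (|q| R)^(-k), apart from the common factor |q|^m.\<close>
  define W where "W p = (\<Sum>r\<in>I. \<Sum>k=N..0. norm (fls_nth (a p r) k) * (norm q * R) powi (-k))" for p
  define W' where "W' = (\<Sum>p\<in>I. W p)"
  have qR: "norm q * R > 0" using q R by simp
  have W0: "W p \<ge> 0" for p unfolding W_def using qR by (intro sum_nonneg mult_nonneg_nonneg) auto
  have WW: "W p \<le> W'" if "p \<in> I" for p
    unfolding W'_def using that I W0 by (intro member_le_sum) auto
  obtain Y where Y: "\<And>p n. p \<in> I \<Longrightarrow> n > Y \<Longrightarrow> fls_nth (y p) n = 0"
  proof -
    have "\<forall>p\<in>I. \<exists>b. \<forall>n>b. fls_nth (y p) n = 0" using y unfolding laurent_poly_iff by blast
    then obtain b where b: "\<And>p n. p \<in> I \<Longrightarrow> n > b p \<Longrightarrow> fls_nth (y p) n = 0" by metis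
    have "bdd_above (b ` I)" using I by auto
    then obtain Y where "\<And>p. p \<in> I \<Longrightarrow> b p \<le> Y" by (auto simp: bdd_above_def)
    then show ?thesis using b that[of Y] by (meson le_less_trans)
  qed
  have "(\<lambda>n. norm q ^ n * W') \<longlonglongrightarrow> 0 * W'"
    using q by (intro tendsto_intros LIMSEQ_realpow_zero) auto
  then have "eventually (\<lambda>n. norm q ^ n * W' < 1/2) sequentially"
    by (intro order_tendstoD(2)[of _ 0]) auto
  then obtain t :: nat where t: "norm q ^ t * W' < 1/2" by (auto simp: eventually_sequentially)
  \<comment> \<open>From T on, the factor |q|^m beats these weights and \<open>y\<close> has no
    coefficients.\<close>
  define T where "T = max (int t) (Y + 1)"
  have qT: "norm q powi m * W p \<le> 1/2" if "m \<ge> T" "p \<in> I" for m p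
  proof -
    have "m \<ge> int t" using that by (simp add: T_def)
    then have "norm q powi m \<le> norm q powi (int t)" using q by (intro power_int_decreasing) auto
    then have "norm q powi m * W p \<le> norm q ^ t * W'" using WW[OF that(2)] W0 q by (intro mult_mono) auto
    then show ?thesis using t by simp
  qed
  have key: "norm (fls_nth (x p) m) \<le> C * R powi m * (1/2) ^ l" if "p \<in> I" "m \<ge> T" for p m l
    using that
  proof (induction l arbitrary: p m)
    case 0
    then show ?case using R by simp
  next
    case (Suc l)
    have "fls_nth (x p) m = (\<Sum>r\<in>I. fls_nth (a p r * phiK q (x r)) m) + fls_nth (y p) m"
      by (subst eq[OF Suc.prems(1)]) (simp add: fls_nth_sum)
    also have "fls_nth (y p) m = 0" using Suc.prems Y by (auto simp: T_def)
    also have "(\<Sum>r\<in>I. fls_nth (a p r * phiK q (x r)) m) = (\<Sum>r\<in>I. \<Sum>k=N..0. fls_nth (a p r) k * (q powi (m - k) * fls_nth (x r) (m - k)))"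
      using Suc.prems a aN by (intro sum.cong refl) (subst fls_times_nth_window[of N _ 0], auto)
    finally have "norm (fls_nth (x p) m) = norm (\<Sum>r\<in>I. \<Sum>k=N..0. fls_nth (a p r) k * (q powi (m - k) * fls_nth (x r) (m - k)))" by simp
    also have "\<dots> \<le> (\<Sum>r\<in>I. \<Sum>k=N..0. norm (fls_nth (a p r) k * (q powi (m - k) * fls_nth (x r) (m - k))))"
      by (intro order_trans[OF norm_sum] sum_mono norm_sum)
    also have "\<dots> \<le> (\<Sum>r\<in>I. \<Sum>k=N..0. norm (fls_nth (a p r) k) * (norm q powi (m - k) * (C * R powi (m - k) * (1/2) ^ l)))"
    proof (intro sum_mono)
      fix r k assume rk: "r \<in> I" "k \<in> {N..0}"
      have "norm (fls_nth (x r) (m - k)) \<le> C * R powi (m - k) * (1/2) ^ l"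
        by (rule Suc.IH) (use rk Suc.prems in auto)
      then show "norm (fls_nth (a p r) k * (q powi (m - k) * fls_nth (x r) (m - k))) \<le>
        norm (fls_nth (a p r) k) * (norm q powi (m - k) * (C * R powi (m - k) * (1/2) ^ l))"
        unfolding norm_mult norm_power_int by (intro mult_left_mono) auto
    qed
    also have "\<dots> = (\<Sum>r\<in>I. \<Sum>k=N..0. (C * R powi m * (1/2) ^ l * norm q powi m) * (norm (fls_nth (a p r) k) * (norm q * R) powi (-k)))"
    proof (intro sum.cong refl)
      fix r k
      have "norm q powi (m - k) * R powi (m - k) = norm q powi m * R powi m * (norm q * R) powi (-k)"
        using q R by (simp add: power_int_mult_distrib power_int_diff power_int_minus field_simps)
      then show "norm (fls_nth (a p r) k) * (norm q powi (m - k) * (C * R powi (m - k) * (1/2) ^ l)) =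
        (C * R powi m * (1/2) ^ l * norm q powi m) * (norm (fls_nth (a p r) k) * (norm q * R) powi (-k))"
        by (simp add: algebra_simps)
    qed
    also have "\<dots> = C * R powi m * (1/2) ^ l * (norm q powi m * W p)"
      by (simp add: W_def sum_distrib_left mult.assoc)
    also have "\<dots> \<le> C * R powi m * (1/2) ^ l * (1/2)"
      using qT[OF Suc.prems(2,1)] R by (intro mult_left_mono) auto
    finally show ?case by simp
  qed
  have "fls_nth (x p) m = 0" if m: "m \<ge> T" for m
  proof -
    have "(\<lambda>l. C * R powi m * (1/2) ^ l) \<longlonglongrightarrow> C * R powi m * 0"
      by (intro tendsto_intros LIMSEQ_realpow_zero) auto
    then have "norm (fls_nth (x p) m) \<le> C * R powi m * 0"
      using key[OF p m] by (intro LIMSEQ_le_const) auto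
    then show ?thesis by simp
  qed
  then show ?thesis unfolding laurent_poly_iff by (intro exI[of _ T]) auto
qed

text \<open>Restricted to finitely many coordinates, even an infinite family of vectors spans a
  finite-dimensional space. Elimination of one coordinate at a time picks the spanning members from
  the family itself.\<close>

lemma finite_spanning_subfamily:
  fixes U :: "'b \<Rightarrow> 'a \<Rightarrow> complex"
  assumes "finite J"
  shows "\<exists>F. finite F \<and> F \<subseteq> B \<and> (\<forall>b\<in>B. \<exists>c. \<forall>x\<in>J. U b x = (\<Sum>f\<in>F. c f * U f x))"
  using assms
proof (induction J arbitrary: U rule: finite_induct)
  case empty
  then show ?case by (intro exI[of _ "{}"]) auto
next
  case (insert z J)
  show ?case
  proof (cases "\<forall>b\<in>B. U b z = 0")
    case True
    obtain F where F: "finite F" "F \<subseteq> B" "\<forall>b\<in>B. \<exists>c. \<forall>x\<in>J. U b x = (\<Sum>f\<in>F. c f * U f x)"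
      using insert.IH[of U] by blast
    have "\<exists>c. \<forall>x\<in>insert z J. U b x = (\<Sum>f\<in>F. c f * U f x)" if b: "b \<in> B" for b
    proof -
      obtain c where c: "\<forall>x\<in>J. U b x = (\<Sum>f\<in>F. c f * U f x)" using bspec[OF F(3) b] by (elim exE)
      have "(\<Sum>f\<in>F. c f * U f z) = 0"
        by (rule sum.neutral) (use True F(2) in auto)
      then have "\<forall>x\<in>insert z J. U b x = (\<Sum>f\<in>F. c f * U f x)" using c True b by simp
      then show ?thesis by (intro exI[of _ c])
    qed
    then show ?thesis using F(1,2) by (intro exI[of _ F] conjI ballI)
  next
    case False
    then obtain b0 where b0: "b0 \<in> B" "U b0 z \<noteq> 0" by blast
    define r where "r b = U b z / U b0 z" for b
    define U' where "U' b x = U b x - r b * U b0 x" for b x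
    obtain F where F: "finite F" "F \<subseteq> B" "\<forall>b\<in>B. \<exists>c. \<forall>x\<in>J. U' b x = (\<Sum>f\<in>F. c f * U' f x)"
      using insert.IH[of U'] by blast
    have U'z: "U' b z = 0" for b using b0 by (simp add: U'_def r_def)
    have "\<exists>c. \<forall>x\<in>insert z J. U b x = (\<Sum>f\<in>insert b0 F. c f * U f x)" if b: "b \<in> B" for b
    proof -
      obtain c where c: "\<forall>x\<in>J. U' b x = (\<Sum>f\<in>F. c f * U' f x)" using bspec[OF F(3) b] by (elim exE)
      then have c': "\<forall>x\<in>insert z J. U' b x = (\<Sum>f\<in>F. c f * U' f x)" using U'z by simp
      define K where "K = r b - (\<Sum>f\<in>F. c f * r f)"
      define d where "d f = (if f \<in> F then c f else 0) + (if f = b0 then K else 0)" for f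
      have "U b x = (\<Sum>f\<in>insert b0 F. d f * U f x)" if x: "x \<in> insert z J" for x
      proof -
        have "U b x = U' b x + r b * U b0 x" by (simp add: U'_def)
        also have "U' b x = (\<Sum>f\<in>F. c f * U f x) - (\<Sum>f\<in>F. c f * r f) * U b0 x"
        proof -
          have "U' b x = (\<Sum>f\<in>F. c f * U' f x)" using c' x by blast
          then show ?thesis by (simp add: U'_def algebra_simps sum_subtractf sum_distrib_left)
        qed
        finally have "U b x = (\<Sum>f\<in>F. c f * U f x) + K * U b0 x" by (simp add: K_def algebra_simps)
        also have "(\<Sum>f\<in>F. c f * U f x) = (\<Sum>f\<in>insert b0 F. (if f \<in> F then c f else 0) * U f x)"
          using F(1) by (intro sum.mono_neutral_cong_left) auto
        also have "K * U b0 x = (\<Sum>f\<in>insert b0 F. (if f = b0 then K else 0) * U f x)"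
          using F(1) by (simp add: if_distrib[of "\<lambda>x. x * _"] cong: if_cong)
        finally show ?thesis by (simp add: d_def sum.distrib algebra_simps)
      qed
      then show ?thesis by (intro exI[of _ d] ballI)
    qed
    then show ?thesis using F(1,2) b0(1) by (intro exI[of _ "insert b0 F"] conjI ballI) auto
  qed
qed

text \<open>The matrix \<open>a\<close> may have positive exponents, but those of its iterates stay
  at most C. Up to Laurent polynomials the combinations \<open>X\<close> satisfy X (k, i) = phi (X
  (k + 1, i)). Modulo negative exponents the coefficient vectors \<open>Y\<close> of these
  combinations lie in a finite-dimensional space, so finitely many \<open>X\<close> together with x
  form a closed system whose coefficients have no positive exponents, and the contraction argument
  applies to it.\<close>

lemma laurent_fixed_bounded:
  fixes P :: "nat \<Rightarrow> 'i \<Rightarrow> 'i \<Rightarrow> complex fls"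
  assumes q: "0 < norm q" "norm q < 1" and I: "finite I"
    and P0: "\<And>i j. i \<in> I \<Longrightarrow> j \<in> I \<Longrightarrow> P 0 i j = (if i = j then 1 else 0)"
    and PS: "\<And>k i j. i \<in> I \<Longrightarrow> j \<in> I \<Longrightarrow> P (Suc k) i j = (\<Sum>l\<in>I. P k i l * phiK (q ^ k) (a l j))"
    and Pl: "\<And>k i j. i \<in> I \<Longrightarrow> j \<in> I \<Longrightarrow> laurent_poly (P k i j)"
    and Pd: "\<And>k i j n. i \<in> I \<Longrightarrow> j \<in> I \<Longrightarrow> n > C \<Longrightarrow> fls_nth (P k i j) n = 0"
    and y: "\<And>i. i \<in> I \<Longrightarrow> laurent_poly (y i)" and x: "\<And>i. i \<in> I \<Longrightarrow> conv_fls (x i)"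
    and eq: "\<And>i. i \<in> I \<Longrightarrow> x i = (\<Sum>j\<in>I. a i j * phiK q (x j)) + y i"
    and i: "i \<in> I"
  shows "laurent_poly (x i)"
proof -
  have q0: "q \<noteq> 0" using q by auto
  \<comment> \<open>Undoing the dilation keeps the range of exponents and makes the recursion in k
    free of coefficients.\<close>
  define Y where "Y b j = phiK (inverse q ^ fst b) (P (fst b) (snd b) j)" for b :: "nat \<times> 'i" and j
  define X where "X b = (\<Sum>j\<in>I. Y b j * x j)" for b
  define L where "L b = (\<Sum>j\<in>I. Y b j * y j)" for b
  have Yl: "laurent_poly (Y b j)" if "snd b \<in> I" "j \<in> I" for b j using Pl that by (simp add: Y_def)
  have X0: "X (0, i) = x i" if "i \<in> I" for i
    using that I by (simp add: X_def Y_def P0 if_distrib[of "\<lambda>x. x * _"] cong: if_cong)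
  have Xrec: "X (k, i) = phiK q (X (Suc k, i)) + L (k, i)" if i: "i \<in> I" for k i
  proof -
    have e: "q * (inverse q ^ k * inverse q) = inverse q ^ k" "q * (inverse q * inverse q ^ k) = inverse q ^ k" using q0 by simp_all
    have e2: "inverse q ^ k * q ^ k = 1" using q0 by (simp add: power_inverse)
    have "phiK q (X (Suc k, i)) = (\<Sum>j\<in>I. phiK (inverse q ^ k) (P (Suc k) i j) * phiK q (x j))"
      using q0 by (simp add: X_def Y_def phiK_sum phiK_mult phiK_phiK e)
    also have "\<dots> = (\<Sum>j\<in>I. \<Sum>l\<in>I. phiK (inverse q ^ k) (P k i l) * (a l j * phiK q (x j)))"
      using q0 i by (intro sum.cong refl) (simp add: e2 PS phiK_sum phiK_mult phiK_phiK sum_distrib_right mult.assoc)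
    also have "\<dots> = (\<Sum>l\<in>I. phiK (inverse q ^ k) (P k i l) * (\<Sum>j\<in>I. a l j * phiK q (x j)))"
      by (subst sum.swap) (simp add: sum_distrib_left)
    also have "\<dots> = (\<Sum>l\<in>I. Y (k, i) l * (x l - y l))"
    proof (rule sum.cong[OF refl])
      fix l assume "l \<in> I"
      then have "(\<Sum>j\<in>I. a l j * phiK q (x j)) + y l = x l" by (rule eq[symmetric])
      then have "(\<Sum>j\<in>I. a l j * phiK q (x j)) = x l - y l" by (simp only: eq_diff_eq)
      then show "phiK (inverse q ^ k) (P k i l) * (\<Sum>j\<in>I. a l j * phiK q (x j)) = Y (k, i) l * (x l - y l)"
        by (simp add: Y_def)
    qed
    also have "\<dots> = X (k, i) - L (k, i)" by (simp add: X_def L_def algebra_simps sum_subtractf)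
    finally show ?thesis by simp
  qed
  \<comment> \<open>Exponents from 0 to C are the only nonnegative ones that occur, so finitely many
    coordinates decide linear dependence modulo negative exponents.\<close>
  obtain F where F: "finite F" "F \<subseteq> (UNIV :: nat set) \<times> I"
    and Fs: "\<forall>b\<in>(UNIV :: nat set) \<times> I. \<exists>c. \<forall>z\<in>I\<times>{0..C}. fls_nth (Y b (fst z)) (snd z) = (\<Sum>f\<in>F. c f * fls_nth (Y f (fst z)) (snd z))"
    using finite_spanning_subfamily[of "I\<times>{0..C}" "(UNIV :: nat set) \<times> I" "\<lambda>b z. fls_nth (Y b (fst z)) (snd z)"] I by auto
  obtain c where c: "\<And>b j n. b \<in> (UNIV :: nat set) \<times> I \<Longrightarrow> j \<in> I \<Longrightarrow> 0 \<le> n \<Longrightarrow> n \<le> C \<Longrightarrow> fls_nth (Y b j) n = (\<Sum>f\<in>F. c b f * fls_nth (Y f j) n)"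
  proof -
    obtain c where *: "\<forall>b\<in>(UNIV :: nat set) \<times> I. \<forall>z\<in>I\<times>{0..C}. fls_nth (Y b (fst z)) (snd z) = (\<Sum>f\<in>F. c b f * fls_nth (Y f (fst z)) (snd z))"
      using bchoice[OF Fs] by blast
    show ?thesis
    proof (rule that[of c])
      fix b j n assume "b \<in> (UNIV :: nat set) \<times> I" "j \<in> I" "0 \<le> n" "n \<le> C"
      then show "fls_nth (Y b j) n = (\<Sum>f\<in>F. c b f * fls_nth (Y f j) n)"
        using bspec[OF bspec[OF *, of b], of "(j, n)"] by simp
    qed
  qed
  define R where "R b j = Y b j - (\<Sum>f\<in>F. fls_const (c b f) * Y f j)" for b j
  have Rd: "fls_nth (R b j) n = 0" if b: "snd b \<in> I" and j: "j \<in> I" and n: "n \<ge> 0" for b j n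
  proof (cases "n \<le> C")
    case True
    then show ?thesis using c[of b j n] b j n by (simp add: R_def fls_nth_sum mem_Times_iff)
  next
    case False
    have "fls_nth (Y f j) n = 0" if "snd f \<in> I" for f using that False Pd j by (simp add: Y_def)
    moreover have "snd f \<in> I" if "f \<in> F" for f using that F by auto
    ultimately show ?thesis using b by (simp add: R_def fls_nth_sum)
  qed
  have Xexp: "X b = (\<Sum>f\<in>F. fls_const (c b f) * X f) + (\<Sum>j\<in>I. R b j * x j)" for b
  proof -
    have "X b = (\<Sum>j\<in>I. (\<Sum>f\<in>F. fls_const (c b f) * Y f j) * x j + R b j * x j)"
      by (simp add: X_def R_def algebra_simps)
    also have "\<dots> = (\<Sum>j\<in>I. (\<Sum>f\<in>F. fls_const (c b f) * Y f j) * x j) + (\<Sum>j\<in>I. R b j * x j)"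
      by (rule sum.distrib)
    also have "(\<Sum>j\<in>I. (\<Sum>f\<in>F. fls_const (c b f) * Y f j) * x j) = (\<Sum>f\<in>F. fls_const (c b f) * X f)"
      unfolding X_def sum_distrib_left sum_distrib_right by (subst sum.swap) (simp add: mult.assoc)
    finally show ?thesis .
  qed
  \<comment> \<open>Unknowns of the enlarged system: \<open>Inl\<close> for the chosen combinations,
    \<open>Inr\<close> for the original x, which are the combinations with k = 0. \<open>nx\<close>
    is the index of the \<open>X\<close> on the right-hand side.\<close>
  define nx where "nx z = (case z of Inl b \<Rightarrow> (Suc (fst b), snd b) | Inr i \<Rightarrow> (Suc 0, i))" for z :: "(nat \<times> 'i) + 'i"
  define cur where "cur z = (case z of Inl b \<Rightarrow> b | Inr i \<Rightarrow> (0, i))" for z :: "(nat \<times> 'i) + 'i"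
  define X' where "X' z = X (cur z)" for z
  define A where "A z w = phiK q (case w of Inl f \<Rightarrow> fls_const (c (nx z) f) | Inr j \<Rightarrow> R (nx z) j)" for z w
  have mem: "snd (cur z) \<in> I" "snd (nx z) \<in> I" if "z \<in> F <+> I" for z
    using that F by (auto simp: cur_def nx_def)
  have "laurent_poly (X' (Inr i))"
  proof (rule laurent_fixed_contraction[OF q, of "F <+> I" A "\<lambda>z. L (cur z)"])
    show "finite (F <+> I)" using F I by auto
    show "fls_nth (A z w) n = 0" if "z \<in> F <+> I" "w \<in> F <+> I" "n > 0" for z w n
      using that mem(2)[OF that(1)] Rd[of "nx z" _ n] by (cases w) (auto simp: A_def)
    show "laurent_poly (L (cur z))" if "z \<in> F <+> I" for z
      unfolding L_def using mem[OF that] Yl y by (intro laurent_sum) auto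
    show "conv_fls (X' z)" if "z \<in> F <+> I" for z
      unfolding X'_def X_def using mem[OF that] Yl x
      by (intro coef_ring_sum[OF coef_ring_conv]) (auto simp: conv_fls_laurent)
    show "X' z = (\<Sum>w\<in>F <+> I. A z w * phiK q (X' w)) + L (cur z)" if z: "z \<in> F <+> I" for z
    proof -
      have "X' z = phiK q (X (nx z)) + L (cur z)"
        using Xrec[of "snd (cur z)" "fst (cur z)"] mem[OF z] by (cases z) (auto simp: X'_def cur_def nx_def)
      also have "phiK q (X (nx z)) = (\<Sum>f\<in>F. A z (Inl f) * phiK q (X' (Inl f))) + (\<Sum>j\<in>I. A z (Inr j) * phiK q (X' (Inr j)))"
        using q0 by (subst Xexp) (auto simp: phiK_add phiK_sum phiK_mult A_def X'_def cur_def X0 intro!: sum.cong)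
      also have "\<dots> = (\<Sum>w\<in>F <+> I. A z w * phiK q (X' w))"
        using F(1) I by (simp add: sum.Plus)
      finally show ?thesis .
    qed
    show "Inr i \<in> F <+> I" using i by auto
  qed
  then show ?thesis using i by (simp add: X'_def cur_def X0)
qed

lemma gdata_fixed_laurent:
  assumes q: "0 < norm q" "norm q < 1" and g: "gdata q n s A D"
    and x: "\<And>i. i < n \<Longrightarrow> conv_fls (x i)" and eq: "\<And>i. i < n \<Longrightarrow> x i = (\<Sum>j<n. A $$ (i, j) * phiK q (x j))"
    and i: "i < n"
  shows "laurent_poly (x i)"
proof -
  have q0: "q \<noteq> 0" using q by auto
  have A: "A \<in> carrier_mat n n" "entries_in laurent_poly A" "tri n s A" "gro q n s A" "gro (inverse q) n (\<lambda>i. - s i) (hat A)"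
    using g by (auto simp: gdata_def half_data_def)
  have itc: "it q A k \<in> carrier_mat n n" for k using A by simp
  have ti: "tri n s (it q A k)" for k by (rule tri_it[OF A(1,3)])
  have itl: "laurent_poly (it q A k $$ (i, j))" if "i < n" "j < n" for i j k
    using entries_in_it[OF coef_ring_laurent A(1,2)] itc that by (rule entries_inD)
  have itS: "it q A (Suc k) $$ (i, j) = (\<Sum>l<n. it q A k $$ (i, l) * phiK (q ^ k) (A $$ (l, j)))" if "i < n" "j < n" for i j k
    unfolding it_Suc'[OF q0 A(1)] using that A itc by (subst index_mult_sum[of _ n n _ n]) auto
  have xit: "x i = (\<Sum>j<n. it q A k $$ (i, j) * phiK (q ^ k) (x j))" if i: "i < n" for i k
    using i
  proof (induction k)
    case 0
    have "(\<Sum>j<n. it q A 0 $$ (i, j) * phiK (q ^ 0) (x j)) = (\<Sum>j<n. if j = i then x j else 0)"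
      using 0 A by (intro sum.cong) auto
    then show ?case using 0 by simp
  next
    case (Suc k)
    have "x i = (\<Sum>j<n. it q A k $$ (i, j) * phiK (q ^ k) (x j))" using Suc by blast
    also have "\<dots> = (\<Sum>j<n. it q A k $$ (i, j) * phiK (q ^ k) (\<Sum>l<n. A $$ (j, l) * phiK q (x l)))"
      by (rule sum.cong[OF refl], subst eq) auto
    also have "\<dots> = (\<Sum>j<n. \<Sum>l<n. it q A k $$ (i, j) * phiK (q ^ k) (A $$ (j, l)) * phiK (q ^ Suc k) (x l))"
      using q0 by (simp add: phiK_sum phiK_mult phiK_phiK sum_distrib_left mult.assoc mult.commute[of _ q])
    also have "\<dots> = (\<Sum>l<n. it q A (Suc k) $$ (i, l) * phiK (q ^ Suc k) (x l))"
      using Suc.prems by (subst sum.swap) (simp add: itS sum_distrib_right del: it.simps)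
    finally show ?case .
  qed
  \<comment> \<open>At the highest positive slope where x does not vanish, columns of lower slope
    are zero by triangularity and components of higher slope by choice. Only the diagonal block
    acts, and it raises the valuation without bound.\<close>
  have pos: "x i = 0" if i: "i < n" "s i > 0" for i
  proof (rule ccontr)
    assume nz: "x i \<noteq> 0"
    define T where "T = s ` {j. j < n \<and> s j > 0 \<and> x j \<noteq> 0}"
    have T: "finite T" "T \<noteq> {}" using nz i by (auto simp: T_def)
    obtain p where p: "p < n" "s p > 0" "x p \<noteq> 0" "s p = Max T" using Max_in[OF T] by (auto simp: T_def)
    have mx: "x j = 0" if "j < n" "s j > s p" for j
    proof (rule ccontr)
      assume "x j \<noteq> 0"
      then have "s j \<in> T" using that p(2) unfolding T_def by auto
      then show False using Max_ge[OF T(1), of "s j"] that p(4) by simp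
    qed
    obtain m0 where m0: "\<forall>j\<in>{..<n}. vge (x j) m0" using vge_ex_finite[of "{..<n}" x] by blast
    obtain K where K: "\<And>k i j. i < n \<Longrightarrow> j < n \<Longrightarrow> s i = s j \<Longrightarrow> vge (it q A k $$ (i, j)) (real k * s i - K)"
      using A(4) unfolding gro_def by blast
    have v: "vge (x p) ((real k * s p - K) + m0)" for k
      unfolding xit[OF p(1), of k]
    proof (rule vge_sum)
      fix j assume "j \<in> {..<n}"
      then have j: "j < n" by simp
      consider "s j < s p" | "s j = s p" | "s j > s p" by linarith
      then show "vge (it q A k $$ (p, j) * phiK (q ^ k) (x j)) ((real k * s p - K) + m0)"
      proof cases
        case 1
        then show ?thesis using ti[of k] p j by (simp add: tri_def)
      next
        case 2
        then show ?thesis using K[of p j k] p j m0 q0 by (intro vge_mult) auto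
      next
        case 3
        then show ?thesis using mx j by simp
      qed
    qed
    have "x p = 0"
    proof (rule vge_unbounded)
      fix N :: nat
      obtain k :: nat where "real k > (real N + K - m0) / s p" using reals_Archimedean2 by blast
      then have "real N \<le> (real k * s p - K) + m0" using p(2) by (simp add: pos_divide_less_eq)
      then show "\<exists>y\<ge>real N. vge (x p) y" using v by blast
    qed
    then show False using p by simp
  qed
  show ?thesis using i
  \<comment> \<open>Descending induction on the slope, measured by the number of indices of larger
    slope; the components already treated enter as the inhomogeneous term.\<close>
  proof (induction "card {j. j < n \<and> s j > s i}" arbitrary: i rule: less_induct)
    case less
    show ?case
    proof (cases "s i > 0")
      case True
      then show ?thesis using pos less.prems by simp
    next
      case False
      define I where "I = {j. j < n \<and> s j = s i}"
      have up: "laurent_poly (x j)" if j: "j < n" "s j > s i" for j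
      proof (rule less.hyps)
        show "card {l. l < n \<and> s l > s j} < card {l. l < n \<and> s l > s i}"
          by (rule psubset_card_mono) (use j in auto)
      qed fact
      obtain K where K: "\<And>k i j. i < n \<Longrightarrow> j < n \<Longrightarrow> - s i = - s j \<Longrightarrow> vge (it (inverse q) (hat A) k $$ (i, j)) (real k * - s i - K)"
        using A(5) unfolding gro_def by blast
      \<comment> \<open>For slope at most 0, growth at rate - s at infinity bounds the degrees of
        the iterates by K for every k.\<close>
      define C where "C = \<lceil>K\<rceil>"
      define y where "y j = (\<Sum>l\<in>{l. l < n \<and> s l > s i}. A $$ (j, l) * phiK q (x l))" for j
      have split_sum: "(\<Sum>l<n. f l) = (\<Sum>l\<in>I. f l) + (\<Sum>l\<in>{l. l < n \<and> s l > s i}. f l)"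
        if "\<And>l. l < n \<Longrightarrow> s l < s i \<Longrightarrow> f l = 0" for f :: "nat \<Rightarrow> complex fls"
      proof -
        have "(\<Sum>l<n. f l) = (\<Sum>l\<in>I \<union> {l. l < n \<and> s l > s i}. f l)"
        proof (rule sum.mono_neutral_right)
          show "\<forall>l\<in>{..<n} - (I \<union> {l. l < n \<and> s l > s i}). f l = 0"
          proof
            fix l assume "l \<in> {..<n} - (I \<union> {l. l < n \<and> s l > s i})"
            then have "l < n" "s l < s i" by (auto simp: I_def)
            then show "f l = 0" by (rule that)
          qed
        qed (auto simp: I_def)
        also have "\<dots> = (\<Sum>l\<in>I. f l) + (\<Sum>l\<in>{l. l < n \<and> s l > s i}. f l)"
          by (rule sum.union_disjoint) (auto simp: I_def)
        finally show ?thesis .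
      qed
      show ?thesis
      proof (rule laurent_fixed_bounded[OF q, of I "\<lambda>k i j. it q A k $$ (i, j)" "\<lambda>i j. A $$ (i, j)" C y])
        show "finite I" by (simp add: I_def)
        show "it q A 0 $$ (p, r) = (if p = r then 1 else 0)" if "p \<in> I" "r \<in> I" for p r
          using that A by (auto simp: I_def)
        show "it q A (Suc k) $$ (p, r) = (\<Sum>l\<in>I. it q A k $$ (p, l) * phiK (q ^ k) (A $$ (l, r)))" if pr: "p \<in> I" "r \<in> I" for k p r
        proof -
          have "it q A (Suc k) $$ (p, r) = (\<Sum>l<n. it q A k $$ (p, l) * phiK (q ^ k) (A $$ (l, r)))"
            by (rule itS) (use pr in \<open>auto simp: I_def\<close>)
          also have "\<dots> = (\<Sum>l\<in>I. it q A k $$ (p, l) * phiK (q ^ k) (A $$ (l, r)))"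
          proof (rule sum.mono_neutral_right)
            show "\<forall>l\<in>{..<n} - I. it q A k $$ (p, l) * phiK (q ^ k) (A $$ (l, r)) = 0"
            proof
              fix l assume "l \<in> {..<n} - I"
              then have "l < n" "s l < s p \<or> s r < s l" using pr by (auto simp: I_def)
              then show "it q A k $$ (p, l) * phiK (q ^ k) (A $$ (l, r)) = 0"
                using ti[of k] A(3) pr by (auto simp: tri_def I_def)
            qed
          qed (auto simp: I_def)
          finally show ?thesis .
        qed
        show "laurent_poly (it q A k $$ (p, r))" if "p \<in> I" "r \<in> I" for k p r using itl that by (simp add: I_def)
        show "fls_nth (it q A k $$ (p, r)) m = 0" if pr: "p \<in> I" "r \<in> I" and m: "m > C" for k p r m
        proof -
          have lt: "p < n" "r < n" "s p = s r" "s p = s i" using pr by (auto simp: I_def)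
          have "vge (it (inverse q) (hat A) k $$ (p, r)) (real k * - s p - K)" using K lt by simp
          then have "vge (to_K' (it q A k $$ (p, r))) (real k * - s p - K)"
            unfolding hat_it[OF A(1,2)] using lt itc[of k] by simp
          then have "vge (to_K' (it q A k $$ (p, r))) (- K)"
            using False lt by (elim vge_mono) (auto simp: mult_nonneg_nonpos)
          moreover have "real_of_int (- m) < - K" using m unfolding C_def by linarith
          ultimately have "fls_nth (to_K' (it q A k $$ (p, r))) (- m) = 0" by (rule vge_nth)
          then show ?thesis using itl lt by simp
        qed
        show "laurent_poly (y p)" if "p \<in> I" for p
          unfolding y_def using that up A by (intro laurent_sum) (auto simp: I_def intro!: laurent_poly_mult intro: entries_inD)
        show "conv_fls (x p)" if "p \<in> I" for p using x that by (simp add: I_def)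
        show "x p = (\<Sum>r\<in>I. A $$ (p, r) * phiK q (x r)) + y p" if p: "p \<in> I" for p
        proof -
          have "x p = (\<Sum>r<n. A $$ (p, r) * phiK q (x r))" by (rule eq) (use p in \<open>simp add: I_def\<close>)
          also have "\<dots> = (\<Sum>r\<in>I. A $$ (p, r) * phiK q (x r)) + y p"
            unfolding y_def by (rule split_sum) (use A(3) p in \<open>auto simp: tri_def I_def\<close>)
          finally show ?thesis .
        qed
        show "i \<in> I" using less.prems by (simp add: I_def)
      qed
    qed
  qed
qed

lemma gdata_hom_laurent:
  assumes q: "0 < norm q" "norm q < 1" and g: "gdata q n s A D" "gdata q m t B E"
    and F: "F \<in> carrier_mat m n" "entries_in conv_fls F" "F * A = B * mphi q F"
  shows "entries_in laurent_poly F"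
proof -
  have q0: "q \<noteq> 0" using q by auto
  have c: "A \<in> carrier_mat n n" "D \<in> carrier_mat n n" "A * D\<^sup>T = 1\<^sub>m n" "B \<in> carrier_mat m m"
    using g by (auto simp: gdata_def half_data_def)
  \<comment> \<open>F listed row by row is a horizontal vector of the internal Hom, whose matrix is
    the tensor product of \<open>B\<close> with the contragredient \<open>D\<close> of
    \<open>A\<close>.\<close>
  define x where "x i = F $$ (i div n, i mod n)" for i
  have gk: "gdata q (m * n) (\<lambda>i. t (i div n) + - s (i mod n)) (kron B D) (kron E A)"
    by (rule gdata_kron[OF q0 g(2) gdata_dual[OF g(1)]])
  have "F = F * (A * D\<^sup>T)" using c F by (simp add: right_mult_one_mat[of _ m n])
  also have "\<dots> = (B * mphi q F) * D\<^sup>T" unfolding F(3)[symmetric] using c F(1) by (simp add: assoc_mult_mat[of _ m n _ n _ n])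
  finally have Feq: "F = B * mphi q F * D\<^sup>T" .
  have xeq: "x i = (\<Sum>j<m*n. kron B D $$ (i, j) * phiK q (x j))" if i: "i < m * n" for i
  proof -
    note b = div_mod_bounds[OF i]
    have "(\<Sum>j<m*n. kron B D $$ (i, j) * phiK q (x j)) = (\<Sum>j<m*n. B $$ (i div n, j div n) * D $$ (i mod n, j mod n) * phiK q (F $$ (j div n, j mod n)))"
      using i by (intro sum.cong refl) (simp add: index_kron[OF c(4,2)] x_def)
    also have "\<dots> = (\<Sum>a<m. \<Sum>d<n. B $$ (i div n, a) * D $$ (i mod n, d) * phiK q (F $$ (a, d)))"
      by (rule div_mod_sum)
    also have "\<dots> = (\<Sum>d<n. (\<Sum>a<m. B $$ (i div n, a) * phiK q (F $$ (a, d))) * D $$ (i mod n, d))"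
      by (subst sum.swap) (simp add: sum_distrib_right mult.assoc mult.commute[of "phiK q _"])
    also have "\<dots> = (\<Sum>d<n. (B * mphi q F) $$ (i div n, d) * D\<^sup>T $$ (d, i mod n))"
      using b F c by (intro sum.cong refl) (auto simp: index_mult_sum[OF c(4), of "mphi q F" n] simp del: index_mult_mat)
    also have "\<dots> = (B * mphi q F * D\<^sup>T) $$ (i div n, i mod n)"
      using b c F by (subst index_mult_sum[of _ m n _ n]) auto
    finally show ?thesis using arg_cong[OF Feq, of "\<lambda>M. M $$ (i div n, i mod n)"] by (simp only: x_def)
  qed
  show ?thesis
  proof (rule entries_inI[OF F(1)])
    fix p r assume pr: "p < m" "r < n"
    have lt: "p * n + r < m * n"
    proof -
      have "p * n + r < (p + 1) * n" using pr by simp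
      also have "\<dots> \<le> m * n" using pr by (intro mult_le_mono1) simp
      finally show ?thesis .
    qed
    have "laurent_poly (x (p * n + r))"
    proof (rule gdata_fixed_laurent[OF q gk _ xeq lt])
      show "conv_fls (x i)" if "i < m * n" for i
        using div_mod_bounds[OF that] F by (auto simp: x_def intro: entries_inD)
    qed auto
    then show "laurent_poly (F $$ (p, r))" using pr by (simp add: x_def)
  qed
qed

section \<open>Difference equations modulo Laurent polynomials\<close>

text \<open>Neumann series for x = a phi(x) + y, truncated below order D: there phi contributes a
  factor |q|^D, while the geometric bounds on a and y contribute only a constant. No slope
  hypothesis enters, because the equation is ignored below D.\<close>

lemma truncated_solution:
  fixes a :: "'i \<Rightarrow> 'i \<Rightarrow> complex fls" and N :: nat and D :: int
  assumes q: "0 < norm q" "norm q < 1" and I: "finite I"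
    and a: "\<And>p r n. p \<in> I \<Longrightarrow> r \<in> I \<Longrightarrow> norm (fls_nth (a p r) n) \<le> C * \<rho> powi n"
    and aN: "\<And>p r n. p \<in> I \<Longrightarrow> r \<in> I \<Longrightarrow> n < - int N \<Longrightarrow> fls_nth (a p r) n = 0"
    and C: "C \<ge> 0" "\<rho> > 0" and \<sigma>: "\<sigma> \<ge> 2 * \<rho>"
    and y: "\<And>p n. p \<in> I \<Longrightarrow> norm (fls_nth (y p) n) \<le> Cy * \<sigma> powi n" and Cy: "Cy \<ge> 0"
    and D: "2 * real (card I) * C * (\<sigma> / \<rho>) ^ N * norm q powi D \<le> 1 / 2"
  shows "\<exists>x. \<forall>p\<in>I. conv_fls (x p) \<and> (\<forall>n<D. fls_nth (x p) n = 0) \<and>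
    (\<forall>n\<ge>D. fls_nth (x p - (\<Sum>r\<in>I. a p r * phiK q (x r)) - y p) n = 0)"
proof -
  have q0: "q \<noteq> 0" using q by auto
  have \<sigma>0: "\<sigma> > 0" using C \<sigma> by simp
  \<comment> \<open>One application of a phi, keeping only exponents from D on; j runs up to m + N
    because a has no exponents below - N.\<close>
  define T :: "('i \<Rightarrow> int \<Rightarrow> complex) \<Rightarrow> 'i \<Rightarrow> int \<Rightarrow> complex" where
    "T u p m = (if m < D then 0 else \<Sum>r\<in>I. \<Sum>j=D..m+int N. fls_nth (a p r) (m - j) * (q powi j * u r j))" for u p m
  define u0 where "u0 p m = (if m < D then 0 else fls_nth (y p) m)" for p m
  define u where "u l = (T ^^ l) u0" for l
  have uS: "u (Suc l) = T (u l)" for l by (simp add: u_def)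
  have ub: "norm (u l p m) \<le> Cy * \<sigma> powi m * (1/2) ^ l" if "p \<in> I" for l p m
    using that
  proof (induction l arbitrary: p m)
    case 0
    then show ?case using y[OF 0] Cy \<sigma>0 by (auto simp: u_def u0_def)
  next
    case (Suc l)
    show ?case
    proof (cases "m < D")
      case True
      then show ?thesis using Cy \<sigma>0 by (simp add: uS T_def)
    next
      case False
      \<comment> \<open>Powers of the ratio between the growth of a and that allowed for the
        solution. The ratio is at most 1/2, so the sum over j is at most 2, up to the factor
        (\<sigma> / \<rho>)^N caused by the N possible negative exponents of a.\<close>
      define g where "g j = (\<rho> / \<sigma>) powi (m - j)" for j
      have "norm (u (Suc l) p m) = norm (\<Sum>r\<in>I. \<Sum>j=D..m+int N. fls_nth (a p r) (m - j) * (q powi j * u l r j))"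
        using False by (simp add: uS T_def)
      also have "\<dots> \<le> (\<Sum>r\<in>I. \<Sum>j=D..m+int N. norm (fls_nth (a p r) (m - j) * (q powi j * u l r j)))"
        by (intro order_trans[OF norm_sum] sum_mono norm_sum)
      also have "\<dots> \<le> (\<Sum>r\<in>I. \<Sum>j=D..m+int N. C * norm q powi D * Cy * \<sigma> powi m * (1/2) ^ l * g j)"
      proof (intro sum_mono)
        fix r j assume rj: "r \<in> I" "j \<in> {D..m + int N}"
        have 1: "norm (fls_nth (a p r) (m - j)) \<le> C * \<rho> powi (m - j)" using a Suc.prems rj by simp
        have 2: "norm q powi j \<le> norm q powi D" using q rj by (intro power_int_decreasing) auto
        have 3: "norm (u l r j) \<le> Cy * \<sigma> powi j * (1/2) ^ l" using Suc.IH rj by simp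
        have "norm (fls_nth (a p r) (m - j) * (q powi j * u l r j)) \<le> (C * \<rho> powi (m - j)) * (norm q powi D * (Cy * \<sigma> powi j * (1/2) ^ l))"
          unfolding norm_mult norm_power_int using C q Cy \<sigma>0
          by (intro mult_mono 1 2 3) auto
        also have "\<sigma> powi j = \<sigma> powi m * (1 / \<sigma>) powi (m - j)"
          using \<sigma>0 by (simp add: power_int_diff power_int_divide_distrib)
        then have "(C * \<rho> powi (m - j)) * (norm q powi D * (Cy * \<sigma> powi j * (1/2) ^ l)) = C * norm q powi D * Cy * \<sigma> powi m * (1/2) ^ l * g j"
          by (simp add: g_def power_int_divide_distrib)
        finally show "norm (fls_nth (a p r) (m - j) * (q powi j * u l r j)) \<le> C * norm q powi D * Cy * \<sigma> powi m * (1/2) ^ l * g j" .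
      qed
      also have "\<dots> = real (card I) * (C * norm q powi D * Cy * \<sigma> powi m * (1/2) ^ l * (\<Sum>j=D..m+int N. g j))"
        by (simp add: sum_distrib_left)
      also have "\<dots> \<le> real (card I) * (C * norm q powi D * Cy * \<sigma> powi m * (1/2) ^ l * (2 * (\<sigma> / \<rho>) ^ N))"
      proof (intro mult_left_mono)
        have "(\<Sum>j=D..m+int N. g j) = (\<Sum>i<nat (m + int N - D + 1). (\<rho> / \<sigma>) powi (int i - int N))"
          unfolding g_def by (rule sum.reindex_bij_witness[of _ "\<lambda>i. m + int N - int i" "\<lambda>j. nat (m + int N - j)"]) auto
        also have "\<dots> = (\<sigma> / \<rho>) ^ N * (\<Sum>i<nat (m + int N - D + 1). (\<rho> / \<sigma>) ^ i)"
          using C \<sigma>0 by (simp add: sum_distrib_left power_int_diff power_divide field_simps)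
        also have "(\<Sum>i<nat (m + int N - D + 1). (\<rho> / \<sigma>) ^ i) \<le> (\<Sum>i<nat (m + int N - D + 1). (1 / 2) ^ i)"
          using C \<sigma> \<sigma>0 by (intro sum_mono power_mono) (auto simp: field_simps)
        also have "\<dots> \<le> (\<Sum>i. (1/2::real) ^ i)"
          by (intro sum_le_suminf summable_geometric) auto
        also have "\<dots> = 2" by (subst suminf_geometric) auto
        finally show "(\<Sum>j=D..m+int N. g j) \<le> 2 * (\<sigma> / \<rho>) ^ N" using C \<sigma>0 by (simp add: mult.commute)
      qed (use C q Cy \<sigma>0 in auto)
      also have "\<dots> = (Cy * \<sigma> powi m * (1/2) ^ l) * (2 * real (card I) * C * (\<sigma> / \<rho>) ^ N * norm q powi D)"
        by (simp add: algebra_simps)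
      also have "\<dots> \<le> (Cy * \<sigma> powi m * (1/2) ^ l) * (1 / 2)"
        using D Cy \<sigma>0 by (intro mult_left_mono) auto
      finally show ?thesis by simp
    qed
  qed
  have summ: "summable (\<lambda>l. u l p m)" if "p \<in> I" for p m
  proof (rule summable_comparison_test)
    show "\<exists>N. \<forall>l\<ge>N. norm (u l p m) \<le> Cy * \<sigma> powi m * (1/2) ^ l" using ub[OF that] by blast
    show "summable (\<lambda>l. Cy * \<sigma> powi m * (1/2) ^ l)" by (intro summable_mult summable_geometric) auto
  qed
  define X where "X p m = (\<Sum>l. u l p m)" for p m
  have Xb: "norm (X p m) \<le> (2 * Cy) * \<sigma> powi m" if "p \<in> I" for p m
  proof -
    have "norm (X p m) \<le> (\<Sum>l. Cy * \<sigma> powi m * (1/2) ^ l)"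
      unfolding X_def by (rule norm_suminf_le) (use ub[OF that] in \<open>auto intro!: summable_mult summable_geometric\<close>)
    also have "\<dots> = Cy * \<sigma> powi m * (\<Sum>l. (1/2) ^ l)" by (rule suminf_mult) (auto intro!: summable_geometric)
    also have "(\<Sum>l. (1/2::real) ^ l) = 2" by (subst suminf_geometric) auto
    finally show ?thesis by (simp add: mult_ac)
  qed
  have ulow: "u l p m = 0" if "m < D" for l p m
    using that by (cases l) (auto simp: uS T_def, simp add: u_def u0_def)
  have Xlow: "X p m = 0" if "m < D" for p m by (simp add: X_def ulow[OF that])
  define x where "x p = Abs_fls (X p)" for p
  have x: "fls_nth (x p) m = X p m" for p m
    unfolding x_def using Xlow by (intro nth_Abs_fls_lower_bound) auto
  have "conv_fls (x p) \<and> (\<forall>n<D. fls_nth (x p) n = 0) \<and>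
    (\<forall>n\<ge>D. fls_nth (x p - (\<Sum>r\<in>I. a p r * phiK q (x r)) - y p) n = 0)" if p: "p \<in> I" for p
  proof (intro conjI allI impI)
    show "conv_fls (x p)" by (rule conv_boundI[OF \<sigma>0, of "2 * Cy"]) (use Xb[OF p] Cy x in auto)
    show "fls_nth (x p) n = 0" if "n < D" for n using Xlow that x by simp
    fix n assume n: "D \<le> n"
    have "X p n = u 0 p n + (\<Sum>l. u (Suc l) p n)"
      unfolding X_def using suminf_split_head[OF summ[OF p]] by simp
    also have "(\<Sum>l. u (Suc l) p n) = (\<Sum>l. \<Sum>r\<in>I. \<Sum>j=D..n+int N. fls_nth (a p r) (n - j) * (q powi j * u l r j))"
      using n by (simp add: uS T_def)
    also have "\<dots> = (\<Sum>r\<in>I. \<Sum>j=D..n+int N. \<Sum>l. fls_nth (a p r) (n - j) * (q powi j * u l r j))"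
    proof -
      have s1: "summable (\<lambda>l. fls_nth (a p r) (n - j) * (q powi j * u l r j))" if "r \<in> I" for r j
        by (intro summable_mult summ that)
      have "(\<Sum>l. \<Sum>r\<in>I. \<Sum>j=D..n+int N. fls_nth (a p r) (n - j) * (q powi j * u l r j)) =
        (\<Sum>r\<in>I. \<Sum>l. \<Sum>j=D..n+int N. fls_nth (a p r) (n - j) * (q powi j * u l r j))"
        by (rule suminf_sum) (intro summable_sum s1)
      also have "\<dots> = (\<Sum>r\<in>I. \<Sum>j=D..n+int N. \<Sum>l. fls_nth (a p r) (n - j) * (q powi j * u l r j))"
        by (intro sum.cong refl suminf_sum s1)
      finally show ?thesis .
    qed
    also have "\<dots> = (\<Sum>r\<in>I. \<Sum>j=D..n+int N. fls_nth (a p r) (n - j) * (q powi j * X r j))"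
      using summ unfolding X_def by (intro sum.cong refl) (simp add: suminf_mult summable_mult)
    also have "\<dots> = (\<Sum>r\<in>I. fls_nth (a p r * phiK q (x r)) n)"
    proof (rule sum.cong[OF refl])
      fix r assume r: "r \<in> I"
      have "fls_nth (a p r * phiK q (x r)) n = (\<Sum>i=- int N..n-D. fls_nth (a p r) i * fls_nth (phiK q (x r)) (n - i))"
        by (rule fls_times_nth_bounds) (use aN p r x Xlow in auto)
      also have "\<dots> = (\<Sum>j=D..n+int N. fls_nth (a p r) (n - j) * fls_nth (phiK q (x r)) j)"
        by (rule sum.reindex_bij_witness[of _ "\<lambda>j. n - j" "\<lambda>i. n - i"]) auto
      finally show "(\<Sum>j=D..n+int N. fls_nth (a p r) (n - j) * (q powi j * X r j)) = fls_nth (a p r * phiK q (x r)) n"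
        by (simp add: x)
    qed
    finally have "X p n = fls_nth (y p) n + (\<Sum>r\<in>I. fls_nth (a p r * phiK q (x r)) n)" using n by (simp add: u_def u0_def)
    then show "fls_nth (x p - (\<Sum>r\<in>I. a p r * phiK q (x r)) - y p) n = 0" by (simp add: x fls_nth_sum)
  qed
  then show ?thesis by blast
qed

text \<open>What the truncated solution leaves over has exponents below D only, hence is a Laurent
  polynomial. D can be chosen after all constants of a and y are fixed.\<close>

lemma solve_mod_laurent:
  fixes a :: "'i \<Rightarrow> 'i \<Rightarrow> complex fls"
  assumes q: "0 < norm q" "norm q < 1" and I: "finite I"
    and a: "\<And>p r. p \<in> I \<Longrightarrow> r \<in> I \<Longrightarrow> conv_fls (a p r)" and y: "\<And>p. p \<in> I \<Longrightarrow> conv_fls (y p)"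
  shows "\<exists>x. \<forall>p\<in>I. conv_fls (x p) \<and> laurent_poly (x p - (\<Sum>r\<in>I. a p r * phiK q (x r)) - y p)"
proof -
  obtain \<rho> C where \<rho>: "\<rho> \<ge> 1" "C \<ge> 0" "\<And>p r n. p \<in> I \<Longrightarrow> r \<in> I \<Longrightarrow> norm (fls_nth (a p r) n) \<le> C * \<rho> powi n"
  proof -
    have "finite (I \<times> I)" using I by simp
    from conv_bound_finite[OF this, of "\<lambda>z. a (fst z) (snd z)"] a
    obtain r0 where "r0 \<ge> 1" "\<forall>r\<ge>r0. \<exists>C\<ge>0. \<forall>i\<in>I\<times>I. \<forall>n. norm (fls_nth (a (fst i) (snd i)) n) \<le> C * r powi n" by auto
    then show ?thesis using that by (metis SigmaI fst_conv order_refl snd_conv)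
  qed
  obtain s0 where s0: "s0 \<ge> 1" "\<forall>s\<ge>s0. \<exists>C\<ge>0. \<forall>p\<in>I. \<forall>n. norm (fls_nth (y p) n) \<le> C * s powi n"
    using conv_bound_finite[OF I, of y] y by auto
  define \<sigma> where "\<sigma> = max s0 (2 * \<rho>)"
  obtain Cy where Cy: "Cy \<ge> 0" "\<And>p n. p \<in> I \<Longrightarrow> norm (fls_nth (y p) n) \<le> Cy * \<sigma> powi n"
    using s0(2)[rule_format, of \<sigma>] by (auto simp: \<sigma>_def)
  obtain v where v: "\<forall>z\<in>I\<times>I. vge (a (fst z) (snd z)) v"
    using vge_ex_finite[of "I\<times>I" "\<lambda>z. a (fst z) (snd z)"] I by blast
  define N where "N = nat (- \<lfloor>v\<rfloor>)"
  have aN: "fls_nth (a p r) n = 0" if "p \<in> I" "r \<in> I" "n < - int N" for p r n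
  proof (rule vge_nth)
    show "vge (a p r) v" using v that by auto
    have "n < \<lfloor>v\<rfloor>" using that unfolding N_def by linarith
    then show "real_of_int n < v" by linarith
  qed
  have "(\<lambda>n. 2 * real (card I) * C * (\<sigma> / \<rho>) ^ N * norm q ^ n) \<longlonglongrightarrow> 2 * real (card I) * C * (\<sigma> / \<rho>) ^ N * 0"
    using q by (intro tendsto_intros LIMSEQ_realpow_zero) auto
  then have "eventually (\<lambda>n. 2 * real (card I) * C * (\<sigma> / \<rho>) ^ N * norm q ^ n < 1/2) sequentially"
    by (intro order_tendstoD(2)[of _ 0]) auto
  then obtain D :: nat where D: "2 * real (card I) * C * (\<sigma> / \<rho>) ^ N * norm q ^ D < 1/2" by (auto simp: eventually_sequentially)
  have D': "2 * real (card I) * C * (\<sigma> / \<rho>) ^ N * norm q powi (int D) \<le> 1 / 2" using D by simp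
  have "\<exists>x. \<forall>p\<in>I. conv_fls (x p) \<and> (\<forall>n<int D. fls_nth (x p) n = 0) \<and>
    (\<forall>n\<ge>int D. fls_nth (x p - (\<Sum>r\<in>I. a p r * phiK q (x r)) - y p) n = 0)"
    by (rule truncated_solution[OF q I \<rho>(3) aN \<rho>(2) _ _ Cy(2,1) D']) (use \<rho>(1) in \<open>auto simp: \<sigma>_def\<close>)
  then obtain x where x: "\<forall>p\<in>I. conv_fls (x p) \<and> (\<forall>n<int D. fls_nth (x p) n = 0) \<and>
    (\<forall>n\<ge>int D. fls_nth (x p - (\<Sum>r\<in>I. a p r * phiK q (x r)) - y p) n = 0)" by blast
  have "laurent_poly (x p - (\<Sum>r\<in>I. a p r * phiK q (x r)) - y p)" if "p \<in> I" for p
    unfolding laurent_poly_iff by (rule exI[of _ "int D"]) (use x that in auto)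
  then show ?thesis using x by blast
qed

section \<open>A vector of least slope\<close>

text \<open>A Schur form with zero diagonal; each further factor pushes the nonzero entries up by
  one diagonal.\<close>

lemma nilpotent_if_no_eigenvalue:
  fixes A :: "complex mat"
  assumes A: "A \<in> carrier_mat n n" and ev: "\<And>k. eigenvalue A k \<Longrightarrow> k = 0"
  shows "A ^\<^sub>m n = 0\<^sub>m n n"
proof -
  obtain as where as: "char_poly A = (\<Prod>a\<leftarrow>as. [:- a, 1:])" using char_poly_factorized[OF A] by blast
  obtain B where B: "B \<in> carrier_mat n n" "upper_triangular B" "similar_mat A B"
    using schur_decomposition_exists[OF A as] by blast
  have diag: "B $$ (i, i) = 0" if i: "i < n" for i
  proof -
    have "poly (char_poly B) (B $$ (i, i)) = 0"
      unfolding char_poly_upper_triangular[OF B(1,2)] poly_prod_list prod_list_zero_iff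
      using i B(1) by (auto simp: diag_mat_def image_iff intro!: bexI[of _ i])
    then have "eigenvalue A (B $$ (i, i))"
      unfolding eigenvalue_root_char_poly[OF A] char_poly_similar[OF B(3)] .
    then show ?thesis by (rule ev)
  qed
  have pw: "(B ^\<^sub>m k) $$ (i, j) = 0" if "i < n" "j < n" "j < i + k" for i j k
    using that
  proof (induction k arbitrary: j)
    case 0
    then show ?case using B(1) by auto
  next
    case (Suc k)
    have c: "B ^\<^sub>m k \<in> carrier_mat n n" using B(1) by (rule pow_carrier_mat)
    have "(B ^\<^sub>m Suc k) $$ (i, j) = (\<Sum>l<n. (B ^\<^sub>m k) $$ (i, l) * B $$ (l, j))"
      using Suc.prems B(1) c by (auto simp: scalar_prod_def atLeast0LessThan intro!: sum.cong)
    also have "\<dots> = 0"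
    proof (rule sum.neutral, rule ballI)
      fix l assume "l \<in> {..<n}"
      then show "(B ^\<^sub>m k) $$ (i, l) * B $$ (l, j) = 0"
        using Suc.IH[of l] Suc.prems diag[of j] upper_triangularD[OF B(2), of j l] B(1)
        by (cases "l < i + k"; cases "l = j") auto
    qed
    finally show ?case .
  qed
  have "B ^\<^sub>m n = 0\<^sub>m n n"
    by (rule eq_matI) (use pw B(1) pow_carrier_mat[OF B(1), of n] in auto)
  moreover obtain P Q where PQ: "similar_mat_wit A B P Q" using B(3) unfolding similar_mat_def by blast
  moreover have "P \<in> carrier_mat n n" "Q \<in> carrier_mat n n" using similar_mat_witD2[OF A PQ] by auto
  ultimately show ?thesis using similar_mat_wit_pow_id[OF PQ, of n] by simp
qed

lemma solve_linear_complex: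
  fixes M :: "complex mat"
  assumes M: "M \<in> carrier_mat n n" and inj: "\<And>v. v \<in> carrier_vec n \<Longrightarrow> M *\<^sub>v v = 0\<^sub>v n \<Longrightarrow> v = 0\<^sub>v n"
  shows "\<exists>u. \<forall>i<n. (\<Sum>j<n. M $$ (i, j) * u j) = b i"
proof -
  have d: "det M \<noteq> 0" using det_0_iff_vec_prod_zero[OF M] inj by auto
  have adj: "adj_mat M \<in> carrier_mat n n" "M * adj_mat M = det M \<cdot>\<^sub>m 1\<^sub>m n" using adj_mat[OF M] by auto
  define u where "u j = (\<Sum>l<n. adj_mat M $$ (j, l) * b l) / det M" for j
  have "(\<Sum>j<n. M $$ (i, j) * u j) = b i" if i: "i < n" for i
  proof -
    have MA: "(\<Sum>j<n. M $$ (i, j) * adj_mat M $$ (j, l)) = (if i = l then det M else 0)" if l: "l < n" for l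
    proof -
      have "(\<Sum>j<n. M $$ (i, j) * adj_mat M $$ (j, l)) = (M * adj_mat M) $$ (i, l)"
        using M adj(1) i l by (auto simp: scalar_prod_def atLeast0LessThan intro!: sum.cong)
      then show ?thesis using adj(2) i l by simp
    qed
    have "(\<Sum>j<n. M $$ (i, j) * u j) = (\<Sum>l<n. (\<Sum>j<n. M $$ (i, j) * adj_mat M $$ (j, l)) * b l) / det M"
      unfolding u_def sum_distrib_right sum_divide_distrib sum_distrib_left by (subst sum.swap) (simp add: sum_divide_distrib sum_distrib_left mult.assoc)
    also have "\<dots> = (\<Sum>l<n. (if i = l then det M else 0) * b l) / det M" using MA by simp
    also have "\<dots> = b i" using d i by (simp add: if_distrib[of "\<lambda>x. x * _"] cong: if_cong)
    finally show ?thesis .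
  qed
  then show ?thesis by blast
qed

text \<open>The coefficient of order m of e has to satisfy (q^m B0 - c) e_m = known terms, solvable
  because c / q^m exceeds every eigenvalue of \<open>B0\<close> in modulus. Convergence is not
  estimated along this recursion: a polynomial solution to sufficiently high order is corrected by
  the truncated Neumann series.\<close>

lemma adams_eigenvector:
  fixes B :: "complex fls mat"
  assumes q: "0 < norm q" "norm q < 1" and B: "B \<in> carrier_mat n n" "entries_in conv_fls B"
    and int: "\<And>i j k. i < n \<Longrightarrow> j < n \<Longrightarrow> k < 0 \<Longrightarrow> fls_nth (B $$ (i, j)) k = 0"
    and B0: "B0 = map_mat (\<lambda>f. fls_nth f 0) B" and c: "eigenvalue B0 c" "c \<noteq> 0" "\<And>k. eigenvalue B0 k \<Longrightarrow> norm k \<le> norm c"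
  shows "\<exists>e. (\<forall>i<n. conv_fls (e i)) \<and> (\<exists>i<n. e i \<noteq> 0) \<and> (\<forall>i<n. (\<Sum>j<n. B $$ (i, j) * phiK q (e j)) = fls_const c * e i)"
proof -
  have q0: "q \<noteq> 0" using q by auto
  have B0c: "B0 \<in> carrier_mat n n" using B B0 by simp
  obtain v where v: "v \<in> carrier_vec n" "v \<noteq> 0\<^sub>v n" "B0 *\<^sub>v v = c \<cdot>\<^sub>v v"
    using c(1) B0c unfolding eigenvalue_def eigenvector_def by auto
  have B0v: "(\<Sum>j<n. fls_nth (B $$ (i, j)) 0 * v $ j) = c * v $ i" if i: "i < n" for i
  proof -
    have "(B0 *\<^sub>v v) $ i = (\<Sum>j<n. fls_nth (B $$ (i, j)) 0 * v $ j)"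
      using i v(1) B by (auto simp: B0 scalar_prod_def atLeast0LessThan intro!: sum.cong)
    then show ?thesis using v i by simp
  qed
  obtain i0 where i0: "i0 < n" "v $ i0 \<noteq> 0" using v(1,2) by (metis carrier_vecD eq_vecI index_zero_vec)
  define res where "res e i = (\<Sum>j<n. B $$ (i, j) * phiK q (e j)) - fls_const c * e i" for e i
  have stp: "\<exists>u. \<forall>i<n. (\<Sum>j<n. fls_nth (B $$ (i, j)) 0 * (q ^ D * u j)) - c * u i = b i" if D: "D > 0" for D b
  proof -
    define M where "M = mat n n (\<lambda>(i, j). q ^ D * fls_nth (B $$ (i, j)) 0 - (if i = j then c else 0))"
    have Mc: "M \<in> carrier_mat n n" by (simp add: M_def)
    have Mx: "(\<Sum>j<n. M $$ (i, j) * w j) = (\<Sum>j<n. fls_nth (B $$ (i, j)) 0 * (q ^ D * w j)) - c * w i" if "i < n" for i w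
    proof -
      have "(\<Sum>j<n. M $$ (i, j) * w j) = (\<Sum>j<n. fls_nth (B $$ (i, j)) 0 * (q ^ D * w j) - (if i = j then c * w j else 0))"
        using that by (intro sum.cong) (auto simp: M_def algebra_simps)
      then show ?thesis using that by (simp add: sum_subtractf)
    qed
    have "\<exists>u. \<forall>i<n. (\<Sum>j<n. M $$ (i, j) * u j) = b i"
    proof (rule solve_linear_complex[OF Mc])
      fix w :: "complex Matrix.vec" assume w: "w \<in> carrier_vec n" "M *\<^sub>v w = 0\<^sub>v n"
      show "w = 0\<^sub>v n"
      proof (rule ccontr)
        assume nz: "w \<noteq> 0\<^sub>v n"
        have "(\<Sum>j<n. M $$ (i, j) * w $ j) = 0" if "i < n" for i
        proof -
          have "(\<Sum>j<n. M $$ (i, j) * w $ j) = (M *\<^sub>v w) $ i"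
            using that w(1) Mc by (auto simp: scalar_prod_def atLeast0LessThan intro!: sum.cong)
          also have "\<dots> = 0" unfolding w(2) using that by simp
          finally show ?thesis .
        qed
        then have *: "(\<Sum>j<n. fls_nth (B $$ (i, j)) 0 * (q ^ D * w $ j)) = c * w $ i" if "i < n" for i
          using Mx[OF that, of "\<lambda>j. w $ j"] that by simp
        have "B0 *\<^sub>v w = (c / q ^ D) \<cdot>\<^sub>v w"
        proof (rule eq_vecI)
          fix i assume "i < dim_vec ((c / q ^ D) \<cdot>\<^sub>v w)"
          then have i: "i < n" using w by simp
          have "(B0 *\<^sub>v w) $ i = (\<Sum>j<n. fls_nth (B $$ (i, j)) 0 * w $ j)"
            using i w(1) B by (auto simp: B0 scalar_prod_def atLeast0LessThan intro!: sum.cong)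
          also have "\<dots> = (\<Sum>j<n. fls_nth (B $$ (i, j)) 0 * (q ^ D * w $ j)) / q ^ D"
            unfolding sum_divide_distrib using q0 by (intro sum.cong) auto
          finally show "(B0 *\<^sub>v w) $ i = ((c / q ^ D) \<cdot>\<^sub>v w) $ i" using *[OF i] i w by simp
        qed (use w B0c in auto)
        then have "eigenvalue B0 (c / q ^ D)"
          unfolding eigenvalue_def eigenvector_def using w(1) nz B0c by auto
        then have "norm (c / q ^ D) \<le> norm c" by (rule c(3))
        then have "norm c \<le> norm c * norm q ^ D" using q by (simp add: norm_divide norm_power field_simps)
        moreover have "norm q ^ D < 1" using q D by (simp add: power_less_one_iff)
        ultimately show False using c(2) by (simp add: mult_le_cancel_left1)
      qed
    qed
    then show ?thesis using Mx by auto
  qed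
  have poly: "\<exists>e. (\<forall>i<n. laurent_poly (e i) \<and> (\<forall>k<0. fls_nth (e i) k = 0) \<and> fls_nth (e i) 0 = v $ i) \<and>
     (\<forall>i<n. \<forall>k\<le>int D. fls_nth (res e i) k = 0)" for D :: nat
  proof (induction D)
    case 0
    define e where "e i = fls_const (v $ i)" for i
    have "fls_nth (res e i) k = 0" if "i < n" "k \<le> 0" for i k
    proof -
      have "fls_nth (B $$ (i, j) * fls_const (v $ j)) k = fls_nth (B $$ (i, j)) k * v $ j" for j
        by simp
      then have "fls_nth (res e i) k = (\<Sum>j<n. fls_nth (B $$ (i, j)) k * v $ j) - c * (if k = 0 then v $ i else 0)"
        by (simp add: res_def e_def fls_nth_sum)
      then show ?thesis using that B0v[of i] int by (cases "k = 0") auto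
    qed
    moreover have "laurent_poly (e i)" "k < 0 \<Longrightarrow> fls_nth (e i) k = 0" "fls_nth (e i) 0 = v $ i" for i k
      by (simp_all add: e_def)
    ultimately show ?case by (intro exI[of _ e]) simp
  next
    case (Suc D)
    then obtain e where e: "\<And>i. i < n \<Longrightarrow> laurent_poly (e i)" "\<And>i k. i < n \<Longrightarrow> k < 0 \<Longrightarrow> fls_nth (e i) k = 0" "\<And>i. i < n \<Longrightarrow> fls_nth (e i) 0 = v $ i"
      "\<And>i k. i < n \<Longrightarrow> k \<le> int D \<Longrightarrow> fls_nth (res e i) k = 0" by blast
    obtain u where u: "\<And>i. i < n \<Longrightarrow> (\<Sum>j<n. fls_nth (B $$ (i, j)) 0 * (q ^ Suc D * u j)) - c * u i = - fls_nth (res e i) (int (Suc D))"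
      using stp[of "Suc D" "\<lambda>i. - fls_nth (res e i) (int (Suc D))"] by auto
    define m where "m i = fls_const (u i) * fls_X_intpow (int (Suc D))" for i
    define e' where "e' i = e i + m i" for i
    have nm: "fls_nth (f * m i) k = fls_nth f (k - int (Suc D)) * u i" for f i k
    proof -
      have "f * m i = (f * fls_const (u i)) * fls_X_intpow (int (Suc D))" by (simp only: m_def mult.assoc)
      also have "\<dots> = fls_shift (- int (Suc D)) (f * fls_const (u i))" by (rule fls_X_intpow_times_conv_shift(2))
      finally have "fls_nth (f * m i) k = fls_nth (f * fls_const (u i)) (k - int (Suc D))"
        by (simp only: fls_shift_nth diff_conv_add_uminus)
      then show ?thesis by simp
    qed
    have mk: "fls_nth (m i) k = (if k = int (Suc D) then u i else 0)" for i k using nm[of 1 i k] by simp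
    have pm: "phiK q (m i) = fls_const (q ^ Suc D) * m i" for i
      by (rule fls_eqI) (simp add: mk del: of_nat_Suc power_Suc)
    have r': "fls_nth (res e' i) k = fls_nth (res e i) k + ((\<Sum>j<n. fls_nth (B $$ (i, j)) (k - int (Suc D)) * (q ^ Suc D * u j)) - (if k = int (Suc D) then c * u i else 0))" for i k
    proof -
      have "res e' i = res e i + ((\<Sum>j<n. (B $$ (i, j) * fls_const (q ^ Suc D)) * m j) - fls_const c * m i)"
        by (simp add: res_def e'_def phiK_add pm algebra_simps sum.distrib)
      moreover have "fls_nth ((B $$ (i, j) * fls_const (q ^ Suc D)) * m j) k = fls_nth (B $$ (i, j)) (k - int (Suc D)) * (q ^ Suc D * u j)" for j
        unfolding nm by simp
      moreover have "fls_nth (fls_const c * m i) k = (if k = int (Suc D) then c * u i else 0)" unfolding nm by simp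
      ultimately show ?thesis by (simp add: fls_nth_sum)
    qed
    have "fls_nth (res e' i) k = 0" if i: "i < n" and k: "k \<le> int (Suc D)" for i k
    proof (cases "k = int (Suc D)")
      case True
      then show ?thesis using r'[of i k] u[OF i] by simp
    next
      case False
      then show ?thesis using r'[of i k] e(4)[OF i, of k] k int[OF i] by simp
    qed
    moreover have "laurent_poly (e' i)" "\<forall>k<0. fls_nth (e' i) k = 0" "fls_nth (e' i) 0 = v $ i" if "i < n" for i
    proof -
      show "laurent_poly (e' i)" unfolding e'_def m_def
        by (intro laurent_poly_add e(1) that laurent_poly_mult laurent_poly_const laurent_poly_X)
      show "\<forall>k<0. fls_nth (e' i) k = 0" "fls_nth (e' i) 0 = v $ i" using e(2,3)[OF that] mk by (auto simp: e'_def)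
    qed
    ultimately show ?case by (intro exI[of _ e']) auto
  qed
  define a where "a i j = fls_const (1 / c) * B $$ (i, j)" for i j
  have ac: "conv_fls (a i j)" if "i < n" "j < n" for i j using that B by (auto simp: a_def intro!: conv_fls_mult intro: entries_inD)
  obtain \<rho> C where \<rho>: "\<rho> \<ge> 1" "C \<ge> 0" "\<And>p r k. p \<in> {..<n} \<Longrightarrow> r \<in> {..<n} \<Longrightarrow> norm (fls_nth (a p r) k) \<le> C * \<rho> powi k"
  proof -
    have "finite ({..<n} \<times> {..<n})" by simp
    from conv_bound_finite[OF this, of "\<lambda>z. a (fst z) (snd z)"] ac
    obtain r0 where "r0 \<ge> 1" "\<forall>r\<ge>r0. \<exists>C\<ge>0. \<forall>i\<in>{..<n} \<times> {..<n}. \<forall>k. norm (fls_nth (a (fst i) (snd i)) k) \<le> C * r powi k" by auto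
    then show ?thesis using that by (metis SigmaI fst_conv order_refl snd_conv)
  qed
  have "(\<lambda>k. 2 * real n * C * norm q ^ k) \<longlonglongrightarrow> 2 * real n * C * 0"
    using q by (intro tendsto_intros LIMSEQ_realpow_zero) auto
  then have "eventually (\<lambda>k. 2 * real n * C * norm q ^ k < 1/2) sequentially"
    by (intro order_tendstoD(2)[of _ 0]) auto
  then obtain D0 :: nat where D0: "2 * real n * C * norm q ^ D0 < 1/2" by (auto simp: eventually_sequentially)
  \<comment> \<open>At least 1, so that the correction leaves the constant term v, and with it the
    nonvanishing of e, untouched. Since B has no negative exponents, N = 0, and D can be fixed
    before e and \<open>\<sigma>\<close>.\<close>
  define D where "D = Suc D0"
  have CD: "C * norm q ^ D \<le> C * norm q ^ D0" unfolding D_def using q \<rho> by (intro mult_left_mono power_decreasing) auto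
  have "2 * real n * (C * norm q ^ D) \<le> 2 * real n * (C * norm q ^ D0)" by (rule mult_left_mono[OF CD]) simp
  then have D: "2 * real (card {..<n}) * C * (\<sigma> / \<rho>) ^ 0 * norm q powi (int D) \<le> 1 / 2" for \<sigma> using D0 by (simp add: mult.assoc)
  obtain e where e: "\<And>i. i < n \<Longrightarrow> laurent_poly (e i)" "\<And>i k. i < n \<Longrightarrow> k < 0 \<Longrightarrow> fls_nth (e i) k = 0" "\<And>i. i < n \<Longrightarrow> fls_nth (e i) 0 = v $ i"
    "\<And>i k. i < n \<Longrightarrow> k \<le> int D \<Longrightarrow> fls_nth (res e i) k = 0" using poly[of D] by blast
  define y where "y i = fls_const (1 / c) * res e i" for i
  have yc: "conv_fls (y i)" if "i < n" for i
    unfolding y_def res_def using that B e(1)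
    by (auto intro!: conv_fls_mult conv_fls_diff coef_ring_sum[OF coef_ring_conv] conv_fls_phiK conv_fls_laurent[of "e _"] intro: entries_inD)
  obtain s0 where s0: "s0 \<ge> 1" "\<forall>s\<ge>s0. \<exists>C\<ge>0. \<forall>p\<in>{..<n}. \<forall>k. norm (fls_nth (y p) k) \<le> C * s powi k"
    using conv_bound_finite[of "{..<n}" y] yc by auto
  define \<sigma> where "\<sigma> = max s0 (2 * \<rho>)"
  obtain Cy where Cy: "Cy \<ge> 0" "\<And>p k. p \<in> {..<n} \<Longrightarrow> norm (fls_nth (y p) k) \<le> Cy * \<sigma> powi k"
    using s0(2)[rule_format, of \<sigma>] by (auto simp: \<sigma>_def)
  have a0: "fls_nth (a p r) k = 0" if "p \<in> {..<n}" "r \<in> {..<n}" "k < - int 0" for p r k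
    using int that by (simp add: a_def)
  have "\<exists>x. \<forall>p\<in>{..<n}. conv_fls (x p) \<and> (\<forall>k<int D. fls_nth (x p) k = 0) \<and>
    (\<forall>k\<ge>int D. fls_nth (x p - (\<Sum>r\<in>{..<n}. a p r * phiK q (x r)) - y p) k = 0)"
    by (rule truncated_solution[OF q _ \<rho>(3) a0 \<rho>(2) _ _ Cy(2,1) D]) (use \<rho>(1) in \<open>auto simp: \<sigma>_def\<close>)
  then obtain x where x: "\<And>p. p < n \<Longrightarrow> conv_fls (x p)" "\<And>p k. p < n \<Longrightarrow> k < int D \<Longrightarrow> fls_nth (x p) k = 0"
    "\<And>p k. p < n \<Longrightarrow> k \<ge> int D \<Longrightarrow> fls_nth (x p - (\<Sum>r\<in>{..<n}. a p r * phiK q (x r)) - y p) k = 0"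
    by auto
  \<comment> \<open>Below D the correction x vanishes, and so do y and, as a has no negative
    exponents, a phi(x); the truncated equation therefore holds exactly.\<close>
  have z: "x p - (\<Sum>r\<in>{..<n}. a p r * phiK q (x r)) - y p = 0" if p: "p < n" for p
  proof (rule fls_eqI)
    fix k
    show "fls_nth (x p - (\<Sum>r\<in>{..<n}. a p r * phiK q (x r)) - y p) k = fls_nth 0 k"
    proof (cases "k \<ge> int D")
      case True
      then show ?thesis using x(3) p by simp
    next
      case False
      have "fls_nth (a p r * phiK q (x r)) k = 0" if "r < n" for r
        using False x(2)[OF that] a0 p that by (subst fls_times_nth_bounds[of 0 _ "int D"]) auto
      moreover have "fls_nth (y p) k = 0" using e(4)[OF p] False by (simp add: y_def)
      ultimately show ?thesis using x(2)[OF p] False by (simp add: fls_nth_sum)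
    qed
  qed
  have c1: "fls_const c * (fls_const (1 / c) * g) = g" for g
    using c(2) by (simp add: mult.assoc[symmetric] fls_const_mult_const)
  have "(\<Sum>j<n. B $$ (i, j) * phiK q (e j + x j)) = fls_const c * (e i + x i)" if i: "i < n" for i
  proof -
    have "fls_const c * x i = fls_const c * ((\<Sum>r<n. a i r * phiK q (x r)) + y i)" using z[OF i] by (simp add: algebra_simps)
    also have "\<dots> = (\<Sum>r<n. B $$ (i, r) * phiK q (x r)) + res e i"
      by (simp only: a_def y_def distrib_left sum_distrib_left mult.assoc c1)
    finally show ?thesis by (simp add: res_def phiK_add algebra_simps sum.distrib)
  qed
  moreover have "conv_fls (e i + x i)" if "i < n" for i using e(1) x(1) that by (simp add: conv_fls_laurent)
  moreover have "e i0 + x i0 \<noteq> 0"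
  proof -
    have "fls_nth (e i0 + x i0) 0 = v $ i0" using e(3) x(2)[of i0 0] i0 by (simp add: D_def)
    then show ?thesis using i0(2) by (metis fls_zero_nth)
  qed
  ultimately show ?thesis using i0(1) by (intro exI[of _ "\<lambda>i. e i + x i"]) auto
qed

text \<open>Steinitz exchange by matrices. Independence gives E k a nonzero coordinate at some
  \<open>l0\<close> at least k; column \<open>l0\<close> of the current basis is dropped, column k
  moves into its place, and E k becomes column k.\<close>

lemma basis_extension:
  assumes E: "\<And>j l. j < d \<Longrightarrow> l < n \<Longrightarrow> conv_fls (E j l)"
    and ind: "\<And>g. (\<And>l. l < n \<Longrightarrow> (\<Sum>j<d. g j * E j l) = 0) \<Longrightarrow> \<forall>j<d. g j = (0 :: complex fls)"
  shows "d \<le> n \<and> (\<exists>X. X \<in> carrier_mat n n \<and> entries_in conv_fls X \<and> det X \<noteq> 0 \<and> (\<forall>j<d. \<forall>l<n. X $$ (l, j) = E j l))"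
proof -
  have "k \<le> d \<Longrightarrow> k \<le> n \<and> (\<exists>X. X \<in> carrier_mat n n \<and> entries_in conv_fls X \<and> det X \<noteq> 0 \<and> (\<forall>j<k. \<forall>l<n. X $$ (l, j) = E j l))" for k
  proof (induction k)
    case 0
    then show ?case by (intro conjI exI[of _ "1\<^sub>m n"]) (auto simp: entries_in_one[OF coef_ring_conv])
  next
    case (Suc k)
    then obtain X where X: "X \<in> carrier_mat n n" "entries_in conv_fls X" "det X \<noteq> 0" "\<And>j l. j < k \<Longrightarrow> l < n \<Longrightarrow> X $$ (l, j) = E j l" and kn: "k \<le> n" by auto
    obtain V where V: "V \<in> carrier_mat n n" "entries_in conv_fls V" "X * V = 1\<^sub>m n" "V * X = 1\<^sub>m n"
      using conv_matrix_inverse[OF X(1-3)] by blast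
    have kd: "k < d" using Suc.prems by simp
    define g where "g l = (\<Sum>m<n. V $$ (l, m) * E k m)" for l
    have gc: "conv_fls (g l)" if "l < n" for l
      unfolding g_def using that V E kd by (auto intro!: coef_ring_sum[OF coef_ring_conv] conv_fls_mult intro: entries_inD)
    have Xg: "(\<Sum>l<n. X $$ (m, l) * g l) = E k m" if m: "m < n" for m
    proof -
      have "(\<Sum>l<n. X $$ (m, l) * g l) = (\<Sum>m'<n. (\<Sum>l<n. X $$ (m, l) * V $$ (l, m')) * E k m')"
        unfolding g_def sum_distrib_left sum_distrib_right by (subst sum.swap) (simp add: mult.assoc)
      also have "\<dots> = (\<Sum>m'<n. (if m = m' then 1 else 0) * E k m')"
        using m V(3) by (intro sum.cong refl) (simp add: index_mult_sum[OF X(1) V(1), symmetric] del: index_mult_mat)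
      also have "\<dots> = E k m" using m by (simp add: if_distrib[of "\<lambda>x. x * _"] cong: if_cong)
      finally show ?thesis .
    qed
    have "\<exists>l0<n. k \<le> l0 \<and> g l0 \<noteq> 0"
    proof (rule ccontr)
      assume no: "\<not> ?thesis"
      then have g0: "g l = 0" if "k \<le> l" "l < n" for l using that by blast
      \<comment> \<open>If all coordinates from k on vanished, this would be a dependence among the
        first k + 1 vectors.\<close>
      define h where "h j = (if j < k then g j else if j = k then -1 else 0)" for j
      have "(\<Sum>j<d. h j * E j l) = 0" if l: "l < n" for l
      proof -
        have "(\<Sum>j<d. h j * E j l) = (\<Sum>j\<in>insert k {..<k}. h j * E j l)"
          using kd by (intro sum.mono_neutral_right) (auto simp: h_def)
        also have "\<dots> = (\<Sum>j<k. g j * X $$ (l, j)) - E k l" using X(4) l by (simp add: h_def)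
        also have "(\<Sum>j<k. g j * X $$ (l, j)) = (\<Sum>j<n. g j * X $$ (l, j))"
          using kn g0 by (intro sum.mono_neutral_left) auto
        also have "\<dots> = E k l" using Xg[OF l] by (simp add: mult.commute)
        finally show ?thesis by simp
      qed
      then have "\<forall>j<d. h j = 0" by (rule ind)
      then show False using kd by (auto simp: h_def)
    qed
    then obtain l0 where l0: "l0 < n" "k \<le> l0" "g l0 \<noteq> 0" by blast
    define W where "W = mat n n (\<lambda>(l, j). if j = k then g l else if j = l0 then (if l = k then 1 else 0) else (if l = j then 1 else 0))"
    have W: "W \<in> carrier_mat n n" "entries_in conv_fls W" using gc by (auto simp: W_def entries_in_def)
    have "det W \<noteq> 0"
    proof
      assume "det W = 0"
      then obtain u where u: "u \<in> carrier_vec n" "u \<noteq> 0\<^sub>v n" "W *\<^sub>v u = 0\<^sub>v n"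
        using det_0_iff_vec_prod_zero[OF W(1)] by blast
      have Wu: "(\<Sum>j<n. W $$ (l, j) * u $ j) = 0" if "l < n" for l
      proof -
        have "(\<Sum>j<n. W $$ (l, j) * u $ j) = (W *\<^sub>v u) $ l"
          using that u(1) W(1) by (auto simp: scalar_prod_def atLeast0LessThan intro!: sum.cong)
        then show ?thesis using u(3) that by simp
      qed
      have kn': "k < n" using l0 by simp
      have split: "(\<Sum>j<n. W $$ (l, j) * u $ j) = g l * u $ k + (\<Sum>j\<in>{..<n}-{k}. W $$ (l, j) * u $ j)" if "l < n" for l
        using kn' that by (subst sum.remove[of _ k]) (auto simp: W_def)
      have "(\<Sum>j\<in>{..<n}-{k}. W $$ (l0, j) * u $ j) = 0"
        using l0 by (intro sum.neutral) (auto simp: W_def)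
      then have uk: "u $ k = 0" using split[OF l0(1)] Wu[OF l0(1)] l0 by simp
      have rest: "(\<Sum>j\<in>{..<n}-{k}. W $$ (l, j) * u $ j) = 0" if "l < n" for l
        using split[OF that] Wu[OF that] uk by simp
      have "u $ l = 0" if l: "l < n" for l
      proof -
        consider "l = k" | "l = l0" "l \<noteq> k" | "l \<noteq> k" "l \<noteq> l0" by blast
        then show ?thesis
        proof cases
          case 2
          have "(\<Sum>j\<in>{..<n}-{k}. W $$ (k, j) * u $ j) = (\<Sum>j\<in>{l0}. W $$ (k, j) * u $ j)"
            using 2 l0 kn' by (intro sum.mono_neutral_right) (auto simp: W_def)
          then show ?thesis using rest[OF kn'] 2 l0 kn' by (simp add: W_def)
        next
          case 3
          have "(\<Sum>j\<in>{..<n}-{k}. W $$ (l, j) * u $ j) = (\<Sum>j\<in>{l}. W $$ (l, j) * u $ j)"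
            using 3 l by (intro sum.mono_neutral_right) (auto simp: W_def)
          then show ?thesis using rest[OF l] 3 l by (simp add: W_def)
        qed (use uk in simp)
      qed
      then have "u = 0\<^sub>v n" using u(1) by (intro eq_vecI) auto
      then show False using u(2) by simp
    qed
    then have "det (X * W) \<noteq> 0" using det_mult[OF X(1) W(1)] X(3) by simp
    moreover have "(X * W) $$ (l, j) = E j l" if j: "j < Suc k" and l: "l < n" for j l
    proof -
      have jn: "j < n" using j l0 by simp
      show ?thesis
      proof (cases "j = k")
        case True
        have Wk: "W $$ (m, k) = g m" if "m < n" for m using that jn True by (simp add: W_def)
        show ?thesis unfolding index_mult_sum[OF X(1) W(1) l jn] using Xg[OF l] True by (simp add: Wk)
      next
        case False
        have "(X * W) $$ (l, j) = (\<Sum>m<n. X $$ (l, m) * (if m = j then 1 else 0))"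
          unfolding index_mult_sum[OF X(1) W(1) l jn] using False j l0 jn by (intro sum.cong refl) (auto simp: W_def)
        also have "\<dots> = X $$ (l, j)" using jn by (simp add: if_distrib[of "\<lambda>x. _ * x"] cong: if_cong)
        finally show ?thesis using X(4)[of j l] False j l by simp
      qed
    qed
    moreover have "X * W \<in> carrier_mat n n" "entries_in conv_fls (X * W)" using X W entries_in_mult[OF coef_ring_conv X(1) W(1)] by auto
    ultimately show ?case using l0 by (intro conjI exI[of _ "X * W"]) auto
  qed
  from this[of d] show ?thesis by simp
qed

section \<open>Leading coefficients of iterates and the weighted norm\<close>

lemma vge_int:
  assumes "vge f y" "real_of_int t - 1 < y"
  shows "vge f (real_of_int t)"
  unfolding vge_def
proof (intro allI impI)
  fix n assume "fls_nth f n \<noteq> 0"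
  then have "y \<le> real_of_int n" using assms(1) by (simp add: vge_def)
  then have "real_of_int (t - 1) < real_of_int n" using assms(2) by simp
  then have "t - 1 < n" by (simp only: of_int_less_iff)
  then show "real_of_int t \<le> real_of_int n" by simp
qed

lemma fls_nth_mult_lowest:
  assumes "vge f (real_of_int a)" "vge g (real_of_int b)"
  shows "fls_nth (f * g) (a + b) = fls_nth f a * fls_nth g b"
proof -
  have "fls_nth (f * g) (a + b) = (\<Sum>i=a..a + b - b. fls_nth f i * fls_nth g (a + b - i))"
    by (rule fls_times_nth_bounds) (use assms vge_nth in auto)
  then show ?thesis by simp
qed

text \<open>When all entries have valuation at least t, the coefficients at z^(k t) of the k-th
  iterates multiply like constant matrices. Dilation contributes only a scalar, a power of q,
  because all exponents involved agree.\<close>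

lemma it_lowest_coefficient:
  assumes q: "q \<noteq> 0" and N: "N \<in> carrier_mat n n" and v: "\<And>i j. i < n \<Longrightarrow> j < n \<Longrightarrow> vge (N $$ (i, j)) (real_of_int t)"
    and N0: "N0 = map_mat (\<lambda>f. fls_nth f t) N"
  shows "\<exists>\<kappa>\<noteq>0. \<forall>i<n. \<forall>j<n. fls_nth (it q N k $$ (i, j)) (int k * t) = \<kappa> * (N0 ^\<^sub>m k) $$ (i, j)"
proof (induction k)
  case 0
  then show ?case using N N0 by (intro exI[of _ 1]) auto
next
  case (Suc k)
  then obtain \<kappa> where \<kappa>: "\<kappa> \<noteq> 0" "\<And>i j. i < n \<Longrightarrow> j < n \<Longrightarrow> fls_nth (it q N k $$ (i, j)) (int k * t) = \<kappa> * (N0 ^\<^sub>m k) $$ (i, j)" by blast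
  have N0c: "N0 \<in> carrier_mat n n" using N N0 by simp
  have ic: "it q N k \<in> carrier_mat n n" using N by simp
  have iv: "vge (it q N k $$ (i, j)) (real_of_int (int k * t))" if "i < n" "j < n" for i j
    using it_weights[OF q N, of "real_of_int t" "\<lambda>_. 0" i j k] v that by simp
  have pc: "N0 ^\<^sub>m k \<in> carrier_mat n n" by (rule pow_carrier_mat[OF N0c])
  have "fls_nth (it q N (Suc k) $$ (i, j)) (int (Suc k) * t) = (q powi (int k * t) * \<kappa>) * (N0 ^\<^sub>m Suc k) $$ (i, j)" if ij: "i < n" "j < n" for i j
  proof -
    have "it q N (Suc k) $$ (i, j) = (\<Sum>m<n. N $$ (i, m) * phiK q (it q N k $$ (m, j)))"
      using ij N carrier_matD[OF ic] unfolding it.simps by (subst index_mult_sum[of _ n n _ n]) auto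
    then have "fls_nth (it q N (Suc k) $$ (i, j)) (t + int k * t) = (\<Sum>m<n. fls_nth (N $$ (i, m)) t * fls_nth (phiK q (it q N k $$ (m, j))) (int k * t))"
      using ij v iv q by (simp add: fls_nth_sum fls_nth_mult_lowest del: fls_nth_phiK it.simps)
    also have "\<dots> = (\<Sum>m<n. N0 $$ (i, m) * (q powi (int k * t) * (\<kappa> * (N0 ^\<^sub>m k) $$ (m, j))))"
      using ij \<kappa>(2) N by (intro sum.cong refl) (auto simp: N0)
    also have "\<dots> = (q powi (int k * t) * \<kappa>) * (\<Sum>m<n. N0 $$ (i, m) * (N0 ^\<^sub>m k) $$ (m, j))"
      by (simp add: sum_distrib_left mult_ac)
    also have "(\<Sum>m<n. N0 $$ (i, m) * (N0 ^\<^sub>m k) $$ (m, j)) = (N0 * N0 ^\<^sub>m k) $$ (i, j)"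
      using ij N0c pc by (auto simp: scalar_prod_def atLeast0LessThan intro!: sum.cong)
    also have "N0 * N0 ^\<^sub>m k = N0 ^\<^sub>m Suc k"
    proof (induction k)
      case (Suc k)
      have "N0 * N0 ^\<^sub>m Suc k = (N0 * N0 ^\<^sub>m k) * N0"
        using N0c pow_carrier_mat[OF N0c, of k] by (simp add: assoc_mult_mat[of _ n n _ n _ n])
      then show ?case using Suc by simp
    qed (use N0c in simp)
    finally show ?thesis by (simp add: algebra_simps)
  qed
  then show ?case using \<kappa>(1) q by (intro exI[of _ "q powi (int k * t) * \<kappa>"]) auto
qed

lemma companion_weights:
  assumes "\<And>i. i < n \<Longrightarrow> vge (a i) (x * (real n - real i))" "i < n" "j < n"
  shows "vge (companion n a $$ (i, j)) (x + x * real j - x * real i)"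
proof -
  have "vge (if j = n - 1 then - a i else 0) (x + x * real j - x * real i)"
    using assms(1)[of i] assms(2,3) by (auto simp: of_nat_diff algebra_simps)
  moreover have "vge (if i = j + 1 then 1 else 0) (x + x * real j - x * real i)"
    by (auto simp: algebra_simps)
  ultimately show ?thesis using assms by (auto simp: companion_def intro: vge_add)
qed

text \<open>The fewer than M remaining steps, and rounding k down to a multiple of M, cost a bounded
  amount.\<close>

lemma grow_from_multiple:
  assumes q: "q \<noteq> 0" and C: "C \<in> carrier_mat n n" and M: "M > (0::nat)"
    and g: "\<And>l i j. i < n \<Longrightarrow> j < n \<Longrightarrow> vge (it q C (M * l) $$ (i, j)) (real l * z - K)"
  shows "grow q n C (z / real M)"
proof -
  obtain L where L: "\<And>r i j. r < M \<Longrightarrow> i < n \<Longrightarrow> j < n \<Longrightarrow> vge (it q C r $$ (i, j)) L"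
  proof -
    have "finite ({..<M} \<times> {..<n} \<times> {..<n})" by simp
    from vge_ex_finite[OF this, of "\<lambda>(r, p). it q C r $$ p"]
    obtain x where x: "\<forall>z\<in>{..<M} \<times> {..<n} \<times> {..<n}. vge (case z of (r, p) \<Rightarrow> it q C r $$ p) x" by blast
    show ?thesis
    proof (rule that[of x])
      fix r i j assume "r < M" "i < n" "j < n"
      then show "vge (it q C r $$ (i, j)) x" using bspec[OF x, of "(r, i, j)"] by simp
    qed
  qed
  have "vge (it q C k $$ (i, j)) (real k * (z / real M) - (K - L + \<bar>z\<bar>))" if ij: "i < n" "j < n" for k i j
  proof -
    define l r where "l = k div M" and "r = k mod M"
    have k: "k = M * l + r" "r < M" using M by (auto simp: l_def r_def)
    have "vge ((it q C (M * l) * mphi (q ^ (M * l)) (it q C r)) $$ (i, j)) ((real l * z - K) + L)"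
    proof (rule vge_mat_mult[OF _ _ g _ ij])
      fix i j assume "i < n" "j < n"
      moreover have "it q C r \<in> carrier_mat n n" using C by simp
      ultimately show "vge (mphi (q ^ (M * l)) (it q C r) $$ (i, j)) L" using L k(2) q by auto
    qed (use C in auto)
    then have "vge (it q C k $$ (i, j)) ((real l * z - K) + L)" unfolding k(1) it_add[OF q C] .
    moreover have "real k * (z / real M) = real l * z + real r / real M * z"
      using M by (simp add: k(1) field_simps)
    moreover have "real r / real M * z \<le> \<bar>z\<bar>"
    proof -
      have "\<bar>real r / real M * z\<bar> \<le> 1 * \<bar>z\<bar>" unfolding abs_mult using k(2) by (intro mult_right_mono) auto
      then show ?thesis by linarith
    qed
    ultimately show ?thesis by (elim vge_mono) linarith
  qed
  then show ?thesis unfolding grow_def by blast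
qed

text \<open>The norm min (v(u_l) + x l) is at least y. With these weights the companion operator
  raises the norm by at least x, which \<open>kry_lattice_val\<close> iterates.\<close>

definition lattice_val :: "nat \<Rightarrow> real \<Rightarrow> (nat \<Rightarrow> complex fls) \<Rightarrow> real \<Rightarrow> bool" where
  "lattice_val n x u y \<longleftrightarrow> (\<forall>l<n. vge (u l) (y - x * real l))"

lemma kry_lattice_val:
  assumes q: "q \<noteq> 0" and C: "C = companion n a" "\<And>i. i < n \<Longrightarrow> vge (a i) (x * (real n - real i))"
    and u: "lattice_val n x (kry q C f j) y"
  shows "lattice_val n x (kry q C f (j + k)) (y + real k * x)"
proof (induction k)
  case 0
  then show ?case using u by simp
next
  case (Suc k)
  have Cc: "C \<in> carrier_mat n n" by (simp add: C)
  show ?case unfolding lattice_val_def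
  proof (intro allI impI)
    fix l assume l: "l < n"
    have "vge (kry q C f (Suc (j + k)) l) (y + real (Suc k) * x - x * real l)"
      unfolding kry_Suc[OF q Cc l]
    proof (rule vge_sum)
      fix m assume "m \<in> {..<n}"
      then have "vge (C $$ (l, m)) (x + x * real m - x * real l)" "vge (kry q C f (j + k) m) (y + real k * x - x * real m)"
        using Suc l companion_weights[of n a x l m] C by (auto simp: lattice_val_def)
      then have "vge (C $$ (l, m) * phiK q (kry q C f (j + k) m)) ((x + x * real m - x * real l) + (y + real k * x - x * real m))"
        using q by (intro vge_mult) auto
      then show "vge (C $$ (l, m) * phiK q (kry q C f (j + k) m)) (y + real (Suc k) * x - x * real l)"
        by (simp add: algebra_simps)
    qed
    then show "vge (kry q C f (j + Suc k) l) (y + real (Suc k) * x - x * real l)" by simp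
  qed
qed

text \<open>The values of \<open>\<Phi>\<^sup>j f\<close> under the norm \<open>min (v (u l) + x l)\<close> are \<open>\<nu> f + j t / d\<close>,
  which for \<open>j < d\<close> are pairwise incongruent modulo 1.\<close>

lemma kry_independent:
  assumes q: "q \<noteq> 0" and C: "C = companion n a" "\<And>i. i < n \<Longrightarrow> vge (a i) (x * (real n - real i))"
    and x: "x = real_of_int t / real d" "d > 0" "coprime t (int d)"
    and f: "\<And>l. l < n \<Longrightarrow> kry q C f d l = fls_const c * fls_X_intpow t * f l" "c \<noteq> 0" "\<exists>l<n. f l \<noteq> 0"
    and g: "\<And>l. l < n \<Longrightarrow> (\<Sum>j<d. g j * kry q C f j l) = 0"
  shows "\<forall>j<d. g j = 0"
proof (rule ccontr)
  assume "\<not> ?thesis"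
  then obtain j1 where j1: "j1 < d" "g j1 \<noteq> 0" by blast
  have Cc: "C \<in> carrier_mat n n" by (simp add: C)
  have f0: "kry q C f 0 l = f l" if "l < n" for l
    using that Cc by (simp add: kry_def if_distrib[of "\<lambda>x. x * _"] cong: if_cong)
  define S where "S = {l. l < n \<and> f l \<noteq> 0}"
  define w where "w l = real_of_int (fls_subdegree (f l)) + x * real l" for l
  define y0 where "y0 = Min (w ` S)"
  have S: "finite S" "S \<noteq> {}" using f(3) by (auto simp: S_def)
  have lv: "lattice_val n x (kry q C f 0) y \<longleftrightarrow> y \<le> y0" for y
  proof -
    have "lattice_val n x (kry q C f 0) y \<longleftrightarrow> (\<forall>l\<in>S. y \<le> w l)"
      using f0 by (auto simp: lattice_val_def vge_iff S_def w_def algebra_simps)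
    also have "\<dots> \<longleftrightarrow> y \<le> y0" unfolding y0_def using S by simp
    finally show ?thesis .
  qed
  have lj: "lattice_val n x (kry q C f j) (y0 + real j * x)" for j
    using kry_lattice_val[OF q C, where j = 0 and k = j and y = y0] lv by simp
  \<comment> \<open>Apart from \<open>y0\<close>, a lower bound for the norm of g_j Phi^j f. As t is
    prime to d, any two of these numbers with nonzero g_j differ by a nonzero multiple of 1 /
    d.\<close>
  define h where "h j = real_of_int (fls_subdegree (g j)) + real j * x" for j
  define J where "J = {j. j < d \<and> g j \<noteq> 0}"
  have J: "finite J" "J \<noteq> {}" using j1 by (auto simp: J_def)
  have "Min (h ` J) \<in> h ` J" using J by (intro Min_in) auto
  then obtain i where i: "i \<in> J" "h i = Min (h ` J)" by auto
  have gap: "h i + 1 / real d \<le> h j" if j: "j \<in> J" "j \<noteq> i" for j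
  proof -
    have le: "h i \<le> h j" unfolding i(2) using J j by auto
    define m where "m = int d * (fls_subdegree (g j) - fls_subdegree (g i)) + (int j - int i) * t"
    have xd: "real d * x = real_of_int t" using x by simp
    have "real d * (h j - h i) = real d * (real_of_int (fls_subdegree (g j)) - real_of_int (fls_subdegree (g i))) + (real j - real i) * (real d * x)"
      by (simp add: h_def algebra_simps)
    also have "\<dots> = real_of_int m" unfolding xd m_def by simp
    finally have m: "real d * (h j - h i) = real_of_int m" .
    have "m \<noteq> 0"
    proof
      assume "m = 0"
      then have "(int j - int i) * t = int d * (fls_subdegree (g i) - fls_subdegree (g j))"
        unfolding m_def by (simp add: algebra_simps)
      then have "int d dvd (int j - int i) * t" by simp
      then have "int d dvd int j - int i"
        using coprime_dvd_mult_left_iff[OF coprime_commute[THEN iffD1, OF x(3)]] by blast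
      moreover have "\<bar>int j - int i\<bar> < int d" using i j by (auto simp: J_def)
      moreover from calculation have "int d dvd \<bar>int j - int i\<bar>" by simp
      ultimately have "int j - int i = 0" using zdvd_imp_le[of "\<bar>int j - int i\<bar>" "int d"] zdvd_imp_le[of "int d" "\<bar>int j - int i\<bar>"] by linarith
      then show False using j by simp
    qed
    moreover have "real_of_int m \<ge> 0" unfolding m[symmetric] using le by simp
    ultimately have "real_of_int m \<ge> 1" by linarith
    then have "real d * (h j - h i) \<ge> 1" using m by simp
    then show ?thesis using x(2) by (simp add: field_simps)
  qed
  have iJ: "i < d" "g i \<noteq> 0" using i by (auto simp: J_def)
  have summand: "vge (g j * kry q C f j l) (y0 + h i + 1 / real d - x * real l)" if j: "j < d" "j \<noteq> i" and l: "l < n" for j l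
  proof (cases "g j = 0")
    case False
    have "vge (g j) (real_of_int (fls_subdegree (g j)))" by (simp add: vge_iff)
    moreover have "vge (kry q C f j l) (y0 + real j * x - x * real l)" using lj[of j] l by (simp add: lattice_val_def)
    ultimately have "vge (g j * kry q C f j l) (real_of_int (fls_subdegree (g j)) + (y0 + real j * x - x * real l))" by (rule vge_mult)
    moreover have "h i + 1 / real d \<le> h j" using gap[of j] j False by (simp add: J_def)
    ultimately show ?thesis by (elim vge_mono) (simp add: h_def)
  qed simp
  \<comment> \<open>In a vanishing combination the term with least h equals minus the sum of the
    others, so the norm of Phi^i f exceeds its guaranteed bound by 1 / d. Applying Phi^(d - i)
    carries this gain to Phi^d f = c z^t f, whose norm is exactly t more than that of f.\<close>
  have li: "lattice_val n x (kry q C f i) (y0 + real i * x + 1 / real d)"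
    unfolding lattice_val_def
  proof (intro allI impI)
    fix l assume l: "l < n"
    have "0 = g i * kry q C f i l + (\<Sum>j\<in>{..<d}-{i}. g j * kry q C f j l)"
      using g[OF l] iJ by (simp add: sum.remove)
    then have "g i * kry q C f i l = - (\<Sum>j\<in>{..<d}-{i}. g j * kry q C f j l)" by (simp add: eq_neg_iff_add_eq_0)
    also have "vge \<dots> (y0 + h i + 1 / real d - x * real l)" using summand l by (auto intro!: vge_sum)
    finally have *: "vge (g i * kry q C f i l) (y0 + h i + 1 / real d - x * real l)" .
    then show "vge (kry q C f i l) (y0 + real i * x + 1 / real d - x * real l)"
      using iJ by (cases "kry q C f i l = 0") (auto simp: vge_iff h_def)
  qed
  have "lattice_val n x (kry q C f (i + (d - i))) ((y0 + real i * x + 1 / real d) + real (d - i) * x)"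
    by (rule kry_lattice_val[OF q C(1) _ li]) (use C(2) in auto)
  then have ld: "lattice_val n x (kry q C f d) (y0 + real d * x + 1 / real d)"
    using iJ by (simp add: of_nat_diff algebra_simps)
  have "lattice_val n x (kry q C f 0) (y0 + 1 / real d)"
    unfolding lattice_val_def
  proof (intro allI impI)
    fix l assume l: "l < n"
    have "vge (fls_const c * fls_X_intpow t * f l) (y0 + real d * x + 1 / real d - x * real l)"
      using ld l unfolding lattice_val_def f(1)[OF l, symmetric] by blast
    moreover have "fls_subdegree (fls_const c * fls_X_intpow t * f l) = t + fls_subdegree (f l)" if "f l \<noteq> 0"
      using f(2) that by (simp del: fls_X_intpow_times_conv_shift)
    moreover have "real d * x = real_of_int t" using x by simp
    ultimately show "vge (kry q C f 0 l) (y0 + 1 / real d - x * real l)"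
      using f0[OF l] f(2) by (cases "f l = 0") (auto simp: vge_iff simp del: fls_X_intpow_times_conv_shift)
  qed
  then show False using lv x(2) by simp
qed

section \<open>Extensions of slope data\<close>

text \<open>A path of indices contributing to an entry with row in J and column outside crosses the
  boundary exactly once. The pieces before and after the crossing grow by assumption and the
  crossing costs a bounded amount. Valuations of a sum do not deteriorate with the number of
  possible crossing times, so the total loss is independent of k. This is what permits extensions
  within one slope.\<close>

lemma gro_extension:
  assumes q: "q \<noteq> 0" and A: "A \<in> carrier_mat n n" and t: "tri n s A"
    and J: "\<And>i j. i < n \<Longrightarrow> j < n \<Longrightarrow> i \<notin> J \<Longrightarrow> j \<in> J \<Longrightarrow> A $$ (i, j) = 0"
    and K: "\<And>k i j. i < n \<Longrightarrow> j < n \<Longrightarrow> s i = s j \<Longrightarrow> (i \<in> J \<longleftrightarrow> j \<in> J) \<Longrightarrow> vge (it q A k $$ (i, j)) (real k * (e * s i) - K)"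
    and e: "e \<noteq> 0"
  shows "gro q n (\<lambda>i. e * s i) A"
proof -
  define s' where "s' i = e * s i" for i
  note K = K[folded s'_def]
  obtain u where u: "\<And>i j. i < n \<Longrightarrow> j < n \<Longrightarrow> vge (A $$ (i, j)) u" using vge_mat_ex[of n n A] by blast
  define S where "S = (\<Sum>i<n. \<bar>s' i\<bar>)"
  have S: "\<bar>s' i\<bar> \<le> S" if "i < n" for i
    unfolding S_def using that by (intro member_le_sum[of i _ "\<lambda>i. \<bar>s' i\<bar>"]) auto
  \<comment> \<open>Each of the two pieces loses K; the crossing step yields u in place of the slope
    s', and u and S absorb the difference.\<close>
  define K' where "K' = 2 * \<bar>K\<bar> - u + S"
  have c: "it q A k \<in> carrier_mat n n" for k using A by simp
  have ti: "tri n s (it q A k)" for k by (rule tri_it[OF A t])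
  \<comment> \<open>Part of the entry of the (j + k)-th iterate whose index after j factors lies in
    J. For p in J and r outside, it is the whole entry when j = 0 and vanishes when k = 0.\<close>
  define M where "M k j p r = (\<Sum>l\<in>{..<n}\<inter>J. it q A j $$ (p, l) * phiK (q ^ j) (it q A k $$ (l, r)))" for k j p r
  have M: "vge (M k j p r) (real (j + k) * s' p - K')" if pr: "p < n" "r < n" "p \<in> J" "r \<notin> J" "s p = s r" for k j p r
  proof (induction k arbitrary: j)
    case 0
    have "M 0 j p r = 0" unfolding M_def using pr A by (intro sum.neutral) auto
    then show ?case by simp
  next
    case (Suc k)
    have "it q A (Suc k) $$ (l, r) = (\<Sum>l'<n. A $$ (l, l') * phiK q (it q A k $$ (l', r)))" if "l < n" for l
      using that pr A carrier_matD[OF c[of k]] unfolding it.simps by (subst index_mult_sum[of _ n n _ n]) auto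
    then have "M (Suc k) j p r = (\<Sum>l\<in>{..<n}\<inter>J. \<Sum>l'<n. it q A j $$ (p, l) * phiK (q ^ j) (A $$ (l, l')) * phiK (q ^ Suc j) (it q A k $$ (l', r)))"
      unfolding M_def using q
      by (intro sum.cong refl) (simp add: phiK_sum phiK_mult phiK_phiK sum_distrib_left mult.assoc mult.commute[of _ q])
    also have "\<dots> = (\<Sum>l'<n. \<Sum>l\<in>{..<n}\<inter>J. it q A j $$ (p, l) * phiK (q ^ j) (A $$ (l, l')) * phiK (q ^ Suc j) (it q A k $$ (l', r)))"
      by (rule sum.swap)
    also have "{..<n} = ({..<n}\<inter>J) \<union> ({..<n} - J)" by blast
    also have "(\<Sum>l'\<in>({..<n}\<inter>J) \<union> ({..<n} - J). \<Sum>l\<in>(({..<n}\<inter>J) \<union> ({..<n} - J))\<inter>J. it q A j $$ (p, l) * phiK (q ^ j) (A $$ (l, l')) * phiK (q ^ Suc j) (it q A k $$ (l', r)))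
      = (\<Sum>l'\<in>{..<n}\<inter>J. \<Sum>l\<in>{..<n}\<inter>J. it q A j $$ (p, l) * phiK (q ^ j) (A $$ (l, l')) * phiK (q ^ Suc j) (it q A k $$ (l', r)))
       + (\<Sum>l'\<in>{..<n}-J. \<Sum>l\<in>{..<n}\<inter>J. it q A j $$ (p, l) * phiK (q ^ j) (A $$ (l, l')) * phiK (q ^ Suc j) (it q A k $$ (l', r)))"
    proof -
      have "(({..<n}\<inter>J) \<union> ({..<n} - J))\<inter>J = {..<n}\<inter>J" by blast
      then show ?thesis by (subst sum.union_disjoint) auto
    qed
    also have "(\<Sum>l'\<in>{..<n}\<inter>J. \<Sum>l\<in>{..<n}\<inter>J. it q A j $$ (p, l) * phiK (q ^ j) (A $$ (l, l')) * phiK (q ^ Suc j) (it q A k $$ (l', r))) = M k (Suc j) p r"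
      unfolding M_def
    proof (rule sum.cong[OF refl])
      fix l' assume l': "l' \<in> {..<n} \<inter> J"
      have "it q A (Suc j) $$ (p, l') = (\<Sum>l<n. it q A j $$ (p, l) * phiK (q ^ j) (A $$ (l, l')))"
        unfolding it_Suc'[OF q A] using l' pr A c by (subst index_mult_sum[of _ n n _ n]) auto
      also have "\<dots> = (\<Sum>l\<in>{..<n}\<inter>J. it q A j $$ (p, l) * phiK (q ^ j) (A $$ (l, l')))"
        by (rule sum.mono_neutral_right) (use J l' in auto)
      finally show "(\<Sum>l\<in>{..<n}\<inter>J. it q A j $$ (p, l) * phiK (q ^ j) (A $$ (l, l')) * phiK (q ^ Suc j) (it q A k $$ (l', r))) =
        it q A (Suc j) $$ (p, l') * phiK (q ^ Suc j) (it q A k $$ (l', r))"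
        by (simp add: sum_distrib_right)
    qed
    finally have eq: "M (Suc k) j p r = M k (Suc j) p r + (\<Sum>l'\<in>{..<n}-J. \<Sum>l\<in>{..<n}\<inter>J. it q A j $$ (p, l) * phiK (q ^ j) (A $$ (l, l')) * phiK (q ^ Suc j) (it q A k $$ (l', r)))" .
    have "vge (\<Sum>l'\<in>{..<n}-J. \<Sum>l\<in>{..<n}\<inter>J. it q A j $$ (p, l) * phiK (q ^ j) (A $$ (l, l')) * phiK (q ^ Suc j) (it q A k $$ (l', r))) (real (j + Suc k) * s' p - K')"
    proof (intro vge_sum)
      fix l l' assume l: "l \<in> {..<n}\<inter>J" "l' \<in> {..<n}-J"
      show "vge (it q A j $$ (p, l) * phiK (q ^ j) (A $$ (l, l')) * phiK (q ^ Suc j) (it q A k $$ (l', r))) (real (j + Suc k) * s' p - K')"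
      proof (cases "s l < s p \<or> s l' < s l \<or> s r < s l'")
        case True
        then have "it q A j $$ (p, l) = 0 \<or> A $$ (l, l') = 0 \<or> it q A k $$ (l', r) = 0"
          using ti[of j] ti[of k] t pr l unfolding tri_def by auto
        then show ?thesis by auto
      next
        case False
        then have e: "s l = s p" "s l' = s p" using pr by auto
          then have e': "s' l' = s' p" by (simp add: s'_def)
        have "vge (it q A j $$ (p, l)) (real j * s' p - K)" "vge (A $$ (l, l')) u" "vge (it q A k $$ (l', r)) (real k * s' l' - K)"
          using l pr e by (intro K u; simp)+
        then have "vge (it q A j $$ (p, l) * phiK (q ^ j) (A $$ (l, l')) * phiK (q ^ Suc j) (it q A k $$ (l', r)))
           (((real j * s' p - K) + u) + (real k * s' l' - K))"
          using q by (intro vge_mult) auto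
        moreover have "real (j + Suc k) * s' p - K' \<le> ((real j * s' p - K) + u) + (real k * s' l' - K)"
          using S[OF pr(1)] e' by (simp add: K'_def algebra_simps)
        ultimately show ?thesis by (rule vge_mono)
      qed
    qed
    then show ?case unfolding eq using Suc[of "Suc j"] by (intro vge_add) auto
  qed
  have bz: "it q A k $$ (i, j) = 0" if "i < n" "j < n" "i \<notin> J" "j \<in> J" for i j k
    using that
  proof (induction k arbitrary: i j)
    case 0
    then show ?case using A by auto
  next
    case (Suc k)
    have "it q A (Suc k) $$ (i, j) = (\<Sum>l'<n. A $$ (i, l') * phiK q (it q A k $$ (l', j)))"
      using Suc.prems A carrier_matD[OF c[of k]] unfolding it.simps by (subst index_mult_sum[of _ n n _ n]) auto
    also have "\<dots> = 0"
    proof (rule sum.neutral, rule ballI)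
      fix l assume "l \<in> {..<n}"
      then show "A $$ (i, l) * phiK q (it q A k $$ (l, j)) = 0"
        using J[of i l] Suc.prems Suc.IH[of l j] by (cases "l \<in> J") auto
    qed
    finally show ?case .
  qed
  have "vge (it q A k $$ (i, j)) (real k * s' i - (\<bar>K\<bar> + \<bar>K'\<bar>))" if ij: "i < n" "j < n" "s i = s j" for k i j
  proof (cases "i \<in> J \<longleftrightarrow> j \<in> J")
    case True
    show ?thesis by (rule vge_mono[OF K[OF ij True]]) auto
  next
    case False
    show ?thesis
    proof (cases "i \<in> J")
      case True
      have "M k 0 i j = (\<Sum>l\<in>{i}. it q A 0 $$ (i, l) * phiK (q ^ 0) (it q A k $$ (l, j)))"
        unfolding M_def by (rule sum.mono_neutral_right) (use True ij A in auto)
      then have "M k 0 i j = it q A k $$ (i, j)" using ij A by simp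
      then show ?thesis using M[of i j k 0] ij True False by (auto elim!: vge_mono)
    next
      case F: False
      then show ?thesis using False bz[of i j k] ij by simp
    qed
  qed
  then show ?thesis unfolding gro_def s'_def using e by (metis mult_left_cancel)
qed


text \<open>The values \<open>\<alpha>\<close> and \<open>\<beta>\<close> only record which of the
  two blocks is stable. Both orders occur, since the contragredient of an upper triangular extension
  is lower triangular.\<close>

lemma gro_two_blocks:
  assumes q: "q \<noteq> 0" and e: "e \<noteq> 0" and X: "X \<in> carrier_mat (d + m) (d + m)" "tri (d + m) s X" "tri (d + m) (\<lambda>p. if p < d then \<alpha> else \<beta>) X" "\<alpha> \<noteq> \<beta>"
    and g: "gro q d (\<lambda>i. e * s i) (sub_block 0 d X)" "gro q m (\<lambda>i. e * s (d + i)) (sub_block d m X)"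
  shows "gro q (d + m) (\<lambda>i. e * s i) X"
proof -
  define u :: "nat \<Rightarrow> real" where "u p = (if p < d then \<alpha> else \<beta>)" for p
  define J where "J = (if \<alpha> < \<beta> then {..<d} else {d..})"
  obtain K where K: "\<And>k i j. i < d \<Longrightarrow> j < d \<Longrightarrow> e * s i = e * s j \<Longrightarrow> vge (it q (sub_block 0 d X) k $$ (i, j)) (real k * (e * s i) - K)"
    using g(1) unfolding gro_def by blast
  obtain L where L: "\<And>k i j. i < m \<Longrightarrow> j < m \<Longrightarrow> e * s (d + i) = e * s (d + j) \<Longrightarrow> vge (it q (sub_block d m X) k $$ (i, j)) (real k * (e * s (d + i)) - L)"
    using g(2) unfolding gro_def by blast
  have u: "tri (d + m) u X" using X(3) by (simp add: u_def[abs_def])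
  show ?thesis
  proof (rule gro_extension[OF q X(1,2), where J = J and K = "max K L"])
    show "X $$ (i, j) = 0" if "i < d + m" "j < d + m" "i \<notin> J" "j \<in> J" for i j
    proof -
      have "u j < u i" using that X(4) by (auto simp: u_def J_def split: if_splits)
      then show ?thesis using u that unfolding tri_def by blast
    qed
    fix k i j assume ij: "i < d + m" "j < d + m" "s i = s j" "i \<in> J \<longleftrightarrow> j \<in> J"
    then consider "i < d" "j < d" | "d \<le> i" "d \<le> j" by (auto simp: J_def split: if_splits)
    then show "vge (it q X k $$ (i, j)) (real k * (e * s i) - max K L)"
    proof cases
      case 1
      have "{p. p < d + m \<and> u p = \<alpha>} = {0..<0+d}" using X(4) by (auto simp: u_def)
      then have "it q (sub_block 0 d X) k = sub_block 0 d (it q X k)" by (rule sub_block_it[OF X(1) u]) (use 1 in simp)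
      then have "vge (it q X k $$ (i, j)) (real k * (e * s i) - K)" using K[of i j k] 1 ij by (simp add: sub_block_def)
      then show ?thesis by (rule vge_mono) simp
    next
      case 2
      have "{p. p < d + m \<and> u p = \<beta>} = {d..<d+m}" using X(4) by (auto simp: u_def)
      then have "it q (sub_block d m X) k = sub_block d m (it q X k)" by (rule sub_block_it[OF X(1) u]) (use 2 ij in simp)
      then have "vge (it q X k $$ (i, j)) (real k * (e * s i) - L)" using L[of "i - d" "j - d" k] 2 ij by (simp add: sub_block_def)
      then show ?thesis by (rule vge_mono) simp
    qed
  qed (rule e)
qed

lemma half_data_extension:
  assumes q: "q \<noteq> 0" and X: "X \<in> carrier_mat (d + m) (d + m)" "entries_in laurent_poly X" "tri (d + m) s X"
    "tri (d + m) (\<lambda>p. if p < d then \<alpha> else \<beta>) X" "\<alpha> \<noteq> \<beta>"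
    and h: "half_data q d s (sub_block 0 d X)" "half_data q m (\<lambda>i. s (d + i)) (sub_block d m X)"
  shows "half_data q (d + m) s X"
proof -
  have "gro q (d + m) (\<lambda>i. 1 * s i) X"
    by (rule gro_two_blocks[OF q _ X(1,3,4,5)]) (use h in \<open>auto simp: half_data_def\<close>)
  moreover have "gro (inverse q) (d + m) (\<lambda>i. -1 * s i) (hat X)"
  proof (rule gro_two_blocks[OF _ _ _ tri_hat[OF X(1,3)] tri_hat[OF X(1,4)] X(5)])
    show "gro (inverse q) d (\<lambda>i. -1 * s i) (sub_block 0 d (hat X))"
      using h(1) sub_block_map[of 0 d "d + m" X to_K'] X(1) by (simp add: half_data_def)
    show "gro (inverse q) m (\<lambda>i. -1 * s (d + i)) (sub_block d m (hat X))"
      using h(2) sub_block_map[of d m "d + m" X to_K'] X(1) by (simp add: half_data_def)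
  qed (use q X in auto)
  ultimately show ?thesis using X by (simp add: half_data_def)
qed

lemma vge_step:
  assumes "vge f (real_of_int a)" "fls_nth f a = 0"
  shows "vge f (real_of_int (a + 1))"
  unfolding vge_def
proof (intro allI impI)
  fix n assume n: "fls_nth f n \<noteq> 0"
  then have "real_of_int a \<le> real_of_int n" "n \<noteq> a" using assms by (auto simp: vge_def)
  then have "a + 1 \<le> n" by simp
  then show "real_of_int (a + 1) \<le> real_of_int n" by (simp only: of_int_le_iff)
qed

text \<open>The number x = t / d is the largest growth rate of \<open>C\<close>. On the unit ball of
  the norm min (v(u_l) + x l) the operator z^-t Phi^d is integral, and its reduction is not
  nilpotent, for otherwise the growth rate could be increased. An eigenvector of the reduction with
  nonzero eigenvalue of largest modulus lifts by Adams' lemma, applied to the dilation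
  \<open>q ^ d\<close>.\<close>

lemma slope_vector:
  assumes q: "0 < norm q" "norm q < 1" and n: "n \<ge> 1" and a: "\<And>i. i \<le> n \<Longrightarrow> conv_fls (a i)" "a n = 1" "a 0 \<noteq> 0"
    and C: "C = companion n a"
  shows "\<exists>x t d c f. x = real_of_int t / real d \<and> d > 0 \<and> coprime t (int d) \<and> c \<noteq> 0 \<and>
    (\<forall>i<n. vge (a i) (x * (real n - real i))) \<and> (\<forall>y. grow q n C y \<longrightarrow> y \<le> x) \<and>
    (\<forall>l<n. conv_fls (f l)) \<and> (\<exists>l<n. f l \<noteq> 0) \<and>
    (\<forall>l<n. kry q C f d l = fls_const c * fls_X_intpow t * f l)"
proof -
  have q0: "q \<noteq> 0" using q by auto
  have Cc: "C \<in> carrier_mat n n" by (simp add: C)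
  define S where "S = {i. i < n \<and> a i \<noteq> 0}"
  define w where "w i = real_of_int (fls_subdegree (a i)) / (real n - real i)" for i
  have "0 \<in> S" using n a(3) by (simp add: S_def)
  then have S: "finite S" "S \<noteq> {}" by (auto simp: S_def)
  define x where "x = Min (w ` S)"
  have "x \<in> w ` S" unfolding x_def using S by (intro Min_in) auto
  then obtain i0 where i0: "i0 < n" "a i0 \<noteq> 0" "x = w i0" by (auto simp: S_def)
  have va: "vge (a i) (x * (real n - real i))" if i: "i < n" for i
  proof (cases "a i = 0")
    case False
    then have "x \<le> w i" unfolding x_def using S i by (intro Min_le) (auto simp: S_def)
    then show ?thesis using i by (simp add: vge_iff w_def pos_le_divide_eq)
  qed simp
  have mx: "y \<le> x" if y: "grow q n C y" for y
  proof -
    have "vge (a i0) (y * (real n - real i0))"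
      by (rule gauss_newton[where a = a, OF q0 n a(2) _ i0(1)]) (use y C in simp)
    then have "y * (real n - real i0) \<le> real_of_int (fls_subdegree (a i0))" using i0(2) by (simp add: vge_iff)
    then show ?thesis using i0 by (simp add: w_def pos_le_divide_eq)
  qed
  define v0 m0 g where "v0 = fls_subdegree (a i0)" and "m0 = int n - int i0" and "g = gcd v0 m0"
  have m0: "m0 > 0" using i0 by (simp add: m0_def)
  have g: "g > 0" using m0 by (simp add: g_def)
  define t d where "t = v0 div g" and "d = nat (m0 div g)"
  have gm: "m0 = g * (m0 div g)" "v0 = g * t" by (simp_all add: g_def t_def)
  have "m0 div g > 0" using gm(1) m0 g by (metis zero_less_mult_pos)
  then have d: "d > 0" "int d = m0 div g" by (simp_all add: d_def)
  have cop: "coprime t (int d)" unfolding d(2) t_def g_def by (rule div_gcd_coprime) (use m0 in auto)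
  have xt: "x = real_of_int t / real d"
  proof -
    have "x = real_of_int v0 / real_of_int m0" unfolding i0(3) w_def v0_def m0_def by simp
    also have "\<dots> = real_of_int (g * t) / real_of_int (g * int d)" using gm d by simp
    also have "\<dots> = real_of_int t / real d" using g by simp
    finally show ?thesis .
  qed
  define Z :: "int \<Rightarrow> complex fls" where "Z k = fls_X_intpow k" for k
  have Zm: "Z k * Z l = Z (k + l)" for k l by (simp add: Z_def fls_X_intpow_times_conv_shift add.commute)
  have Z0: "Z 0 = 1" by (simp add: Z_def)
  have Zv: "vge (Z k) y \<longleftrightarrow> y \<le> real_of_int k" for k y by (simp add: Z_def vge_iff)
  have Zc: "conv_fls (Z k)" for k unfolding Z_def by (rule conv_fls_X)
  have Zinv: "Z (- k) * Z k = 1" "Z k * Z (- k) = 1" for k by (simp_all add: Zm Z0)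
  have Zcan: "Z k * (Z (- k) * h) = h" for k h by (simp add: mult.assoc[symmetric] Zinv)
  \<comment> \<open>The weights x j need not be integral; the unit ball is spanned by the coordinate
    vectors multiplied by z^(k j), with the exponent rounded up.\<close>
  define k where "k j = \<lceil>- x * real j\<rceil>" for j
  define q' where "q' = q ^ d"
  have q': "0 < norm q'" "norm q' < 1" "q' \<noteq> 0" using q d by (auto simp: q'_def norm_power power_less_one_iff)
  define Cd where "Cd = it q C d"
  have Cd: "Cd \<in> carrier_mat n n" using Cc by (simp add: Cd_def)
  have Cconv: "entries_in conv_fls C"
  proof (rule entries_inI[OF Cc])
    fix i j assume "i < n" "j < n"
    then show "conv_fls (C $$ (i, j))" using a(1)[of i] by (auto simp: C companion_def)
  qed
  have Cdconv: "entries_in conv_fls Cd" unfolding Cd_def by (rule entries_in_it[OF coef_ring_conv Cc Cconv])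
  have Cdv: "vge (Cd $$ (i, j)) (real_of_int t + x * real j - x * real i)" if "i < n" "j < n" for i j
  proof -
    have "vge (Cd $$ (i, j)) (real d * x + x * real j - x * real i)" unfolding Cd_def
      by (rule it_weights[OF q0 Cc, where r = "\<lambda>i. x * real i"]) (use companion_weights[of n a x] va C that in auto)
    then show ?thesis using xt d by simp
  qed
  define N where "N = mat n n (\<lambda>(i, j). Z (- k i) * (Cd $$ (i, j) * phiK q' (Z (k j))))"
  have N: "N \<in> carrier_mat n n" by (simp add: N_def)
  have Nv: "vge (N $$ (i, j)) (real_of_int t)" if ij: "i < n" "j < n" for i j
  \<comment> \<open>Rounding loses less than 1 and valuations are integers, so the bound t
    survives.\<close>
  proof (rule vge_int)
    show "vge (N $$ (i, j)) (- real_of_int (k i) + ((real_of_int t + x * real j - x * real i) + real_of_int (k j)))"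
    proof -
      have "vge (Z (- k i) * (Cd $$ (i, j) * phiK q' (Z (k j)))) (- real_of_int (k i) + ((real_of_int t + x * real j - x * real i) + real_of_int (k j)))"
        by (intro vge_mult Cdv ij) (use q'(3) Zv in auto)
      then show ?thesis using ij by (simp add: N_def)
    qed
    have "- x * real j \<le> real_of_int (k j)" "real_of_int (k i) < - x * real i + 1" unfolding k_def by linarith+
    then show "real_of_int t - 1 < - real_of_int (k i) + ((real_of_int t + x * real j - x * real i) + real_of_int (k j))"
      by linarith
  qed
  define B where "B = mat n n (\<lambda>(i, j). Z (- t) * N $$ (i, j))"
  have B: "B \<in> carrier_mat n n" by (simp add: B_def)
  have Bconv: "entries_in conv_fls B"
    by (rule entries_inI[OF B]) (auto simp: B_def N_def intro!: conv_fls_mult conv_fls_phiK Zc entries_inD[OF Cdconv Cd])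
  have Nshift: "fls_nth (Z (- t) * h) m = fls_nth h (m + t)" for h m
    unfolding Z_def fls_X_intpow_times_conv_shift(1) by (simp only: fls_shift_nth minus_minus)
  have Bint: "fls_nth (B $$ (i, j)) m = 0" if "i < n" "j < n" "m < 0" for i j m
    using Nv[OF that(1,2)] that by (simp add: B_def Nshift vge_nth)
  define B0 where "B0 = map_mat (\<lambda>f. fls_nth f 0) B"
  have B0: "B0 \<in> carrier_mat n n" using B by (simp add: B0_def)
  have B0N: "B0 = map_mat (\<lambda>f. fls_nth f t) N"
    by (rule eq_matI) (auto simp: B0_def B_def Nshift N_def)
  have "\<exists>c. eigenvalue B0 c \<and> c \<noteq> 0"
  proof (rule ccontr)
    assume no: "\<not> ?thesis"
    have nil: "B0 ^\<^sub>m n = 0\<^sub>m n n" by (rule nilpotent_if_no_eigenvalue[OF B0]) (use no in blast)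
    obtain \<kappa> where \<kappa>: "\<And>i j. i < n \<Longrightarrow> j < n \<Longrightarrow> fls_nth (it q' N n $$ (i, j)) (int n * t) = \<kappa> * (B0 ^\<^sub>m n) $$ (i, j)"
      using it_lowest_coefficient[OF q'(3) N Nv B0N, of n] by blast
    \<comment> \<open>A nilpotent reduction would make n steps gain at least one power of z beyond
      z^(n t).\<close>
    have Mv: "vge (it q' N n $$ (i, j)) (real_of_int (int n * t + 1))" if ij: "i < n" "j < n" for i j
    proof (rule vge_step)
      show "vge (it q' N n $$ (i, j)) (real_of_int (int n * t))"
        using it_weights[OF q'(3) N, of "real_of_int t" "\<lambda>_. 0" i j n] Nv ij by simp
      show "fls_nth (it q' N n $$ (i, j)) (int n * t) = 0" using \<kappa>[OF ij] nil ij by simp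
    qed
    have itN: "vge (it q' N (n * l) $$ (i, j)) (real l * real_of_int (int n * t + 1))" if "i < n" "j < n" for i j l
    proof -
      have "vge (it (q' ^ n) (it q' N n) l $$ (i, j)) (real l * real_of_int (int n * t + 1) + 0 - 0)"
        by (rule it_weights[of _ _ n, where r = "\<lambda>_. 0"]) (use q' N Mv that in auto)
      then show ?thesis using it_pow[OF q'(3) N, of n l] by simp
    qed
    define Dm Di where "Dm = mat n n (\<lambda>(i, j). if i = j then Z (k i) else 0)" and "Di = mat n n (\<lambda>(i, j). if i = j then Z (- k i) else 0)"
    have D: "Dm \<in> carrier_mat n n" "Di \<in> carrier_mat n n" by (auto simp: Dm_def Di_def)
    have DmX: "(Dm * X) $$ (i, j) = Z (k i) * X $$ (i, j)" if "X \<in> carrier_mat n n" "i < n" "j < n" for X i j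
    proof -
      have "(Dm * X) $$ (i, j) = (\<Sum>m<n. if m = i then Z (k i) * X $$ (m, j) else 0)"
        unfolding index_mult_sum[OF D(1) that] using that by (intro sum.cong) (auto simp: Dm_def)
      then show ?thesis using that by simp
    qed
    have DD: "Dm * Di = 1\<^sub>m n"
      by (rule eq_matI) (use D DmX[OF D(2)] in \<open>auto simp: Di_def Zinv\<close>)
    then have DD': "Di * Dm = 1\<^sub>m n" by (rule mat_mult_left_right_inverse[OF D])
    have "Dm * N = Cd * mphi q' Dm"
    proof (rule eq_matI)
      fix i j assume "i < dim_row (Cd * mphi q' Dm)" "j < dim_col (Cd * mphi q' Dm)"
      then have ij: "i < n" "j < n" using Cd D by auto
      have "(Cd * mphi q' Dm) $$ (i, j) = (\<Sum>m<n. Cd $$ (i, m) * mphi q' Dm $$ (m, j))"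
        by (rule index_mult_sum[OF Cd _ ij]) (use D in simp)
      also have "\<dots> = (\<Sum>m<n. if m = j then Cd $$ (i, m) * phiK q' (Z (k j)) else 0)"
        by (intro sum.cong refl) (use ij in \<open>auto simp: Dm_def\<close>)
      also have "\<dots> = (Dm * N) $$ (i, j)" using ij DmX[OF N ij] by (simp add: N_def Zcan)
      finally show "(Dm * N) $$ (i, j) = (Cd * mphi q' Dm) $$ (i, j)" by simp
    qed (use Cd D N in auto)
    then have hom: "Di * Cd = N * mphi q' Di"
      by (rule hom_inverse[OF q'(3) N Cd D DD DD'])
    obtain h where h: "\<And>i j. i < n \<Longrightarrow> j < n \<Longrightarrow> vge (Dm $$ (i, j)) h" using vge_mat_ex[of n n Dm] by blast
    obtain h' where h': "\<And>i j. i < n \<Longrightarrow> j < n \<Longrightarrow> vge (Di $$ (i, j)) h'" using vge_mat_ex[of n n Di] by blast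
    have itC: "vge (it q C (d * n * l) $$ (i, j)) (real l * real_of_int (int n * t + 1) - (- h - h'))" if ij: "i < n" "j < n" for i j l
    proof -
      have "it q C (d * (n * l)) = Dm * (it q' N (n * l) * mphi (q' ^ (n * l)) Di)"
        unfolding it_pow[OF q0 Cc, symmetric] q'_def[symmetric] Cd_def[symmetric]
        by (rule it_gauge'[OF q'(3) Cd N D(2,1) DD hom])
      moreover have "vge ((Dm * (it q' N (n * l) * mphi (q' ^ (n * l)) Di)) $$ (i, j)) (h + (real l * real_of_int (int n * t + 1) + h'))"
        using D N q' h' by (intro vge_mat_mult[of _ n n _ n] h itN ij) auto
      ultimately show ?thesis by (simp add: mult.assoc algebra_simps)
    qed
    have "grow q n C (real_of_int (int n * t + 1) / real (d * n))"
      by (rule grow_from_multiple[OF q0 Cc _ itC]) (use d n in auto)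
    then have "real_of_int (int n * t + 1) / real (d * n) \<le> x" by (rule mx)
    then show False using d n unfolding xt by (simp add: field_simps)
  qed
  then obtain c1 where c1: "eigenvalue B0 c1" "c1 \<noteq> 0" by blast
  have fin: "finite {c. eigenvalue B0 c}" using card_finite_spectrum(1)[OF B0] by (simp add: spectrum_def)
  have "Max (norm ` {c. eigenvalue B0 c}) \<in> norm ` {c. eigenvalue B0 c}" using fin c1 by (intro Max_in) auto
  then obtain c where c: "eigenvalue B0 c" "norm c = Max (norm ` {c. eigenvalue B0 c})" by auto
  have cmax: "norm k \<le> norm c" if "eigenvalue B0 k" for k unfolding c(2) using fin that by (intro Max_ge) auto
  have c0: "c \<noteq> 0" using cmax[OF c1(1)] c1(2) by auto
  obtain e where e: "\<And>i. i < n \<Longrightarrow> conv_fls (e i)" "\<exists>i<n. e i \<noteq> 0"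
    "\<And>i. i < n \<Longrightarrow> (\<Sum>j<n. B $$ (i, j) * phiK q' (e j)) = fls_const c * e i"
    using adams_eigenvector[OF q'(1,2) B Bconv Bint B0_def c(1) c0 cmax] by blast
  define f where "f l = Z (k l) * e l" for l
  have "kry q C f d l = fls_const c * fls_X_intpow t * f l" if l: "l < n" for l
  proof -
    have "kry q C f d l = (\<Sum>m<n. Cd $$ (l, m) * phiK q' (Z (k m)) * phiK q' (e m))"
      using Cc q'(3) by (simp add: kry_def f_def Cd_def q'_def phiK_mult mult.assoc)
    also have "\<dots> = (\<Sum>m<n. (Z (k l) * Z t) * (B $$ (l, m) * phiK q' (e m)))"
    proof (rule sum.cong[OF refl])
      fix m assume "m \<in> {..<n}"
      then have m: "m < n" by simp
      have "Cd $$ (l, m) * phiK q' (Z (k m)) = Z (k l) * N $$ (l, m)" using l m by (simp add: N_def Zcan)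
      also have "N $$ (l, m) = Z t * B $$ (l, m)" using l m by (simp add: B_def Zcan)
      finally show "Cd $$ (l, m) * phiK q' (Z (k m)) * phiK q' (e m) = (Z (k l) * Z t) * (B $$ (l, m) * phiK q' (e m))"
        by (simp add: mult.assoc)
    qed
    also have "\<dots> = (Z (k l) * Z t) * (fls_const c * e l)" using e(3)[OF l] by (simp only: sum_distrib_left[symmetric])
    also have "\<dots> = fls_const c * Z t * f l" by (simp only: f_def mult_ac)
    finally show ?thesis by (simp only: Z_def)
  qed
  moreover have "conv_fls (f l)" if "l < n" for l using e(1) Zc that by (simp add: f_def)
  moreover have "\<exists>l<n. f l \<noteq> 0"
  proof -
    obtain i where i: "i < n" "e i \<noteq> 0" using e(2) by blast
    have "Z (k i) \<noteq> 0" using Zinv(1)[of "k i"] by auto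
    then show ?thesis using i by (intro exI[of _ i]) (simp add: f_def)
  qed
  ultimately show ?thesis using xt d(1) cop c0 va mx
    by (intro exI[of _ x] exI[of _ t] exI[of _ d] exI[of _ c] exI[of _ f]) auto
qed

text \<open>The simple pure object of slope \<open>t / d\<close> has a cyclic vector \<open>e\<close> with \<open>\<Phi>\<^sup>d e = c z\<^sup>t e\<close>.\<close>

definition simple_op :: "nat \<Rightarrow> complex \<Rightarrow> int \<Rightarrow> nat \<Rightarrow> complex fls" where
  "simple_op d c t i = (if i = 0 then - (fls_const c * fls_X_intpow t) else if i = d then 1 else 0)"

lemma laurent_simple_op: "laurent_poly (simple_op d c t i)"
  unfolding simple_op_def by (auto intro!: laurent_poly_uminus laurent_poly_mult laurent_poly_const laurent_poly_X simp del: fls_X_intpow_times_conv_shift)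

lemma fls_nth_mono: "fls_nth (fls_const c * fls_X_intpow t) n = (if n = t then c else (0 :: complex))"
  by (subst fls_X_intpow_times_conv_shift(2)) (auto simp: fls_shift_nth)

lemma simple_op_0:
  assumes "c \<noteq> 0"
  shows "simple_op d c t 0 \<noteq> 0" "fls_subdegree (simple_op d c t 0) = t"
proof -
  have nth: "fls_nth (simple_op d c t 0) n = (if n = t then - c else 0)" for n
    unfolding simple_op_def by (simp add: fls_nth_mono del: fls_X_intpow_times_conv_shift)
  show "simple_op d c t 0 \<noteq> 0" using nth[of t] assms by (metis fls_zero_nth neg_equal_0_iff_equal)
  show "fls_subdegree (simple_op d c t 0) = t"
    by (rule fls_subdegree_eqI) (use nth assms in auto)
qed

lemma simple_op_slope:
  assumes "d > 0" "c \<noteq> 0"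
  shows "newton_single_slope d (simple_op d c t) (real_of_int t / real d)"
  unfolding newton_single_slope_def
proof (intro conjI allI impI)
  fix i assume i: "i \<le> d" "simple_op d c t i \<noteq> 0"
  then consider "i = 0" | "i = d" "i \<noteq> 0" by (auto simp: simple_op_def split: if_splits)
  then show "- real_of_int (fls_subdegree (simple_op d c t i)) \<le> - real_of_int (fls_subdegree (simple_op d c t 0)) + real_of_int t / real d * real i"
  proof cases
    case 2
    then have "simple_op d c t i = 1" by (simp add: simple_op_def)
    then show ?thesis using 2 assms by (simp add: simple_op_0)
  qed simp
qed (use assms in \<open>auto simp: simple_op_0\<close>)

lemma fls_inverse_mono: "inverse (fls_const c * fls_X_intpow t) = fls_const (inverse c) * fls_X_intpow (- t :: int)" if "c \<noteq> (0::complex)"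
proof (rule inverse_unique)
  have "(fls_const c * fls_X_intpow t) * (fls_const (inverse c) * fls_X_intpow (- t)) = (fls_const c * fls_const (inverse c)) * (fls_X_intpow t * fls_X_intpow (- t))"
    by (simp only: mult_ac)
  also have "fls_X_intpow t * fls_X_intpow (- t) = (1 :: complex fls)" by (simp add: fls_X_intpow_times_conv_shift)
  also have "fls_const c * fls_const (inverse c) = 1" using that by (simp add: fls_const_mult_const)
  finally show "(fls_const c * fls_X_intpow t) * (fls_const (inverse c) * fls_X_intpow (- t)) = 1" by simp
qed

lemma simple_op_div:
  assumes "c \<noteq> 0" "i < d"
  shows "- simple_op d c t (Suc i) / simple_op d c t 0 = (if Suc i = d then fls_const (inverse c) * fls_X_intpow (- t) else 0)"
proof (cases "Suc i = d")
  case True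
  then have s1: "simple_op d c t (Suc i) = 1" by (simp add: simple_op_def)
  have s0: "simple_op d c t 0 = - (fls_const c * fls_X_intpow t)" by (simp only: simple_op_def refl if_True)
  show ?thesis unfolding s1 s0
    by (simp only: minus_divide_divide inverse_eq_divide[symmetric] fls_inverse_mono[OF assms(1)] True if_True refl)
next
  case False
  then show ?thesis by (simp add: simple_op_def)
qed

lemma to_K'_mono: "to_K' (fls_const c * fls_X_intpow t) = fls_const c * fls_X_intpow (- t)"
proof -
  have l: "laurent_poly (fls_const c * fls_X_intpow t)" by (intro laurent_poly_mult laurent_poly_const laurent_poly_X)
  show ?thesis
    by (rule fls_eqI) (simp only: fls_nth_to_K'[OF l] fls_nth_mono, auto)
qed

text \<open>Expansion at infinity turns the companion matrix for c and t into that for c and - t,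
  because all coefficients are monomials. The growth estimate for a single-slope polygon thus gives
  the bounds at both points, for the matrix and for its contragredient.\<close>

lemma gdata_simple:
  assumes q: "q \<noteq> 0" and d: "d > 0" and c: "c \<noteq> 0"
  shows "gdata q d (\<lambda>_. real_of_int t / real d) (companion d (simple_op d c t)) ((companion_inv d (simple_op d c t))\<^sup>T)"
proof -
  define a where "a = simple_op d c t"
  define b where "b = simple_op d c (- t)"
  have a: "a d = 1" "a 0 \<noteq> 0" "newton_single_slope d a (real_of_int t / real d)"
    using d c simple_op_slope[OF d c] simple_op_0 by (auto simp: a_def) (simp add: simple_op_def)
  have b: "b d = 1" "b 0 \<noteq> 0" "newton_single_slope d b (- (real_of_int t / real d))"
    using d c simple_op_slope[OF d c, of "- t"] simple_op_0 by (auto simp: b_def) (simp add: simple_op_def)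
  have tK: "to_K' (a i) = b i" for i
  proof -
    have "to_K' (- h) = - to_K' h" if "laurent_poly h" for h using that by (intro fls_eqI) simp
    then show ?thesis
      unfolding a_def b_def simple_op_def
      by (auto simp: to_K'_mono intro!: laurent_poly_mult laurent_poly_const laurent_poly_X simp del: fls_X_intpow_times_conv_shift)
  qed
  have div: "- a (Suc i) / a 0 = (if Suc i = d then fls_const (inverse c) * fls_X_intpow (- t) else 0)"
    "- b (Suc i) / b 0 = (if Suc i = d then fls_const (inverse c) * fls_X_intpow (- (- t)) else 0)" if "i < d" for i
    unfolding a_def b_def by (rule simple_op_div[OF c that])+
  have al: "laurent_poly (a i)" for i unfolding a_def by (rule laurent_simple_op)
  have ad: "laurent_poly (- a (Suc i) / a 0)" if "i < d" for i
  proof (cases "Suc i = d")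
    case True
    show ?thesis unfolding div[OF that] if_P[OF True] by (intro laurent_poly_mult laurent_poly_const laurent_poly_X)
  next
    case False
    show ?thesis unfolding div[OF that] if_not_P[OF False] by simp
  qed
  have hC: "hat (companion d a) = companion d b"
  proof (rule eq_matI)
    fix i j assume "i < dim_row (companion d b)" "j < dim_col (companion d b)"
    then have ij: "i < d" "j < d" by (auto simp: companion_def)
    have "to_K' (- a i) = - b i" using al[of i] tK[of i] by (intro fls_eqI) (auto simp flip: tK)
    then show "hat (companion d a) $$ (i, j) = companion d b $$ (i, j)"
      using ij al[of i] by (auto simp: companion_def to_K'_add)
  qed (auto simp: companion_def)
  have hI: "hat (companion_inv d a) = companion_inv d b"
  proof (rule eq_matI)
    fix i j assume "i < dim_row (companion_inv d b)" "j < dim_col (companion_inv d b)"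
    then have ij: "i < d" "j < d" by (auto simp: companion_inv_def)
    have "to_K' (- a (Suc i) / a 0) = - b (Suc i) / b 0"
      unfolding div[OF ij(1)] if_distrib[of to_K'] to_K'_mono to_K'_0 ..
    then show "hat (companion_inv d a) $$ (i, j) = companion_inv d b $$ (i, j)"
      using ij by (auto simp: companion_inv_def)
  qed (auto simp: companion_inv_def)
  have lC: "entries_in laurent_poly (companion d a)" using al by (auto simp: entries_in_def companion_def)
  have lI: "entries_in laurent_poly ((companion_inv d a)\<^sup>T)" using ad by (auto simp: entries_in_def companion_inv_def)
  have iq: "inverse q \<noteq> 0" using q by simp
  note g1 = pure_companion_grow[OF q a]
  note g2 = pure_companion_grow[OF iq b]
  have "half_data q d (\<lambda>_. real_of_int t / real d) (companion d a)"
    unfolding half_data_def hC using lC g1 g2 by (auto simp: tri_def gro_def grow_def)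
  moreover have "half_data q d (\<lambda>_. - (real_of_int t / real d)) ((companion_inv d a)\<^sup>T)"
    unfolding half_data_def map_mat_transpose[symmetric] hI using lI g1 g2 by (auto simp: tri_def gro_def grow_def)
  ultimately show ?thesis using companion_inverse[OF a(2,1)] d by (simp add: gdata_def a_def)
qed

section \<open>Algebraizing extensions\<close>

lemma sub_block_four_block:
  assumes "A \<in> carrier_mat d d" "B \<in> carrier_mat d m" "C \<in> carrier_mat m d" "D \<in> carrier_mat m m"
  shows "sub_block 0 d (four_block_mat A B C D) = A" "sub_block d m (four_block_mat A B C D) = D"
  by (rule eq_matI; use assms in \<open>auto simp: sub_block_def\<close>)+

lemma mphi_four_block:
  assumes "A \<in> carrier_mat d d" "B \<in> carrier_mat d m" "C \<in> carrier_mat m d" "D \<in> carrier_mat m m"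
  shows "mphi q (four_block_mat A B C D) = four_block_mat (mphi q A) (mphi q B) (mphi q C) (mphi q D)"
  by (rule map_four_block_mat[OF assms])

lemma entries_in_four_block:
  assumes "A \<in> carrier_mat d d" "B \<in> carrier_mat d m" "C \<in> carrier_mat m d" "D \<in> carrier_mat m m"
    "entries_in P A" "entries_in P B" "entries_in P C" "entries_in P D"
  shows "entries_in P (four_block_mat A B C D)"
proof (rule entries_inI[OF four_block_carrier_mat[OF assms(1,4)]])
  fix i j assume "i < d + m" "j < d + m"
  then show "P (four_block_mat A B C D $$ (i, j))"
    using assms(1,4) entries_inD[OF assms(5,1)] entries_inD[OF assms(6,2)] entries_inD[OF assms(7,3)] entries_inD[OF assms(8,4)]
    by auto
qed

lemma entries_in_zero: "coef_ring P \<Longrightarrow> entries_in P (0\<^sub>m n m)"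
  by (auto simp: entries_in_def coef_ringD)

lemma tri_four_block:
  assumes "A \<in> carrier_mat d d" "D \<in> carrier_mat m m" "tri d u A" "tri m (\<lambda>p. u (d + p)) D"
    and "\<And>i j. i < d \<Longrightarrow> j < m \<Longrightarrow> u (d + j) < u i \<Longrightarrow> B $$ (i, j) = 0"
    and "\<And>i j. i < d \<Longrightarrow> j < m \<Longrightarrow> u i < u (d + j) \<Longrightarrow> C $$ (j, i) = 0"
  shows "tri (d + m) u (four_block_mat A B C D)"
  unfolding tri_def
proof (intro allI impI)
  fix i j assume ij: "i < d + m" "j < d + m" "u j < u i"
  consider "i < d" "j < d" | "i < d" "\<not> j < d" | "\<not> i < d" "j < d" | "\<not> i < d" "\<not> j < d" by blast
  then show "four_block_mat A B C D $$ (i, j) = 0"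
  proof cases
    case 1
    then show ?thesis using assms(1,2,3) ij by (simp add: tri_def)
  next
    case 2
    then show ?thesis using assms(5)[of i "j - d"] assms(1,2) ij by simp
  next
    case 3
    then show ?thesis using assms(6)[of j "i - d"] assms(1,2) ij by simp
  next
    case 4
    then have "D $$ (i - d, j - d) = 0"
      using assms(4) ij unfolding tri_def by (metis add_diff_inverse_nat nat_add_left_cancel_less)
    then show ?thesis using 4 assms(1,2) ij by simp
  qed
qed

lemma mphi_zero [simp]: "mphi q (0\<^sub>m n m) = 0\<^sub>m n m" by (rule eq_matI) auto

text \<open>The submodule of slope x comes first and may share its slope with part of the quotient,
  so growth rests on the crossing argument of \<open>gro_extension\<close>, for the matrix and for
  its lower triangular contragredient.\<close>

lemma gdata_extension:
  assumes q: "q \<noteq> 0" and g1: "gdata q d (\<lambda>_. x) C D1" and g2: "gdata q m s B D2" and s: "\<And>p. p < m \<Longrightarrow> x \<le> s p"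
    and U: "U \<in> carrier_mat d m" "entries_in laurent_poly U"
  shows "\<exists>D. gdata q (d + m) (\<lambda>p. if p < d then x else s (p - d)) (four_block_mat C U (0\<^sub>m m d) B) D"
proof -
  define u where "u p = (if p < d then x else s (p - d))" for p
  have c: "C \<in> carrier_mat d d" "D1 \<in> carrier_mat d d" "B \<in> carrier_mat m m" "D2 \<in> carrier_mat m m" "C * D1\<^sup>T = 1\<^sub>m d" "B * D2\<^sup>T = 1\<^sub>m m"
    "entries_in laurent_poly C" "entries_in laurent_poly B" "entries_in laurent_poly D1" "entries_in laurent_poly D2"
    "tri m s B" "tri m (\<lambda>i. - s i) D2"
    using g1 g2 by (auto simp: gdata_def half_data_def)
  \<comment> \<open>Off-diagonal block - C^-1 U B^-1 of the inverse matrix; it is Laurent because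
    the inverses of \<open>C\<close> and \<open>B\<close> are.\<close>
  define W where "W = - (D1\<^sup>T * (U * D2\<^sup>T))"
  have W0: "D1\<^sup>T * (U * D2\<^sup>T) \<in> carrier_mat d m"
    using c U by (intro mult_carrier_mat[of _ d d _ m] mult_carrier_mat[of _ d m _ m]) auto
  have W: "W \<in> carrier_mat d m" using W0 by (simp add: W_def)
  have Wl: "entries_in laurent_poly W"
  proof (rule entries_inI[OF W])
    fix i j assume ij: "i < d" "j < m"
    have "entries_in laurent_poly (D1\<^sup>T * (U * D2\<^sup>T))"
      using c U by (intro entries_in_mult[OF coef_ring_laurent, of _ d d _ m] entries_in_mult[OF coef_ring_laurent, of _ d m _ m] entries_in_transpose mult_carrier_mat[of _ d m]) auto
    then have "laurent_poly ((D1\<^sup>T * (U * D2\<^sup>T)) $$ (i, j))"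
      by (rule entries_inD[OF _ W0 ij])
    moreover have "W $$ (i, j) = - (D1\<^sup>T * (U * D2\<^sup>T)) $$ (i, j)"
      unfolding W_def using W0 ij by (intro index_uminus_mat) auto
    ultimately show "laurent_poly (W $$ (i, j))" by simp
  qed
  define X where "X = four_block_mat C U (0\<^sub>m m d) B"
  define D where "D = four_block_mat D1 (0\<^sub>m d m) (W\<^sup>T) D2"
  have Xc: "X \<in> carrier_mat (d + m) (d + m)" and Dc: "D \<in> carrier_mat (d + m) (d + m)" using c by (auto simp: X_def D_def)
  have DT: "D\<^sup>T = four_block_mat (D1\<^sup>T) W (0\<^sub>m m d) (D2\<^sup>T)"
    unfolding D_def using c W by (subst transpose_four_block_mat[of _ d d _ m _ m]) auto
  have XD: "X * D\<^sup>T = 1\<^sub>m (d + m)"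
  proof -
    have "X * D\<^sup>T = four_block_mat (C * D1\<^sup>T + U * 0\<^sub>m m d) (C * W + U * D2\<^sup>T) (0\<^sub>m m d * D1\<^sup>T + B * 0\<^sub>m m d) (0\<^sub>m m d * W + B * D2\<^sup>T)"
      unfolding X_def DT by (rule mult_four_block_mat[of _ d d _ m _ m _ _ d _ m]) (use c U W in auto)
    also have "C * W = - (U * D2\<^sup>T)"
    proof -
      have "C * W = - (C * (D1\<^sup>T * (U * D2\<^sup>T)))" unfolding W_def by (rule uminus_mult_right_mat) (use carrier_matD[OF c(1)] carrier_matD[OF c(2)] in simp)
      also have "C * (D1\<^sup>T * (U * D2\<^sup>T)) = (C * D1\<^sup>T) * (U * D2\<^sup>T)" using c U by (intro assoc_mult_mat[symmetric, of _ d d _ d _ m]) auto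
      also have "\<dots> = U * D2\<^sup>T" unfolding c(5) using c U by (intro left_mult_one_mat[of _ d m]) auto
      finally show ?thesis .
    qed
    also have "- (U * D2\<^sup>T) + U * D2\<^sup>T = 0\<^sub>m d m" using c U by (intro uminus_l_inv_mat[of _ d m]) auto
    finally show ?thesis using c U W by (simp add: left_mult_zero_mat[of _ d d] left_mult_zero_mat[of _ d m] right_mult_zero_mat[of _ d m] right_mult_zero_mat[of _ m m])
  qed
  have DX: "D\<^sup>T * X = 1\<^sub>m (d + m)" by (rule mat_mult_left_right_inverse[OF Xc _ XD]) (use Dc in simp)
  have Xl: "entries_in laurent_poly X"
    unfolding X_def by (rule entries_in_four_block[OF c(1) U(1) _ c(3) c(7) U(2) entries_in_zero[OF coef_ring_laurent] c(8)]) simp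
  have Dl: "entries_in laurent_poly D"
    unfolding D_def by (rule entries_in_four_block[OF c(2) _ _ c(4) c(9) entries_in_zero[OF coef_ring_laurent] entries_in_transpose[OF Wl] c(10)]) (use W in simp_all)
  have "half_data q (d + m) u X"
  proof (rule half_data_extension[OF q Xc Xl, where \<alpha> = 0 and \<beta> = 1])
    show "tri (d + m) u X"
      unfolding X_def by (rule tri_four_block[OF c(1,3)])
        (use s c(11) in \<open>auto simp: u_def tri_def not_less[symmetric]\<close>)
    show "tri (d + m) (\<lambda>p. if p < d then 0 else 1) X"
      unfolding X_def by (rule tri_four_block[OF c(1,3)]) (auto simp: tri_def)
    show "half_data q d u (sub_block 0 d X)"
      using g1 sub_block_four_block(1)[OF c(1) U(1) _ c(3)] unfolding X_def gdata_def
      by (simp add: half_data_def u_def gro_def tri_def)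
    show "half_data q m (\<lambda>i. u (d + i)) (sub_block d m X)"
      using g2 sub_block_four_block(2)[OF c(1) U(1) _ c(3)] unfolding X_def gdata_def
      by (simp add: u_def)
  qed simp
  moreover have "half_data q (d + m) (\<lambda>i. - u i) D"
  proof (rule half_data_extension[OF q Dc Dl, where \<alpha> = 1 and \<beta> = 0])
    show "tri (d + m) (\<lambda>i. - u i) D"
      unfolding D_def by (rule tri_four_block[OF c(2,4)])
        (use s c(12) in \<open>auto simp: u_def tri_def not_less[symmetric]\<close>)
    show "tri (d + m) (\<lambda>p. if p < d then 1 else 0) D"
      unfolding D_def by (rule tri_four_block[OF c(2,4)]) (auto simp: tri_def)
    show "half_data q d (\<lambda>i. - u i) (sub_block 0 d D)"
      using g1 sub_block_four_block(1)[OF c(2) _ _ c(4)] W unfolding D_def gdata_def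
      by (simp add: half_data_def u_def gro_def tri_def)
    show "half_data q m (\<lambda>i. - u (d + i)) (sub_block d m D)"
      using g2 sub_block_four_block(2)[OF c(2) _ _ c(4)] W unfolding D_def gdata_def
      by (simp add: u_def)
  qed simp
  ultimately have "gdata q (d + m) u X D" unfolding gdata_def using XD DX by simp
  then show ?thesis unfolding X_def u_def[abs_def] by blast
qed

text \<open>\<open>V\<close> is meant to be the inverse of the quotient matrix: after this
  normalization, changing the splitting by f changes the extension class by f - C phi(f) V. With one
  unknown for each entry this is x - a phi(x) = y, solvable modulo Laurent polynomials whatever the
  slopes.\<close>

lemma laurent_extension_class:
  fixes C U V :: "complex fls mat"
  assumes q: "0 < norm q" "norm q < 1" and C: "C \<in> carrier_mat d d" "entries_in conv_fls C"
    and V: "V \<in> carrier_mat m m" "entries_in conv_fls V" and Y: "Y \<in> carrier_mat d m" "entries_in conv_fls Y"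
  shows "\<exists>f. f \<in> carrier_mat d m \<and> entries_in conv_fls f \<and> entries_in laurent_poly (f - C * mphi q f * V + Y)"
proof -
  define I where "I = {..<d} \<times> {..<m}"
  define a where "a p r = C $$ (fst p, fst r) * V $$ (snd r, snd p)" for p r :: "nat \<times> nat"
  define y where "y p = - Y $$ p" for p
  have "\<exists>x. \<forall>p\<in>I. conv_fls (x p) \<and> laurent_poly (x p - (\<Sum>r\<in>I. a p r * phiK q (x r)) - y p)"
  proof (rule solve_mod_laurent[OF q])
    show "conv_fls (a p r)" if "p \<in> I" "r \<in> I" for p r
      using that C V by (auto simp: a_def I_def intro!: conv_fls_mult intro: entries_inD)
    show "conv_fls (y p)" if "p \<in> I" for p
      using that Y by (auto simp: y_def I_def intro!: conv_fls_uminus intro: entries_inD)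
  qed (simp add: I_def)
  then obtain x where x: "\<And>p. p \<in> I \<Longrightarrow> conv_fls (x p)" "\<And>p. p \<in> I \<Longrightarrow> laurent_poly (x p - (\<Sum>r\<in>I. a p r * phiK q (x r)) - y p)" by blast
  define f where "f = mat d m x"
  have f: "f \<in> carrier_mat d m" by (simp add: f_def)
  have "entries_in conv_fls f" by (rule entries_inI[OF f]) (use x(1) in \<open>auto simp: f_def I_def\<close>)
  moreover have "entries_in laurent_poly (f - C * mphi q f * V + Y)"
  proof (rule entries_inI)
    show "f - C * mphi q f * V + Y \<in> carrier_mat d m" using f C V Y by auto
    fix i j assume ij: "i < d" "j < m"
    have "(C * mphi q f * V) $$ (i, j) = (\<Sum>l<m. (\<Sum>k<d. C $$ (i, k) * phiK q (x (k, l))) * V $$ (l, j))"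
    proof -
      have cf: "C * mphi q f \<in> carrier_mat d m" using C f by (intro mult_carrier_mat[of _ d d]) auto
      have "(C * mphi q f) $$ (i, l) = (\<Sum>k<d. C $$ (i, k) * phiK q (x (k, l)))" if l: "l < m" for l
        using l f by (subst index_mult_sum[OF C(1) _ ij(1) l]) (auto simp: f_def)
      then show ?thesis unfolding index_mult_sum[OF cf V(1) ij] by simp
    qed
    also have "\<dots> = (\<Sum>k<d. \<Sum>l<m. C $$ (i, k) * V $$ (l, j) * phiK q (x (k, l)))"
      unfolding sum_distrib_right by (subst sum.swap) (simp add: mult_ac)
    also have "\<dots> = (\<Sum>r\<in>I. a (i, j) r * phiK q (x r))"
      by (simp add: I_def a_def sum.cartesian_product split_def)
    finally have e: "(C * mphi q f * V) $$ (i, j) = (\<Sum>r\<in>I. a (i, j) r * phiK q (x r))" .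
    have fij: "f $$ (i, j) = x (i, j)" using ij by (simp add: f_def)
    have "(f - C * mphi q f * V + Y) $$ (i, j) = f $$ (i, j) - (C * mphi q f * V) $$ (i, j) + Y $$ (i, j)"
      using ij f C V Y by (simp del: index_mult_mat(1))
    also have "\<dots> = x (i, j) - (\<Sum>r\<in>I. a (i, j) r * phiK q (x r)) - y (i, j)"
      unfolding e fij y_def by simp
    finally show "laurent_poly ((f - C * mphi q f * V + Y) $$ (i, j))" using x(2)[of "(i, j)"] ij by (simp add: I_def)
  qed
  ultimately show ?thesis using f by blast
qed

text \<open>The quotient is replaced by its global model \<open>B\<close>, and a unipotent change of
  basis by f makes the off-diagonal block Laurent. The equation for f is solved after multiplication
  by B^-1; multiplying back by \<open>B\<close> keeps the block Laurent.\<close>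

lemma gdata_split_extension:
  assumes q: "0 < norm q" "norm q < 1" and g1: "gdata q d (\<lambda>_. x) C D1" and g2: "gdata q m s B D2" and s: "\<And>p. p < m \<Longrightarrow> x \<le> s p"
    and U: "U \<in> carrier_mat d m" "entries_in conv_fls U" and A2: "A2 \<in> carrier_mat m m" "diso conv_fls (phiK q) m A2 m B"
  shows "\<exists>X D. gdata q (d + m) (\<lambda>p. if p < d then x else s (p - d)) X D \<and>
    diso conv_fls (phiK q) (d + m) (four_block_mat C U (0\<^sub>m m d) A2) (d + m) X"
proof -
  have q0: "q \<noteq> 0" using q by auto
  have c: "C \<in> carrier_mat d d" "B \<in> carrier_mat m m" "D2 \<in> carrier_mat m m" "D2\<^sup>T * B = 1\<^sub>m m" "B * D2\<^sup>T = 1\<^sub>m m"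
    "entries_in laurent_poly C" "entries_in laurent_poly B" "entries_in laurent_poly D2"
    using g1 g2 by (auto simp: gdata_def half_data_def)
  obtain G H where G: "G \<in> carrier_mat m m" "H \<in> carrier_mat m m" "entries_in conv_fls G" "entries_in conv_fls H"
    "G * H = 1\<^sub>m m" "H * G = 1\<^sub>m m" "G * A2 = B * mphi q G" using A2(2) unfolding diso_iff by auto
  have GH: "mphi q H * mphi q G = 1\<^sub>m m" using G q0 mphi_mult[of q H m m G m] by simp
  define V where "V = D2\<^sup>T"
  have V: "V \<in> carrier_mat m m" "entries_in conv_fls V" "V * B = 1\<^sub>m m"
    using c by (auto simp: V_def entries_in_transpose entries_in_laurent_conv)
  define UH where "UH = U * mphi q H"
  have UH: "UH \<in> carrier_mat d m" "entries_in conv_fls UH"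
    using U G by (auto simp: UH_def intro!: entries_in_mult[OF coef_ring_conv, of _ d m _ m] entries_in_mphi[OF coef_ring_conv])
  obtain f where f: "f \<in> carrier_mat d m" "entries_in conv_fls f" "entries_in laurent_poly (f - C * mphi q f * V + UH * V)"
    using laurent_extension_class[OF q c(1) entries_in_laurent_conv[OF c(6)] V(1,2), of "UH * V"] UH V
      entries_in_mult[OF coef_ring_conv UH(1) V(1)] by auto
  define F where "F = f * G"
  define U' where "U' = (f - C * mphi q f * V + UH * V) * B"
  have F: "F \<in> carrier_mat d m" "entries_in conv_fls F" using f G by (auto simp: F_def intro!: entries_in_mult[OF coef_ring_conv, of _ d m _ m])
  have cc: "C * mphi q f \<in> carrier_mat d m" using c f by (intro mult_carrier_mat[of _ d d]) auto
  have E: "f - C * mphi q f * V + UH * V \<in> carrier_mat d m" using f cc UH V by auto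
  have U': "U' \<in> carrier_mat d m" "entries_in laurent_poly U'"
    unfolding U'_def by (rule mult_carrier_mat[OF E c(2)], rule entries_in_mult[OF coef_ring_laurent E c(2) f(3) c(7)])
  have U'eq: "U' = f * B - C * mphi q f + UH"
  proof -
    have "U' = (f - C * mphi q f * V) * B + (UH * V) * B"
      unfolding U'_def using f cc V UH c by (intro add_mult_distrib_mat[of _ d m]) auto
    also have "(f - C * mphi q f * V) * B = f * B - (C * mphi q f * V) * B"
      using f cc V c by (intro minus_mult_distrib_mat[of _ d m]) auto
    also have "(C * mphi q f * V) * B = C * mphi q f" using cc V c by (simp add: assoc_mult_mat[of _ d m _ m _ m] right_mult_one_mat[of _ d m])
    also have "(UH * V) * B = UH" using UH V c by (simp add: assoc_mult_mat[of _ d m _ m _ m] right_mult_one_mat[of _ d m])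
    finally show ?thesis .
  qed
  define X where "X = four_block_mat C U' (0\<^sub>m m d) B"
  obtain D where D: "gdata q (d + m) (\<lambda>p. if p < d then x else s (p - d)) X D"
    using gdata_extension[OF q0 g1 g2 s U'] unfolding X_def by blast
  \<comment> \<open>Product of the unipotent matrix with off-diagonal block f and the block diagonal
    matrix with blocks 1 and \<open>G\<close>, whence F = f G.\<close>
  define P where "P = four_block_mat (1\<^sub>m d) F (0\<^sub>m m d) G"
  have P: "P \<in> carrier_mat (d + m) (d + m)" "entries_in conv_fls P"
    unfolding P_def by (rule four_block_carrier_mat[OF one_carrier_mat G(1)])
      (rule entries_in_four_block[OF one_carrier_mat F(1) _ G(1) entries_in_one[OF coef_ring_conv] F(2) entries_in_zero[OF coef_ring_conv] G(3)], simp)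
  have "det G * det H = 1" using det_mult[OF G(1,2)] G(5) by simp
  then have "det P \<noteq> 0" unfolding P_def using F G
    by (subst det_four_block_mat_lower_left_zero[of _ d _ m]) auto
  then obtain Q where Q: "Q \<in> carrier_mat (d + m) (d + m)" "entries_in conv_fls Q" "P * Q = 1\<^sub>m (d + m)" "Q * P = 1\<^sub>m (d + m)"
    using conv_matrix_inverse[OF P] by blast
  define A where "A = four_block_mat C U (0\<^sub>m m d) A2"
  have "P * A = four_block_mat (1\<^sub>m d * C + F * 0\<^sub>m m d) (1\<^sub>m d * U + F * A2) (0\<^sub>m m d * C + G * 0\<^sub>m m d) (0\<^sub>m m d * U + G * A2)"
    unfolding P_def A_def by (rule mult_four_block_mat[of _ d d _ m _ m _ _ d _ m]) (use c U F G A2 in auto)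
  also have "\<dots> = four_block_mat C (U + F * A2) (0\<^sub>m m d) (G * A2)"
    using c U F G A2 by (simp add: left_mult_one_mat[of _ d d] left_mult_one_mat[of _ d m] left_mult_zero_mat[of _ d d] left_mult_zero_mat[of _ d m] right_mult_zero_mat[of _ d m] right_mult_zero_mat[of _ m m] mult_carrier_mat[of F d m A2 m])
  finally have PA: "P * A = four_block_mat C (U + F * A2) (0\<^sub>m m d) (G * A2)" .
  have mP: "mphi q P = four_block_mat (1\<^sub>m d) (mphi q F) (0\<^sub>m m d) (mphi q G)"
    unfolding P_def using F G by (subst mphi_four_block[of _ d _ m]) auto
  have "X * mphi q P = four_block_mat (C * 1\<^sub>m d + U' * 0\<^sub>m m d) (C * mphi q F + U' * mphi q G) (0\<^sub>m m d * 1\<^sub>m d + B * 0\<^sub>m m d) (0\<^sub>m m d * mphi q F + B * mphi q G)"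
    unfolding X_def mP by (rule mult_four_block_mat[of _ d d _ m _ m _ _ d _ m]) (use c U' F G in auto)
  also have "\<dots> = four_block_mat C (C * mphi q F + U' * mphi q G) (0\<^sub>m m d) (B * mphi q G)"
    using c U' F G by (simp add: right_mult_one_mat[of _ d d] left_mult_zero_mat[of _ d d] left_mult_zero_mat[of _ d m] right_mult_zero_mat[of _ d m] right_mult_zero_mat[of _ m m])
  finally have XP: "X * mphi q P = four_block_mat C (C * mphi q F + U' * mphi q G) (0\<^sub>m m d) (B * mphi q G)" .
  have "C * mphi q F + U' * mphi q G = U + F * A2"
  proof -
    have FA: "F * A2 = f * B * mphi q G" unfolding F_def using f G A2 c by (simp add: assoc_mult_mat[of _ d m _ m _ m])
    have CF: "C * mphi q F = C * mphi q f * mphi q G"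
      unfolding F_def using f G c q0 by (subst mphi_mult[of _ _ d m _ m]) (auto simp: assoc_mult_mat[of _ d d _ m _ m])
    have UHG: "UH * mphi q G = U" unfolding UH_def using U G GH by (simp add: assoc_mult_mat[of _ d m _ m _ m])
    have fB: "f * B \<in> carrier_mat d m" using f c by (intro mult_carrier_mat[of _ d m])
    have "U' * mphi q G = (f * B - C * mphi q f) * mphi q G + UH * mphi q G"
      unfolding U'eq by (rule add_mult_distrib_mat[OF minus_carrier_mat[OF cc] UH(1)]) (use G in simp)
    also have "(f * B - C * mphi q f) * mphi q G = f * B * mphi q G - C * mphi q f * mphi q G"
      using fB cc G by (intro minus_mult_distrib_mat[of _ d m]) auto
    finally have "U' * mphi q G = F * A2 - C * mphi q F + U" unfolding FA CF UHG .
    moreover have "C * mphi q F \<in> carrier_mat d m" "F * A2 \<in> carrier_mat d m" using c F A2 by (auto intro: mult_carrier_mat[of _ d d] mult_carrier_mat[of _ d m])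
    moreover have PR: "P + (R - P + U) = U + R" if "P \<in> carrier_mat d m" "R \<in> carrier_mat d m" for P R
      by (rule eq_matI) (use that U(1) in auto)
    ultimately show ?thesis by (simp only: PR)
  qed
  then have "P * A = X * mphi q P" unfolding PA XP G(7) by simp
  then have "diso conv_fls (phiK q) (d + m) A (d + m) X" unfolding diso_iff using P Q by blast
  then show ?thesis using D unfolding A_def by blast
qed

text \<open>The vectors f, ..., Phi^(d-1) f are independent because their norms are incongruent, and
  span a submodule given by Phi^d - c z^t; completing them to a basis exhibits the extension. The
  quotient inherits the growth rate x, which keeps the slopes ascending in the recursion.\<close>

lemma first_slope_splitting:
  assumes q: "0 < norm q" "norm q < 1" "\<And>i. i > 0 \<Longrightarrow> q ^ i \<noteq> 1"
    and A: "A \<in> carrier_mat n n" "entries_in conv_fls A" "det A \<noteq> 0" "grow q n A y" and n: "n \<ge> 1"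
  shows "\<exists>x t d c m U A2. n = d + m \<and> d > 0 \<and> c \<noteq> 0 \<and> x = real_of_int t / real d \<and> y \<le> x \<and>
    U \<in> carrier_mat d m \<and> entries_in conv_fls U \<and> A2 \<in> carrier_mat m m \<and> entries_in conv_fls A2 \<and> det A2 \<noteq> 0 \<and>
    grow q m A2 x \<and> diso conv_fls (phiK q) n A n (four_block_mat (companion d (simple_op d c t)) U (0\<^sub>m m d) A2)"
proof -
  have q0: "q \<noteq> 0" using q by auto
  obtain a G H where a: "\<And>i. i \<le> n \<Longrightarrow> conv_fls (a i)" "a n = 1" and G: "G \<in> carrier_mat n n" "H \<in> carrier_mat n n"
    "entries_in conv_fls G" "entries_in conv_fls H" "G * H = 1\<^sub>m n" "H * G = 1\<^sub>m n" "G * A = companion n a * mphi q G"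
    using cyclic_companion[OF q0 q(3) A(1-3) n] by blast
  define C where "C = companion n a"
  have C: "C \<in> carrier_mat n n" "G * A = C * mphi q G" using G by (auto simp: C_def)
  have Cconv: "entries_in conv_fls C"
  proof (rule entries_inI[OF C(1)])
    fix i j assume "i < n" "j < n"
    then show "conv_fls (C $$ (i, j))" using a(1)[of i] by (auto simp: C_def companion_def)
  qed
  have "det G * det A = det C * phiK q (det G)"
    using arg_cong[OF C(2), of det] A(1) G(1) C(1) q0
    by (simp add: det_mult[of G n A] det_mult[of C n "mphi q G"] det_mphi del: comm_ring_hom.hom_det)
  moreover have "det G \<noteq> 0" using arg_cong[OF G(5), of det] det_mult[OF G(1,2)] by auto
  ultimately have dC: "det C \<noteq> 0" using A(3) by auto
  then have a0: "a 0 \<noteq> 0" using det_companion[OF n, of a] by (auto simp: C_def)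
  have "H * C = A * mphi q H"
    by (rule hom_inverse[of q A n C G H]) (use q0 A G C in auto)
  then have gC: "grow q n C y"
    by (intro grow_gauge[of q C n A H G]) (use q0 A G C in auto)
  obtain x t d c f where x: "x = real_of_int t / real d" and d: "d > 0" and cop: "coprime t (int d)" and c: "c \<noteq> 0"
    and va: "\<And>i. i < n \<Longrightarrow> vge (a i) (x * (real n - real i))" and mx: "\<And>y. grow q n C y \<Longrightarrow> y \<le> x"
    and f: "\<And>l. l < n \<Longrightarrow> conv_fls (f l)" "\<exists>l<n. f l \<noteq> 0"
    and fk: "\<And>l. l < n \<Longrightarrow> kry q C f d l = fls_const c * fls_X_intpow t * f l"
    using slope_vector[OF q(1,2) n a a0 C_def] by blast
  have ck: "conv_fls (kry q C f j l)" if "l < n" for j l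
    unfolding kry_def using that C f entries_in_it[OF coef_ring_conv C(1) Cconv]
    by (intro coef_ring_sum[OF coef_ring_conv] conv_fls_mult conv_fls_phiK) (auto intro: entries_inD[of _ _ n n])
  obtain X where dn: "d \<le> n" and X: "X \<in> carrier_mat n n" "entries_in conv_fls X" "det X \<noteq> 0"
    "\<And>j l. j < d \<Longrightarrow> l < n \<Longrightarrow> X $$ (l, j) = kry q C f j l"
    using basis_extension[of d n "kry q C f", OF ck kry_independent[OF q0 C_def va x d cop fk c f(2)]] by blast
  obtain V where V: "V \<in> carrier_mat n n" "entries_in conv_fls V" "X * V = 1\<^sub>m n" "V * X = 1\<^sub>m n"
    using conv_matrix_inverse[OF X(1-3)] by blast
  have CX: "C * mphi q X \<in> carrier_mat n n" using C X by (intro mult_carrier_mat[of _ n n]) auto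
  define Y where "Y = V * (C * mphi q X)"
  have Y: "Y \<in> carrier_mat n n" unfolding Y_def by (rule mult_carrier_mat[OF V(1) CX])
  have Yc: "entries_in conv_fls Y" unfolding Y_def
    by (rule entries_in_mult[OF coef_ring_conv V(1) CX V(2) entries_in_mult[OF coef_ring_conv C(1) _ Cconv]])
      (use X in \<open>auto intro!: entries_in_mphi[OF coef_ring_conv]\<close>)
  have XY: "X * Y = C * mphi q X"
    unfolding Y_def using X V CX by (simp add: assoc_mult_mat[of _ n n _ n _ n, symmetric] left_mult_one_mat[of _ n n])
  have k0: "kry q C f 0 l = f l" if "l < n" for l
    using that C(1) by (simp add: kry_def if_distrib[of "\<lambda>x. x * _"] cong: if_cong)
  have CXk: "(C * mphi q X) $$ (l, j) = kry q C f (Suc j) l" if "j < d" "l < n" for j l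
    unfolding kry_Suc[OF q0 C(1) that(2)] using that dn X
    by (subst index_mult_sum[OF C(1) _ that(2), of _ n]) auto
  \<comment> \<open>Phi shifts the Krylov basis and closes up at Phi^d f = c z^t f, so the first d
    columns stay in the submodule.\<close>
  have Ycol: "Y $$ (k, j) = (if k < d then companion d (simple_op d c t) $$ (k, j) else 0)" if k: "k < n" and j: "j < d" for k j
  proof -
    have jn: "j < n" using j dn by simp
    have Yk: "Y $$ (k, j) = (\<Sum>l<n. V $$ (k, l) * kry q C f (Suc j) l)"
      unfolding Y_def index_mult_sum[OF V(1) CX k jn] using CXk[OF j] by simp
    have VX: "(\<Sum>l<n. V $$ (k, l) * kry q C f i l) = (if k = i then 1 else 0)" if "i < d" for i
    proof -
      have i: "i < n" using that dn by simp
      have "(\<Sum>l<n. V $$ (k, l) * kry q C f i l) = (\<Sum>l<n. V $$ (k, l) * X $$ (l, i))" using X(4)[OF that] by simp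
      also have "\<dots> = (1\<^sub>m n :: complex fls mat) $$ (k, i)" unfolding index_mult_sum[OF V(1) X(1) k i, symmetric] V(4) ..
      finally show ?thesis using k i by simp
    qed
    show ?thesis
    proof (cases "Suc j = d")
      case True
      have "Y $$ (k, j) = (\<Sum>l<n. fls_const c * fls_X_intpow t * (V $$ (k, l) * kry q C f 0 l))"
        unfolding Yk True by (intro sum.cong refl) (simp only: lessThan_iff fk k0 mult_ac)
      also have "\<dots> = fls_const c * fls_X_intpow t * (if k = 0 then 1 else 0)"
        unfolding sum_distrib_left[symmetric] VX[OF d] ..
      finally show ?thesis using True d by (auto simp: companion_def simple_op_def)
    next
      case False
      then show ?thesis unfolding Yk using VX[of "Suc j"] j by (auto simp: companion_def)
    qed
  qed
  define m where "m = n - d"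
  have m: "n = d + m" using dn by (simp add: m_def)
  define U where "U = mat d m (\<lambda>(i, j). Y $$ (i, d + j))"
  define A2 where "A2 = sub_block d m Y"
  have U: "U \<in> carrier_mat d m" "entries_in conv_fls U"
    using entries_inD[OF Yc Y] m by (auto simp: U_def entries_in_def)
  have A2: "A2 \<in> carrier_mat m m" "entries_in conv_fls A2"
    using entries_inD[OF Yc Y] m by (auto simp: A2_def sub_block_def entries_in_def)
  have Yb: "Y = four_block_mat (companion d (simple_op d c t)) U (0\<^sub>m m d) A2"
  proof (rule eq_matI)
    fix i j assume "i < dim_row (four_block_mat (companion d (simple_op d c t)) U (0\<^sub>m m d) A2)"
      "j < dim_col (four_block_mat (companion d (simple_op d c t)) U (0\<^sub>m m d) A2)"
    then have ij: "i < d + m" "j < d + m" using A2 by (auto simp: companion_def)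
    show "Y $$ (i, j) = four_block_mat (companion d (simple_op d c t)) U (0\<^sub>m m d) A2 $$ (i, j)"
      using ij Ycol[of i j] m A2(1) by (auto simp: U_def A2_def sub_block_def) (auto simp: companion_def)
  qed (use Y A2 m in \<open>auto simp: companion_def\<close>)
  have "det X * det Y = det C * phiK q (det X)"
    using arg_cong[OF XY, of det] X(1) Y C(1) q0
    by (simp add: det_mult[of X n Y] det_mult[of C n "mphi q X"] det_mphi del: comm_ring_hom.hom_det)
  then have "det Y \<noteq> 0" using dC X(3) q0 by auto
  moreover have "det Y = det (companion d (simple_op d c t)) * det A2"
    unfolding Yb using U A2 by (intro det_four_block_mat_lower_left_zero[of _ d _ m]) auto
  ultimately have dA2: "det A2 \<noteq> 0" by auto
  have "grow q n C x"
    by (rule grow_weights[OF q0 C(1), where r = "\<lambda>i. x * real i"]) (use companion_weights[of n a x] va in \<open>auto simp: C_def\<close>)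
  then have gY: "grow q n Y x" by (intro grow_gauge[OF q0 Y C(1) X(1) V(1) V(4) XY])
  \<comment> \<open>The labels 0 and 1 used here only mark submodule and quotient; the growth rate
    is x throughout.\<close>
  have gA2: "grow q m A2 x"
  proof (cases "m = 0")
    case False
    show ?thesis unfolding A2_def
    proof (rule sub_block_grow[OF Y, where s = "\<lambda>p. if p < d then 0 else 1" and \<sigma> = 1 and t = "\<lambda>_. x"])
      show "tri n (\<lambda>p. if p < d then 0 else 1) Y" using Ycol by (auto simp: tri_def split: if_splits)
      show "gro q n (\<lambda>_. x) Y" using gY by (simp add: gro_def grow_def)
    qed (use False m in auto)
  qed (simp add: grow_def)
  have "diso conv_fls (phiK q) n Y n C" unfolding diso_iff using X V XY by blast
  then have "diso conv_fls (phiK q) n C n Y" by (rule diso_sym[OF q0 Y C(1)])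
  moreover have "diso conv_fls (phiK q) n A n C" unfolding diso_iff using G C by blast
  ultimately have "diso conv_fls (phiK q) n A n Y" using diso_trans[OF coef_ring_conv q0 A(1) C(1) Y] by blast
  then show ?thesis using m d c x mx[OF gC] U A2 dA2 gA2 unfolding Yb by blast
qed

text \<open>The growth rate y is carried through the induction: the quotient grows at rate x, so its
  model has all slopes at least x and may follow the submodule of slope x in an ascending
  filtration.\<close>

lemma essential_surjectivity:
  assumes q: "0 < norm q" "norm q < 1" "\<And>i. i > 0 \<Longrightarrow> q ^ i \<noteq> 1"
    and A: "A \<in> carrier_mat n n" "entries_in conv_fls A" "det A \<noteq> 0" "grow q n A y"
  shows "\<exists>B D s. gdata q n s B D \<and> (\<forall>p<n. y \<le> s p) \<and> diso conv_fls (phiK q) n A n B"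
  using A
proof (induction n arbitrary: A y rule: less_induct)
  case (less n)
  have q0: "q \<noteq> 0" using q by auto
  show ?case
  proof (cases "n = 0")
    case True
    have "gdata q n (\<lambda>_. y) A A"
      using less.prems(1) True by (auto simp: gdata_def half_data_def entries_in_def tri_def gro_def intro!: eq_matI)
    then show ?thesis using diso_refl[OF coef_ring_conv less.prems(1)] True by blast
  next
    case False
    obtain x t d c m U A2 where n: "n = d + m" and d: "d > 0" and c: "c \<noteq> 0" and x: "x = real_of_int t / real d" "y \<le> x"
      and U: "U \<in> carrier_mat d m" "entries_in conv_fls U"
      and A2: "A2 \<in> carrier_mat m m" "entries_in conv_fls A2" "det A2 \<noteq> 0" "grow q m A2 x"
      and iso: "diso conv_fls (phiK q) n A n (four_block_mat (companion d (simple_op d c t)) U (0\<^sub>m m d) A2)"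
      using first_slope_splitting[OF q less.prems] False by (metis One_nat_def Suc_leI neq0_conv)
    have "m < n" using n d by simp
    from less.IH[OF this A2] obtain B D s where B: "gdata q m s B D" "\<And>p. p < m \<Longrightarrow> x \<le> s p" "diso conv_fls (phiK q) m A2 m B" by blast
    have g1: "gdata q d (\<lambda>_. x) (companion d (simple_op d c t)) ((companion_inv d (simple_op d c t))\<^sup>T)"
      unfolding x(1) by (rule gdata_simple[OF q0 d c])
    obtain X E where X: "gdata q (d + m) (\<lambda>p. if p < d then x else s (p - d)) X E"
      "diso conv_fls (phiK q) (d + m) (four_block_mat (companion d (simple_op d c t)) U (0\<^sub>m m d) A2) (d + m) X"
      using gdata_split_extension[OF q(1,2) g1 B(1,2) U A2(1) B(3)] by blast
    have "four_block_mat (companion d (simple_op d c t)) U (0\<^sub>m m d) A2 \<in> carrier_mat n n"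
      unfolding n using A2(1) by (intro four_block_carrier_mat) auto
    moreover have "X \<in> carrier_mat n n" using X(1) by (simp add: gdata_def half_data_def n)
    ultimately have "diso conv_fls (phiK q) n A n X"
      using diso_trans[OF coef_ring_conv q0 less.prems(1) _ _ iso] X(2) unfolding n by blast
    moreover have "\<forall>p<n. y \<le> (if p < d then x else s (p - d))"
      using x(2) B(2) n by (auto intro: order_trans[OF x(2)])
    ultimately show ?thesis using X(1) unfolding n[symmetric] by blast
  qed
qed

section \<open>The equivalence\<close>

lemma gdata_global_mod: "gdata q n s A D \<Longrightarrow> global_mod n A"
  unfolding global_mod_def dmod_def invertible_over_def
  by (auto simp: gdata_def half_data_def entries_in_transpose intro!: exI[of _ "D\<^sup>T"])

lemma gdata_imp_asc_self:
  assumes "q \<noteq> 0" "\<And>i. i > 0 \<Longrightarrow> q ^ i \<noteq> 1" "gdata q n s A D"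
  shows "asc_slope_filtration q n A"
  by (rule gdata_imp_asc[OF assms(1,2) gdata_global_mod[OF assms(3)] diso_refl[OF coef_ring_laurent] assms(3)])
    (use assms(3) in \<open>auto simp: gdata_def half_data_def\<close>)

lemma diso_kron:
  assumes P: "coef_ring P" and q: "q \<noteq> 0" and c: "A \<in> carrier_mat n n" "A' \<in> carrier_mat n n" "B \<in> carrier_mat m m" "B' \<in> carrier_mat m m"
    and iso: "diso P (phiK q) n A n A'" "diso P (phiK q) m B m B'"
  shows "diso P (phiK q) (n * m) (kron A B) (n * m) (kron A' B')"
proof -
  obtain G H where G: "G \<in> carrier_mat n n" "H \<in> carrier_mat n n" "entries_in P G" "entries_in P H"
    "G * H = 1\<^sub>m n" "H * G = 1\<^sub>m n" "G * A = A' * mphi q G" using iso(1) unfolding diso_iff by auto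
  obtain G' H' where G': "G' \<in> carrier_mat m m" "H' \<in> carrier_mat m m" "entries_in P G'" "entries_in P H'"
    "G' * H' = 1\<^sub>m m" "H' * G' = 1\<^sub>m m" "G' * B = B' * mphi q G'" using iso(2) unfolding diso_iff by auto
  have "kron G G' * kron A B = kron A' B' * mphi q (kron G G')"
    unfolding mphi_kron[OF q G(1) G'(1)] kron_mult[OF G(1) G'(1) c(1,3)] G(7) G'(7)
    by (rule kron_mult[symmetric]) (use c G G' in auto)
  moreover have "kron G G' * kron H H' = 1\<^sub>m (n * m)" "kron H H' * kron G G' = 1\<^sub>m (n * m)"
    using kron_mult[OF G(1) G'(1) G(2) G'(2)] kron_mult[OF G(2) G'(2) G(1) G'(1)] G(5,6) G'(5,6) by (simp_all add: kron_one)
  ultimately show ?thesis unfolding diso_iff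
    using G(1,2) G'(1,2) kron_entries[OF P G(1) G'(1) G(3) G'(3)] kron_entries[OF P G(2) G'(2) G(4) G'(4)]
    by (intro conjI refl exI[of _ "kron G G'"] exI[of _ "kron H H'"]) auto
qed

lemma dmod_kron:
  assumes P: "coef_ring P" and "dmod P n A" "dmod P m (B :: complex fls mat)"
  shows "dmod P (n * m) (kron A B)"
proof -
  obtain Ai where A: "A \<in> carrier_mat n n" "Ai \<in> carrier_mat n n" "entries_in P A" "entries_in P Ai" "A * Ai = 1\<^sub>m n" "Ai * A = 1\<^sub>m n"
    using assms(2) unfolding dmod_def invertible_over_def by blast
  obtain Bi where B: "B \<in> carrier_mat m m" "Bi \<in> carrier_mat m m" "entries_in P B" "entries_in P Bi" "B * Bi = 1\<^sub>m m" "Bi * B = 1\<^sub>m m"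
    using assms(3) unfolding dmod_def invertible_over_def by blast
  show ?thesis unfolding dmod_def invertible_over_def
    using A(1,2) B(1,2) kron_entries[OF P A(1) B(1) A(3) B(3)] kron_entries[OF P A(2) B(2) A(4) B(4)]
      kron_mult[OF A(1) B(1) A(2) B(2)] kron_mult[OF A(2) B(2) A(1) B(1)] A(5,6) B(5,6)
    by (intro conjI exI[of _ "kron Ai Bi"]) (auto simp: kron_one)
qed

lemma asc_imp_global_mod: "asc_slope_filtration q n A \<Longrightarrow> global_mod n A"
  by (simp add: asc_slope_filtration_def)

lemma global_mod_carrier: "global_mod n A \<Longrightarrow> A \<in> carrier_mat n n"
  by (simp add: global_mod_def dmod_def invertible_over_def)

lemma asc_kron:
  assumes q: "q \<noteq> 0" "\<And>i. i > 0 \<Longrightarrow> q ^ i \<noteq> 1" and asc: "asc_slope_filtration q n A" "asc_slope_filtration q m B"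
  shows "asc_slope_filtration q (n * m) (kron A B)"
proof -
  note gl = asc[THEN asc_imp_global_mod]
  obtain A' D s where A': "A' \<in> carrier_mat n n" "diso laurent_poly (phiK q) n A n A'" "gdata q n s A' D"
    using asc_imp_gdata[OF q(1) asc(1)] by blast
  obtain B' E t where B': "B' \<in> carrier_mat m m" "diso laurent_poly (phiK q) m B m B'" "gdata q m t B' E"
    using asc_imp_gdata[OF q(1) asc(2)] by blast
  have gm: "global_mod (n * m) (kron A B)" using dmod_kron[OF coef_ring_laurent] gl by (simp add: global_mod_def)
  have iso: "diso laurent_poly (phiK q) (n * m) (kron A B) (n * m) (kron A' B')"
    by (rule diso_kron[OF coef_ring_laurent q(1) global_mod_carrier[OF gl(1)] A'(1) global_mod_carrier[OF gl(2)] B'(1) A'(2) B'(2)])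
  show ?thesis by (rule gdata_imp_asc[OF q(1) _ gm iso gdata_kron[OF q(1) A'(3) B'(3)]]) (rule q(2))
qed

text \<open>Dualizing reverses the filtration and changes the sign of the slopes, so the filtration
  ascends again; in slope data this just exchanges \<open>B\<close> and \<open>D\<close>.\<close>

lemma asc_dual:
  assumes q: "q \<noteq> 0" "\<And>i. i > 0 \<Longrightarrow> q ^ i \<noteq> 1" and asc: "asc_slope_filtration q n A"
  shows "asc_slope_filtration q n (dual_mat laurent_poly n A)"
proof -
  define Ai where "Ai = (SOME B. B \<in> carrier_mat n n \<and> entries_in laurent_poly B \<and> A * B = 1\<^sub>m n \<and> B * A = 1\<^sub>m n)"
  note gl = asc_imp_global_mod[OF asc]
  then have A: "A \<in> carrier_mat n n" "entries_in laurent_poly A"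
    and ex: "\<exists>B. B \<in> carrier_mat n n \<and> entries_in laurent_poly B \<and> A * B = 1\<^sub>m n \<and> B * A = 1\<^sub>m n"
    unfolding global_mod_def dmod_def invertible_over_def by blast+
  have Ai: "Ai \<in> carrier_mat n n" "entries_in laurent_poly Ai" "A * Ai = 1\<^sub>m n" "Ai * A = 1\<^sub>m n"
    using someI_ex[OF ex] unfolding Ai_def by blast+
  obtain B D s where B: "B \<in> carrier_mat n n" "diso laurent_poly (phiK q) n A n B" "gdata q n s B D"
    using asc_imp_gdata[OF q(1) asc] by blast
  obtain G H where G: "G \<in> carrier_mat n n" "H \<in> carrier_mat n n" "entries_in laurent_poly G" "entries_in laurent_poly H"
    "G * H = 1\<^sub>m n" "H * G = 1\<^sub>m n" "G * A = B * mphi q G" using B(2) unfolding diso_iff by auto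
  have D: "D \<in> carrier_mat n n" "B * D\<^sup>T = 1\<^sub>m n" using B(3) by (auto simp: gdata_def half_data_def)
  have "H * B = A * mphi q H" by (rule hom_inverse[of q A n B G H]) (use q A B G in auto)
  then have "H\<^sup>T * Ai\<^sup>T = (D\<^sup>T)\<^sup>T * mphi q (H\<^sup>T)"
    by (intro dual_gauge[of q A n B Ai "D\<^sup>T" H]) (use q A B G D Ai in auto)
  then have e: "H\<^sup>T * Ai\<^sup>T = D * mphi q (H\<^sup>T)" by simp
  have "H\<^sup>T * G\<^sup>T = 1\<^sub>m n" "G\<^sup>T * H\<^sup>T = 1\<^sub>m n"
    using G by (simp_all add: transpose_mult[of _ n n _ n, symmetric])
  then have iso: "diso laurent_poly (phiK q) n (Ai\<^sup>T) n D" unfolding diso_iff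
    using G e by (intro conjI refl exI[of _ "H\<^sup>T"] exI[of _ "G\<^sup>T"]) (auto simp: entries_in_transpose)
  have gm: "global_mod n (Ai\<^sup>T)"
  proof -
    have "Ai\<^sup>T * A\<^sup>T = 1\<^sub>m n" "A\<^sup>T * Ai\<^sup>T = 1\<^sub>m n"
      using A Ai by (simp_all add: transpose_mult[of _ n n _ n, symmetric])
    then show ?thesis unfolding global_mod_def dmod_def invertible_over_def
      using A Ai by (intro conjI exI[of _ "A\<^sup>T"]) (auto simp: entries_in_transpose)
  qed
  have "asc_slope_filtration q n (Ai\<^sup>T)"
    by (rule gdata_imp_asc[OF q(1) _ gm iso gdata_dual[OF B(3)]]) (rule q(2))
  then show ?thesis by (simp add: dual_mat_def Ai_def)
qed

text \<open>The unit object is the companion module of Phi - 1, of slope 0.\<close>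

lemma asc_unit:
  assumes q: "q \<noteq> 0" "\<And>i. i > 0 \<Longrightarrow> q ^ i \<noteq> 1"
  shows "asc_slope_filtration q 1 (1\<^sub>m 1)"
proof -
  have "companion 1 (simple_op 1 1 0) = 1\<^sub>m 1"
    by (rule eq_matI) (auto simp: companion_def simple_op_def)
  then show ?thesis using gdata_imp_asc_self[OF q gdata_simple[OF q(1), of 1 1 0]] by simp
qed

text \<open>A morphism over K is transported to the adapted bases, where it is Laurent, and carried
  back by base changes that are themselves defined over R.\<close>

lemma asc_hom_laurent:
  assumes q: "0 < norm q" "norm q < 1" and asc: "asc_slope_filtration q n A" "asc_slope_filtration q m B"
    and F: "dhom conv_fls (phiK q) n A m B F"
  shows "dhom laurent_poly (phiK q) n A m B F"
proof -
  have q0: "q \<noteq> 0" using q by auto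
  note car = asc[THEN asc_imp_global_mod, THEN global_mod_carrier]
  have F: "F \<in> carrier_mat m n" "entries_in conv_fls F" "F * A = B * mphi q F" using F by (auto simp: dhom_def)
  obtain A' D s where A': "A' \<in> carrier_mat n n" "diso laurent_poly (phiK q) n A n A'" "gdata q n s A' D"
    using asc_imp_gdata[OF q0 asc(1)] by blast
  obtain G H where G: "G \<in> carrier_mat n n" "H \<in> carrier_mat n n" "entries_in laurent_poly G" "entries_in laurent_poly H"
    "G * H = 1\<^sub>m n" "H * G = 1\<^sub>m n" "G * A = A' * mphi q G" using A'(2) unfolding diso_iff by auto
  obtain B' E t where B': "B' \<in> carrier_mat m m" "diso laurent_poly (phiK q) m B m B'" "gdata q m t B' E"
    using asc_imp_gdata[OF q0 asc(2)] by blast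
  obtain X Y where X: "X \<in> carrier_mat m m" "Y \<in> carrier_mat m m" "entries_in laurent_poly X" "entries_in laurent_poly Y"
    "X * Y = 1\<^sub>m m" "Y * X = 1\<^sub>m m" "X * B = B' * mphi q X" using B'(2) unfolding diso_iff by auto
  have HA: "H * A' = A * mphi q H" by (rule hom_inverse[OF q0 car(1) A'(1) G(1,2,5,6,7)])
  have FH: "(F * H) * A' = B * mphi q (F * H)" by (rule hom_comp[OF q0 A'(1) car(1,2) G(2) F(1) HA F(3)])
  have FHc: "F * H \<in> carrier_mat m n" by (rule mult_carrier_mat[OF F(1) G(2)])
  define F' where "F' = X * (F * H)"
  have F'c: "F' \<in> carrier_mat m n" unfolding F'_def by (rule mult_carrier_mat[OF X(1) FHc])
  have "F' * A' = B' * mphi q F'" unfolding F'_def by (rule hom_comp[OF q0 A'(1) car(2) B'(1) FHc X(1) FH X(7)])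
  moreover have "entries_in conv_fls F'" unfolding F'_def
    by (rule entries_in_mult[OF coef_ring_conv X(1) FHc entries_in_laurent_conv[OF X(3)]
          entries_in_mult[OF coef_ring_conv F(1) G(2) F(2) entries_in_laurent_conv[OF G(4)]]])
  ultimately have l: "entries_in laurent_poly F'" by (intro gdata_hom_laurent[OF q A'(3) B'(3) F'c])
  have "Y * F' = (Y * X) * (F * H)" unfolding F'_def by (rule assoc_mult_mat[OF X(2,1) FHc, symmetric])
  then have "Y * F' * G = F * H * G" using FHc by (simp add: X(6) left_mult_one_mat[of _ m n])
  also have "\<dots> = F * (H * G)" by (rule assoc_mult_mat[OF F(1) G(2,1)])
  also have "\<dots> = F" using F(1) by (simp add: G(6) right_mult_one_mat[of _ m n])
  finally have "F = Y * F' * G" ..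
  moreover have "entries_in laurent_poly (Y * F' * G)"
    by (rule entries_in_mult[OF coef_ring_laurent mult_carrier_mat[OF X(2) F'c] G(1) entries_in_mult[OF coef_ring_laurent X(2) F'c X(4) l] G(3)])
  ultimately show ?thesis using F by (simp add: dhom_def)
qed

text \<open>Every module over K has some growth rate, for instance a common lower bound for the
  valuations of its matrix entries; this starts the induction.\<close>

lemma asc_essentially_surjective:
  assumes q: "0 < norm q" "norm q < 1" "\<And>i. i > 0 \<Longrightarrow> q ^ i \<noteq> 1" and A: "dmod conv_fls n A"
  shows "\<exists>B. asc_slope_filtration q n B \<and> diso conv_fls (phiK q) n B n A"
proof -
  have q0: "q \<noteq> 0" using q by auto
  obtain Ai where A: "A \<in> carrier_mat n n" "entries_in conv_fls A" "Ai \<in> carrier_mat n n" "A * Ai = 1\<^sub>m n"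
    using A unfolding dmod_def invertible_over_def by blast
  have d: "det A \<noteq> 0" using arg_cong[OF A(4), of det] det_mult[OF A(1,3)] by auto
  obtain y where "\<And>i j. i < n \<Longrightarrow> j < n \<Longrightarrow> vge (A $$ (i, j)) y" using vge_mat_ex[of n n A] by blast
  then have g: "grow q n A y" using grow_weights[OF q0 A(1), of y "\<lambda>_. 0"] by simp
  obtain B D s where B: "gdata q n s B D" "diso conv_fls (phiK q) n A n B"
    using essential_surjectivity[OF q A(1,2) d g] by blast
  have "B \<in> carrier_mat n n" using B(1) by (simp add: gdata_def half_data_def)
  then show ?thesis using diso_sym[OF q0 A(1) _ B(2)] gdata_imp_asc_self[OF q0 q(3) B(1)] by blast
qed

theorem theorem4p3:
  fixes q :: complex
  assumes "0 < norm q" and "norm q < 1"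
  shows
    \<comment> \<open>the source category is a rigid tensor (Tannakian) full subcategory of global modules\<close>
    "asc_slope_filtration q 1 (1\<^sub>m 1)
     \<and> (\<forall>n A m B. asc_slope_filtration q n A \<and> asc_slope_filtration q m B \<longrightarrow>
          asc_slope_filtration q (n * m) (kron A B))
     \<and> (\<forall>n A. asc_slope_filtration q n A \<longrightarrow>
          asc_slope_filtration q n (dual_mat laurent_poly n A))
     \<comment> \<open>T is full (and trivially faithful): every K-morphism of the base changes comes from
         a unique global morphism\<close>
     \<and> (\<forall>n A m B F. asc_slope_filtration q n A \<and> asc_slope_filtration q m B \<longrightarrow>
          (dhom conv_fls (phiK q) n A m B F \<longleftrightarrow> dhom laurent_poly (phiK q) n A m B F))
     \<comment> \<open>T is essentially surjective\<close>
     \<and> (\<forall>n A. dmod conv_fls n A \<longrightarrow>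
          (\<exists>m B. asc_slope_filtration q m B \<and> diso conv_fls (phiK q) m B n A))"
proof -
  have q0: "q \<noteq> 0" using assms by auto
  have q1: "q ^ i \<noteq> 1" if "i > 0" for i
  proof
    assume "q ^ i = 1"
    then have "norm q ^ i = 1" by (simp flip: norm_power)
    moreover have "norm q ^ i < 1" using that assms by (simp add: power_less_one_iff)
    ultimately show False by simp
  qed
  show ?thesis
  proof (intro conjI allI impI)
    show "asc_slope_filtration q 1 (1\<^sub>m 1)"
      by (rule asc_unit[OF q0]) (rule q1)
    show "asc_slope_filtration q (n * m) (kron A B)" if "asc_slope_filtration q n A \<and> asc_slope_filtration q m B" for n A m B
      by (rule asc_kron[OF q0 _ conjunct1[OF that] conjunct2[OF that]]) (rule q1)
    show "asc_slope_filtration q n (dual_mat laurent_poly n A)" if "asc_slope_filtration q n A" for n A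
      by (rule asc_dual[OF q0 _ that]) (rule q1)
    show "dhom conv_fls (phiK q) n A m B F \<longleftrightarrow> dhom laurent_poly (phiK q) n A m B F"
      if "asc_slope_filtration q n A \<and> asc_slope_filtration q m B" for n A m B F
      using asc_hom_laurent[OF assms conjunct1[OF that] conjunct2[OF that]]
      by (auto simp: dhom_def entries_in_laurent_conv)
    show "\<exists>m B. asc_slope_filtration q m B \<and> diso conv_fls (phiK q) m B n A" if "dmod conv_fls n A" for n A
      by (rule exI[of _ n], rule asc_essentially_surjective[OF assms _ that]) (rule q1)
  qed
qed

end
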